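(* Let $i:S\hookrightarrow\Sigma$ be a closed immersion of schemes defined by a square zero ideal $J\subset\mathcal{O}_\Sigma$. The map $$\nu:\ \Sigma\longrightarrow\Sigma\vee_S I_S(J)$$ induced by the ring homomorphism $\mathcal{O}_\Sigma\times_{\mathcal{O}_S}D_S(J)\to\mathcal{O}_\Sigma$, $(u,\bar u+j\epsilon)\mapsto u+j$, defines a right cotorsor structure on $\Sigma$, in the category of $S$-pointed schemes, under the coaction of the (coabelian) cogroup object $I_S(J)$.
   Context: Since $J^2=0$, $J$ is a quasi-coherent $\mathcal{O}_S$-module. For a quasi-coherent $\mathcal{O}_S$-module $M$, $D_S(M):=\mathcal{O}_S\oplus M\epsilon$ is the $\mathcal{O}_S$-algebra with $\epsilon^2=0$ (so $M\epsilon$ is a square zero ideal), augmented to $\mathcal{O}_S$ by $M\mapsto 0$, and $I_S(M):=\mathrm{Spec}(D_S(M))$, with the section $S\hookrightarrow I_S(M)$ given by the augmentation. The $S$-pointed schemes considered are square zero immersions $S\hookrightarrow T$; they correspond dually to the category $\mathrm{EX}(\mathcal{O}_S)$ of $\mathcal{O}_S$-augmented rings whose augmentation ideal is square zero and quasi-coherent as an $\mathcal{O}_S$-module. $T\vee_S T'$ denotes the coproduct, i.e. the amalgamated sum under $S$, with structure ring the fibre product $\mathcal{O}_T\times_{\mathcal{O}_S}\mathcal{O}_{T'}$. For $u\in\mathcal{O}_\Sigma$, $\bar u$ is its image in $\mathcal{O}_S$, and $j\in J$. The cogroup structure on $I_S(M)$ has comultiplication $I_S(M)\to I_S(M\times M)\simeq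 I_S(M)\vee_S I_S(M)$ induced by the addition $M\times M\to M$, counit $I_S(M)\to S$ induced by $0\to M$, and coinverse induced by $m\mapsto -m$. An object $E$ of a category $\mathcal{C}$ is a (right) cotorsor under a cogroup object $\Gamma$ of $\mathcal{C}$ for a coaction $\nu:E\to E\vee\Gamma$ if, in the opposite category $\mathcal{C}^{\circ}$, $E^\circ$ is a (right) torsor under the group object $\Gamma^\circ$ via $\nu^\circ$. *)

theory Defs
  imports "HOL-Analysis.Function_Topology" "HOL-Algebra.Ideal" "HOL-Algebra.Module"
    "HOL-Algebra.QuotRing"
begin

section \<open>Group objects and torsors, cogroup objects and cotorsors\<close>

text \<open>Composition takes the three objects as arguments, so that morphisms need not record their
  source and target: \<open>Comp C X Y Z g f\<close> is \<open>g\<close> after \<open>f\<close> for \<open>f : X \<rightarrow> Y\<close> and \<open>g : Y \<rightarrow> Z\<close>.\<close>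

record ('o, 'm) category_data =
  Ob :: "'o set"
  Hom :: "'o \<Rightarrow> 'o \<Rightarrow> 'm set"
  Id :: "'o \<Rightarrow> 'm"
  Comp :: "'o \<Rightarrow> 'o \<Rightarrow> 'o \<Rightarrow> 'm \<Rightarrow> 'm \<Rightarrow> 'm"

definition category :: "('o, 'm) category_data \<Rightarrow> bool" where
  "category C \<longleftrightarrow>
     (\<forall>X\<in>Ob C. Id C X \<in> Hom C X X) \<and>
     (\<forall>X\<in>Ob C. \<forall>Y\<in>Ob C. \<forall>Z\<in>Ob C. \<forall>f\<in>Hom C X Y. \<forall>g\<in>Hom C Y Z. Comp C X Y Z g f \<in> Hom C X Z) \<and>
     (\<forall>X\<in>Ob C. \<forall>Y\<in>Ob C. \<forall>f\<in>Hom C X Y.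
        Comp C X X Y f (Id C X) = f \<and> Comp C X Y Y (Id C Y) f = f) \<and>
     (\<forall>W\<in>Ob C. \<forall>X\<in>Ob C. \<forall>Y\<in>Ob C. \<forall>Z\<in>Ob C. \<forall>f\<in>Hom C W X. \<forall>g\<in>Hom C X Y. \<forall>h\<in>Hom C Y Z.
        Comp C W X Z (Comp C X Y Z h g) f = Comp C W Y Z h (Comp C W X Y g f))"

definition opposite :: "('o, 'm) category_data \<Rightarrow> ('o, 'm) category_data" where
  "opposite C = \<lparr> Ob = Ob C, Hom = (\<lambda>X Y. Hom C Y X), Id = Id C,
                  Comp = (\<lambda>X Y Z g f. Comp C Z Y X f g) \<rparr>"

definition is_terminal :: "('o, 'm) category_data \<Rightarrow> 'o \<Rightarrow> bool" where
  "is_terminal C t \<longleftrightarrow> t \<in> Ob C \<and> (\<forall>X\<in>Ob C. \<exists>!u. u \<in> Hom C X t)"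

definition to_terminal :: "('o, 'm) category_data \<Rightarrow> 'o \<Rightarrow> 'o \<Rightarrow> 'm" where
  "to_terminal C t X = (THE u. u \<in> Hom C X t)"

definition is_product :: "('o, 'm) category_data \<Rightarrow> 'o \<Rightarrow> 'o \<Rightarrow> 'o \<Rightarrow> 'm \<Rightarrow> 'm \<Rightarrow> bool" where
  "is_product C A B P p q \<longleftrightarrow>
     A \<in> Ob C \<and> B \<in> Ob C \<and> P \<in> Ob C \<and> p \<in> Hom C P A \<and> q \<in> Hom C P B \<and>
     (\<forall>X\<in>Ob C. \<forall>f\<in>Hom C X A. \<forall>g\<in>Hom C X B.
        \<exists>!h. h \<in> Hom C X P \<and> Comp C X P A p h = f \<and> Comp C X P B q h = g)"

definition pairing ::
  "('o, 'm) category_data \<Rightarrow> 'o \<Rightarrow> 'o \<Rightarrow> 'o \<Rightarrow> 'm \<Rightarrow> 'm \<Rightarrow> 'o \<Rightarrow> 'm \<Rightarrow> 'm \<Rightarrow> 'm" where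
  "pairing C A B P p q X f g =
     (THE h. h \<in> Hom C X P \<and> Comp C X P A p h = f \<and> Comp C X P B q h = g)"

definition is_iso :: "('o, 'm) category_data \<Rightarrow> 'o \<Rightarrow> 'o \<Rightarrow> 'm \<Rightarrow> bool" where
  "is_iso C X Y f \<longleftrightarrow> f \<in> Hom C X Y \<and>
     (\<exists>g\<in>Hom C Y X. Comp C X Y X g f = Id C X \<and> Comp C Y X Y f g = Id C Y)"

definition is_coequalizer ::
  "('o, 'm) category_data \<Rightarrow> 'o \<Rightarrow> 'o \<Rightarrow> 'm \<Rightarrow> 'm \<Rightarrow> 'o \<Rightarrow> 'm \<Rightarrow> bool" where
  "is_coequalizer C X Y f g Z u \<longleftrightarrow>
     u \<in> Hom C Y Z \<and> Comp C X Y Z u f = Comp C X Y Z u g \<and>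
     (\<forall>W\<in>Ob C. \<forall>v\<in>Hom C Y W. Comp C X Y W v f = Comp C X Y W v g \<longrightarrow>
        (\<exists>!w. w \<in> Hom C Z W \<and> Comp C Y Z W w u = v))"

record ('o, 'm) group_data =
  gobj :: 'o
  gprod :: 'o
  gfst :: 'm
  gsnd :: 'm
  gmul :: 'm
  gterm :: 'o
  gunit :: 'm
  ginv :: 'm

text \<open>The structure induced by the data on the set of \<open>X\<close>-valued points.\<close>

definition points_group ::
  "('o, 'm) category_data \<Rightarrow> ('o, 'm) group_data \<Rightarrow> 'o \<Rightarrow> 'm monoid" where
  "points_group C \<Gamma> X =
     \<lparr> carrier = Hom C X (gobj \<Gamma>),
       mult = (\<lambda>x y. Comp C X (gprod \<Gamma>) (gobj \<Gamma>) (gmul \<Gamma>)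
                 (pairing C (gobj \<Gamma>) (gobj \<Gamma>) (gprod \<Gamma>) (gfst \<Gamma>) (gsnd \<Gamma>) X x y)),
       one = Comp C X (gterm \<Gamma>) (gobj \<Gamma>) (gunit \<Gamma>) (to_terminal C (gterm \<Gamma>) X) \<rparr>"

definition group_object :: "('o, 'm) category_data \<Rightarrow> ('o, 'm) group_data \<Rightarrow> bool" where
  "group_object C \<Gamma> \<longleftrightarrow>
     category C \<and> is_terminal C (gterm \<Gamma>) \<and>
     is_product C (gobj \<Gamma>) (gobj \<Gamma>) (gprod \<Gamma>) (gfst \<Gamma>) (gsnd \<Gamma>) \<and>
     gmul \<Gamma> \<in> Hom C (gprod \<Gamma>) (gobj \<Gamma>) \<and>
     gunit \<Gamma> \<in> Hom C (gterm \<Gamma>) (gobj \<Gamma>) \<and>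
     ginv \<Gamma> \<in> Hom C (gobj \<Gamma>) (gobj \<Gamma>) \<and>
     (\<forall>X\<in>Ob C. group (points_group C \<Gamma> X) \<and>
        (\<forall>x\<in>Hom C X (gobj \<Gamma>).
           Comp C X (gobj \<Gamma>) (gobj \<Gamma>) (ginv \<Gamma>) x = inv\<^bsub>points_group C \<Gamma> X\<^esub> x))"

definition abelian_group_object :: "('o, 'm) category_data \<Rightarrow> ('o, 'm) group_data \<Rightarrow> bool" where
  "abelian_group_object C \<Gamma> \<longleftrightarrow>
     group_object C \<Gamma> \<and> (\<forall>X\<in>Ob C. comm_group (points_group C \<Gamma> X))"

text \<open>\<open>(P, p, q)\<close> is a product of \<open>E\<close> and \<open>\<Gamma>\<close>, and \<open>\<nu> : P \<rightarrow> E\<close>. For a torsor, besides the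
  simple transitivity (the morphism \<open>(x, g) \<mapsto> (x, x g)\<close> from \<open>P\<close> to \<open>E \<times> E\<close> is an isomorphism),
  \<open>E\<close> has to be inhabited: the morphism to the terminal object is an effective epimorphism, that
  is, the coequalizer of the two projections of \<open>E \<times> E\<close>.\<close>

definition right_action :: "('o, 'm) category_data \<Rightarrow> ('o, 'm) group_data \<Rightarrow>
    'o \<Rightarrow> 'o \<Rightarrow> 'm \<Rightarrow> 'm \<Rightarrow> 'm \<Rightarrow> bool" where
  "right_action C \<Gamma> E P p q \<nu> \<longleftrightarrow>
     is_product C E (gobj \<Gamma>) P p q \<and> \<nu> \<in> Hom C P E \<and>
     (let act = (\<lambda>X x g. Comp C X P E \<nu> (pairing C E (gobj \<Gamma>) P p q X x g))
      in \<forall>X\<in>Ob C. \<forall>x\<in>Hom C X E.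
           act X x \<one>\<^bsub>points_group C \<Gamma> X\<^esub> = x \<and>
           (\<forall>g\<in>Hom C X (gobj \<Gamma>). \<forall>h\<in>Hom C X (gobj \<Gamma>).
              act X (act X x g) h = act X x (g \<otimes>\<^bsub>points_group C \<Gamma> X\<^esub> h)))"

definition right_torsor :: "('o, 'm) category_data \<Rightarrow> ('o, 'm) group_data \<Rightarrow>
    'o \<Rightarrow> 'o \<Rightarrow> 'm \<Rightarrow> 'm \<Rightarrow> 'm \<Rightarrow> bool" where
  "right_torsor C \<Gamma> E P p q \<nu> \<longleftrightarrow>
     group_object C \<Gamma> \<and> right_action C \<Gamma> E P p q \<nu> \<and>
     (\<exists>R a b. is_product C E E R a b \<and>
        is_iso C P R (pairing C E E R a b P p \<nu>) \<and>
        is_coequalizer C R E a b (gterm \<Gamma>) (to_terminal C (gterm \<Gamma>) E))"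

text \<open>The fields of \<open>group_data\<close> are read in the opposite category: \<open>gprod\<close>, \<open>gfst\<close>, \<open>gsnd\<close> are
  the coproduct and the coprojections, \<open>gterm\<close> the initial object, \<open>gmul\<close>, \<open>gunit\<close>, \<open>ginv\<close> the
  comultiplication, counit and coinverse.\<close>

definition coabelian_cogroup_object :: "('o, 'm) category_data \<Rightarrow> ('o, 'm) group_data \<Rightarrow> bool" where
  "coabelian_cogroup_object C \<Gamma> \<longleftrightarrow> abelian_group_object (opposite C) \<Gamma>"

definition right_cotorsor :: "('o, 'm) category_data \<Rightarrow> ('o, 'm) group_data \<Rightarrow>
    'o \<Rightarrow> 'o \<Rightarrow> 'm \<Rightarrow> 'm \<Rightarrow> 'm \<Rightarrow> bool" where
  "right_cotorsor C \<Gamma> E P p q \<nu> \<longleftrightarrow> right_torsor (opposite C) \<Gamma> E P p q \<nu>"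


section \<open>Ringed spaces\<close>

text \<open>Sections and restrictions are meaningful on open sets only.\<close>

record ('p, 'r) ringed =
  under :: "'p topology"
  sec :: "'p set \<Rightarrow> 'r ring"
  res :: "'p set \<Rightarrow> 'p set \<Rightarrow> 'r \<Rightarrow> 'r"

abbreviation pts :: "('p, 'r) ringed \<Rightarrow> 'p set" where
  "pts X \<equiv> topspace (under X)"

abbreviation opens :: "('p, 'r) ringed \<Rightarrow> 'p set set" where
  "opens X \<equiv> {U. openin (under X) U}"

definition ringed_space :: "('p, 'r) ringed \<Rightarrow> bool" where
  "ringed_space X \<longleftrightarrow>
     (\<forall>U\<in>opens X. cring (sec X U)) \<and>
     (\<forall>U\<in>opens X. \<forall>V\<in>opens X. V \<subseteq> U \<longrightarrow> res X U V \<in> ring_hom (sec X U) (sec X V)) \<and>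
     (\<forall>U\<in>opens X. \<forall>s\<in>carrier (sec X U). res X U U s = s) \<and>
     (\<forall>U\<in>opens X. \<forall>V\<in>opens X. \<forall>W\<in>opens X. W \<subseteq> V \<and> V \<subseteq> U \<longrightarrow>
        (\<forall>s\<in>carrier (sec X U). res X V W (res X U V s) = res X U W s)) \<and>
     (\<forall>\<V> \<subseteq> opens X. \<forall>s\<in>carrier (sec X (\<Union>\<V>)). \<forall>t\<in>carrier (sec X (\<Union>\<V>)).
        (\<forall>V\<in>\<V>. res X (\<Union>\<V>) V s = res X (\<Union>\<V>) V t) \<longrightarrow> s = t) \<and>
     (\<forall>\<V> \<subseteq> opens X. \<forall>s. (\<forall>V\<in>\<V>. s V \<in> carrier (sec X V)) \<and>
        (\<forall>V\<in>\<V>. \<forall>W\<in>\<V>. res X V (V \<inter> W) (s V) = res X W (V \<inter> W) (s W)) \<longrightarrow>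
        (\<exists>t\<in>carrier (sec X (\<Union>\<V>)). \<forall>V\<in>\<V>. res X (\<Union>\<V>) V t = s V))"

definition open_subspace :: "('p, 'r) ringed \<Rightarrow> 'p set \<Rightarrow> ('p, 'r) ringed" where
  "open_subspace X U = \<lparr> under = subtopology (under X) U, sec = sec X, res = res X \<rparr>"

text \<open>\<open>shf f V\<close> is the ring homomorphism from the sections of the target over \<open>V\<close> to the sections
  of the source over the preimage of \<open>V\<close>. All components are required to be extensional, so that
  equality of morphisms is equality of records.\<close>

record ('p, 'r, 'q, 's) morph =
  ptf :: "'p \<Rightarrow> 'q"
  shf :: "'q set \<Rightarrow> 's \<Rightarrow> 'r"

definition preim :: "('p, 'r) ringed \<Rightarrow> ('p, 'r, 'q, 's) morph \<Rightarrow> 'q set \<Rightarrow> 'p set" where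
  "preim X f V = {x \<in> pts X. ptf f x \<in> V}"

definition ringed_morphism ::
  "('p, 'r) ringed \<Rightarrow> ('q, 's) ringed \<Rightarrow> ('p, 'r, 'q, 's) morph \<Rightarrow> bool" where
  "ringed_morphism X Y f \<longleftrightarrow>
     continuous_map (under X) (under Y) (ptf f) \<and> ptf f \<in> extensional (pts X) \<and>
     shf f \<in> extensional (opens Y) \<and>
     (\<forall>V\<in>opens Y. shf f V \<in> ring_hom (sec Y V) (sec X (preim X f V)) \<and>
                  shf f V \<in> extensional (carrier (sec Y V))) \<and>
     (\<forall>V\<in>opens Y. \<forall>W\<in>opens Y. W \<subseteq> V \<longrightarrow> (\<forall>s\<in>carrier (sec Y V).
        res X (preim X f V) (preim X f W) (shf f V s) = shf f W (res Y V W s)))"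

definition id_morph :: "('p, 'r) ringed \<Rightarrow> ('p, 'r, 'p, 'r) morph" where
  "id_morph X = \<lparr> ptf = (\<lambda>x\<in>pts X. x), shf = (\<lambda>V\<in>opens X. \<lambda>s\<in>carrier (sec X V). s) \<rparr>"

definition comp_morph ::
  "('p, 'r) ringed \<Rightarrow> ('q, 's) ringed \<Rightarrow> ('v, 'w) ringed \<Rightarrow>
   ('q, 's, 'v, 'w) morph \<Rightarrow> ('p, 'r, 'q, 's) morph \<Rightarrow> ('p, 'r, 'v, 'w) morph" where
  "comp_morph X Y Z g f =
     \<lparr> ptf = (\<lambda>x\<in>pts X. ptf g (ptf f x)),
       shf = (\<lambda>V\<in>opens Z. \<lambda>s\<in>carrier (sec Z V). shf f (preim Y g V) (shf g V s)) \<rparr>"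

definition ringed_iso ::
  "('p, 'r) ringed \<Rightarrow> ('q, 's) ringed \<Rightarrow> ('p, 'r, 'q, 's) morph \<Rightarrow> bool" where
  "ringed_iso X Y f \<longleftrightarrow> ringed_morphism X Y f \<and>
     (\<exists>g. ringed_morphism Y X g \<and>
          comp_morph X Y X g f = id_morph X \<and> comp_morph Y X Y f g = id_morph Y)"


section \<open>Spectra and schemes\<close>

definition zariski :: "'r ring \<Rightarrow> 'r set topology" where
  "zariski R = topology_generated_by {{P. primeideal P R \<and> f \<notin> P} |f. f \<in> carrier R}"

text \<open>The fraction \<open>a / f\<close> in the localization of \<open>R\<close> at the prime ideal \<open>P\<close>, as an equivalence
  class of pairs.\<close>

definition loc_frac :: "'r ring \<Rightarrow> 'r set \<Rightarrow> 'r \<Rightarrow> 'r \<Rightarrow> ('r \<times> 'r) set" where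
  "loc_frac R P a f = {(b, g). b \<in> carrier R \<and> g \<in> carrier R - P \<and>
     (\<exists>h\<in>carrier R - P. h \<otimes>\<^bsub>R\<^esub> ((g \<otimes>\<^bsub>R\<^esub> a) \<ominus>\<^bsub>R\<^esub> (f \<otimes>\<^bsub>R\<^esub> b)) = \<zero>\<^bsub>R\<^esub>)}"

definition localization :: "'r ring \<Rightarrow> 'r set \<Rightarrow> ('r \<times> 'r) set ring" where
  "localization R P =
     \<lparr> carrier = {loc_frac R P a f |a f. a \<in> carrier R \<and> f \<in> carrier R - P},
       mult = (\<lambda>x y. \<Union>(a, f)\<in>x. \<Union>(b, g)\<in>y. loc_frac R P (a \<otimes>\<^bsub>R\<^esub> b) (f \<otimes>\<^bsub>R\<^esub> g)),
       one = loc_frac R P \<one>\<^bsub>R\<^esub> \<one>\<^bsub>R\<^esub>,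
       zero = loc_frac R P \<zero>\<^bsub>R\<^esub> \<one>\<^bsub>R\<^esub>,
       add = (\<lambda>x y. \<Union>(a, f)\<in>x. \<Union>(b, g)\<in>y.
                loc_frac R P ((a \<otimes>\<^bsub>R\<^esub> g) \<oplus>\<^bsub>R\<^esub> (b \<otimes>\<^bsub>R\<^esub> f)) (f \<otimes>\<^bsub>R\<^esub> g)) \<rparr>"

text \<open>Sections of the structure sheaf are the functions into the localizations that are locally
  given by a fraction.\<close>

definition spec_sections :: "'r ring \<Rightarrow> 'r set set \<Rightarrow> ('r set \<Rightarrow> ('r \<times> 'r) set) set" where
  "spec_sections R U = {s \<in> PiE U (\<lambda>P. carrier (localization R P)).
     \<forall>P\<in>U. \<exists>V a f. openin (zariski R) V \<and> P \<in> V \<and> V \<subseteq> U \<and> a \<in> carrier R \<and> f \<in> carrier R \<and>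
       (\<forall>Q\<in>V. f \<notin> Q \<and> s Q = loc_frac R Q a f)}"

definition Spec :: "'r ring \<Rightarrow> ('r set, 'r set \<Rightarrow> ('r \<times> 'r) set) ringed" where
  "Spec R =
     \<lparr> under = zariski R,
       sec = (\<lambda>U. \<lparr> carrier = spec_sections R U,
                    mult = (\<lambda>s t. \<lambda>P\<in>U. s P \<otimes>\<^bsub>localization R P\<^esub> t P),
                    one = (\<lambda>P\<in>U. \<one>\<^bsub>localization R P\<^esub>),
                    zero = (\<lambda>P\<in>U. \<zero>\<^bsub>localization R P\<^esub>),
                    add = (\<lambda>s t. \<lambda>P\<in>U. s P \<oplus>\<^bsub>localization R P\<^esub> t P) \<rparr>),
       res = (\<lambda>U V s. restrict s V) \<rparr>"

text \<open>The ring is necessarily isomorphic to the ring of sections over \<open>U\<close>, so that letting it range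
  over the rings with elements in \<^typ>\<open>'r\<close> is no restriction.\<close>

definition affine_open :: "('p, 'r) ringed \<Rightarrow> 'p set \<Rightarrow> bool" where
  "affine_open X U \<longleftrightarrow> openin (under X) U \<and>
     (\<exists>(R :: 'r ring) f. cring R \<and> ringed_iso (open_subspace X U) (Spec R) f)"

definition scheme :: "('p, 'r) ringed \<Rightarrow> bool" where
  "scheme X \<longleftrightarrow> ringed_space X \<and> (\<forall>x\<in>pts X. \<exists>U. x \<in> U \<and> affine_open X U)"

text \<open>The germ at \<open>x\<close> of a section \<open>s\<close> over \<open>U\<close> is a unit of the stalk at \<open>x\<close>. A homomorphism of
  local rings is local if and only if it reflects units.\<close>

definition germ_unit :: "('p, 'r) ringed \<Rightarrow> 'p \<Rightarrow> 'p set \<Rightarrow> 'r \<Rightarrow> bool" where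
  "germ_unit X x U s \<longleftrightarrow>
     (\<exists>V. openin (under X) V \<and> x \<in> V \<and> V \<subseteq> U \<and> res X U V s \<in> Units (sec X V))"

definition scheme_morphism ::
  "('p, 'r) ringed \<Rightarrow> ('q, 's) ringed \<Rightarrow> ('p, 'r, 'q, 's) morph \<Rightarrow> bool" where
  "scheme_morphism X Y f \<longleftrightarrow> ringed_morphism X Y f \<and>
     (\<forall>V\<in>opens Y. \<forall>s\<in>carrier (sec Y V). \<forall>x\<in>preim X f V.
        germ_unit X x (preim X f V) (shf f V s) \<longrightarrow> germ_unit Y (ptf f x) V s)"

definition closed_immersion ::
  "('p, 'r) ringed \<Rightarrow> ('q, 's) ringed \<Rightarrow> ('p, 'r, 'q, 's) morph \<Rightarrow> bool" where
  "closed_immersion X Y f \<longleftrightarrow> scheme X \<and> scheme Y \<and> scheme_morphism X Y f \<and>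
     embedding_map (under X) (under Y) (ptf f) \<and> closedin (under Y) (ptf f ` pts X) \<and>
     (\<forall>V\<in>opens Y. \<forall>s\<in>carrier (sec X (preim X f V)). \<forall>y\<in>V.
        \<exists>W u. openin (under Y) W \<and> y \<in> W \<and> W \<subseteq> V \<and> u \<in> carrier (sec Y W) \<and>
              shf f W u = res X (preim X f V) (preim X f W) s)"

definition ideal_sections :: "('p, 'r) ringed \<Rightarrow> ('q, 's) ringed \<Rightarrow>
    ('p, 'r, 'q, 's) morph \<Rightarrow> 'q set \<Rightarrow> 's set" where
  "ideal_sections X Y f V = a_kernel (sec Y V) (sec X (preim X f V)) (shf f V)"

definition square_zero_immersion ::
  "('p, 'r) ringed \<Rightarrow> ('q, 's) ringed \<Rightarrow> ('p, 'r, 'q, 's) morph \<Rightarrow> bool" where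
  "square_zero_immersion X Y f \<longleftrightarrow> closed_immersion X Y f \<and>
     (\<forall>V\<in>opens Y. \<forall>a\<in>ideal_sections X Y f V. \<forall>b\<in>ideal_sections X Y f V.
        a \<otimes>\<^bsub>sec Y V\<^esub> b = \<zero>\<^bsub>sec Y V\<^esub>)"


section \<open>The category of pointed schemes\<close>

text \<open>For a fixed \<open>S\<close>, an object is a square zero immersion of \<open>S\<close> into a scheme \<open>T\<close>.\<close>

type_synonym ('p, 'r) pointed = "('p, 'r) ringed \<times> ('p, 'r, 'p, 'r) morph"

definition pointed_schemes ::
  "('p, 'r) ringed \<Rightarrow> (('p, 'r) pointed, ('p, 'r, 'p, 'r) morph) category_data" where
  "pointed_schemes S =
     \<lparr> Ob = {(T, i). square_zero_immersion S T i},
       Hom = (\<lambda>(T, i) (T', i'). {f. scheme_morphism T T' f \<and> comp_morph S T T' f i = i'}),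
       Id = (\<lambda>(T, i). id_morph T),
       Comp = (\<lambda>(X, _) (Y, _) (Z, _) g f. comp_morph X Y Z g f) \<rparr>"

text \<open>Amalgamated sums and \<open>\<O>\<^sub>S \<oplus> M\<epsilon>\<close> have pairs as sections. In order to stay within a single
  category, the sections are taken in a type that is closed under the formation of pairs (a
  universe); it contains an arbitrary type \<^typ>\<open>'a\<close>, so that every scheme is isomorphic to one of
  this kind.\<close>

datatype 'a universe = Atom 'a | Duo (left: "'a universe") (right: "'a universe")


subsection \<open>Amalgamated sums\<close>

text \<open>A square zero immersion is a homeomorphism. The amalgamated sum of \<open>(T, i)\<close> and \<open>(T', i')\<close>
  has the underlying space of \<open>S\<close>, and its ring of sections over \<open>U\<close> is the fibre product over
  \<open>\<O>\<^sub>S(U)\<close> of the sections of \<open>\<O>\<^sub>T\<close> over \<open>i(U)\<close> and of \<open>\<O>\<^sub>T\<^sub>'\<close> over \<open>i'(U)\<close>.\<close>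

definition amalg_ring :: "('p, 'a universe) pointed \<Rightarrow> ('p, 'a universe) pointed \<Rightarrow>
    'p set \<Rightarrow> 'a universe ring" where
  "amalg_ring = (\<lambda>(T, i) (T', i') U.
     let A = sec T (ptf i ` U); B = sec T' (ptf i' ` U) in
     \<lparr> carrier = {Duo a b |a b. a \<in> carrier A \<and> b \<in> carrier B \<and>
                    shf i (ptf i ` U) a = shf i' (ptf i' ` U) b},
       mult = (\<lambda>x y. Duo (left x \<otimes>\<^bsub>A\<^esub> left y) (right x \<otimes>\<^bsub>B\<^esub> right y)),
       one = Duo \<one>\<^bsub>A\<^esub> \<one>\<^bsub>B\<^esub>,
       zero = Duo \<zero>\<^bsub>A\<^esub> \<zero>\<^bsub>B\<^esub>,
       add = (\<lambda>x y. Duo (left x \<oplus>\<^bsub>A\<^esub> left y) (right x \<oplus>\<^bsub>B\<^esub> right y)) \<rparr>)"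

definition amalg_space :: "('p, 'a universe) ringed \<Rightarrow> ('p, 'a universe) pointed \<Rightarrow>
    ('p, 'a universe) pointed \<Rightarrow> ('p, 'a universe) ringed" where
  "amalg_space S = (\<lambda>(T, i) (T', i').
     \<lparr> under = under S,
       sec = amalg_ring (T, i) (T', i'),
       res = (\<lambda>U V x. Duo (res T (ptf i ` U) (ptf i ` V) (left x))
                          (res T' (ptf i' ` U) (ptf i' ` V) (right x))) \<rparr>)"

definition amalg :: "('p, 'a universe) ringed \<Rightarrow> ('p, 'a universe) pointed \<Rightarrow>
    ('p, 'a universe) pointed \<Rightarrow> ('p, 'a universe) pointed" where
  "amalg S = (\<lambda>(T, i) T'.
     (amalg_space S (T, i) T',
      \<lparr> ptf = (\<lambda>x\<in>pts S. x),
        shf = (\<lambda>U\<in>opens S. \<lambda>x\<in>carrier (amalg_ring (T, i) T' U). shf i (ptf i ` U) (left x)) \<rparr>))"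

definition point_inverse :: "('p, 'r) ringed \<Rightarrow> ('p, 'r) pointed \<Rightarrow> 'p \<Rightarrow> 'p" where
  "point_inverse S = (\<lambda>(T, i). \<lambda>y\<in>pts T. inv_into (pts S) (ptf i) y)"

definition amalg_inl :: "('p, 'a universe) ringed \<Rightarrow> ('p, 'a universe) pointed \<Rightarrow>
    ('p, 'a universe) pointed \<Rightarrow> ('p, 'a universe, 'p, 'a universe) morph" where
  "amalg_inl S T T' =
     \<lparr> ptf = point_inverse S T,
       shf = (\<lambda>U\<in>opens S. \<lambda>x\<in>carrier (amalg_ring T T' U). left x) \<rparr>"

definition amalg_inr :: "('p, 'a universe) ringed \<Rightarrow> ('p, 'a universe) pointed \<Rightarrow>
    ('p, 'a universe) pointed \<Rightarrow> ('p, 'a universe, 'p, 'a universe) morph" where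
  "amalg_inr S T T' =
     \<lparr> ptf = point_inverse S T',
       shf = (\<lambda>U\<in>opens S. \<lambda>x\<in>carrier (amalg_ring T T' U). right x) \<rparr>"


subsection \<open>Dual numbers\<close>

record ('p, 'r, 'm) module_sheaf =
  msec :: "'p set \<Rightarrow> ('r, 'm) module"
  mres :: "'p set \<Rightarrow> 'p set \<Rightarrow> 'm \<Rightarrow> 'm"

text \<open>\<open>Duo a m\<close> stands for \<open>a + m\<epsilon>\<close>.\<close>

definition dual_ring :: "('p, 'a universe) ringed \<Rightarrow>
    ('p, 'a universe, 'a universe) module_sheaf \<Rightarrow> 'p set \<Rightarrow> 'a universe ring" where
  "dual_ring S M U = (let A = sec S U; N = msec M U in
     \<lparr> carrier = {Duo a m |a m. a \<in> carrier A \<and> m \<in> carrier N},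
       mult = (\<lambda>x y. Duo (left x \<otimes>\<^bsub>A\<^esub> left y)
                         ((left x \<odot>\<^bsub>N\<^esub> right y) \<oplus>\<^bsub>N\<^esub> (left y \<odot>\<^bsub>N\<^esub> right x))),
       one = Duo \<one>\<^bsub>A\<^esub> \<zero>\<^bsub>N\<^esub>,
       zero = Duo \<zero>\<^bsub>A\<^esub> \<zero>\<^bsub>N\<^esub>,
       add = (\<lambda>x y. Duo (left x \<oplus>\<^bsub>A\<^esub> left y) (right x \<oplus>\<^bsub>N\<^esub> right y)) \<rparr>)"

text \<open>The sheaf of rings \<open>D\<^sub>S(M)\<close>. Since its augmentation ideal is nilpotent, the underlying space
  of its relative spectrum is that of \<open>S\<close>, so that the same ringed space also represents
  \<open>I\<^sub>S(M)\<close>; see \<open>relative_spectrum\<close> below.\<close>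

definition dual_numbers :: "('p, 'a universe) ringed \<Rightarrow>
    ('p, 'a universe, 'a universe) module_sheaf \<Rightarrow> ('p, 'a universe) ringed" where
  "dual_numbers S M =
     \<lparr> under = under S, sec = dual_ring S M,
       res = (\<lambda>U V x. Duo (res S U V (left x)) (mres M U V (right x))) \<rparr>"

definition dual_structure :: "('p, 'a universe) ringed \<Rightarrow>
    ('p, 'a universe, 'a universe) module_sheaf \<Rightarrow> ('p, 'a universe, 'p, 'a universe) morph" where
  "dual_structure S M =
     \<lparr> ptf = (\<lambda>x\<in>pts S. x),
       shf = (\<lambda>U\<in>opens S. \<lambda>a\<in>carrier (sec S U). Duo a \<zero>\<^bsub>msec M U\<^esub>) \<rparr>"

definition I_pointed :: "('p, 'a universe) ringed \<Rightarrow>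
    ('p, 'a universe, 'a universe) module_sheaf \<Rightarrow> ('p, 'a universe) pointed" where
  "I_pointed S M =
     (dual_numbers S M,
      \<lparr> ptf = (\<lambda>x\<in>pts S. x),
        shf = (\<lambda>U\<in>opens S. \<lambda>x\<in>carrier (dual_ring S M U). left x) \<rparr>)"

text \<open>An \<open>\<O>\<^sub>S\<close>-algebra is given as a morphism \<open>a : A \<rightarrow> S\<close> of ringed spaces over the identity of
  the space of \<open>S\<close>. Its relative spectrum is the \<open>S\<close>-scheme \<open>p : X \<rightarrow> S\<close>, unique up to unique
  isomorphism, that is affine over \<open>S\<close> with direct image of the structure sheaf isomorphic to it.\<close>

definition affine_morphism ::
  "('p, 'r) ringed \<Rightarrow> ('q, 's) ringed \<Rightarrow> ('p, 'r, 'q, 's) morph \<Rightarrow> bool" where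
  "affine_morphism X S p \<longleftrightarrow> scheme X \<and> scheme S \<and> scheme_morphism X S p \<and>
     (\<forall>x\<in>pts S. \<exists>U. x \<in> U \<and> affine_open S U \<and> affine_open X (preim X p U))"

definition relative_spectrum :: "('q, 's) ringed \<Rightarrow> ('q, 'b) ringed \<Rightarrow> ('q, 'b, 'q, 's) morph \<Rightarrow>
    ('p, 'r) ringed \<Rightarrow> ('p, 'r, 'q, 's) morph \<Rightarrow> bool" where
  "relative_spectrum S A a X p \<longleftrightarrow>
     ringed_space A \<and> under A = under S \<and> ringed_morphism A S a \<and> (\<forall>x\<in>pts S. ptf a x = x) \<and>
     affine_morphism X S p \<and>
     (\<exists>\<phi>. (\<forall>U\<in>opens S. \<phi> U \<in> ring_iso (sec A U) (sec X (preim X p U))) \<and>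
          (\<forall>U\<in>opens S. \<forall>V\<in>opens S. V \<subseteq> U \<longrightarrow> (\<forall>s\<in>carrier (sec A U).
             \<phi> V (res A U V s) = res X (preim X p U) (preim X p V) (\<phi> U s))) \<and>
          (\<forall>U\<in>opens S. \<forall>b\<in>carrier (sec S U). \<phi> U (shf a U b) = shf p U b))"

text \<open>The comultiplication is the composite of \<open>I\<^sub>S(M) \<rightarrow> I\<^sub>S(M \<times> M)\<close>, induced by the addition of \<open>M\<close>,
  with the identification of \<open>I\<^sub>S(M \<times> M)\<close> with the amalgamated sum of two copies of \<open>I\<^sub>S(M)\<close>.
  On sections it is given by \<open>(a + m\<epsilon>, a + m'\<epsilon>) \<mapsto> a + (m + m')\<epsilon>\<close>, the
  counit by \<open>a \<mapsto> a + 0\<epsilon>\<close> and the coinverse by \<open>a + m\<epsilon> \<mapsto> a - m\<epsilon>\<close>.\<close>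

definition I_comult :: "('p, 'a universe) ringed \<Rightarrow>
    ('p, 'a universe, 'a universe) module_sheaf \<Rightarrow> ('p, 'a universe, 'p, 'a universe) morph" where
  "I_comult S M =
     \<lparr> ptf = (\<lambda>x\<in>pts S. x),
       shf = (\<lambda>U\<in>opens S. \<lambda>x\<in>carrier (amalg_ring (I_pointed S M) (I_pointed S M) U).
                Duo (left (left x)) (right (left x) \<oplus>\<^bsub>msec M U\<^esub> right (right x))) \<rparr>"

definition I_coinverse :: "('p, 'a universe) ringed \<Rightarrow>
    ('p, 'a universe, 'a universe) module_sheaf \<Rightarrow> ('p, 'a universe, 'p, 'a universe) morph" where
  "I_coinverse S M =
     \<lparr> ptf = (\<lambda>x\<in>pts S. x),
       shf = (\<lambda>U\<in>opens S. \<lambda>x\<in>carrier (dual_ring S M U).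
                Duo (left x) (\<ominus>\<^bsub>msec M U\<^esub> right x)) \<rparr>"

definition I_cogroup :: "('p, 'a universe) ringed \<Rightarrow>
    ('p, 'a universe, 'a universe) module_sheaf \<Rightarrow>
    (('p, 'a universe) pointed, ('p, 'a universe, 'p, 'a universe) morph) group_data" where
  "I_cogroup S M =
     \<lparr> gobj = I_pointed S M,
       gprod = amalg S (I_pointed S M) (I_pointed S M),
       gfst = amalg_inl S (I_pointed S M) (I_pointed S M),
       gsnd = amalg_inr S (I_pointed S M) (I_pointed S M),
       gmul = I_comult S M,
       gterm = (S, id_morph S),
       gunit = dual_structure S M,
       ginv = I_coinverse S M \<rparr>"


subsection \<open>The ideal of a square zero immersion as a module, and the coaction\<close>

text \<open>The ideal \<open>J\<close> of \<open>(T, i)\<close>, transported to the space of \<open>S\<close>. A section \<open>b\<close> of \<open>\<O>\<^sub>S\<close> acts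
  as multiplication by any local lift of \<open>b\<close> to \<open>\<O>\<^sub>T\<close>. The fields \<open>mult\<close> and \<open>one\<close> are irrelevant.\<close>

definition ideal_module ::
  "('p, 'r) ringed \<Rightarrow> ('p, 'r) pointed \<Rightarrow> ('p, 'r, 'r) module_sheaf" where
  "ideal_module S = (\<lambda>(T, i).
     \<lparr> msec = (\<lambda>U. let A = sec T (ptf i ` U); J = ideal_sections S T i (ptf i ` U) in
         \<lparr> carrier = J, mult = mult A, one = one A, zero = zero A, add = add A,
           smult = (\<lambda>b j. THE k. k \<in> J \<and>
             (\<forall>V\<in>opens S. V \<subseteq> U \<longrightarrow> (\<forall>u\<in>carrier (sec T (ptf i ` V)).
                shf i (ptf i ` V) u = res S U V b \<longrightarrow>
                res T (ptf i ` U) (ptf i ` V) k =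
                  u \<otimes>\<^bsub>sec T (ptf i ` V)\<^esub> res T (ptf i ` U) (ptf i ` V) j))) \<rparr>),
       mres = (\<lambda>U V. res T (ptf i ` U) (ptf i ` V)) \<rparr>)"

text \<open>The elements of the fibre product are \<open>Duo u (Duo b j)\<close> with \<open>b\<close> the image of \<open>u\<close>,
  and such an element is sent to \<open>u + j\<close>.\<close>

definition coaction ::
  "('p, 'a universe) ringed \<Rightarrow> ('p, 'a universe) pointed \<Rightarrow>
   ('p, 'a universe, 'p, 'a universe) morph" where
  "coaction S = (\<lambda>(T, i).
     \<lparr> ptf = point_inverse S (T, i),
       shf = (\<lambda>U\<in>opens S.
                \<lambda>x\<in>carrier (amalg_ring (T, i) (I_pointed S (ideal_module S (T, i))) U).
                  left x \<oplus>\<^bsub>sec T (ptf i ` U)\<^esub> right (right x)) \<rparr>)"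

end

theory Submission
  imports Defs
begin

text \<open>A square zero immersion is a homeomorphism, so everything can be transported to the space of
  \<open>S\<close>: a square zero immersion becomes a sheaf of rings there with a locally surjective
  homomorphism to the structure sheaf whose kernel has square zero, and morphisms of pointed schemes
  become homomorphisms of such sheaves. Affineness of an open set is intrinsic: its points correspond
  to the primes of the ring of sections, with sections on basic open sets being fractions. In this
  form dual numbers and amalgamated sums are seen to be schemes, because \<open>S\<close> and \<open>\<Sigma>\<close> have a basis
  of common affine open sets, on which the ideal \<open>J\<close> localizes.

  A \<open>W\<close>-valued point of \<open>I\<^sub>S(J)\<close> is a derivation \<open>d\<close> with values in \<open>J\<close>, and it acts on a homomorphism
  \<open>x\<close> into \<open>\<O>\<^sub>\<Sigma>\<close> by \<open>x + d\<close>. Two such homomorphisms over \<open>\<O>\<^sub>S\<close> differ by a unique derivation,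
  which is the torsor property. The quotient by the action is the terminal object since a
  homomorphism out of \<open>\<O>\<^sub>\<Sigma>\<close> that is invariant under translation by \<open>J\<close> factors through \<open>\<O>\<^sub>S\<close>.\<close>

text \<open>The spectra here are concrete: points are prime ideals and sections are functions into
  localizations. An isomorphism with such a spectrum is awkward to write down for a space whose
  sections are pairs. The locale \<open>affine_chart\<close> avoids this: its axioms mention only
  points, germs that are units, and local fractions, so they can be verified for a new sheaf, and
  \<open>affine_open_chart\<close> and \<open>affine_chart_imp_affine_open\<close> translate back
  and forth. A square zero kernel changes neither primes nor unit germs, so an extension inherits
  the charts of its base as soon as the kernel localizes. This is carried out for extensions whose
  augmentation has a ring section, which is enough: dual numbers are split over \<open>S\<close>,
  and an amalgamated sum with dual numbers is split over its other summand by sending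
  \<open>u\<close> to the pair of \<open>u\<close> and its image with zero \<epsilon>-part. The
  coproduct of the thickening with itself needs no chart of its own: the sum with the dual numbers,
  with coprojection and coaction as legs, already has its universal property.\<close>

section \<open>Commutative algebra: ideals, primes and units\<close>

lemma (in cring) ideal_intro:
  assumes "I \<subseteq> carrier R" "\<zero> \<in> I" "\<And>a b. a \<in> I \<Longrightarrow> b \<in> I \<Longrightarrow> a \<oplus> b \<in> I"
    and abs: "\<And>r a. r \<in> carrier R \<Longrightarrow> a \<in> I \<Longrightarrow> r \<otimes> a \<in> I"
  shows "ideal I R"
proof (rule idealI[OF ring_axioms])
  show "subgroup I (add_monoid R)"
  proof (rule add.subgroupI)
    fix a assume a: "a \<in> I"
    then have "\<ominus> \<one> \<otimes> a \<in> I" by (intro abs) auto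
    then show "\<ominus> a \<in> I" using a assms(1) by (simp add: l_minus subset_iff)
  qed (use assms in auto)
next
  fix a x assume "a \<in> I" "x \<in> carrier R"
  then show "x \<otimes> a \<in> I" "a \<otimes> x \<in> I" using abs assms(1) m_comm[of a x] by auto
qed

text \<open>Zorn's lemma gives an ideal maximal among those containing \<open>I\<close> and missing
  all powers of \<open>f\<close>, and maximality makes it prime. Applied to ideals of annihilators
  or of admissible denominators, it turns a condition at every point into the existence of one
  exponent; this takes the place of quasi-compactness arguments.\<close>

lemma (in cring) prime_avoiding_powers:
  assumes I: "ideal I R" and f: "f \<in> carrier R" and av: "\<And>n::nat. f [^] n \<notin> I"
  shows "\<exists>P. primeideal P R \<and> I \<subseteq> P \<and> f \<notin> P"
proof -
  define \<A> where "\<A> = {L. ideal L R \<and> I \<subseteq> L \<and> (\<forall>n::nat. f [^] n \<notin> L)}"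
  have "\<exists>M\<in>\<A>. \<forall>L\<in>\<A>. M \<subseteq> L \<longrightarrow> L = M"
  proof (rule subset_Zorn)
    fix C assume C: "subset.chain \<A> C"
    show "\<exists>U\<in>\<A>. \<forall>L\<in>C. L \<subseteq> U"
    proof (cases "C = {}")
      case True
      then show ?thesis using I av by (auto simp: \<A>_def)
    next
      case False
      have "C \<subseteq> \<A>" using C by (simp add: pred_on.chain_def)
      then have idC: "ideal L R" if "L \<in> C" for L using that by (auto simp: \<A>_def)
      have "ideal (\<Union>C) R"
      proof (rule ideal_intro)
        show "\<Union>C \<subseteq> carrier R" using ideal.Icarr[OF idC] by blast
        obtain L where "L \<in> C" using False by blast
        then show "\<zero> \<in> \<Union>C"
          using additive_subgroup.zero_closed[OF ideal.axioms(1)[OF idC]] by blast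
        show "a \<oplus> b \<in> \<Union>C" if ab: "a \<in> \<Union>C" "b \<in> \<Union>C" for a b
        proof -
          obtain L L' where L: "L \<in> C" "a \<in> L" "L' \<in> C" "b \<in> L'" using ab by blast
          then have "L \<subseteq> L' \<or> L' \<subseteq> L" using C unfolding pred_on.chain_def by auto
          then obtain L where "L \<in> C" "a \<in> L" "b \<in> L" using L by blast
          then show ?thesis using additive_subgroup.a_closed[OF ideal.axioms(1)[OF idC]] by blast
        qed
        show "r \<otimes> a \<in> \<Union>C" if "r \<in> carrier R" "a \<in> \<Union>C" for r a
          using that ideal.I_l_closed[OF idC] by blast
      qed
      then have "\<Union>C \<in> \<A>"
        using False \<open>C \<subseteq> \<A>\<close> by (auto simp: \<A>_def)
      then show ?thesis by blast
    qed
  qed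
  then obtain M where M: "M \<in> \<A>" and max: "\<And>L. L \<in> \<A> \<Longrightarrow> M \<subseteq> L \<Longrightarrow> L = M" by blast
  have idM: "ideal M R" and IM: "I \<subseteq> M" and avM: "\<And>n::nat. f [^] n \<notin> M"
    using M by (auto simp: \<A>_def)
  interpret M: ideal M R by fact
  \<comment> \<open>Adjoining \<open>a\<close> to \<open>M\<close> gives a strictly larger ideal, so
    maximality forces a power of \<open>f\<close> into it.\<close>
  have ex: "\<exists>n::nat. \<exists>m\<in>M. \<exists>r\<in>carrier R. f [^] n = m \<oplus> r \<otimes> a"
    if a: "a \<in> carrier R" "a \<notin> M" for a
  proof (rule ccontr)
    assume neg: "\<not> ?thesis"
    let ?L = "M <+>\<^bsub>R\<^esub> PIdl a"
    have L: "ideal ?L R" using idM cgenideal_ideal[OF a(1)] by (rule add_ideals)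
    have Msub: "M \<subseteq> ?L"
    proof
      fix m assume m: "m \<in> M"
      have "m = m \<oplus> \<zero> \<otimes> a" using m M.Icarr a by simp
      moreover have "\<zero> \<otimes> a \<in> PIdl a" unfolding cgenideal_def by blast
      ultimately show "m \<in> ?L" using m unfolding set_add_def' by blast
    qed
    have aL: "a \<in> ?L"
    proof -
      have "a = \<zero> \<oplus> \<one> \<otimes> a" using a by simp
      moreover have "\<one> \<otimes> a \<in> PIdl a" unfolding cgenideal_def by blast
      ultimately show ?thesis using M.zero_closed unfolding set_add_def' by blast
    qed
    have "?L \<in> \<A>"
      using L Msub IM neg by (auto simp: \<A>_def set_add_def' cgenideal_def)
    from max[OF this Msub] aL a show False by simp
  qed
  have "primeideal M R"
  proof (rule primeidealI[OF idM is_cring])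
    \<comment> \<open>The zeroth power of \<open>f\<close> is the unit, so missing all powers
      includes being proper.\<close>
    show "carrier R \<noteq> M" using avM[of 0] by auto
    fix a b assume a: "a \<in> carrier R" and b: "b \<in> carrier R" and ab: "a \<otimes> b \<in> M"
    show "a \<in> M \<or> b \<in> M"
    proof (rule ccontr)
      assume "\<not> ?thesis"
      then have na: "a \<notin> M" and nb: "b \<notin> M" by auto
      obtain n m r where 1: "m \<in> M" "r \<in> carrier R" "f [^] (n::nat) = m \<oplus> r \<otimes> a"
        using ex[OF a na] by blast
      obtain n' m' r' where 2: "m' \<in> M" "r' \<in> carrier R" "f [^] (n'::nat) = m' \<oplus> r' \<otimes> b"
        using ex[OF b nb] by blast
      have mc: "m \<in> carrier R" "m' \<in> carrier R" using 1 2 M.Icarr by auto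
      have "f [^] (n + n') = f [^] n \<otimes> f [^] n'" using f by (simp add: nat_pow_mult)
      \<comment> \<open>Every term of the expansion has a factor \<open>m\<close>, \<open>m'\<close>
        or \<open>a \<otimes> b\<close>, and all of these lie in \<open>M\<close>.\<close>
      also have "\<dots> = (m \<otimes> (m' \<oplus> r' \<otimes> b) \<oplus> m' \<otimes> (r \<otimes> a)) \<oplus> (r \<otimes> r') \<otimes> (a \<otimes> b)"
        unfolding 1(3) 2(3) using mc 1(2) 2(2) a b by algebra
      also have "\<dots> \<in> M"
        using M.I_r_closed[OF 1(1), of "m' \<oplus> r' \<otimes> b"] M.I_r_closed[OF 2(1), of "r \<otimes> a"]
          M.I_l_closed[OF ab, of "r \<otimes> r'"] 1 2 a b mc
        by (simp add: M.a_closed)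
      finally show False using avM by blast
    qed
  qed
  then show ?thesis using IM avM[of 1] f by auto
qed

lemma (in cring) Units_iff: "u \<in> Units R \<longleftrightarrow> u \<in> carrier R \<and> (\<exists>v\<in>carrier R. u \<otimes> v = \<one>)"
  unfolding Units_def using m_comm by auto

lemma ring_hom_Units:
  assumes h: "h \<in> ring_hom R S" and u: "u \<in> Units R"
  shows "h u \<in> Units S"
proof -
  from u obtain v where "v \<in> carrier R" "v \<otimes>\<^bsub>R\<^esub> u = \<one>\<^bsub>R\<^esub>" "u \<otimes>\<^bsub>R\<^esub> v = \<one>\<^bsub>R\<^esub>" "u \<in> carrier R"
    by (auto simp: Units_def)
  then show ?thesis
    unfolding Units_def using h
    by (auto intro!: bexI[of _ "h v"] simp: ring_hom_closed ring_hom_one[OF h] simp flip: ring_hom_mult[OF h])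
qed

lemma ring_hom_minus:
  assumes "h \<in> ring_hom R S" "cring R" "cring S" "x \<in> carrier R" "y \<in> carrier R"
  shows "h (x \<ominus>\<^bsub>R\<^esub> y) = h x \<ominus>\<^bsub>S\<^esub> h y" "h (\<ominus>\<^bsub>R\<^esub> y) = \<ominus>\<^bsub>S\<^esub> h y"
proof -
  interpret ring_hom_cring R S h using assms by (simp add: ring_hom_cring_def ring_hom_cring_axioms_def)
  show "h (x \<ominus>\<^bsub>R\<^esub> y) = h x \<ominus>\<^bsub>S\<^esub> h y" "h (\<ominus>\<^bsub>R\<^esub> y) = \<ominus>\<^bsub>S\<^esub> h y"
    using assms by (simp_all add: R.minus_eq S.minus_eq)
qed

lemma (in cring) Units_mult_iff:
  assumes "a \<in> carrier R" "b \<in> carrier R"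
  shows "a \<otimes> b \<in> Units R \<longleftrightarrow> a \<in> Units R \<and> b \<in> Units R"
proof
  assume "a \<otimes> b \<in> Units R"
  then obtain v where v: "v \<in> carrier R" "a \<otimes> b \<otimes> v = \<one>" by (auto simp: Units_iff)
  have "a \<otimes> (b \<otimes> v) = \<one>" "b \<otimes> (a \<otimes> v) = \<one>"
    using v assms by (auto simp: m_ac)
  then show "a \<in> Units R \<and> b \<in> Units R"
    unfolding Units_iff using assms v by blast
qed (simp add: Units_m_closed)

lemma (in cring) Units_cancel:
  assumes "u \<in> Units R" "a \<in> carrier R" "b \<in> carrier R" "u \<otimes> a = u \<otimes> b"
  shows "a = b"
  using assms Units_l_cancel by blast

section \<open>Sheaves of rings\<close>

locale sheaf_space =
  fixes X :: "('p, 'r) ringed"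
  assumes ringed: "ringed_space X"
begin

lemma sec_cring: "openin (under X) U \<Longrightarrow> cring (sec X U)"
  using ringed unfolding ringed_space_def by simp

lemma sec_ring: "openin (under X) U \<Longrightarrow> ring (sec X U)"
  using sec_cring cring.axioms(1) by blast

lemma res_hom:
  "openin (under X) U \<Longrightarrow> openin (under X) V \<Longrightarrow> V \<subseteq> U \<Longrightarrow> res X U V \<in> ring_hom (sec X U) (sec X V)"
  using ringed unfolding ringed_space_def by simp

lemma res_id: "openin (under X) U \<Longrightarrow> s \<in> carrier (sec X U) \<Longrightarrow> res X U U s = s"
  using ringed unfolding ringed_space_def by simp

lemma res_res:
  "openin (under X) U \<Longrightarrow> openin (under X) V \<Longrightarrow> openin (under X) W \<Longrightarrow> W \<subseteq> V \<Longrightarrow> V \<subseteq> U \<Longrightarrow>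
   s \<in> carrier (sec X U) \<Longrightarrow> res X V W (res X U V s) = res X U W s"
  using ringed unfolding ringed_space_def by simp

lemma res_closed:
  "openin (under X) U \<Longrightarrow> openin (under X) V \<Longrightarrow> V \<subseteq> U \<Longrightarrow> s \<in> carrier (sec X U) \<Longrightarrow>
   res X U V s \<in> carrier (sec X V)"
  using res_hom ring_hom_closed by metis

lemma res_zero:
  "openin (under X) U \<Longrightarrow> openin (under X) V \<Longrightarrow> V \<subseteq> U \<Longrightarrow> res X U V \<zero>\<^bsub>sec X U\<^esub> = \<zero>\<^bsub>sec X V\<^esub>"
  by (rule ring_hom_zero[OF res_hom]) (auto intro: sec_ring)

lemma res_one:
  "openin (under X) U \<Longrightarrow> openin (under X) V \<Longrightarrow> V \<subseteq> U \<Longrightarrow> res X U V \<one>\<^bsub>sec X U\<^esub> = \<one>\<^bsub>sec X V\<^esub>"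
  by (rule ring_hom_one[OF res_hom])

lemma res_mult:
  "openin (under X) U \<Longrightarrow> openin (under X) V \<Longrightarrow> V \<subseteq> U \<Longrightarrow>
   s \<in> carrier (sec X U) \<Longrightarrow> t \<in> carrier (sec X U) \<Longrightarrow>
   res X U V (s \<otimes>\<^bsub>sec X U\<^esub> t) = res X U V s \<otimes>\<^bsub>sec X V\<^esub> res X U V t"
  by (rule ring_hom_mult[OF res_hom])

lemma res_add:
  "openin (under X) U \<Longrightarrow> openin (under X) V \<Longrightarrow> V \<subseteq> U \<Longrightarrow>
   s \<in> carrier (sec X U) \<Longrightarrow> t \<in> carrier (sec X U) \<Longrightarrow>
   res X U V (s \<oplus>\<^bsub>sec X U\<^esub> t) = res X U V s \<oplus>\<^bsub>sec X V\<^esub> res X U V t"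
  by (rule ring_hom_add[OF res_hom])

lemma res_minus:
  assumes "openin (under X) U" "openin (under X) V" "V \<subseteq> U"
    "s \<in> carrier (sec X U)" "t \<in> carrier (sec X U)"
  shows "res X U V (s \<ominus>\<^bsub>sec X U\<^esub> t) = res X U V s \<ominus>\<^bsub>sec X V\<^esub> res X U V t"
    "res X U V (\<ominus>\<^bsub>sec X U\<^esub> t) = \<ominus>\<^bsub>sec X V\<^esub> res X U V t"
  using ring_hom_minus[OF res_hom[OF assms(1-3)]] assms sec_cring by auto

lemma res_pow:
  assumes "openin (under X) U" "openin (under X) V" "V \<subseteq> U" "s \<in> carrier (sec X U)"
  shows "res X U V (s [^]\<^bsub>sec X U\<^esub> (n::nat)) = res X U V s [^]\<^bsub>sec X V\<^esub> n"
proof -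
  interpret ring_hom_ring "sec X U" "sec X V" "res X U V"
    using assms res_hom sec_ring by (intro ring_hom_ringI2) auto
  show ?thesis using assms by (simp add: hom_nat_pow)
qed

text \<open>The open sets on which the two sections agree cover \<open>U\<close>, so the sheaf axiom
  for covers applies.\<close>

lemma separated:
  assumes U: "openin (under X) U" and s: "s \<in> carrier (sec X U)" and t: "t \<in> carrier (sec X U)"
    and loc: "\<And>x. x \<in> U \<Longrightarrow> \<exists>V. openin (under X) V \<and> x \<in> V \<and> V \<subseteq> U \<and> res X U V s = res X U V t"
  shows "s = t"
proof -
  define \<V> where "\<V> = {V. openin (under X) V \<and> V \<subseteq> U \<and> res X U V s = res X U V t}"
  have un: "\<Union>\<V> = U" using loc unfolding \<V>_def by blast
  have sep: "\<forall>\<V> \<subseteq> opens X. \<forall>s\<in>carrier (sec X (\<Union>\<V>)). \<forall>t\<in>carrier (sec X (\<Union>\<V>)).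
        (\<forall>V\<in>\<V>. res X (\<Union>\<V>) V s = res X (\<Union>\<V>) V t) \<longrightarrow> s = t"
    using ringed unfolding ringed_space_def by (elim conjE)
  have "\<V> \<subseteq> opens X" by (auto simp: \<V>_def)
  from sep[rule_format, OF this, unfolded un, OF s t] show ?thesis
    by (auto simp: \<V>_def)
qed

text \<open>The local data form a relation instead of a function of the open set, so that sections
  built from arbitrary local lifts can be fed in directly. Compatibility of \<open>V\<close> with
  itself makes the section over each \<open>V\<close> unique.\<close>

lemma glue:
  assumes U: "openin (under X) U"
    and Q: "\<And>V s. Q V s \<Longrightarrow> openin (under X) V \<and> V \<subseteq> U \<and> s \<in> carrier (sec X V)"
    and cov: "\<And>x. x \<in> U \<Longrightarrow> \<exists>V s. x \<in> V \<and> Q V s"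
    and comp: "\<And>V s V' s'. Q V s \<Longrightarrow> Q V' s' \<Longrightarrow> res X V (V \<inter> V') s = res X V' (V \<inter> V') s'"
  shows "\<exists>t\<in>carrier (sec X U). \<forall>V s. Q V s \<longrightarrow> res X U V t = s"
proof -
  define \<V> where "\<V> = {V. \<exists>s. Q V s}"
  define f where "f V = (SOME s. Q V s)" for V
  have f: "Q V (f V)" if "V \<in> \<V>" for V using that unfolding f_def \<V>_def by (auto intro: someI_ex)
  have uniq: "s = f V" if "Q V s" for V s
  proof -
    have q: "Q V (f V)" using that by (intro f) (auto simp: \<V>_def)
    show ?thesis using comp[OF that q] Q[OF that] Q[OF q] by (simp add: res_id)
  qed
  have un: "\<Union>\<V> = U" using cov Q unfolding \<V>_def by blast
  have gl: "\<forall>\<V> \<subseteq> opens X. \<forall>s. (\<forall>V\<in>\<V>. s V \<in> carrier (sec X V)) \<and>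
        (\<forall>V\<in>\<V>. \<forall>W\<in>\<V>. res X V (V \<inter> W) (s V) = res X W (V \<inter> W) (s W)) \<longrightarrow>
        (\<exists>t\<in>carrier (sec X (\<Union>\<V>)). \<forall>V\<in>\<V>. res X (\<Union>\<V>) V t = s V)"
    using ringed unfolding ringed_space_def by (elim conjE)
  have sub: "\<V> \<subseteq> opens X" using Q by (auto simp: \<V>_def)
  have "(\<forall>V\<in>\<V>. f V \<in> carrier (sec X V)) \<and>
        (\<forall>V\<in>\<V>. \<forall>W\<in>\<V>. res X V (V \<inter> W) (f V) = res X W (V \<inter> W) (f W))"
    using f Q comp by meson
  from gl[rule_format, OF sub this, unfolded un] obtain t where
    "t \<in> carrier (sec X U)" "\<forall>V\<in>\<V>. res X U V t = f V" by blast
  then show ?thesis using uniq by (intro bexI[of _ t]) (auto simp: \<V>_def)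
qed

section \<open>Unit germs and the loci they define\<close>

lemma germ_unit_res:
  assumes U: "openin (under X) U" and V: "openin (under X) V" and "V \<subseteq> U" "x \<in> V" "s \<in> carrier (sec X U)"
  shows "germ_unit X x V (res X U V s) \<longleftrightarrow> germ_unit X x U s"
proof
  assume "germ_unit X x V (res X U V s)"
  then obtain W where W: "openin (under X) W" "x \<in> W" "W \<subseteq> V" "res X V W (res X U V s) \<in> Units (sec X W)"
    unfolding germ_unit_def by blast
  then show "germ_unit X x U s"
    unfolding germ_unit_def using assms res_res[of U V W s] by (intro exI[of _ W]) auto
next
  assume "germ_unit X x U s"
  then obtain W where W: "openin (under X) W" "x \<in> W" "W \<subseteq> U" "res X U W s \<in> Units (sec X W)"
    unfolding germ_unit_def by blast
  have o: "openin (under X) (W \<inter> V)" using W V by blast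
  have "res X W (W \<inter> V) (res X U W s) \<in> Units (sec X (W \<inter> V))"
    using W o by (auto intro: ring_hom_Units[OF res_hom])
  then have "res X V (W \<inter> V) (res X U V s) \<in> Units (sec X (W \<inter> V))"
    using res_res[of U W "W \<inter> V" s] res_res[of U V "W \<inter> V" s] assms W o by simp
  then show "germ_unit X x V (res X U V s)"
    unfolding germ_unit_def using assms W o by (intro exI[of _ "W \<inter> V"]) auto
qed

text \<open>In a commutative ring a product is a unit only if both factors are. This is the
  primality of the set of nonunit germs, and it makes the locus of a product the intersection of the
  loci.\<close>

lemma germ_unit_mult:
  assumes U: "openin (under X) U" "x \<in> U" "s \<in> carrier (sec X U)" "t \<in> carrier (sec X U)"
  shows "germ_unit X x U (s \<otimes>\<^bsub>sec X U\<^esub> t) \<longleftrightarrow> germ_unit X x U s \<and> germ_unit X x U t"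
proof
  assume "germ_unit X x U (s \<otimes>\<^bsub>sec X U\<^esub> t)"
  then obtain V where V: "openin (under X) V" "x \<in> V" "V \<subseteq> U" "res X U V (s \<otimes>\<^bsub>sec X U\<^esub> t) \<in> Units (sec X V)"
    unfolding germ_unit_def by blast
  interpret cring "sec X V" using V sec_cring by blast
  have "res X U V s \<in> Units (sec X V) \<and> res X U V t \<in> Units (sec X V)"
    using V assms by (simp add: res_mult Units_mult_iff res_closed)
  then show "germ_unit X x U s \<and> germ_unit X x U t"
    unfolding germ_unit_def using V by blast
next
  assume "germ_unit X x U s \<and> germ_unit X x U t"
  then obtain V V' where V: "openin (under X) V" "x \<in> V" "V \<subseteq> U" "res X U V s \<in> Units (sec X V)"
    and V': "openin (under X) V'" "x \<in> V'" "V' \<subseteq> U" "res X U V' t \<in> Units (sec X V')"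
    unfolding germ_unit_def by blast
  let ?W = "V \<inter> V'"
  have o: "openin (under X) ?W" using V V' by blast
  have "res X V ?W (res X U V s) \<in> Units (sec X ?W)" "res X V' ?W (res X U V' t) \<in> Units (sec X ?W)"
    using V V' o by (auto intro: ring_hom_Units[OF res_hom])
  then have "res X U ?W s \<in> Units (sec X ?W)" "res X U ?W t \<in> Units (sec X ?W)"
    using res_res[of U V ?W s] res_res[of U V' ?W t] assms V V' o by auto
  moreover interpret cring "sec X ?W" using o by (rule sec_cring)
  have "res X U ?W (s \<otimes>\<^bsub>sec X U\<^esub> t) = res X U ?W s \<otimes>\<^bsub>sec X ?W\<^esub> res X U ?W t"
    using assms V o by (intro res_mult) auto
  ultimately have "res X U ?W (s \<otimes>\<^bsub>sec X U\<^esub> t) \<in> Units (sec X ?W)" by simp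
  then show "germ_unit X x U (s \<otimes>\<^bsub>sec X U\<^esub> t)"
    unfolding germ_unit_def using V V' o by blast
qed

lemma germ_unit_one:
  assumes "openin (under X) U" "x \<in> U"
  shows "germ_unit X x U \<one>\<^bsub>sec X U\<^esub>"
proof -
  interpret cring "sec X U" using assms sec_cring by blast
  show ?thesis unfolding germ_unit_def using assms res_one[of U U]
    by (intro exI[of _ U]) auto
qed

lemma germ_unit_pow:
  assumes "openin (under X) U" "x \<in> U" "s \<in> carrier (sec X U)" "germ_unit X x U s"
  shows "germ_unit X x U (s [^]\<^bsub>sec X U\<^esub> (n::nat))"
proof -
  interpret cring "sec X U" using assms sec_cring by blast
  show ?thesis using assms by (induction n) (auto simp: germ_unit_mult germ_unit_one)
qed

text \<open>The nonvanishing locus of \<open>s\<close>; in a spectrum it is the basic open set of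
  \<open>s\<close>. Phrased through unit germs it makes sense in any ringed space.\<close>

definition D :: "'p set \<Rightarrow> 'r \<Rightarrow> 'p set" where
  "D U s = {x \<in> U. germ_unit X x U s}"

lemma D_subset: "D U s \<subseteq> U" by (auto simp: D_def)

lemma openin_D:
  assumes "openin (under X) U" "s \<in> carrier (sec X U)"
  shows "openin (under X) (D U s)"
proof (subst openin_subopen, rule ballI)
  fix x assume x: "x \<in> D U s"
  then obtain V where V: "openin (under X) V" "x \<in> V" "V \<subseteq> U" "res X U V s \<in> Units (sec X V)"
    unfolding D_def germ_unit_def by blast
  then have "V \<subseteq> D U s" unfolding D_def germ_unit_def by blast
  then show "\<exists>T. openin (under X) T \<and> x \<in> T \<and> T \<subseteq> D U s" using V by blast
qed

lemma D_mult:
  assumes "openin (under X) U" "s \<in> carrier (sec X U)" "t \<in> carrier (sec X U)"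
  shows "D U (s \<otimes>\<^bsub>sec X U\<^esub> t) = D U s \<inter> D U t"
  using assms by (auto simp: D_def germ_unit_mult)

lemma D_res:
  assumes "openin (under X) U" "openin (under X) V" "V \<subseteq> U" "s \<in> carrier (sec X U)"
  shows "D V (res X U V s) = D U s \<inter> V"
  using assms by (auto simp: D_def germ_unit_res)

text \<open>Near each point \<open>u\<close> is invertible and cancels; separatedness makes the
  local equalities global.\<close>

lemma germ_unit_cancel:
  assumes U: "openin (under X) U" and u: "u \<in> carrier (sec X U)" and s: "s \<in> carrier (sec X U)"
    and t: "t \<in> carrier (sec X U)"
    and gu: "\<And>x. x \<in> U \<Longrightarrow> germ_unit X x U u" and eq: "u \<otimes>\<^bsub>sec X U\<^esub> s = u \<otimes>\<^bsub>sec X U\<^esub> t"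
  shows "s = t"
proof (rule separated[OF U s t])
  fix x assume "x \<in> U"
  from gu[OF this] obtain V where V: "openin (under X) V" "x \<in> V" "V \<subseteq> U" "res X U V u \<in> Units (sec X V)"
    unfolding germ_unit_def by blast
  interpret cring "sec X V" using V sec_cring by blast
  have "res X U V u \<otimes>\<^bsub>sec X V\<^esub> res X U V s = res X U V u \<otimes>\<^bsub>sec X V\<^esub> res X U V t"
    using arg_cong[OF eq, of "res X U V"] V U u s t by (simp add: res_mult)
  then have "res X U V s = res X U V t"
    using V U s t res_closed by (auto intro: Units_cancel[OF V(4)])
  then show "\<exists>V. openin (under X) V \<and> x \<in> V \<and> V \<subseteq> U \<and> res X U V s = res X U V t" using V by blast
qed

text \<open>Inverses are unique, so local inverses agree on overlaps and glue to some
  \<open>t\<close>; that \<open>u\<close> times \<open>t\<close> is 1 is again a local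
  statement.\<close>

lemma Units_from_germs:
  assumes U: "openin (under X) U" and u: "u \<in> carrier (sec X U)"
    and gu: "\<And>x. x \<in> U \<Longrightarrow> germ_unit X x U u"
  shows "u \<in> Units (sec X U)"
proof -
  define Q where "Q V s \<longleftrightarrow> openin (under X) V \<and> V \<subseteq> U \<and> s \<in> carrier (sec X V) \<and>
     res X U V u \<otimes>\<^bsub>sec X V\<^esub> s = \<one>\<^bsub>sec X V\<^esub>" for V s
  have "\<exists>t\<in>carrier (sec X U). \<forall>V s. Q V s \<longrightarrow> res X U V t = s"
  proof (rule glue[OF U])
    fix x assume "x \<in> U"
    from gu[OF this] obtain V where V: "openin (under X) V" "x \<in> V" "V \<subseteq> U" "res X U V u \<in> Units (sec X V)"
      unfolding germ_unit_def by blast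
    interpret cring "sec X V" using V sec_cring by blast
    show "\<exists>V s. x \<in> V \<and> Q V s" using V unfolding Units_iff Q_def by blast
  next
    fix V s V' s' assume q: "Q V s" "Q V' s'"
    let ?W = "V \<inter> V'"
    have o: "openin (under X) ?W" using q by (auto simp: Q_def)
    interpret cring "sec X ?W" using o by (rule sec_cring)
    have 1: "res X U ?W u \<otimes>\<^bsub>sec X ?W\<^esub> res X V ?W s = \<one>\<^bsub>sec X ?W\<^esub>"
      using q o u U res_mult[of V ?W "res X U V u" s] res_res[of U V ?W u] res_one[of V ?W]
      by (auto simp: Q_def res_closed)
    have 2: "res X U ?W u \<otimes>\<^bsub>sec X ?W\<^esub> res X V' ?W s' = \<one>\<^bsub>sec X ?W\<^esub>"
      using q o u U res_mult[of V' ?W "res X U V' u" s'] res_res[of U V' ?W u] res_one[of V' ?W]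
      by (auto simp: Q_def res_closed)
    have c: "res X U ?W u \<in> carrier (sec X ?W)" "res X V ?W s \<in> carrier (sec X ?W)" "res X V' ?W s' \<in> carrier (sec X ?W)"
      using q o u U by (auto simp: Q_def intro!: res_closed)
    then have "res X U ?W u \<in> Units (sec X ?W)" using 1 unfolding Units_iff by blast
    then show "res X V ?W s = res X V' ?W s'" using c 1 2 by (metis Units_cancel)
  qed (auto simp: Q_def)
  then obtain t where t: "t \<in> carrier (sec X U)" and tq: "\<And>V s. Q V s \<Longrightarrow> res X U V t = s" by blast
  interpret cring "sec X U" using U by (rule sec_cring)
  have "u \<otimes>\<^bsub>sec X U\<^esub> t = \<one>\<^bsub>sec X U\<^esub>"
  proof (rule separated[OF U])
    fix x assume "x \<in> U"
    from gu[OF this] obtain V where V: "openin (under X) V" "x \<in> V" "V \<subseteq> U" "res X U V u \<in> Units (sec X V)"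
      unfolding germ_unit_def by blast
    interpret V: cring "sec X V" using V sec_cring by blast
    obtain s where s: "s \<in> carrier (sec X V)" "res X U V u \<otimes>\<^bsub>sec X V\<^esub> s = \<one>\<^bsub>sec X V\<^esub>"
      using V unfolding V.Units_iff by blast
    then have "res X U V t = s" using V by (intro tq) (auto simp: Q_def)
    then have "res X U V (u \<otimes>\<^bsub>sec X U\<^esub> t) = res X U V \<one>\<^bsub>sec X U\<^esub>"
      using s V u t U by (simp add: res_mult res_one)
    then show "\<exists>V. openin (under X) V \<and> x \<in> V \<and> V \<subseteq> U \<and> res X U V (u \<otimes>\<^bsub>sec X U\<^esub> t) = res X U V \<one>\<^bsub>sec X U\<^esub>"
      using V by blast
  qed (use u t in auto)
  then show ?thesis unfolding Units_iff using u t by blast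
qed

end

section \<open>Affine charts\<close>

lemma (in cring) primeideal_intro:
  assumes "I \<subseteq> carrier R" "\<zero> \<in> I" "\<And>a b. a \<in> I \<Longrightarrow> b \<in> I \<Longrightarrow> a \<oplus> b \<in> I"
    and "\<And>r a. r \<in> carrier R \<Longrightarrow> a \<in> I \<Longrightarrow> r \<otimes> a \<in> I" and "\<one> \<notin> I"
    and "\<And>a b. a \<in> carrier R \<Longrightarrow> b \<in> carrier R \<Longrightarrow> a \<otimes> b \<in> I \<Longrightarrow> a \<in> I \<or> b \<in> I"
  shows "primeideal I R"
  using assms by (intro primeidealI ideal_intro is_cring) auto

lemma (in cring) annihilator_ideal: "s \<in> carrier R \<Longrightarrow> ideal {h \<in> carrier R. h \<otimes> s = \<zero>} R"
  by (rule ideal_intro) (auto simp: l_distr m_assoc)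

text \<open>In degree \<open>m + n\<close> every monomial is divisible by \<open>a^m\<close> or by
  \<open>b^n\<close>. The induction multiplies the expansions for \<open>(m - 1, n)\<close> and
  \<open>(m, n - 1)\<close> by \<open>a\<close> and by \<open>b\<close>, which avoids binomial
  coefficients.\<close>

lemma (in cring) sum_pow:
  assumes a: "a \<in> carrier R" and b: "b \<in> carrier R"
  shows "\<exists>c\<in>carrier R. \<exists>d\<in>carrier R. (a \<oplus> b) [^] (m + n) = c \<otimes> a [^] (m::nat) \<oplus> d \<otimes> b [^] (n::nat)"
proof (induction "m + n" arbitrary: m n)
  case 0
  then show ?case by (intro bexI[of _ "\<one>"] bexI[of _ "\<zero>"]) auto
next
  case (Suc k)
  consider "m = 0" | "n = 0" | m' n' where "m = Suc m'" "n = Suc n'" by (cases m; cases n) auto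
  then show ?case
  proof cases
    case 1
    then show ?thesis using a b by (intro bexI[of _ "(a \<oplus> b) [^] n"] bexI[of _ "\<zero>"]) auto
  next
    case 2
    then show ?thesis using a b by (intro bexI[of _ "\<zero>"] bexI[of _ "(a \<oplus> b) [^] m"]) auto
  next
    case 3
    obtain c d where cd: "c \<in> carrier R" "d \<in> carrier R" "(a \<oplus> b) [^] (m' + n) = c \<otimes> a [^] m' \<oplus> d \<otimes> b [^] n"
      using Suc(1)[of m' n] Suc(2) 3 by auto
    obtain c' d' where cd': "c' \<in> carrier R" "d' \<in> carrier R" "(a \<oplus> b) [^] (m + n') = c' \<otimes> a [^] m \<oplus> d' \<otimes> b [^] n'"
      using Suc(1)[of m n'] Suc(2) 3 by auto
    have k: "m + n' = k" "m' + n = k" using Suc(2) 3 by auto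
    have [simp]: "a [^] m \<in> carrier R" "a [^] m' \<in> carrier R" "b [^] n \<in> carrier R" "b [^] n' \<in> carrier R"
      using a b by auto
    have "(a \<oplus> b) [^] (m + n) = (a \<oplus> b) [^] k \<otimes> (a \<oplus> b)"
      using Suc(2) by (metis nat_pow_Suc)
    also have "\<dots> = (a \<oplus> b) [^] k \<otimes> a \<oplus> (a \<oplus> b) [^] k \<otimes> b" using a b by (simp add: r_distr)
    also have "\<dots> = (c \<otimes> a [^] m' \<oplus> d \<otimes> b [^] n) \<otimes> a \<oplus> (c' \<otimes> a [^] m \<oplus> d' \<otimes> b [^] n') \<otimes> b"
      using cd(3) cd'(3) k by metis
    also have "\<dots> = (c \<oplus> c' \<otimes> b) \<otimes> a [^] m \<oplus> (d \<otimes> a \<oplus> d') \<otimes> b [^] n"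
    proof -
      have "a [^] m = a [^] m' \<otimes> a" "b [^] n = b [^] n' \<otimes> b" using 3 by simp_all
      moreover have "a [^] m' \<in> carrier R" "b [^] n' \<in> carrier R" using a b by auto
      ultimately show ?thesis using a b cd(1,2) cd'(1,2)
        by (simp add: l_distr r_distr m_ac a_ac)
    qed
    finally show ?thesis using a b cd(1,2) cd'(1,2)
      by (intro bexI[of _ "c \<oplus> c' \<otimes> b"] bexI[of _ "d \<otimes> a \<oplus> d'"]) auto
  qed
qed

text \<open>The prime of \<open>R\<close> belonging to the point \<open>x\<close>: in a local stalk
  the maximal ideal consists of the nonunits, so it can be described without forming the
  stalk.\<close>

definition vanishing :: "('p, 'r) ringed \<Rightarrow> 'p set \<Rightarrow> 's ring \<Rightarrow> ('s \<Rightarrow> 'r) \<Rightarrow> 'p \<Rightarrow> 's set" where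
  "vanishing X U R \<psi> x = {r \<in> carrier R. \<not> germ_unit X x U (\<psi> r)}"

text \<open>An intrinsic form of being isomorphic to the spectrum of \<open>R\<close>. The axioms on
  \<open>vanishing\<close> and \<open>basis\<close> identify points and topology. The last two say
  that the stalk at \<open>x\<close> is the localization of \<open>R\<close> at the prime of
  \<open>x\<close>: \<open>locally_zero\<close> is injectivity, \<open>locally_fraction\<close>
  surjectivity. Being stalkwise, they are easier to check for a new sheaf than a description of
  sections over basic open sets, which is derived from them.\<close>

locale affine_chart = sheaf_space X + cring R
  for X :: "('p, 'r) ringed" and U :: "'p set" and R :: "'s ring" (structure) and \<psi> :: "'s \<Rightarrow> 'r" +
  assumes open_chart: "openin (under X) U"
    and psi_hom: "\<psi> \<in> ring_hom R (sec X U)"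
    and vanishing_prime: "x \<in> U \<Longrightarrow> primeideal (vanishing X U R \<psi> x) R"
    and vanishing_inj: "inj_on (vanishing X U R \<psi>) U"
    and vanishing_surj: "primeideal P R \<Longrightarrow> \<exists>x\<in>U. P = vanishing X U R \<psi> x"
    and basis: "openin (under X) V \<Longrightarrow> V \<subseteq> U \<Longrightarrow> x \<in> V \<Longrightarrow>
        \<exists>f\<in>carrier R. x \<in> D U (\<psi> f) \<and> D U (\<psi> f) \<subseteq> V"
    and locally_zero: "openin (under X) V \<Longrightarrow> V \<subseteq> U \<Longrightarrow> x \<in> V \<Longrightarrow> s \<in> carrier R \<Longrightarrow>
        res X U V (\<psi> s) = \<zero>\<^bsub>sec X V\<^esub> \<Longrightarrow> \<exists>h\<in>carrier R. x \<in> D U (\<psi> h) \<and> h \<otimes> s = \<zero>"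
    and locally_fraction: "openin (under X) V \<Longrightarrow> V \<subseteq> U \<Longrightarrow> x \<in> V \<Longrightarrow> t \<in> carrier (sec X V) \<Longrightarrow>
        \<exists>W a f. openin (under X) W \<and> x \<in> W \<and> W \<subseteq> V \<and> a \<in> carrier R \<and> f \<in> carrier R \<and> x \<in> D U (\<psi> f) \<and>
          res X U W (\<psi> f) \<otimes>\<^bsub>sec X W\<^esub> res X V W t = res X U W (\<psi> a)"
begin

definition phi :: "'p set \<Rightarrow> 's \<Rightarrow> 'r" where
  "phi V r = res X U V (\<psi> r)"

lemma psi_closed [simp]: "r \<in> carrier R \<Longrightarrow> \<psi> r \<in> carrier (sec X U)"
  using psi_hom ring_hom_closed by metis

lemma phi_hom:
  assumes "openin (under X) V" "V \<subseteq> U"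
  shows "phi V \<in> ring_hom R (sec X V)"
proof -
  have "phi V = res X U V \<circ> \<psi>" by (auto simp: phi_def)
  then show ?thesis using ring_hom_trans[OF psi_hom res_hom[OF open_chart assms]] by simp
qed

lemma phi_cring_hom:
  assumes "openin (under X) V" "V \<subseteq> U"
  shows "ring_hom_cring R (sec X V) (phi V)"
  using phi_hom[OF assms] assms sec_cring is_cring
  by (simp add: ring_hom_cring_def ring_hom_cring_axioms_def)

lemma phi_pow:
  assumes "openin (under X) V" "V \<subseteq> U" "r \<in> carrier R"
  shows "phi V (r [^] (n::nat)) = phi V r [^]\<^bsub>sec X V\<^esub> n"
proof -
  interpret ring_hom_ring R "sec X V" "phi V"
    using assms phi_hom sec_ring ring_axioms by (intro ring_hom_ringI2) auto
  show ?thesis using assms by (simp add: hom_nat_pow)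
qed

lemma res_phi:
  assumes "openin (under X) V" "openin (under X) W" "W \<subseteq> V" "V \<subseteq> U" "r \<in> carrier R"
  shows "res X V W (phi V r) = phi W r"
  using assms open_chart by (simp add: phi_def res_res)

lemma open_D: "f \<in> carrier R \<Longrightarrow> openin (under X) (D U (\<psi> f))"
  by (simp add: openin_D open_chart)

lemma D_iff: "f \<in> carrier R \<Longrightarrow> x \<in> U \<Longrightarrow> x \<in> D U (\<psi> f) \<longleftrightarrow> f \<notin> vanishing X U R \<psi> x"
  by (auto simp: D_def vanishing_def)

lemma D_psi_mult: "f \<in> carrier R \<Longrightarrow> g \<in> carrier R \<Longrightarrow> D U (\<psi> (f \<otimes> g)) = D U (\<psi> f) \<inter> D U (\<psi> g)"
  using ring_hom_mult[OF psi_hom] by (simp add: D_mult open_chart)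

lemma D_psi_one: "D U (\<psi> \<one>) = U"
  using ring_hom_one[OF psi_hom] germ_unit_one[OF open_chart] by (auto simp: D_def)

lemma D_psi_zero: "D U (\<psi> \<zero>) = {}"
proof -
  have "\<zero> \<in> vanishing X U R \<psi> x" if "x \<in> U" for x
    using vanishing_prime[OF that] additive_subgroup.zero_closed ideal.axioms(1) primeideal.axioms(1) by metis
  then show ?thesis by (auto simp: D_def vanishing_def)
qed

lemma D_psi_add:
  assumes "f \<in> carrier R" "g \<in> carrier R"
  shows "D U (\<psi> (f \<oplus> g)) \<subseteq> D U (\<psi> f) \<union> D U (\<psi> g)"
proof
  fix x assume x: "x \<in> D U (\<psi> (f \<oplus> g))"
  then have xU: "x \<in> U" by (auto simp: D_def)
  interpret P: primeideal "vanishing X U R \<psi> x" R using vanishing_prime[OF xU] .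
  show "x \<in> D U (\<psi> f) \<union> D U (\<psi> g)"
    using x xU assms D_iff P.a_closed by auto
qed

lemma D_psi_pow:
  assumes "f \<in> carrier R"
  shows "D U (\<psi> f) \<subseteq> D U (\<psi> (f [^] (n::nat)))"
  using assms by (induction n) (auto simp: D_psi_one D_psi_mult, auto simp: D_def)

section \<open>Sections over a basic open set are fractions\<close>

text \<open>If the annihilator of \<open>s\<close> contained no power of \<open>f\<close>, some
  prime would contain it and miss \<open>f\<close>; at the point of that prime
  \<open>locally_zero\<close> yields an annihilating element outside the prime.\<close>

lemma zero_on_D:
  assumes f: "f \<in> carrier R" and s: "s \<in> carrier R"
    and z: "phi (D U (\<psi> f)) s = \<zero>\<^bsub>sec X (D U (\<psi> f))\<^esub>"
  shows "\<exists>n::nat. f [^] n \<otimes> s = \<zero>"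
proof (rule ccontr)
  assume neg: "\<not> ?thesis"
  let ?I = "{h \<in> carrier R. h \<otimes> s = \<zero>}"
  obtain P where P: "primeideal P R" "?I \<subseteq> P" "f \<notin> P"
    using prime_avoiding_powers[OF annihilator_ideal[OF s] f] neg by auto
  then obtain x where x: "x \<in> U" "P = vanishing X U R \<psi> x" using vanishing_surj by blast
  have xD: "x \<in> D U (\<psi> f)" using P x f D_iff by blast
  obtain h where "h \<in> carrier R" "x \<in> D U (\<psi> h)" "h \<otimes> s = \<zero>"
    using locally_zero[OF open_D[OF f] D_subset xD s] z by (auto simp: phi_def)
  then show False using P x D_iff by blast
qed

text \<open>Says that \<open>t = s / g^n\<close> over the locus of \<open>g\<close>, written without
  division. The exponent is kept as a parameter because gluing has to bring several such fractions
  to a common one.\<close>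

definition extends :: "'p set \<Rightarrow> 'r \<Rightarrow> 's \<Rightarrow> nat \<Rightarrow> 's \<Rightarrow> bool" where
  "extends V t g n s \<longleftrightarrow> s \<in> carrier R \<and>
     phi (D U (\<psi> g)) s = phi (D U (\<psi> g)) g [^]\<^bsub>sec X (D U (\<psi> g))\<^esub> n \<otimes>\<^bsub>sec X (D U (\<psi> g))\<^esub> res X V (D U (\<psi> g)) t"

lemma extends_res:
  assumes e: "extends V t g n s" and V: "openin (under X) V" "V \<subseteq> U" "t \<in> carrier (sec X V)"
    and g: "g \<in> carrier R" "D U (\<psi> g) \<subseteq> V" and W: "openin (under X) W" "W \<subseteq> D U (\<psi> g)"
  shows "phi W s = phi W g [^]\<^bsub>sec X W\<^esub> n \<otimes>\<^bsub>sec X W\<^esub> res X V W t"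
proof -
  let ?D = "D U (\<psi> g)"
  note o = open_D[OF g(1)]
  interpret D: cring "sec X ?D" using o by (rule sec_cring)
  have DU: "?D \<subseteq> U" by (rule D_subset)
  have pc: "phi ?D g \<in> carrier (sec X ?D)" using phi_hom[OF o DU] g ring_hom_closed by metis
  have s: "s \<in> carrier R" using e by (simp add: extends_def)
  have "phi W s = res X ?D W (phi ?D s)" using res_phi[OF o W DU s] by simp
  also have "\<dots> = res X ?D W (phi ?D g [^]\<^bsub>sec X ?D\<^esub> n) \<otimes>\<^bsub>sec X W\<^esub> res X ?D W (res X V ?D t)"
    using e pc V W o g unfolding extends_def by (subst res_mult[symmetric]) (auto intro: res_closed)
  also have "\<dots> = phi W g [^]\<^bsub>sec X W\<^esub> n \<otimes>\<^bsub>sec X W\<^esub> res X V W t"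
    using res_pow[OF o W pc] res_phi[OF o W DU g(1)] res_res[OF V(1) o W(1,2) g(2) V(3)] by simp
  finally show ?thesis .
qed

text \<open>The fraction \<open>s / g^n\<close> expanded by \<open>r^n\<close>; it shows that
  admissible denominators absorb multiples.\<close>

lemma extends_mult:
  assumes V: "openin (under X) V" "V \<subseteq> U" "t \<in> carrier (sec X V)"
    and g: "g \<in> carrier R" "D U (\<psi> g) \<subseteq> V" and r: "r \<in> carrier R" and e: "extends V t g n s"
  shows "extends V t (r \<otimes> g) n (r [^] n \<otimes> s)"
proof -
  let ?W = "D U (\<psi> (r \<otimes> g))"
  have o: "openin (under X) ?W" using g r by (intro open_D) auto
  have WU: "?W \<subseteq> U" by (rule D_subset)
  have WD: "?W \<subseteq> D U (\<psi> g)" using g r by (simp add: D_psi_mult)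
  have s: "s \<in> carrier R" using e by (simp add: extends_def)
  interpret W: ring_hom_cring R "sec X ?W" "phi ?W" using phi_cring_hom[OF o WU] .
  have tc: "res X V ?W t \<in> carrier (sec X ?W)" using V o WD g by (auto intro: res_closed)
  show ?thesis
    unfolding extends_def using extends_res[OF e V g o WD] r g s tc
    by (simp add: phi_pow[OF o WU] W.S.m_assoc W.S.nat_pow_distrib)
qed

text \<open>The fraction \<open>s / g^n\<close> expanded by \<open>g^k\<close>, which leaves the
  locus unchanged.\<close>

lemma extends_raise:
  assumes V: "openin (under X) V" "V \<subseteq> U" "t \<in> carrier (sec X V)"
    and g: "g \<in> carrier R" "D U (\<psi> g) \<subseteq> V" and e: "extends V t g n s"
  shows "extends V t g (n + k) (g [^] k \<otimes> s)"
proof -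
  let ?W = "D U (\<psi> g)"
  have o: "openin (under X) ?W" using g by (intro open_D) auto
  have WU: "?W \<subseteq> U" by (rule D_subset)
  interpret W: ring_hom_cring R "sec X ?W" "phi ?W" using phi_cring_hom[OF o WU] .
  have tc: "res X V ?W t \<in> carrier (sec X ?W)" using V o g by (auto intro: res_closed)
  have gc: "phi ?W g \<in> carrier (sec X ?W)" using g by simp
  show ?thesis
    using e g tc gc unfolding extends_def
    by (simp add: phi_pow[OF o WU] W.S.m_ac flip: W.S.nat_pow_mult)
qed

text \<open>Brought to a common exponent, the two numerators agree over the locus of
  \<open>g1 \<otimes> g2\<close> after cross multiplication, hence in \<open>R\<close> once a power
  of \<open>g1 \<otimes> g2\<close> is multiplied in. Absorbing that power gives
  \<open>g1^N v2 = g2^N v1\<close> in \<open>R\<close>. Writing a power of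
  \<open>g1 \<oplus> g2\<close> as a combination of \<open>g1^N\<close> and \<open>g2^N\<close>, the
  same combination of \<open>v1\<close> and \<open>v2\<close> is the new numerator.\<close>

lemma extends_add:
  assumes V: "openin (under X) V" "V \<subseteq> U" "t \<in> carrier (sec X V)"
    and g: "g1 \<in> carrier R" "g2 \<in> carrier R" "D U (\<psi> g1) \<subseteq> V" "D U (\<psi> g2) \<subseteq> V"
    and e: "extends V t g1 n1 s1" "extends V t g2 n2 s2"
  shows "\<exists>n s. extends V t (g1 \<oplus> g2) n s"
proof -
  \<comment> \<open>The sum is a common exponent: each fraction is raised by the exponent of the
    other.\<close>
  define n where "n = n1 + n2"
  obtain u1 where e1: "extends V t g1 n u1" using extends_raise[OF V g(1,3) e(1)] n_def by blast
  obtain u2 where e2: "extends V t g2 n u2" using extends_raise[OF V g(2,4) e(2), of n1] n_def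
    by (metis add.commute)
  have u: "u1 \<in> carrier R" "u2 \<in> carrier R" using e1 e2 by (auto simp: extends_def)
  let ?W = "D U (\<psi> (g1 \<otimes> g2))"
  have W: "openin (under X) ?W" "?W \<subseteq> U" "?W \<subseteq> D U (\<psi> g1)" "?W \<subseteq> D U (\<psi> g2)" "?W \<subseteq> V"
    using g V(2) open_D[of "g1 \<otimes> g2"] D_subset[of U] by (auto simp: D_psi_mult)
  interpret W: ring_hom_cring R "sec X ?W" "phi ?W" using phi_cring_hom[OF W(1,2)] .
  have tW: "res X V ?W t \<in> carrier (sec X ?W)" using V W by (auto intro: res_closed)
  have "phi ?W (g1 [^] n \<otimes> u2) = phi ?W (g2 [^] n \<otimes> u1)"
    using extends_res[OF e1 V g(1,3) W(1,3)] extends_res[OF e2 V g(2,4) W(1,4)] u g tW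
    by (simp add: phi_pow[OF W(1,2)] W.S.m_ac)
  \<comment> \<open>Two numerators of the same section \<open>t\<close> on the overlap: their cross
    difference restricts to zero, so \<open>zero_on_D\<close> kills it in \<open>R\<close> by a
    power of \<open>g1 \<otimes> g2\<close>.\<close>
  then have "phi ?W (g1 [^] n \<otimes> u2 \<ominus> g2 [^] n \<otimes> u1) = \<zero>\<^bsub>sec X ?W\<^esub>"
    using ring_hom_minus(1)[OF phi_hom[OF W(1,2)] is_cring sec_cring[OF W(1)], of "g1 [^] n \<otimes> u2" "g2 [^] n \<otimes> u1"] u g
    by (simp add: W.S.minus_eq W.S.r_neg del: W.hom_mult)
  then obtain m where m: "(g1 \<otimes> g2) [^] (m::nat) \<otimes> (g1 [^] n \<otimes> u2 \<ominus> g2 [^] n \<otimes> u1) = \<zero>"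
    using zero_on_D[of "g1 \<otimes> g2" "g1 [^] n \<otimes> u2 \<ominus> g2 [^] n \<otimes> u1"] u g by auto
  \<comment> \<open>The surplus \<open>m\<close> is what makes the cross equation hold in
    \<open>R\<close> itself.\<close>
  define N where "N = n + m"
  define v1 where "v1 = g1 [^] m \<otimes> u1"
  define v2 where "v2 = g2 [^] m \<otimes> u2"
  have E1: "extends V t g1 N v1" unfolding N_def v1_def by (rule extends_raise[OF V g(1,3) e1])
  have E2: "extends V t g2 N v2" unfolding N_def v2_def by (rule extends_raise[OF V g(2,4) e2])
  have v: "v1 \<in> carrier R" "v2 \<in> carrier R" using E1 E2 by (auto simp: extends_def)
  define p1 p2 q1 q2 where pq: "p1 = g1 [^] n" "p2 = g2 [^] n" "q1 = g1 [^] m" "q2 = g2 [^] m"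
  have pqc: "p1 \<in> carrier R" "p2 \<in> carrier R" "q1 \<in> carrier R" "q2 \<in> carrier R" using g pq by auto
  have "(q1 \<otimes> q2) \<otimes> (p1 \<otimes> u2 \<ominus> p2 \<otimes> u1) = \<zero>" using m g by (simp add: pq nat_pow_distrib)
  then have cross: "(p1 \<otimes> q1) \<otimes> (q2 \<otimes> u2) = (p2 \<otimes> q2) \<otimes> (q1 \<otimes> u1)"
    using pqc u by (auto simp: minus_eq r_distr r_minus m_ac intro!: minus_equality[symmetric] elim!: sum_zero_eq_neg[THEN trans, rotated 2])
  have cr: "g1 [^] N \<otimes> v2 = g2 [^] N \<otimes> v1"
    using cross g unfolding N_def v1_def v2_def pq by (simp add: nat_pow_mult)
  \<comment> \<open>With exponent \<open>N + N\<close> every term of the expansion carries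
    \<open>g1^N\<close> or \<open>g2^N\<close>.\<close>
  obtain c1 c2 where c: "c1 \<in> carrier R" "c2 \<in> carrier R" "(g1 \<oplus> g2) [^] (N + N) = c1 \<otimes> g1 [^] N \<oplus> c2 \<otimes> g2 [^] N"
    using sum_pow[OF g(1,2)] by blast
  define s where "s = c1 \<otimes> v1 \<oplus> c2 \<otimes> v2"
  have sc: "s \<in> carrier R" using c v by (simp add: s_def)
  have gN: "g1 [^] N \<in> carrier R" "g2 [^] N \<in> carrier R" using g by auto
  have s1: "g1 [^] N \<otimes> s = (g1 \<oplus> g2) [^] (N + N) \<otimes> v1"
  proof -
    have "g1 [^] N \<otimes> s = c1 \<otimes> g1 [^] N \<otimes> v1 \<oplus> c2 \<otimes> (g1 [^] N \<otimes> v2)"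
      unfolding s_def using c(1,2) v gN by (simp add: r_distr m_ac)
    then show ?thesis unfolding cr c(3) using c(1,2) v gN by (simp add: l_distr r_distr m_ac)
  qed
  have s2: "g2 [^] N \<otimes> s = (g1 \<oplus> g2) [^] (N + N) \<otimes> v2"
  proof -
    have "g2 [^] N \<otimes> s = c1 \<otimes> (g2 [^] N \<otimes> v1) \<oplus> c2 \<otimes> g2 [^] N \<otimes> v2"
      unfolding s_def using c(1,2) v gN by (simp add: r_distr m_ac)
    then show ?thesis unfolding cr[symmetric] c(3) using c(1,2) v gN by (simp add: l_distr r_distr m_ac)
  qed
  let ?G = "D U (\<psi> (g1 \<oplus> g2))"
  have G: "openin (under X) ?G" "?G \<subseteq> U" "?G \<subseteq> V" using g D_psi_add[OF g(1,2)] D_subset open_D by auto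
  interpret G: ring_hom_cring R "sec X ?G" "phi ?G" using phi_cring_hom[OF G(1,2)] .
  have tG: "res X V ?G t \<in> carrier (sec X ?G)" using V G by (auto intro: res_closed)
  \<comment> \<open>On the locus of \<open>gi\<close> the power \<open>gi^N\<close> has unit germs,
    so the equation may be tested after multiplication by it, where the cross equation for
    \<open>s\<close> and the fraction with numerator \<open>vi\<close> give it.\<close>
  have loc: "phi W s = phi W (g1 \<oplus> g2) [^]\<^bsub>sec X W\<^esub> (N + N) \<otimes>\<^bsub>sec X W\<^esub> res X V W t"
    if gi: "gi \<in> carrier R" "D U (\<psi> gi) \<subseteq> V" "extends V t gi N vi" "gi [^] N \<otimes> s = (g1 \<oplus> g2) [^] (N + N) \<otimes> vi"
      and W: "openin (under X) W" "W \<subseteq> D U (\<psi> gi)" for gi vi W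
  proof -
    have WU: "W \<subseteq> U" "W \<subseteq> V" using W D_subset gi by blast+
    interpret W: ring_hom_cring R "sec X W" "phi W" using phi_cring_hom[OF W(1) WU(1)] .
    have vi: "vi \<in> carrier R" using gi by (simp add: extends_def)
    have tW: "res X V W t \<in> carrier (sec X W)" using V W WU by (auto intro: res_closed)
    have gc: "phi W gi \<in> carrier (sec X W)" "phi W (g1 \<oplus> g2) \<in> carrier (sec X W)" using gi g by auto
    have gu: "germ_unit X y W (phi W gi)" if "y \<in> W" for y
      using that W WU gi open_chart unfolding phi_def by (subst germ_unit_res) (auto simp: D_def)
    show ?thesis
    proof (rule germ_unit_cancel[OF W(1)])
      show "phi W gi [^]\<^bsub>sec X W\<^esub> N \<otimes>\<^bsub>sec X W\<^esub> phi W s =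
        phi W gi [^]\<^bsub>sec X W\<^esub> N \<otimes>\<^bsub>sec X W\<^esub> (phi W (g1 \<oplus> g2) [^]\<^bsub>sec X W\<^esub> (N + N) \<otimes>\<^bsub>sec X W\<^esub> res X V W t)"
      proof -
        have "phi W gi [^]\<^bsub>sec X W\<^esub> N \<otimes>\<^bsub>sec X W\<^esub> phi W s = phi W (gi [^] N \<otimes> s)"
          using gi(1) sc by (simp add: phi_pow[OF W(1) WU(1)])
        also have "\<dots> = phi W (g1 \<oplus> g2) [^]\<^bsub>sec X W\<^esub> (N + N) \<otimes>\<^bsub>sec X W\<^esub> phi W vi"
          unfolding gi(4) using g vi by (simp add: phi_pow[OF W(1) WU(1)] del: W.hom_add)
        also have "phi W vi = phi W gi [^]\<^bsub>sec X W\<^esub> N \<otimes>\<^bsub>sec X W\<^esub> res X V W t"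
          by (rule extends_res[OF gi(3) V gi(1,2) W])
        finally show ?thesis using gc tW by (simp add: W.S.m_lcomm del: W.hom_add)
      qed
      show "germ_unit X y W (phi W gi [^]\<^bsub>sec X W\<^esub> N)" if "y \<in> W" for y
        using germ_unit_pow[OF W(1) that gc(1) gu[OF that]] .
    qed (use gc tW sc in \<open>auto simp del: W.hom_add\<close>)
  qed
  have "phi ?G s = phi ?G (g1 \<oplus> g2) [^]\<^bsub>sec X ?G\<^esub> (N + N) \<otimes>\<^bsub>sec X ?G\<^esub> res X V ?G t"
  proof (rule separated[OF G(1)])
    show "phi ?G s \<in> carrier (sec X ?G)"
      "phi ?G (g1 \<oplus> g2) [^]\<^bsub>sec X ?G\<^esub> (N + N) \<otimes>\<^bsub>sec X ?G\<^esub> res X V ?G t \<in> carrier (sec X ?G)"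
      using sc g tG by auto
    fix x assume x: "x \<in> ?G"
    obtain gi vi where gi: "gi \<in> carrier R" "D U (\<psi> gi) \<subseteq> V" "extends V t gi N vi"
      "gi [^] N \<otimes> s = (g1 \<oplus> g2) [^] (N + N) \<otimes> vi" "x \<in> D U (\<psi> gi)"
      using x D_psi_add[OF g(1,2)] g E1 E2 s1 s2 by blast
    let ?W = "?G \<inter> D U (\<psi> gi)"
    have W: "openin (under X) ?W" "?W \<subseteq> D U (\<psi> gi)" "?W \<subseteq> ?G" "?W \<subseteq> U" using G open_D[OF gi(1)] by auto
    have pc: "phi ?G (g1 \<oplus> g2) \<in> carrier (sec X ?G)" using g by (simp del: G.hom_add)
    have "res X ?G ?W (phi ?G (g1 \<oplus> g2) [^]\<^bsub>sec X ?G\<^esub> (N + N) \<otimes>\<^bsub>sec X ?G\<^esub> res X V ?G t)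
        = phi ?W (g1 \<oplus> g2) [^]\<^bsub>sec X ?W\<^esub> (N + N) \<otimes>\<^bsub>sec X ?W\<^esub> res X V ?W t"
      using res_mult[OF G(1) W(1,3), of "phi ?G (g1 \<oplus> g2) [^]\<^bsub>sec X ?G\<^esub> (N + N)" "res X V ?G t"] pc tG
        res_pow[OF G(1) W(1,3) pc] res_phi[OF G(1) W(1,3) G(2)] res_res[OF V(1) G(1) W(1,3) G(3) V(3)] g
      by (simp del: G.hom_add)
    then show "\<exists>W. openin (under X) W \<and> x \<in> W \<and> W \<subseteq> ?G \<and> res X ?G W (phi ?G s) =
        res X ?G W (phi ?G (g1 \<oplus> g2) [^]\<^bsub>sec X ?G\<^esub> (N + N) \<otimes>\<^bsub>sec X ?G\<^esub> res X V ?G t)"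
      using loc[OF gi(1-4) W(1,2)] res_phi[OF G(1) W(1,3) G(2) sc] x gi W by (intro exI[of _ ?W]) auto
  qed
  then show ?thesis using sc unfolding extends_def by blast
qed

text \<open>The \<open>h\<close> for which \<open>t\<close> is a fraction over the locus of
  \<open>f \<otimes> h\<close> form an ideal \<open>K\<close>, by \<open>extends_add\<close> and
  \<open>extends_mult\<close>. If \<open>K\<close> missed all powers of \<open>f\<close>, a prime
  containing \<open>K\<close> but not \<open>f\<close> would be a point of the basic open set, and a
  local fraction of \<open>t\<close> there would put into \<open>K\<close> an element that does not
  vanish at that point. A power of \<open>f\<close> in \<open>K\<close> is enough, because all
  positive powers of \<open>f\<close> have the same locus.\<close>

lemma extension:
  assumes f: "f \<in> carrier R" and t: "t \<in> carrier (sec X (D U (\<psi> f)))"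
  shows "\<exists>n s. extends (D U (\<psi> f)) t f n s"
proof -
  let ?V = "D U (\<psi> f)"
  have V: "openin (under X) ?V" "?V \<subseteq> U" using f open_D D_subset by auto
  define K where "K = {h \<in> carrier R. \<exists>n s. extends ?V t (f \<otimes> h) n s}"
  have sub: "D U (\<psi> (f \<otimes> h)) \<subseteq> ?V" if "h \<in> carrier R" for h using f that by (simp add: D_psi_mult)
  have "ideal K R"
  proof (rule ideal_intro)
    show "K \<subseteq> carrier R" by (auto simp: K_def)
    \<comment> \<open>The locus is empty and over the empty set any two sections agree, so exponent
      and numerator may both be 0.\<close>
    have "extends ?V t (f \<otimes> \<zero>) 0 \<zero>"
    proof -
      have z: "D U (\<psi> (f \<otimes> \<zero>)) = {}" using f D_psi_zero by simp
      interpret E: ring_hom_cring R "sec X {}" "phi {}" by (rule phi_cring_hom) auto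
      have "phi {} \<zero> = phi {} (f \<otimes> \<zero>) [^]\<^bsub>sec X {}\<^esub> (0::nat) \<otimes>\<^bsub>sec X {}\<^esub> res X ?V {} t"
        using f V t res_closed[OF V(1) _ _ t, of "{}"] by (intro separated[of "{}"]) auto
      then show ?thesis using z by (simp add: extends_def)
    qed
    then show "\<zero> \<in> K" unfolding K_def by blast
  next
    fix a b assume "a \<in> K" "b \<in> K"
    then obtain n s n' s' where a: "a \<in> carrier R" "extends ?V t (f \<otimes> a) n s"
      and b: "b \<in> carrier R" "extends ?V t (f \<otimes> b) n' s'" unfolding K_def by blast
    then have "\<exists>n s. extends ?V t (f \<otimes> a \<oplus> f \<otimes> b) n s"
      using f sub by (intro extends_add[OF V t _ _ _ _ a(2) b(2)]) auto
    then show "a \<oplus> b \<in> K" using a b f by (simp add: K_def r_distr)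
  next
    fix r a assume r: "r \<in> carrier R" and "a \<in> K"
    then obtain n s where a: "a \<in> carrier R" "extends ?V t (f \<otimes> a) n s" unfolding K_def by blast
    have "extends ?V t (r \<otimes> (f \<otimes> a)) n (r [^] n \<otimes> s)"
      using extends_mult[OF V t _ sub[OF a(1)] r a(2)] f a by simp
    then show "r \<otimes> a \<in> K" using a r f by (auto simp: K_def m_lcomm)
  qed
  moreover have "\<exists>k::nat. f [^] k \<in> K"
  proof (rule ccontr)
    assume "\<not> ?thesis"
    then obtain P where P: "primeideal P R" "K \<subseteq> P" "f \<notin> P"
      using prime_avoiding_powers[OF \<open>ideal K R\<close> f] by auto
    then obtain x where x: "x \<in> U" "P = vanishing X U R \<psi> x" using vanishing_surj by blast
    have xV: "x \<in> ?V" using P x f D_iff by blast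
    obtain W a g where W: "openin (under X) W" "x \<in> W" "W \<subseteq> ?V" "a \<in> carrier R" "g \<in> carrier R" "x \<in> D U (\<psi> g)"
      "res X U W (\<psi> g) \<otimes>\<^bsub>sec X W\<^esub> res X ?V W t = res X U W (\<psi> a)"
      using locally_fraction[OF V xV t] by blast
    have WU: "W \<subseteq> U" using W V by blast
    \<comment> \<open>The local fraction holds only on \<open>W\<close>; multiplying its denominator
      by \<open>w\<close> confines the new locus to \<open>W\<close>.\<close>
    obtain w where w: "w \<in> carrier R" "x \<in> D U (\<psi> w)" "D U (\<psi> w) \<subseteq> W"
      using basis[OF W(1) WU W(2)] by blast
    let ?h = "w \<otimes> g" and ?f = "f \<otimes> (w \<otimes> g)"
    let ?Y = "D U (\<psi> ?f)"
    have Y: "openin (under X) ?Y" "?Y \<subseteq> W" "?Y \<subseteq> U" "?Y \<subseteq> ?V"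
      using f w W V open_D[of ?f] by (auto simp: D_psi_mult)
    interpret Y: ring_hom_cring R "sec X ?Y" "phi ?Y" using phi_cring_hom[OF Y(1,3)] .
    have tc: "res X ?V ?Y t \<in> carrier (sec X ?Y)" using V Y t by (auto intro: res_closed)
    have "phi W g \<otimes>\<^bsub>sec X W\<^esub> res X ?V W t = phi W a" using W by (simp add: phi_def)
    then have "res X W ?Y (phi W g \<otimes>\<^bsub>sec X W\<^esub> res X ?V W t) = phi ?Y a"
      using res_phi[OF W(1) Y(1,2) WU W(4)] by simp
    then have ga: "phi ?Y g \<otimes>\<^bsub>sec X ?Y\<^esub> res X ?V ?Y t = phi ?Y a"
      using res_mult[OF W(1) Y(1,2), of "phi W g" "res X ?V W t"] res_phi[OF W(1) Y(1,2) WU W(5)]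
        res_res[OF V(1) W(1) Y(1,2) W(3) t] res_closed[OF V(1) W(1) W(3) t]
        ring_hom_closed[OF phi_hom[OF W(1) WU] W(5)] by simp
    \<comment> \<open>Exponent 1: from \<open>g t = a\<close> follows
      \<open>(f w g) t = f w a\<close>.\<close>
    have "extends ?V t ?f 1 (f \<otimes> w \<otimes> a)"
      unfolding extends_def using f w W tc ga[symmetric] by (simp add: Y.S.m_assoc)
    then have "?h \<in> K" using w W unfolding K_def by blast
    then have "?h \<in> vanishing X U R \<psi> x" using P x by blast
    moreover have "x \<in> D U (\<psi> ?h)" using w W by (simp add: D_psi_mult)
    ultimately show False using D_iff x w W by blast
  qed
  then obtain k n s where "extends ?V t (f \<otimes> f [^] (k::nat)) n s" unfolding K_def by blast
  then have e: "extends ?V t (f [^] Suc k) n s" using f by (simp add: m_comm)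
  have D_eq: "D U (\<psi> (f [^] Suc k)) = ?V"
    using f D_psi_pow[OF f, of k] by (auto simp: D_psi_mult)
  \<comment> \<open>The \<open>n\<close>-th power of \<open>f^(k+1)\<close> is the power of
    \<open>f\<close> with exponent \<open>(k + 1) n\<close>, and the two loci coincide.\<close>
  have "extends ?V t f (Suc k * n) s"
    using e f phi_pow[OF V f, of "Suc k"] unfolding extends_def D_eq
    by (simp add: monoid.nat_pow_pow[OF ring.is_monoid[OF sec_ring[OF V(1)]]] ring_hom_closed[OF phi_hom[OF V] f] del: nat_pow_Suc Group.nat_pow_Suc)
  then show ?thesis by blast
qed

lemma numerator:
  assumes f: "f \<in> carrier R" and t: "t \<in> carrier (sec X (D U (\<psi> f)))"
  obtains n s where "s \<in> carrier R"
    "phi (D U (\<psi> f)) s = phi (D U (\<psi> f)) f [^]\<^bsub>sec X (D U (\<psi> f))\<^esub> (n::nat) \<otimes>\<^bsub>sec X (D U (\<psi> f))\<^esub> t"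
  using extension[OF assms] t res_id[OF open_D[OF f] t] unfolding extends_def by auto

text \<open>The restriction \<open>g\<close> of \<open>f\<close> is a unit, and every section
  \<open>t\<close> over the smaller set has a numerator \<open>s\<close> in \<open>R\<close> with
  \<open>phi V s = g^n t\<close>. Unit germs, primes and fractions for \<open>t\<close> are thus
  those for \<open>s\<close>, and each axiom reduces to the given chart. The new chart has the ring
  of sections itself as coordinate ring.\<close>

theorem basic_open_chart:
  assumes f: "f \<in> carrier R"
  shows "affine_chart X (D U (\<psi> f)) (sec X (D U (\<psi> f))) id"
proof -
  define V where "V = D U (\<psi> f)"
  define P where "P x = vanishing X V (sec X V) id x" for x
  have Peq: "vanishing X V (sec X V) id = P" by (auto simp: P_def)
  have V: "openin (under X) V" "V \<subseteq> U" using f open_D D_subset by (auto simp: V_def)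
  interpret V: ring_hom_cring R "sec X V" "phi V" using phi_cring_hom[OF V] .
  define g where "g = phi V f"
  have g: "g \<in> carrier (sec X V)" using f by (simp add: g_def)
  have DV: "D V (phi V r) = D U (\<psi> r) \<inter> V" if "r \<in> carrier R" for r
    unfolding phi_def using that V open_chart by (simp add: D_res)
  have gu: "germ_unit X x V g" if "x \<in> V" for x
    using DV[OF f] that by (auto simp: g_def V_def D_def)
  have gun: "germ_unit X x V (g [^]\<^bsub>sec X V\<^esub> (n::nat))" if "x \<in> V" for x n
    using germ_unit_pow[OF V(1) that g gu[OF that]] .
  have num: "\<exists>s n. s \<in> carrier R \<and> phi V s = g [^]\<^bsub>sec X V\<^esub> (n::nat) \<otimes>\<^bsub>sec X V\<^esub> t"
    if "t \<in> carrier (sec X V)" for t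
    using numerator[OF f] that unfolding V_def g_def by metis
  \<comment> \<open>A section and its numerator differ by a power of \<open>g\<close>, whose germs
    on \<open>V\<close> are units.\<close>
  have germ: "germ_unit X x V t \<longleftrightarrow> s \<notin> vanishing X U R \<psi> x"
    if "t \<in> carrier (sec X V)" "s \<in> carrier R" "phi V s = g [^]\<^bsub>sec X V\<^esub> (n::nat) \<otimes>\<^bsub>sec X V\<^esub> t" "x \<in> V" for t s n x
  proof -
    have "germ_unit X x V t \<longleftrightarrow> germ_unit X x V (phi V s)"
      unfolding that(3) using that gun g V by (subst germ_unit_mult) auto
    also have "\<dots> \<longleftrightarrow> x \<in> D U (\<psi> s)" using DV[OF that(2)] that(4) by (auto simp: D_def)
    finally show ?thesis using that V D_iff by blast
  qed
  have phiP: "phi V r \<in> P x \<longleftrightarrow> r \<in> vanishing X U R \<psi> x" if "r \<in> carrier R" "x \<in> V" for r x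
    using germ[OF _ that(1), of "phi V r" 0] that by (auto simp: P_def vanishing_def)
  have memP: "t \<in> P x \<longleftrightarrow> s \<in> vanishing X U R \<psi> x"
    if "t \<in> carrier (sec X V)" "s \<in> carrier R" "phi V s = g [^]\<^bsub>sec X V\<^esub> (n::nat) \<otimes>\<^bsub>sec X V\<^esub> t" "x \<in> V" for t s n x
    using germ[OF that] that by (auto simp: P_def vanishing_def)
  have Pc: "P x \<subseteq> carrier (sec X V)" for x by (auto simp: P_def vanishing_def)
  show ?thesis
    unfolding V_def[symmetric]
  proof (intro affine_chart.intro affine_chart_axioms.intro; (unfold Peq)?)
    show "sheaf_space X" by (rule sheaf_space_axioms)
    show "cring (sec X V)" by (rule V.S.is_cring)
    show "openin (under X) V" by (rule V)
    show "id \<in> ring_hom (sec X V) (sec X V)" by simp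
  next
    fix x assume x: "x \<in> V"
    interpret Q: primeideal "vanishing X U R \<psi> x" R using vanishing_prime x V by blast
    show "primeideal (P x) (sec X V)"
    proof (rule V.S.primeideal_intro)
      show "P x \<subseteq> carrier (sec X V)" by (rule Pc)
      show "\<zero>\<^bsub>sec X V\<^esub> \<in> P x" using phiP[of "\<zero>" x] x by simp
      show "\<one>\<^bsub>sec X V\<^esub> \<notin> P x" using germ_unit_one[OF V(1) x] by (simp add: P_def vanishing_def)
    next
      fix r a assume "r \<in> carrier (sec X V)" "a \<in> P x"
      then show "r \<otimes>\<^bsub>sec X V\<^esub> a \<in> P x" using V x by (auto simp: P_def vanishing_def germ_unit_mult)
    next
      fix a b assume "a \<in> carrier (sec X V)" "b \<in> carrier (sec X V)" "a \<otimes>\<^bsub>sec X V\<^esub> b \<in> P x"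
      then show "a \<in> P x \<or> b \<in> P x" using V x by (auto simp: P_def vanishing_def germ_unit_mult)
    next
      fix a b assume ab: "a \<in> P x" "b \<in> P x"
      have c: "a \<in> carrier (sec X V)" "b \<in> carrier (sec X V)" using ab Pc by auto
      obtain s n where s: "s \<in> carrier R" "phi V s = g [^]\<^bsub>sec X V\<^esub> (n::nat) \<otimes>\<^bsub>sec X V\<^esub> a" using num[OF c(1)] by blast
      obtain s' n' where s': "s' \<in> carrier R" "phi V s' = g [^]\<^bsub>sec X V\<^esub> (n'::nat) \<otimes>\<^bsub>sec X V\<^esub> b" using num[OF c(2)] by blast
      have "s \<in> vanishing X U R \<psi> x" "s' \<in> vanishing X U R \<psi> x" using memP[OF c(1) s x] memP[OF c(2) s' x] ab by auto
      \<comment> \<open>The numerator of \<open>a + b\<close> for the common denominator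
        \<open>g^(n + n')\<close>.\<close>
      then have "f [^] n' \<otimes> s \<oplus> f [^] n \<otimes> s' \<in> vanishing X U R \<psi> x"
        using f by (intro Q.a_closed Q.I_l_closed) auto
      moreover have "phi V (f [^] n' \<otimes> s \<oplus> f [^] n \<otimes> s') = g [^]\<^bsub>sec X V\<^esub> (n + n') \<otimes>\<^bsub>sec X V\<^esub> (a \<oplus>\<^bsub>sec X V\<^esub> b)"
        using s s' f c g
        by (simp add: phi_pow[OF V] V.S.r_distr V.S.m_ac flip: g_def V.S.nat_pow_mult)
      ultimately show "a \<oplus>\<^bsub>sec X V\<^esub> b \<in> P x"
        using memP[of "a \<oplus>\<^bsub>sec X V\<^esub> b" "f [^] n' \<otimes> s \<oplus> f [^] n \<otimes> s'" "n + n'" x] s s' f c x by simp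
    qed
  next
    show "inj_on P V"
    proof (rule inj_onI)
      fix x y assume xy: "x \<in> V" "y \<in> V" "P x = P y"
      have "vanishing X U R \<psi> z = {r \<in> carrier R. phi V r \<in> P z}" if "z \<in> V" for z
        using phiP[OF _ that] by (auto simp: vanishing_def)
      then have "vanishing X U R \<psi> x = vanishing X U R \<psi> y"
        using xy by simp
      then show "x = y" using vanishing_inj xy V by (auto dest: inj_onD)
    qed
  next
    fix P' assume P': "primeideal P' (sec X V)"
    interpret P': primeideal P' "sec X V" by fact
    \<comment> \<open>The prime of \<open>R\<close> under \<open>P'\<close>. It misses
      \<open>f\<close> because \<open>g\<close> is a unit, so its point lies in
      \<open>V\<close>.\<close>
    define Q where "Q = {r \<in> carrier R. phi V r \<in> P'}"
    have h: "ring_hom_ring R (sec X V) (phi V)"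
      using ring_axioms V.S.ring_axioms V.homh by (rule ring_hom_ringI2)
    have Q: "primeideal Q R" unfolding Q_def by (rule ring_hom_ring.primeideal_vimage[OF h is_cring P'])
    have gP: "g \<notin> P'"
    proof
      assume "g \<in> P'"
      moreover have "g \<in> Units (sec X V)" using Units_from_germs[OF V(1) g] gu by blast
      then obtain w where "w \<in> carrier (sec X V)" "g \<otimes>\<^bsub>sec X V\<^esub> w = \<one>\<^bsub>sec X V\<^esub>" by (auto simp: V.S.Units_iff)
      ultimately have "\<one>\<^bsub>sec X V\<^esub> \<in> P'" using P'.I_r_closed by metis
      then show False using P'.one_imp_carrier P'.I_notcarr by blast
    qed
    have gnP: "g [^]\<^bsub>sec X V\<^esub> (n::nat) \<notin> P'" for n
    proof (induction n)
      case 0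
      then show ?case using P'.one_imp_carrier P'.I_notcarr by auto
    next
      case (Suc n)
      then show ?case using P'.I_prime[of "g [^]\<^bsub>sec X V\<^esub> n" g] g gP by auto
    qed
    obtain x where x: "x \<in> U" "Q = vanishing X U R \<psi> x" using vanishing_surj[OF Q] by blast
    have "f \<notin> Q" using gP f by (simp add: Q_def g_def)
    then have xV: "x \<in> V" using x f D_iff by (simp add: V_def)
    have "P' = P x"
    proof (rule Set.set_eqI)
      fix t
      show "t \<in> P' \<longleftrightarrow> t \<in> P x"
      proof (cases "t \<in> carrier (sec X V)")
        case True
        obtain s n where s: "s \<in> carrier R" "phi V s = g [^]\<^bsub>sec X V\<^esub> (n::nat) \<otimes>\<^bsub>sec X V\<^esub> t" using num[OF True] by blast
        have "t \<in> P' \<longleftrightarrow> phi V s \<in> P'"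
          using P'.I_prime[of "g [^]\<^bsub>sec X V\<^esub> n" t] P'.I_l_closed[of t "g [^]\<^bsub>sec X V\<^esub> n"] gnP g True s by auto
        moreover have "phi V s \<in> P' \<longleftrightarrow> s \<in> vanishing X U R \<psi> x" using s(1) x(2) unfolding Q_def by blast
        ultimately show ?thesis using memP[OF True s xV] by blast
      next
        case False
        then show ?thesis using P'.Icarr Pc by blast
      qed
    qed
    then show "\<exists>x\<in>V. P' = P x" using xV by blast
  next
    fix W x assume W: "openin (under X) W" "W \<subseteq> V" "x \<in> W"
    obtain w where "w \<in> carrier R" "x \<in> D U (\<psi> w)" "D U (\<psi> w) \<subseteq> W"
      using basis[OF W(1) _ W(3)] W V by blast
    then show "\<exists>h\<in>carrier (sec X V). x \<in> D V (id h) \<and> D V (id h) \<subseteq> W"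
      using DV W by (intro bexI[of _ "phi V w"]) auto
  next
    fix W x t assume W: "openin (under X) W" "W \<subseteq> V" "x \<in> W" and t: "t \<in> carrier (sec X V)"
      and z: "res X V W (id t) = \<zero>\<^bsub>sec X W\<^esub>"
    have WU: "W \<subseteq> U" and xV: "x \<in> V" using W V by auto
    obtain s n where s: "s \<in> carrier R" "phi V s = g [^]\<^bsub>sec X V\<^esub> (n::nat) \<otimes>\<^bsub>sec X V\<^esub> t" using num[OF t] by blast
    interpret W: cring "sec X W" using W sec_cring by blast
    have "phi W s = res X V W (g [^]\<^bsub>sec X V\<^esub> n \<otimes>\<^bsub>sec X V\<^esub> t)"
      using res_phi[OF V(1) W(1,2) V(2) s(1)] s by simp
    also have "\<dots> = \<zero>\<^bsub>sec X W\<^esub>" using z t g V W res_closed[OF V(1) W(1,2), of "g [^]\<^bsub>sec X V\<^esub> n"] by (simp add: res_mult)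
    finally obtain h where h: "h \<in> carrier R" "x \<in> D U (\<psi> h)" "h \<otimes> s = \<zero>"
      using locally_zero[OF W(1) WU W(3) s(1)] by (auto simp: phi_def)
    \<comment> \<open>Since \<open>h\<close> kills the numerator, \<open>h g^n\<close> kills
      \<open>t\<close>, and \<open>g^n\<close> does not vanish at \<open>x\<close>.\<close>
    have "phi V h \<otimes>\<^bsub>sec X V\<^esub> g [^]\<^bsub>sec X V\<^esub> n \<otimes>\<^bsub>sec X V\<^esub> t = phi V (h \<otimes> s)"
      using h(1) s t g by (simp add: V.S.m_assoc)
    then have "(phi V h \<otimes>\<^bsub>sec X V\<^esub> g [^]\<^bsub>sec X V\<^esub> n) \<otimes>\<^bsub>sec X V\<^esub> t = \<zero>\<^bsub>sec X V\<^esub>" using h by simp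
    moreover have "x \<in> D V (phi V h \<otimes>\<^bsub>sec X V\<^esub> g [^]\<^bsub>sec X V\<^esub> n)"
      using DV[OF h(1)] h g gun[OF xV] V xV by (subst D_mult) (auto simp: D_def)
    ultimately show "\<exists>h\<in>carrier (sec X V). x \<in> D V (id h) \<and> h \<otimes>\<^bsub>sec X V\<^esub> t = \<zero>\<^bsub>sec X V\<^esub>"
      using h g by (intro bexI[of _ "phi V h \<otimes>\<^bsub>sec X V\<^esub> g [^]\<^bsub>sec X V\<^esub> n"]) auto
  next
    fix W x t assume W: "openin (under X) W" "W \<subseteq> V" "x \<in> W" and t: "t \<in> carrier (sec X W)"
    have WU: "W \<subseteq> U" and xV: "x \<in> V" using W V by auto
    obtain Y a h where Y: "openin (under X) Y" "x \<in> Y" "Y \<subseteq> W" "a \<in> carrier R" "h \<in> carrier R" "x \<in> D U (\<psi> h)"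
      "res X U Y (\<psi> h) \<otimes>\<^bsub>sec X Y\<^esub> res X W Y t = res X U Y (\<psi> a)"
      using locally_fraction[OF W(1) WU W(3) t] by blast
    have YV: "Y \<subseteq> V" using Y W by blast
    have "res X V Y (phi V h) \<otimes>\<^bsub>sec X Y\<^esub> res X W Y t = res X V Y (phi V a)"
      using Y res_phi[OF V(1) Y(1) YV V(2)] by (simp add: phi_def)
    then show "\<exists>Y a h. openin (under X) Y \<and> x \<in> Y \<and> Y \<subseteq> W \<and> a \<in> carrier (sec X V) \<and> h \<in> carrier (sec X V) \<and>
      x \<in> D V (id h) \<and> res X V Y (id h) \<otimes>\<^bsub>sec X Y\<^esub> res X W Y t = res X V Y (id a)"
      using Y DV[of h] xV by (intro exI[of _ Y] exI[of _ "phi V a"] exI[of _ "phi V h"]) auto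
  qed
qed

text \<open>The case \<open>f = 1\<close>: an abstract coordinate ring may always be traded for the
  ring of sections.\<close>

corollary canonical_chart: "affine_chart X U (sec X U) id"
  using basic_open_chart[of "\<one>"] D_psi_one by simp

end

section \<open>Spectra\<close>

lemma primeideal_intersect_D:
  "primeideal P R \<Longrightarrow> a \<in> carrier R \<Longrightarrow> b \<in> carrier R \<Longrightarrow> a \<otimes>\<^bsub>R\<^esub> b \<notin> P \<longleftrightarrow> a \<notin> P \<and> b \<notin> P"
  using primeideal.I_prime[of P R a b] ideal.I_l_closed[of P R b a] ideal.I_r_closed[of P R a b]
    primeideal.axioms(1)[of P R] by auto

lemma primeideal_one: "primeideal P R \<Longrightarrow> \<one>\<^bsub>R\<^esub> \<notin> P"
  using ideal.one_imp_carrier primeideal.I_notcarr primeideal.axioms(1) by metis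

text \<open>The operations of \<open>localization\<close> are unions over all representatives; as
  soon as the value is independent of the representatives, the union is that value.\<close>

lemma UN_pairs_const:
  assumes "(a0, f0) \<in> A" "(b0, g0) \<in> B"
    and c: "\<And>a f b g. (a, f) \<in> A \<Longrightarrow> (b, g) \<in> B \<Longrightarrow> F a f b g = c"
  shows "(\<Union>(a, f)\<in>A. \<Union>(b, g)\<in>B. F a f b g) = c"
proof -
  have in1: "(\<Union>(b, g)\<in>B. F a f b g) = c" if "(a, f) \<in> A" for a f
    using c[OF that] assms(2) by (intro SUP_eq_const) auto
  have "(case z of (a, f) \<Rightarrow> \<Union>(b, g)\<in>B. F a f b g) = c" if "z \<in> A" for z
    using in1 that by (cases z) simp
  then show ?thesis using assms(1) by (intro SUP_eq_const) auto
qed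

locale spectrum = cring R for R :: "'r ring" (structure)
begin

lemma topspace_zariski: "topspace (zariski R) = {P. primeideal P R}"
  using primeideal_one[of _ R] unfolding zariski_def topology_generated_by_topspace by blast

lemma zariski_basic_open: "f \<in> carrier R \<Longrightarrow> openin (zariski R) {P. primeideal P R \<and> f \<notin> P}"
  unfolding zariski_def by (rule topology_generated_by_Basis) blast

text \<open>The generating sets are closed under intersection, by multiplying the equations, so they
  form a basis of the topology they generate.\<close>

lemma zariski_basis:
  assumes "openin (zariski R) V" "P \<in> V"
  shows "\<exists>f\<in>carrier R. f \<notin> P \<and> {Q. primeideal Q R \<and> f \<notin> Q} \<subseteq> V"
proof -
  have "generate_topology_on {{P. primeideal P R \<and> f \<notin> P} |f. f \<in> carrier R} V"
    using assms(1) unfolding zariski_def by (rule openin_topology_generated_by)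
  then show ?thesis
    using assms(2)
  proof (induction arbitrary: P)
    case (Int a b)
    obtain f where f: "f \<in> carrier R" "f \<notin> P" "{Q. primeideal Q R \<and> f \<notin> Q} \<subseteq> a"
      using Int by blast
    obtain g where g: "g \<in> carrier R" "g \<notin> P" "{Q. primeideal Q R \<and> g \<notin> Q} \<subseteq> b"
      using Int by blast
    have "generate_topology_on {{P. primeideal P R \<and> f \<notin> P} |f. f \<in> carrier R} a" by fact
    then have "openin (zariski R) a" unfolding zariski_def openin_topology_generated_by_iff .
    then have "primeideal P R" using openin_subset[of "zariski R" a] Int.prems topspace_zariski by blast
    then show ?case
      using f g primeideal_intersect_D[of _ R f g] by (intro bexI[of _ "f \<otimes> g"]) auto
  next
    case (UN K)
    then show ?case by (meson Union_upper UnionE order_trans)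
  qed blast+
qed

lemma loc_frac_mem:
  assumes "primeideal P R" "a \<in> carrier R" "f \<in> carrier R - P"
  shows "(b, g) \<in> loc_frac R P a f \<longleftrightarrow> b \<in> carrier R \<and> g \<in> carrier R - P \<and>
    (\<exists>h\<in>carrier R - P. h \<otimes> (g \<otimes> a) = h \<otimes> (f \<otimes> b))"
proof -
  have "h \<otimes> (g \<otimes> a \<ominus> f \<otimes> b) = \<zero> \<longleftrightarrow> h \<otimes> (g \<otimes> a) = h \<otimes> (f \<otimes> b)"
    if "h \<in> carrier R" "g \<in> carrier R" "b \<in> carrier R" for h g b
  proof -
    have "h \<otimes> (g \<otimes> a \<ominus> f \<otimes> b) = h \<otimes> (g \<otimes> a) \<oplus> \<ominus> (h \<otimes> (f \<otimes> b))"
      using that assms by (simp add: minus_eq r_distr r_minus)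
    then show ?thesis
      using that assms minus_equality[of "h \<otimes> (g \<otimes> a)" "\<ominus> (h \<otimes> (f \<otimes> b))"]
      by (auto simp: r_neg)
  qed
  then show ?thesis unfolding loc_frac_def by auto
qed

lemma loc_frac_eq:
  assumes P: "primeideal P R" and a: "a \<in> carrier R" and f: "f \<in> carrier R - P"
    and b: "b \<in> carrier R" and g: "g \<in> carrier R - P"
  shows "loc_frac R P a f = loc_frac R P b g \<longleftrightarrow> (\<exists>h\<in>carrier R - P. h \<otimes> (g \<otimes> a) = h \<otimes> (f \<otimes> b))"
proof
  assume "loc_frac R P a f = loc_frac R P b g"
  moreover have "(b, g) \<in> loc_frac R P b g" using b g by (auto simp: loc_frac_mem[OF P b g])
  ultimately show "\<exists>h\<in>carrier R - P. h \<otimes> (g \<otimes> a) = h \<otimes> (f \<otimes> b)"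
    using loc_frac_mem[OF P a f] by blast
next
  assume "\<exists>h\<in>carrier R - P. h \<otimes> (g \<otimes> a) = h \<otimes> (f \<otimes> b)"
  then obtain h where h: "h \<in> carrier R" "h \<notin> P" "h \<otimes> (g \<otimes> a) = h \<otimes> (f \<otimes> b)" by blast
  \<comment> \<open>Transitivity of the fraction relation. The middle denominator \<open>g'\<close>
    has to enter the multiplier because \<open>R\<close> may have zero divisors.\<close>
  have tr: "\<exists>h\<in>carrier R - P. h \<otimes> (k \<otimes> a') = h \<otimes> (f' \<otimes> c)"
    if "a' \<in> carrier R" "f' \<in> carrier R" "b' \<in> carrier R" "g' \<in> carrier R - P" "c \<in> carrier R" "k \<in> carrier R"
      "h \<in> carrier R - P" "h' \<in> carrier R - P"
      and e: "h \<otimes> (g' \<otimes> a') = h \<otimes> (f' \<otimes> b')" "h' \<otimes> (k \<otimes> b') = h' \<otimes> (g' \<otimes> c)"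
    for a' f' b' g' c k h h'
  proof (intro bexI)
    have "h \<otimes> h' \<otimes> g' \<otimes> (k \<otimes> a') = h' \<otimes> k \<otimes> (h \<otimes> (g' \<otimes> a'))" using that(1-8) by (simp add: m_ac)
    also have "\<dots> = h \<otimes> f' \<otimes> (h' \<otimes> (k \<otimes> b'))" unfolding e(1) using that(1-8) by (simp add: m_ac)
    also have "\<dots> = h \<otimes> h' \<otimes> g' \<otimes> (f' \<otimes> c)" unfolding e(2) using that(1-8) by (simp add: m_ac)
    finally show "h \<otimes> h' \<otimes> g' \<otimes> (k \<otimes> a') = h \<otimes> h' \<otimes> g' \<otimes> (f' \<otimes> c)" .
    show "h \<otimes> h' \<otimes> g' \<in> carrier R - P" using that primeideal_intersect_D[OF P] by auto
  qed
  show "loc_frac R P a f = loc_frac R P b g"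
  proof (intro Set.set_eqI iffI; clarify)
    fix c k assume "(c, k) \<in> loc_frac R P a f"
    then obtain h' where "c \<in> carrier R" "k \<in> carrier R - P" "h' \<in> carrier R - P" "h' \<otimes> (k \<otimes> a) = h' \<otimes> (f \<otimes> c)"
      unfolding loc_frac_mem[OF P a f] by blast
    then show "(c, k) \<in> loc_frac R P b g"
      unfolding loc_frac_mem[OF P b g] using tr[of b g a f c k h h'] h a b f g by auto
  next
    fix c k assume "(c, k) \<in> loc_frac R P b g"
    then obtain h' where "c \<in> carrier R" "k \<in> carrier R - P" "h' \<in> carrier R - P" "h' \<otimes> (k \<otimes> b) = h' \<otimes> (g \<otimes> c)"
      unfolding loc_frac_mem[OF P b g] by blast
    then show "(c, k) \<in> loc_frac R P a f"
      unfolding loc_frac_mem[OF P a f] using tr[of a f b g c k h h'] h a b f g by auto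
  qed
qed

lemma loc_frac_self: "primeideal P R \<Longrightarrow> a \<in> carrier R \<Longrightarrow> f \<in> carrier R - P \<Longrightarrow> (a, f) \<in> loc_frac R P a f"
  using loc_frac_mem[of P a f a f] by auto

lemma loc_frac_mult:
  assumes P: "primeideal P R" and a: "a \<in> carrier R" and f: "f \<in> carrier R - P"
    and b: "b \<in> carrier R" and g: "g \<in> carrier R - P"
  shows "loc_frac R P a f \<otimes>\<^bsub>localization R P\<^esub> loc_frac R P b g = loc_frac R P (a \<otimes> b) (f \<otimes> g)"
proof -
  have "loc_frac R P (a' \<otimes> b') (f' \<otimes> g') = loc_frac R P (a \<otimes> b) (f \<otimes> g)"
    if af: "(a', f') \<in> loc_frac R P a f" and bg: "(b', g') \<in> loc_frac R P b g" for a' f' b' g'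
  proof -
    obtain h where h: "h \<in> carrier R - P" "h \<otimes> (f' \<otimes> a) = h \<otimes> (f \<otimes> a')" "a' \<in> carrier R" "f' \<in> carrier R - P"
      using af loc_frac_mem[OF P a f] by blast
    obtain k where k: "k \<in> carrier R - P" "k \<otimes> (g' \<otimes> b) = k \<otimes> (g \<otimes> b')" "b' \<in> carrier R" "g' \<in> carrier R - P"
      using bg loc_frac_mem[OF P b g] by blast
    have "(h \<otimes> k) \<otimes> ((f \<otimes> g) \<otimes> (a' \<otimes> b')) = (h \<otimes> (f \<otimes> a')) \<otimes> (k \<otimes> (g \<otimes> b'))"
      using a b f g h(1,3,4) k(1,3,4) by (simp add: m_ac)
    also have "\<dots> = (h \<otimes> (f' \<otimes> a)) \<otimes> (k \<otimes> (g' \<otimes> b))" using h(2) k(2) by simp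
    also have "\<dots> = (h \<otimes> k) \<otimes> ((f' \<otimes> g') \<otimes> (a \<otimes> b))"
      using a b f g h(1,3,4) k(1,3,4) by (simp add: m_ac)
    finally show ?thesis
      using a b f g h k primeideal_intersect_D[OF P]
      by (subst loc_frac_eq[OF P]) (auto intro!: bexI[of _ "h \<otimes> k"])
  qed
  then have "(\<Union>(a, f)\<in>loc_frac R P a f. \<Union>(b, g)\<in>loc_frac R P b g. loc_frac R P (a \<otimes> b) (f \<otimes> g))
      = loc_frac R P (a \<otimes> b) (f \<otimes> g)"
    by (rule UN_pairs_const[OF loc_frac_self[OF P a f] loc_frac_self[OF P b g]])
  then show ?thesis by (simp add: localization_def)
qed

lemma loc_frac_add:
  assumes P: "primeideal P R" and a: "a \<in> carrier R" and f: "f \<in> carrier R - P"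
    and b: "b \<in> carrier R" and g: "g \<in> carrier R - P"
  shows "loc_frac R P a f \<oplus>\<^bsub>localization R P\<^esub> loc_frac R P b g =
    loc_frac R P (a \<otimes> g \<oplus> b \<otimes> f) (f \<otimes> g)"
proof -
  have "loc_frac R P (a' \<otimes> g' \<oplus> b' \<otimes> f') (f' \<otimes> g') = loc_frac R P (a \<otimes> g \<oplus> b \<otimes> f) (f \<otimes> g)"
    if af: "(a', f') \<in> loc_frac R P a f" and bg: "(b', g') \<in> loc_frac R P b g" for a' f' b' g'
  proof -
    obtain h where h: "h \<in> carrier R - P" "h \<otimes> (f' \<otimes> a) = h \<otimes> (f \<otimes> a')" "a' \<in> carrier R" "f' \<in> carrier R - P"
      using af loc_frac_mem[OF P a f] by blast
    obtain k where k: "k \<in> carrier R - P" "k \<otimes> (g' \<otimes> b) = k \<otimes> (g \<otimes> b')" "b' \<in> carrier R" "g' \<in> carrier R - P"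
      using bg loc_frac_mem[OF P b g] by blast
    note c = a b h(3) k(3) DiffD1[OF f] DiffD1[OF g] DiffD1[OF h(1)] DiffD1[OF k(1)] DiffD1[OF h(4)] DiffD1[OF k(4)]
    have "(h \<otimes> k) \<otimes> ((f \<otimes> g) \<otimes> (a' \<otimes> g' \<oplus> b' \<otimes> f'))
      = (h \<otimes> (f \<otimes> a')) \<otimes> (k \<otimes> (g \<otimes> g')) \<oplus> (k \<otimes> (g \<otimes> b')) \<otimes> (h \<otimes> (f \<otimes> f'))"
      using c by (simp add: r_distr m_ac)
    also have "\<dots> = (h \<otimes> (f' \<otimes> a)) \<otimes> (k \<otimes> (g \<otimes> g')) \<oplus> (k \<otimes> (g' \<otimes> b)) \<otimes> (h \<otimes> (f \<otimes> f'))"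
      using h(2) k(2) by simp
    also have "\<dots> = (h \<otimes> k) \<otimes> ((f' \<otimes> g') \<otimes> (a \<otimes> g \<oplus> b \<otimes> f))"
      using c by (simp add: r_distr m_ac)
    finally have e: "(h \<otimes> k) \<otimes> ((f \<otimes> g) \<otimes> (a' \<otimes> g' \<oplus> b' \<otimes> f')) = (h \<otimes> k) \<otimes> ((f' \<otimes> g') \<otimes> (a \<otimes> g \<oplus> b \<otimes> f))" .
    have "h \<otimes> k \<in> carrier R - P" "f \<otimes> g \<in> carrier R - P" "f' \<otimes> g' \<in> carrier R - P"
      using f g h k primeideal_intersect_D[OF P] by auto
    then show ?thesis
      using c e by (subst loc_frac_eq[OF P]) auto
  qed
  then have "(\<Union>(a, f)\<in>loc_frac R P a f. \<Union>(b, g)\<in>loc_frac R P b g. loc_frac R P (a \<otimes> g \<oplus> b \<otimes> f) (f \<otimes> g))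
      = loc_frac R P (a \<otimes> g \<oplus> b \<otimes> f) (f \<otimes> g)"
    by (rule UN_pairs_const[OF loc_frac_self[OF P a f] loc_frac_self[OF P b g]])
  then show ?thesis by (simp add: localization_def)
qed

definition fraction :: "'r set set \<Rightarrow> 'r \<Rightarrow> 'r \<Rightarrow> 'r set \<Rightarrow> ('r \<times> 'r) set" where
  "fraction V a f = (\<lambda>P\<in>V. loc_frac R P a f)"

end

lemma Spec_simps [simp]:
  "under (Spec R) = zariski R"
  "carrier (sec (Spec R) V) = spec_sections R V"
  "s \<otimes>\<^bsub>sec (Spec R) V\<^esub> t = (\<lambda>P\<in>V. s P \<otimes>\<^bsub>localization R P\<^esub> t P)"
  "s \<oplus>\<^bsub>sec (Spec R) V\<^esub> t = (\<lambda>P\<in>V. s P \<oplus>\<^bsub>localization R P\<^esub> t P)"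
  "\<one>\<^bsub>sec (Spec R) V\<^esub> = (\<lambda>P\<in>V. loc_frac R P \<one>\<^bsub>R\<^esub> \<one>\<^bsub>R\<^esub>)"
  "\<zero>\<^bsub>sec (Spec R) V\<^esub> = (\<lambda>P\<in>V. loc_frac R P \<zero>\<^bsub>R\<^esub> \<one>\<^bsub>R\<^esub>)"
  "res (Spec R) V W s = restrict s W"
  by (simp_all add: Spec_def localization_def)

lemma spec_sectionsD:
  assumes "s \<in> spec_sections R U" "P \<in> U"
  shows "\<exists>V a f. openin (zariski R) V \<and> P \<in> V \<and> V \<subseteq> U \<and> a \<in> carrier R \<and> f \<in> carrier R \<and>
       (\<forall>Q\<in>V. f \<notin> Q \<and> s Q = loc_frac R Q a f)"
  using assms unfolding spec_sections_def by simp

lemma open_subspace_simps [simp]: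
  "sec (open_subspace X U) = sec X" "res (open_subspace X U) = res X"
  "under (open_subspace X U) = subtopology (under X) U"
  by (simp_all add: open_subspace_def)

lemma (in spectrum) fraction_section:
  assumes V: "openin (zariski R) V" and a: "a \<in> carrier R" and f: "f \<in> carrier R" "\<And>P. P \<in> V \<Longrightarrow> f \<notin> P"
  shows "fraction V a f \<in> spec_sections R V"
proof -
  have "fraction V a f \<in> PiE V (\<lambda>P. carrier (localization R P))"
    using a f by (auto simp: fraction_def localization_def)
  moreover have "\<forall>P\<in>V. \<exists>W a' f'. openin (zariski R) W \<and> P \<in> W \<and> W \<subseteq> V \<and> a' \<in> carrier R \<and> f' \<in> carrier R \<and>
       (\<forall>Q\<in>W. f' \<notin> Q \<and> fraction V a f Q = loc_frac R Q a' f')"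
    using V a f by (intro ballI exI[of _ V] exI[of _ a] exI[of _ f]) (auto simp: fraction_def)
  ultimately show ?thesis by (simp add: spec_sections_def)
qed

lemma (in spectrum) fraction_hom:
  assumes V: "openin (zariski R) V"
  shows "(\<lambda>a. fraction V a \<one>) \<in> ring_hom R (sec (Spec R) V)"
proof -
  have pr: "primeideal P R" if "P \<in> V" for P using openin_subset[OF V] that topspace_zariski by blast
  show ?thesis
  proof (rule ring_hom_memI)
    fix a assume "a \<in> carrier R"
    then show "fraction V a \<one> \<in> carrier (sec (Spec R) V)"
      using fraction_section[OF V _ one_closed primeideal_one[OF pr]] by simp
  next
    fix a b assume ab: "a \<in> carrier R" "b \<in> carrier R"
    have "loc_frac R P (a \<otimes> b) \<one> = loc_frac R P a \<one> \<otimes>\<^bsub>localization R P\<^esub> loc_frac R P b \<one>"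
      "loc_frac R P (a \<oplus> b) \<one> = loc_frac R P a \<one> \<oplus>\<^bsub>localization R P\<^esub> loc_frac R P b \<one>" if "P \<in> V" for P
      using ab pr[OF that] primeideal_one[OF pr[OF that]] by (simp_all add: loc_frac_mult loc_frac_add)
    then show "fraction V (a \<otimes> b) \<one> = fraction V a \<one> \<otimes>\<^bsub>sec (Spec R) V\<^esub> fraction V b \<one>"
      "fraction V (a \<oplus> b) \<one> = fraction V a \<one> \<oplus>\<^bsub>sec (Spec R) V\<^esub> fraction V b \<one>"
      unfolding fraction_def Spec_simps by (auto intro!: restrict_ext)
  qed (simp add: fraction_def)
qed

text \<open>The isomorphism with a spectrum is unpacked into inverse point maps \<open>p\<close> and
  \<open>q\<close> and inverse maps on sections, and \<open>\<psi> r\<close> is the pullback of the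
  global section \<open>r / 1\<close>. The prime of \<open>x\<close> is then \<open>p x\<close>, and
  the stalkwise axioms express that sections of a spectrum are locally fractions. Finally
  \<open>canonical_chart\<close> replaces the unknown ring by the ring of sections.\<close>

lemma (in sheaf_space) affine_open_chart:
  assumes "affine_open X U"
  shows "affine_chart X U (sec X U) id"
proof -
  obtain R :: "'r ring" and \<phi> where R: "cring R" and oU: "openin (under X) U"
    and iso: "ringed_iso (open_subspace X U) (Spec R) \<phi>"
    using assms unfolding affine_open_def by blast
  interpret R: spectrum R using R by (rule spectrum.intro)
  let ?Y = "open_subspace X U" and ?S = "Spec R"
  obtain g where phi: "ringed_morphism ?Y ?S \<phi>" and g: "ringed_morphism ?S ?Y g"
    and gphi: "comp_morph ?Y ?S ?Y g \<phi> = id_morph ?Y" and phig: "comp_morph ?S ?Y ?S \<phi> g = id_morph ?S"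
    using iso unfolding ringed_iso_def by blast
  define p where "p = ptf \<phi>"
  define q where "q = ptf g"
  have opY: "openin (under ?Y) V \<longleftrightarrow> openin (under X) V \<and> V \<subseteq> U" for V
    using oU by (simp add: openin_open_subtopology)
  have ptsY: "pts ?Y = U" using openin_subset[OF oU] by (simp add: Int_absorb1)
  have ptsS: "pts ?S = {P. primeideal P R}" by (simp add: R.topspace_zariski)
  have contp: "continuous_map (under ?Y) (zariski R) p" and contq: "continuous_map (zariski R) (under ?Y) q"
    using phi g by (auto simp: ringed_morphism_def p_def q_def)
  have UX: "x \<in> pts X" if "x \<in> U" for x using openin_subset[OF oU] that by blast
  have qp: "q (p x) = x" if "x \<in> U" for x
    using arg_cong[OF gphi, of "\<lambda>m. ptf m x"] that UX by (simp add: comp_morph_def id_morph_def p_def q_def)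
  have pq: "p (q P) = P" if "primeideal P R" for P
    using arg_cong[OF phig, of "\<lambda>m. ptf m P"] that ptsS by (simp add: comp_morph_def id_morph_def p_def q_def R.topspace_zariski)
  have pp: "primeideal (p x) R" if "x \<in> U" for x
    using continuous_map_image_subset_topspace[OF contp] that ptsY ptsS by auto
  have qU: "q P \<in> U" if "primeideal P R" for P
    using continuous_map_image_subset_topspace[OF contq] that ptsY ptsS by auto
  define pre where "pre V = {x \<in> U. p x \<in> V}" for V
  have preim_phi: "preim ?Y \<phi> V = pre V" for V using ptsY by (simp add: preim_def pre_def p_def)
  have preim_g: "preim ?S g V = p ` V" if "V \<subseteq> U" for V
  proof -
    have "preim ?S g V = {P. primeideal P R \<and> q P \<in> V}" by (simp add: preim_def q_def R.topspace_zariski)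
    also have "\<dots> = p ` V"
    proof (intro equalityI subsetI)
      fix P assume "P \<in> {P. primeideal P R \<and> q P \<in> V}"
      then show "P \<in> p ` V" using pq[of P] by (metis (mono_tags, lifting) imageI mem_Collect_eq)
    next
      fix P assume "P \<in> p ` V"
      then show "P \<in> {P. primeideal P R \<and> q P \<in> V}" using that qp pp by auto
    qed
    finally show ?thesis .
  qed
  have open_pre: "openin (under X) (pre V)" "pre V \<subseteq> U" if "openin (zariski R) V" for V
    using openin_continuous_map_preimage[OF contp that] opY unfolding ptsY pre_def by auto
  have open_im: "openin (zariski R) (p ` V)" if "openin (under X) V" "V \<subseteq> U" for V
  proof -
    have "openin (zariski R) {P \<in> topspace (zariski R). q P \<in> V}"
      using that opY by (intro openin_continuous_map_preimage[OF contq]) auto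
    then show ?thesis using preim_g[OF that(2)] by (simp add: preim_def q_def)
  qed
  have pre_im: "pre (p ` V) = V" if "V \<subseteq> U" for V
  proof
    show "pre (p ` V) \<subseteq> V"
    proof
      fix x assume "x \<in> pre (p ` V)"
      then obtain y where "x \<in> U" "y \<in> V" "p x = p y" by (auto simp: pre_def)
      then have "x = y" using qp[of x] qp[of y] that by auto
      then show "x \<in> V" using \<open>y \<in> V\<close> by simp
    qed
    show "V \<subseteq> pre (p ` V)" using that by (auto simp: pre_def)
  qed
  have im_pre: "p ` pre V = V" if "openin (zariski R) V" for V
  proof -
    have "V \<subseteq> {P. primeideal P R}" using openin_subset[OF that] by (simp add: R.topspace_zariski)
    then have "P \<in> p ` pre V" if "P \<in> V" for P
      using pq[of P] qU[of P] that by (intro image_eqI[of _ _ "q P"]) (auto simp: pre_def)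
    then show ?thesis by (auto simp: pre_def)
  qed
  have hom_phi: "shf \<phi> V \<in> ring_hom (sec ?S V) (sec X (pre V))" if "openin (zariski R) V" for V
    using phi that unfolding ringed_morphism_def preim_phi by simp
  have nat_phi: "res X (pre V) (pre W) (shf \<phi> V s) = shf \<phi> W (restrict s W)"
    if "openin (zariski R) V" "openin (zariski R) W" "W \<subseteq> V" "s \<in> spec_sections R V" for V W s
    using phi that unfolding ringed_morphism_def preim_phi by simp
  have hom_g: "shf g V \<in> ring_hom (sec X V) (sec ?S (p ` V))" if "openin (under X) V" "V \<subseteq> U" for V
  proof -
    have "V \<in> opens ?Y" using that opY by simp
    then have "shf g V \<in> ring_hom (sec ?Y V) (sec ?S (preim ?S g V))"
      using g unfolding ringed_morphism_def by blast
    then show ?thesis using preim_g[OF that(2)] by simp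
  qed
  have phi_g: "shf \<phi> (p ` V) (shf g V s) = s" if "openin (under X) V" "V \<subseteq> U" "s \<in> carrier (sec X V)" for V s
  proof -
    have "V \<in> opens ?Y" using that opY by simp
    then show ?thesis
      using arg_cong[OF gphi, of "\<lambda>m. shf m V s"] that preim_g[OF that(2)] by (simp add: comp_morph_def id_morph_def)
  qed
  have g_phi: "shf g (pre V) (shf \<phi> V s) = s" if "openin (zariski R) V" "s \<in> spec_sections R V" for V s
    using arg_cong[OF phig, of "\<lambda>m. shf m V s"] that by (simp add: comp_morph_def id_morph_def preim_phi)
  let ?T = "{P. primeideal P R}"
  have oT: "openin (zariski R) ?T" using openin_topspace[of "zariski R"] by (simp add: R.topspace_zariski)
  have preT: "pre ?T = U" using pp by (auto simp: pre_def)
  define \<psi> where "\<psi> r = shf \<phi> ?T (R.fraction ?T r \<one>\<^bsub>R\<^esub>)" for r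
  have frT: "R.fraction V r \<one>\<^bsub>R\<^esub> \<in> spec_sections R V" if "r \<in> carrier R" "openin (zariski R) V" for r V
  proof -
    have "\<one>\<^bsub>R\<^esub> \<notin> P" if "P \<in> V" for P using that \<open>openin (zariski R) V\<close> openin_subset R.topspace_zariski primeideal_one by fastforce
    then show ?thesis using that by (intro R.fraction_section) auto
  qed
  have psi_hom: "\<psi> \<in> ring_hom R (sec X U)"
  proof -
    have "\<psi> = shf \<phi> ?T \<circ> (\<lambda>a. R.fraction ?T a \<one>\<^bsub>R\<^esub>)" by (auto simp: \<psi>_def)
    then show ?thesis using ring_hom_trans[OF R.fraction_hom[OF oT] hom_phi[OF oT]] preT by simp
  qed
  have psi_c: "\<psi> r \<in> carrier (sec X U)" if "r \<in> carrier R" for r using ring_hom_closed[OF psi_hom that] .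
  have sub_T: "V \<subseteq> ?T" if "openin (zariski R) V" for V using openin_subset[OF that] R.topspace_zariski by simp
  have res_psi: "res X U (pre V) (\<psi> r) = shf \<phi> V (R.fraction V r \<one>\<^bsub>R\<^esub>)" if "openin (zariski R) V" "r \<in> carrier R" for V r
  proof -
    have "restrict (R.fraction ?T r \<one>\<^bsub>R\<^esub>) V = R.fraction V r \<one>\<^bsub>R\<^esub>"
      unfolding R.fraction_def restrict_restrict using sub_T[OF that(1)] by (simp add: Int_absorb1)
    then show ?thesis using nat_phi[OF oT that(1) sub_T[OF that(1)] frT[OF that(2) oT]] by (simp add: \<psi>_def preT)
  qed
  have g_res_psi: "shf g V (res X U V (\<psi> r)) = R.fraction (p ` V) r \<one>\<^bsub>R\<^esub>"
    if "openin (under X) V" "V \<subseteq> U" "r \<in> carrier R" for V r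
    using res_psi[OF open_im[OF that(1,2)] that(3)] g_phi[OF open_im[OF that(1,2)] frT[OF that(3) open_im[OF that(1,2)]]] pre_im[OF that(2)]
    by simp
  have germ: "germ_unit X x U (\<psi> r) \<longleftrightarrow> r \<notin> p x" if x: "x \<in> U" and r: "r \<in> carrier R" for x r
  proof
    assume nr: "r \<notin> p x"
    let ?V = "{P. primeideal P R \<and> r \<notin> P}"
    have oV: "openin (zariski R) ?V" by (rule R.zariski_basic_open[OF r])
    interpret V: cring "sec X (pre ?V)" using open_pre[OF oV] sec_cring by blast
    \<comment> \<open>Away from the zeros of \<open>r\<close> the fraction \<open>1 / r\<close> is a
      section, inverse to \<open>r / 1\<close>.\<close>
    have inv: "R.fraction ?V \<one>\<^bsub>R\<^esub> r \<in> spec_sections R ?V" using oV r by (intro R.fraction_section) auto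
    have "R.fraction ?V r \<one>\<^bsub>R\<^esub> \<otimes>\<^bsub>sec ?S ?V\<^esub> R.fraction ?V \<one>\<^bsub>R\<^esub> r = \<one>\<^bsub>sec ?S ?V\<^esub>"
    proof -
      have "loc_frac R P r \<one>\<^bsub>R\<^esub> \<otimes>\<^bsub>localization R P\<^esub> loc_frac R P \<one>\<^bsub>R\<^esub> r = loc_frac R P \<one>\<^bsub>R\<^esub> \<one>\<^bsub>R\<^esub>"
        if "primeideal P R" "r \<notin> P" for P
        using that r primeideal_one[OF that(1)] by (subst R.loc_frac_mult) (auto simp: R.loc_frac_eq intro!: bexI[of _ "\<one>\<^bsub>R\<^esub>"])
      then show ?thesis by (auto simp: R.fraction_def intro!: restrict_ext)
    qed
    then have "res X U (pre ?V) (\<psi> r) \<otimes>\<^bsub>sec X (pre ?V)\<^esub> shf \<phi> ?V (R.fraction ?V \<one>\<^bsub>R\<^esub> r) = \<one>\<^bsub>sec X (pre ?V)\<^esub>"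
      using ring_hom_mult[OF hom_phi[OF oV], of "R.fraction ?V r \<one>\<^bsub>R\<^esub>" "R.fraction ?V \<one>\<^bsub>R\<^esub> r"] ring_hom_one[OF hom_phi[OF oV]]
        frT[OF r oV] inv res_psi[OF oV r] by (simp del: Spec_simps(3-6))
    moreover have "shf \<phi> ?V (R.fraction ?V \<one>\<^bsub>R\<^esub> r) \<in> carrier (sec X (pre ?V))"
      using ring_hom_closed[OF hom_phi[OF oV]] inv by simp
    ultimately have "res X U (pre ?V) (\<psi> r) \<in> Units (sec X (pre ?V))"
      unfolding V.Units_iff using res_closed[OF oU open_pre[OF oV] psi_c[OF r]] by blast
    then show "germ_unit X x U (\<psi> r)"
      unfolding germ_unit_def using open_pre[OF oV] x nr pp[OF x] by (intro exI[of _ "pre ?V"]) (auto simp: pre_def)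
  next
    assume "germ_unit X x U (\<psi> r)"
    then obtain V where V: "openin (under X) V" "x \<in> V" "V \<subseteq> U" "res X U V (\<psi> r) \<in> Units (sec X V)"
      unfolding germ_unit_def by blast
    interpret V: cring "sec X V" using V sec_cring by blast
    obtain v where v: "v \<in> carrier (sec X V)" "res X U V (\<psi> r) \<otimes>\<^bsub>sec X V\<^esub> v = \<one>\<^bsub>sec X V\<^esub>"
      using V unfolding V.Units_iff by blast
    define w where "w = shf g V v"
    have w: "w \<in> spec_sections R (p ` V)" using ring_hom_closed[OF hom_g[OF V(1,3)] v(1)] by (simp add: w_def)
    have "R.fraction (p ` V) r \<one>\<^bsub>R\<^esub> \<otimes>\<^bsub>sec ?S (p ` V)\<^esub> w = \<one>\<^bsub>sec ?S (p ` V)\<^esub>"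
      using ring_hom_mult[OF hom_g[OF V(1,3)], of "res X U V (\<psi> r)" v] ring_hom_one[OF hom_g[OF V(1,3)]] v
        res_closed[OF oU V(1,3) psi_c[OF r]] g_res_psi[OF V(1,3) r]
      by (simp add: w_def del: Spec_simps(3-6))
    from fun_cong[OF this, of "p x"] have e: "loc_frac R (p x) r \<one>\<^bsub>R\<^esub> \<otimes>\<^bsub>localization R (p x)\<^esub> w (p x) = loc_frac R (p x) \<one>\<^bsub>R\<^esub> \<one>\<^bsub>R\<^esub>"
      using V by (simp add: R.fraction_def)
    have "w (p x) \<in> carrier (localization R (p x))" using w V by (auto simp: spec_sections_def)
    then obtain b k where bk: "b \<in> carrier R" "k \<in> carrier R - p x" "w (p x) = loc_frac R (p x) b k"
      by (auto simp: localization_def)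
    have one: "\<one>\<^bsub>R\<^esub> \<in> carrier R - p x" using primeideal_one[OF pp[OF x]] by simp
    have "loc_frac R (p x) (r \<otimes>\<^bsub>R\<^esub> b) k = loc_frac R (p x) \<one>\<^bsub>R\<^esub> \<one>\<^bsub>R\<^esub>"
      using e bk R.loc_frac_mult[OF pp[OF x] r one bk(1,2)] by simp
    then obtain h where h: "h \<in> carrier R - p x" "h \<otimes>\<^bsub>R\<^esub> (\<one>\<^bsub>R\<^esub> \<otimes>\<^bsub>R\<^esub> (r \<otimes>\<^bsub>R\<^esub> b)) = h \<otimes>\<^bsub>R\<^esub> (k \<otimes>\<^bsub>R\<^esub> \<one>\<^bsub>R\<^esub>)"
      using R.loc_frac_eq[OF pp[OF x] _ bk(2) _ one, of "r \<otimes>\<^bsub>R\<^esub> b" "\<one>\<^bsub>R\<^esub>"] bk r by auto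
    \<comment> \<open>At the prime \<open>p x\<close> an inverse \<open>b / k\<close> of
      \<open>r / 1\<close> gives \<open>h r b = h k\<close>. The right side lies outside the prime,
      hence so does \<open>r\<close>.\<close>
    have "h \<otimes>\<^bsub>R\<^esub> (r \<otimes>\<^bsub>R\<^esub> b) \<notin> p x"
      using h bk r primeideal_intersect_D[OF pp[OF x], of h k] by simp
    then show "r \<notin> p x"
      using primeideal_intersect_D[OF pp[OF x], of h "r \<otimes>\<^bsub>R\<^esub> b"] primeideal_intersect_D[OF pp[OF x], of r b]
        h(1) bk(1) r by simp
  qed
  have van: "vanishing X U R \<psi> x = p x" if "x \<in> U" for x
    using germ[OF that] ideal.Icarr[OF primeideal.axioms(1)[OF pp[OF that]]] by (auto simp: vanishing_def)
  have Dpsi: "x \<in> D U (\<psi> r) \<longleftrightarrow> r \<notin> p x" if "x \<in> U" "r \<in> carrier R" for x r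
    using germ[OF that] that by (simp add: D_def)
  have "affine_chart X U R \<psi>"
  proof (intro affine_chart.intro affine_chart_axioms.intro)
    show "sheaf_space X" "cring R" by (rule sheaf_space_axioms R)+
    show "openin (under X) U" "\<psi> \<in> ring_hom R (sec X U)" by (rule oU psi_hom)+
    show "primeideal (vanishing X U R \<psi> x) R" if "x \<in> U" for x using van pp that by simp
    show "inj_on (vanishing X U R \<psi>) U" using van qp by (metis inj_onI)
    show "\<exists>x\<in>U. P = vanishing X U R \<psi> x" if "primeideal P R" for P
      using that qU pq van by (intro bexI[of _ "q P"]) auto
  next
    fix V x assume V: "openin (under X) V" "V \<subseteq> U" "x \<in> V"
    obtain f where f: "f \<in> carrier R" "f \<notin> p x" "{Q. primeideal Q R \<and> f \<notin> Q} \<subseteq> p ` V"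
      using R.zariski_basis[OF open_im[OF V(1,2)], of "p x"] V by blast
    have "D U (\<psi> f) \<subseteq> V"
    proof
      fix y assume y: "y \<in> D U (\<psi> f)"
      then have yU: "y \<in> U" by (auto simp: D_def)
      then have "p y \<in> p ` V" using y f Dpsi pp by blast
      then show "y \<in> V" using pre_im[OF V(2)] yU by (auto simp: pre_def)
    qed
    then show "\<exists>f\<in>carrier R. x \<in> D U (\<psi> f) \<and> D U (\<psi> f) \<subseteq> V" using f Dpsi V by blast
  next
    fix V x s assume V: "openin (under X) V" "V \<subseteq> U" "x \<in> V" and s: "s \<in> carrier R" and z: "res X U V (\<psi> s) = \<zero>\<^bsub>sec X V\<^esub>"
    have xU: "x \<in> U" using V by blast
    have "shf g V \<zero>\<^bsub>sec X V\<^esub> = shf g V (res X U V (\<psi> \<zero>\<^bsub>R\<^esub>))"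
      using ring_hom_zero[OF psi_hom R.ring_axioms sec_ring[OF oU]] res_zero[OF oU V(1,2)] by simp
    then have "R.fraction (p ` V) s \<one>\<^bsub>R\<^esub> = R.fraction (p ` V) \<zero>\<^bsub>R\<^esub> \<one>\<^bsub>R\<^esub>"
      using g_res_psi[OF V(1,2) s] g_res_psi[OF V(1,2) R.zero_closed] z by simp
    from fun_cong[OF this, of "p x"] have "loc_frac R (p x) s \<one>\<^bsub>R\<^esub> = loc_frac R (p x) \<zero>\<^bsub>R\<^esub> \<one>\<^bsub>R\<^esub>"
      using V by (simp add: R.fraction_def)
    then obtain h where "h \<in> carrier R - p x" "h \<otimes>\<^bsub>R\<^esub> (\<one>\<^bsub>R\<^esub> \<otimes>\<^bsub>R\<^esub> s) = h \<otimes>\<^bsub>R\<^esub> (\<one>\<^bsub>R\<^esub> \<otimes>\<^bsub>R\<^esub> \<zero>\<^bsub>R\<^esub>)"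
      using R.loc_frac_eq[OF pp[OF xU] s _ _, of "\<one>\<^bsub>R\<^esub>" "\<zero>\<^bsub>R\<^esub>" "\<one>\<^bsub>R\<^esub>"] primeideal_one[OF pp[OF xU]] by auto
    then show "\<exists>h\<in>carrier R. x \<in> D U (\<psi> h) \<and> h \<otimes>\<^bsub>R\<^esub> s = \<zero>\<^bsub>R\<^esub>"
      using Dpsi[OF xU] s by (intro bexI[of _ h]) auto
  next
    fix V x t assume V: "openin (under X) V" "V \<subseteq> U" "x \<in> V" and t: "t \<in> carrier (sec X V)"
    have xU: "x \<in> U" using V by blast
    let ?s = "shf g V t"
    have s: "?s \<in> spec_sections R (p ` V)" using ring_hom_closed[OF hom_g[OF V(1,2)] t] by simp
    obtain Y a f where Y: "openin (zariski R) Y" "p x \<in> Y" "Y \<subseteq> p ` V" "a \<in> carrier R" "f \<in> carrier R"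
      "\<And>Q. Q \<in> Y \<Longrightarrow> f \<notin> Q \<and> ?s Q = loc_frac R Q a f"
      using spec_sectionsD[OF s imageI[OF V(3)]] by auto
    let ?W = "pre Y"
    have W: "openin (under X) ?W" "x \<in> ?W" "?W \<subseteq> V"
      using open_pre[OF Y(1)] xU Y(2,3) pre_im[OF V(2)] by (auto simp: pre_def)
    have sY: "restrict ?s Y = R.fraction Y a f"
      using Y(6) by (auto simp: R.fraction_def intro!: restrict_ext)
    have sYc: "restrict ?s Y \<in> spec_sections R Y" unfolding sY using Y by (intro R.fraction_section) auto
    have tW: "res X V ?W t = shf \<phi> Y (restrict ?s Y)"
      using nat_phi[OF open_im[OF V(1,2)] Y(1,3) s] phi_g[OF V(1,2) t] pre_im[OF V(2)] by simp
    have "R.fraction Y f \<one>\<^bsub>R\<^esub> \<otimes>\<^bsub>sec ?S Y\<^esub> restrict ?s Y = R.fraction Y a \<one>\<^bsub>R\<^esub>"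
    proof -
      have "loc_frac R Q f \<one>\<^bsub>R\<^esub> \<otimes>\<^bsub>localization R Q\<^esub> loc_frac R Q a f = loc_frac R Q a \<one>\<^bsub>R\<^esub>" if "Q \<in> Y" for Q
      proof -
        have Q: "primeideal Q R" using sub_T[OF Y(1)] that by blast
        show ?thesis using Y(4,5) Y(6)[OF that] primeideal_one[OF Q] Q
          by (subst R.loc_frac_mult) (auto simp: R.loc_frac_eq intro!: bexI[of _ "\<one>\<^bsub>R\<^esub>"])
      qed
      then show ?thesis unfolding sY by (auto simp: R.fraction_def intro!: restrict_ext)
    qed
    then have "res X U ?W (\<psi> f) \<otimes>\<^bsub>sec X ?W\<^esub> res X V ?W t = res X U ?W (\<psi> a)"
      unfolding tW res_psi[OF Y(1,5)] res_psi[OF Y(1,4)]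
      using ring_hom_mult[OF hom_phi[OF Y(1)], of "R.fraction Y f \<one>\<^bsub>R\<^esub>" "restrict ?s Y"] frT[OF Y(5,1)] sYc
      by (simp del: Spec_simps(3-6))
    then show "\<exists>W a f. openin (under X) W \<and> x \<in> W \<and> W \<subseteq> V \<and> a \<in> carrier R \<and> f \<in> carrier R \<and> x \<in> D U (\<psi> f) \<and>
          res X U W (\<psi> f) \<otimes>\<^bsub>sec X W\<^esub> res X V W t = res X U W (\<psi> a)"
      using W Y Dpsi[OF xU Y(5)] by (intro exI[of _ ?W] exI[of _ a] exI[of _ f]) auto
  qed
  then show ?thesis by (rule affine_chart.canonical_chart)
qed

sublocale affine_chart \<subseteq> spectrum R
  by (rule spectrum.intro) (rule is_cring)

text \<open>Closure of the domain is a separate assumption because the lemma is also applied to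
  sections of a spectrum, whose ring axioms are not at hand there.\<close>

lemma ring_hom_cong:
  assumes h: "h \<in> ring_hom R S" and eq: "\<And>x. x \<in> carrier R \<Longrightarrow> h' x = h x"
    and "\<one>\<^bsub>R\<^esub> \<in> carrier R"
    and "\<And>x y. x \<in> carrier R \<Longrightarrow> y \<in> carrier R \<Longrightarrow> x \<otimes>\<^bsub>R\<^esub> y \<in> carrier R"
    and "\<And>x y. x \<in> carrier R \<Longrightarrow> y \<in> carrier R \<Longrightarrow> x \<oplus>\<^bsub>R\<^esub> y \<in> carrier R"
  shows "h' \<in> ring_hom R S"
  by (rule ring_hom_memI)
    (use assms in \<open>simp_all add: ring_hom_closed[OF h] ring_hom_mult[OF h] ring_hom_add[OF h] ring_hom_one[OF h]\<close>)

section \<open>Comparison of a chart with the spectrum of its coordinate ring\<close>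

context affine_chart
begin

abbreviation v where "v \<equiv> vanishing X U R \<psi>"

definition point_of :: "'s set \<Rightarrow> 'p" where
  "point_of P = the_inv_into U v P"

lemma point_of [simp]: "x \<in> U \<Longrightarrow> point_of (v x) = x"
  unfolding point_of_def using vanishing_inj by (rule the_inv_into_f_f)

lemma v_image: "v ` U = {P. primeideal P R}"
  using vanishing_prime vanishing_surj by auto

lemma v_D: "f \<in> carrier R \<Longrightarrow> v ` D U (\<psi> f) = {P. primeideal P R \<and> f \<notin> P}"
  using v_image D_iff[of f] D_subset[of U "\<psi> f"] by (auto simp: image_iff) (metis (no_types) vanishing_surj)

lemma v_inj_mem: "x \<in> U \<Longrightarrow> V \<subseteq> U \<Longrightarrow> v x \<in> v ` V \<longleftrightarrow> x \<in> V"
  by (rule inj_on_image_mem_iff[OF vanishing_inj])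

lemma open_image:
  assumes "openin (under X) V" "V \<subseteq> U"
  shows "openin (zariski R) (v ` V)"
proof (subst openin_subopen, rule ballI)
  fix P assume "P \<in> v ` V"
  then obtain x where x: "x \<in> V" "P = v x" by blast
  obtain f where f: "f \<in> carrier R" "x \<in> D U (\<psi> f)" "D U (\<psi> f) \<subseteq> V" using basis[OF assms x(1)] by blast
  have "openin (zariski R) (v ` D U (\<psi> f))" unfolding v_D[OF f(1)] by (rule zariski_basic_open[OF f(1)])
  then show "\<exists>T. openin (zariski R) T \<and> P \<in> T \<and> T \<subseteq> v ` V"
    using x f by (intro exI[of _ "v ` D U (\<psi> f)"]) auto
qed

lemma open_preimage:
  assumes "openin (zariski R) Z"
  shows "openin (under X) {x \<in> U. v x \<in> Z}"
proof (subst openin_subopen, rule ballI)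
  fix x assume "x \<in> {x \<in> U. v x \<in> Z}"
  then have x: "x \<in> U" "v x \<in> Z" by auto
  obtain f where f: "f \<in> carrier R" "f \<notin> v x" "{Q. primeideal Q R \<and> f \<notin> Q} \<subseteq> Z"
    using zariski_basis[OF assms x(2)] by blast
  have "D U (\<psi> f) \<subseteq> {x \<in> U. v x \<in> Z}"
    using v_D[OF f(1)] f(3) D_subset[of U "\<psi> f"] by blast
  then show "\<exists>T. openin (under X) T \<and> x \<in> T \<and> T \<subseteq> {x \<in> U. v x \<in> Z}"
    using open_D[OF f(1)] f x D_iff by blast
qed

text \<open>Says that \<open>t = a / f\<close> near \<open>x\<close>. A relation is the right form,
  since only the class of the fraction in the localization is unique.\<close>

definition frac_at :: "'p set \<Rightarrow> 'r \<Rightarrow> 'p \<Rightarrow> 's \<Rightarrow> 's \<Rightarrow> bool" where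
  "frac_at V t x a f \<longleftrightarrow> (\<exists>W. openin (under X) W \<and> x \<in> W \<and> W \<subseteq> V \<and> a \<in> carrier R \<and> f \<in> carrier R \<and>
     x \<in> D U (\<psi> f) \<and> phi W f \<otimes>\<^bsub>sec X W\<^esub> res X V W t = phi W a)"

lemma frac_at_ex:
  assumes "openin (under X) V" "V \<subseteq> U" "x \<in> V" "t \<in> carrier (sec X V)"
  shows "\<exists>a f. frac_at V t x a f"
  using locally_fraction[OF assms] unfolding frac_at_def phi_def by blast

lemma frac_atD:
  assumes "frac_at V t x a f"
  shows "a \<in> carrier R" "f \<in> carrier R" "x \<in> D U (\<psi> f)" "f \<in> carrier R - v x"
  using assms D_iff[of f x] D_subset[of U "\<psi> f"] by (auto simp: frac_at_def)

lemma frac_eq_shrink: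
  assumes V: "openin (under X) V" "V \<subseteq> U" "t \<in> carrier (sec X V)" and W: "openin (under X) W" "W \<subseteq> V"
    and a: "a \<in> carrier R" "f \<in> carrier R" and e: "phi W f \<otimes>\<^bsub>sec X W\<^esub> res X V W t = phi W a"
    and Y: "openin (under X) Y" "Y \<subseteq> W"
  shows "phi Y f \<otimes>\<^bsub>sec X Y\<^esub> res X V Y t = phi Y a"
proof -
  have WU: "W \<subseteq> U" using V W by blast
  have "res X W Y (phi W f \<otimes>\<^bsub>sec X W\<^esub> res X V W t) = phi Y a"
    using e res_phi[OF W(1) Y WU a(1)] by simp
  then show ?thesis
    using res_mult[OF W(1) Y, of "phi W f" "res X V W t"] res_phi[OF W(1) Y WU a(2)]
      res_res[OF V(1) W(1) Y W(2) V(3)] ring_hom_closed[OF phi_hom[OF W(1) WU] a(2)] res_closed[OF V(1) W V(3)]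
    by simp
qed

text \<open>Shrinking to the locus of \<open>f\<close> makes one fraction valid at all points of a
  neighbourhood, which is what local fractions in a spectrum require.\<close>

lemma frac_at_near:
  assumes V: "openin (under X) V" "V \<subseteq> U" "t \<in> carrier (sec X V)" and e: "frac_at V t x a f"
  obtains W where "openin (under X) W" "x \<in> W" "W \<subseteq> V" "W \<subseteq> D U (\<psi> f)"
    "phi W f \<otimes>\<^bsub>sec X W\<^esub> res X V W t = phi W a"
proof -
  obtain W where W: "openin (under X) W" "x \<in> W" "W \<subseteq> V" "a \<in> carrier R" "f \<in> carrier R"
     "x \<in> D U (\<psi> f)" "phi W f \<otimes>\<^bsub>sec X W\<^esub> res X V W t = phi W a"
    using e unfolding frac_at_def by blast
  show ?thesis
  proof (rule that[of "W \<inter> D U (\<psi> f)"])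
    show "openin (under X) (W \<inter> D U (\<psi> f))" using W open_D by blast
    then show "phi (W \<inter> D U (\<psi> f)) f \<otimes>\<^bsub>sec X (W \<inter> D U (\<psi> f))\<^esub> res X V (W \<inter> D U (\<psi> f)) t = phi (W \<inter> D U (\<psi> f)) a"
      using W by (intro frac_eq_shrink[OF V W(1,3,4,5,7)]) auto
  qed (use W in auto)
qed

lemma frac_at_neighbours:
  assumes "openin (under X) W" "W \<subseteq> V" "W \<subseteq> D U (\<psi> f)" "y \<in> W" "a \<in> carrier R" "f \<in> carrier R"
    "phi W f \<otimes>\<^bsub>sec X W\<^esub> res X V W t = phi W a"
  shows "frac_at V t y a f"
  using assms unfolding frac_at_def by blast

lemma frac_at_res:
  assumes V: "openin (under X) V" "V \<subseteq> U" "t \<in> carrier (sec X V)" and Y: "openin (under X) Y" "Y \<subseteq> V" and x: "x \<in> Y"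
  shows "frac_at Y (res X V Y t) x a f \<longleftrightarrow> frac_at V t x a f"
proof
  assume "frac_at V t x a f"
  then obtain W where W: "openin (under X) W" "x \<in> W" "W \<subseteq> V" "W \<subseteq> D U (\<psi> f)"
    "phi W f \<otimes>\<^bsub>sec X W\<^esub> res X V W t = phi W a" and af: "a \<in> carrier R" "f \<in> carrier R"
    using frac_at_near[OF V] frac_atD by metis
  have o: "openin (under X) (W \<inter> Y)" using W Y by blast
  have "phi (W \<inter> Y) f \<otimes>\<^bsub>sec X (W \<inter> Y)\<^esub> res X V (W \<inter> Y) t = phi (W \<inter> Y) a"
    by (rule frac_eq_shrink[OF V W(1,3) af W(5) o]) auto
  then show "frac_at Y (res X V Y t) x a f"
    using o W x af res_res[OF V(1) Y(1) o _ Y(2) V(3)] unfolding frac_at_def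
    by (intro exI[of _ "W \<inter> Y"]) auto
next
  assume "frac_at Y (res X V Y t) x a f"
  then obtain W where "openin (under X) W \<and> x \<in> W \<and> W \<subseteq> Y \<and> a \<in> carrier R \<and> f \<in> carrier R \<and>
     x \<in> D U (\<psi> f) \<and> phi W f \<otimes>\<^bsub>sec X W\<^esub> res X Y W (res X V Y t) = phi W a"
    unfolding frac_at_def by blast
  then show "frac_at V t x a f"
    using res_res[OF V(1) Y(1) _ _ Y(2) V(3), of W] Y unfolding frac_at_def
    by (intro exI[of _ W]) auto
qed

text \<open>Near \<open>x\<close> both fractions represent \<open>t\<close>, so their cross
  difference restricts to zero; \<open>locally_zero\<close> provides the multiplier outside the
  prime that equality of fractions asks for.\<close>

lemma frac_at_unique:
  assumes V: "openin (under X) V" "V \<subseteq> U" "t \<in> carrier (sec X V)" and x: "x \<in> V"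
    and 1: "frac_at V t x a f" and 2: "frac_at V t x b k"
  shows "loc_frac R (v x) a f = loc_frac R (v x) b k"
proof -
  obtain W where W: "openin (under X) W" "x \<in> W" "W \<subseteq> V" "W \<subseteq> D U (\<psi> f)"
    "phi W f \<otimes>\<^bsub>sec X W\<^esub> res X V W t = phi W a" using frac_at_near[OF V 1] by blast
  obtain W' where W': "openin (under X) W'" "x \<in> W'" "W' \<subseteq> V" "W' \<subseteq> D U (\<psi> k)"
    "phi W' k \<otimes>\<^bsub>sec X W'\<^esub> res X V W' t = phi W' b" using frac_at_near[OF V 2] by blast
  note d = frac_atD[OF 1] frac_atD[OF 2]
  let ?Y = "W \<inter> W'"
  have Y: "openin (under X) ?Y" "?Y \<subseteq> V" "?Y \<subseteq> U" "x \<in> ?Y" using W W' V by auto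
  interpret Y: ring_hom_cring R "sec X ?Y" "phi ?Y" using phi_cring_hom[OF Y(1,3)] .
  have e1: "phi ?Y f \<otimes>\<^bsub>sec X ?Y\<^esub> res X V ?Y t = phi ?Y a"
    by (rule frac_eq_shrink[OF V W(1,3) _ _ W(5) Y(1)]) (use d in auto)
  have e2: "phi ?Y k \<otimes>\<^bsub>sec X ?Y\<^esub> res X V ?Y t = phi ?Y b"
    by (rule frac_eq_shrink[OF V W'(1,3) _ _ W'(5) Y(1)]) (use d in auto)
  have tc: "res X V ?Y t \<in> carrier (sec X ?Y)" using res_closed[OF V(1) Y(1,2) V(3)] .
  have eq: "phi ?Y (k \<otimes> a) = phi ?Y (f \<otimes> b)"
    using d tc by (simp add: e1[symmetric] e2[symmetric] Y.S.m_lcomm)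
  have "phi ?Y (k \<otimes> a \<ominus> f \<otimes> b) = \<zero>\<^bsub>sec X ?Y\<^esub>"
    using ring_hom_minus(1)[OF phi_hom[OF Y(1,3)] is_cring sec_cring[OF Y(1)], of "k \<otimes> a" "f \<otimes> b"] d eq
    by (simp add: Y.S.minus_eq Y.S.r_neg del: Y.hom_mult)
  then obtain h where h: "h \<in> carrier R" "x \<in> D U (\<psi> h)" "h \<otimes> (k \<otimes> a \<ominus> f \<otimes> b) = \<zero>"
    using locally_zero[OF Y(1,3,4), of "k \<otimes> a \<ominus> f \<otimes> b"] d by (auto simp: phi_def)
  have xU: "x \<in> U" using x V by blast
  have "h \<otimes> (k \<otimes> a) \<ominus> h \<otimes> (f \<otimes> b) = \<zero>" using h d by (simp add: minus_eq r_distr r_minus)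
  then have "h \<otimes> (k \<otimes> a) = h \<otimes> (f \<otimes> b)"
    using h d minus_equality[of "h \<otimes> (k \<otimes> a)" "\<ominus> (h \<otimes> (f \<otimes> b))"] by (simp add: minus_eq)
  then show ?thesis
    using h d xU D_iff[of h x] by (subst loc_frac_eq[OF vanishing_prime[OF xU]]) auto
qed

text \<open>Equality of fractions at one prime is witnessed by a single multiplier \<open>h\<close>,
  and the equation persists on the part of the neighbourhood where \<open>h\<close> and both
  denominators have unit germs.\<close>

lemma frac_at_agree:
  assumes V: "openin (under X) V" "V \<subseteq> U" "t \<in> carrier (sec X V)" "t' \<in> carrier (sec X V)" and x: "x \<in> V"
    and 1: "frac_at V t x a f" and 2: "frac_at V t' x b k"
    and eq: "loc_frac R (v x) a f = loc_frac R (v x) b k"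
  shows "\<exists>Y. openin (under X) Y \<and> x \<in> Y \<and> Y \<subseteq> V \<and> res X V Y t = res X V Y t'"
proof -
  obtain W where W: "openin (under X) W" "x \<in> W" "W \<subseteq> V" "W \<subseteq> D U (\<psi> f)"
    "phi W f \<otimes>\<^bsub>sec X W\<^esub> res X V W t = phi W a" using frac_at_near[OF V(1,2,3) 1] by blast
  obtain W' where W': "openin (under X) W'" "x \<in> W'" "W' \<subseteq> V" "W' \<subseteq> D U (\<psi> k)"
    "phi W' k \<otimes>\<^bsub>sec X W'\<^esub> res X V W' t' = phi W' b" using frac_at_near[OF V(1,2,4) 2] by blast
  note d = frac_atD[OF 1] frac_atD[OF 2]
  have xU: "x \<in> U" using x V by blast
  obtain h where h: "h \<in> carrier R - v x" "h \<otimes> (k \<otimes> a) = h \<otimes> (f \<otimes> b)"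
    using eq d by (subst (asm) loc_frac_eq[OF vanishing_prime[OF xU]]) auto
  let ?Y = "W \<inter> W' \<inter> D U (\<psi> h)"
  have Y: "openin (under X) ?Y" "?Y \<subseteq> V" "?Y \<subseteq> U" "x \<in> ?Y" using W W' V h open_D D_iff xU by auto
  interpret Y: ring_hom_cring R "sec X ?Y" "phi ?Y" using phi_cring_hom[OF Y(1,3)] .
  have e1: "phi ?Y f \<otimes>\<^bsub>sec X ?Y\<^esub> res X V ?Y t = phi ?Y a"
    by (rule frac_eq_shrink[OF V(1,2,3) W(1,3) _ _ W(5) Y(1)]) (use d in auto)
  have e2: "phi ?Y k \<otimes>\<^bsub>sec X ?Y\<^esub> res X V ?Y t' = phi ?Y b"
    by (rule frac_eq_shrink[OF V(1,2,4) W'(1,3) _ _ W'(5) Y(1)]) (use d in auto)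
  have tc: "res X V ?Y t \<in> carrier (sec X ?Y)" "res X V ?Y t' \<in> carrier (sec X ?Y)"
    using res_closed[OF V(1) Y(1,2)] V by auto
  have hc: "h \<in> carrier R" using h by simp
  let ?u = "h \<otimes> (f \<otimes> k)"
  have "phi ?Y ?u \<otimes>\<^bsub>sec X ?Y\<^esub> res X V ?Y t = phi ?Y (h \<otimes> (k \<otimes> a))"
    using d hc tc by (simp add: e1[symmetric] Y.S.m_ac)
  also have "\<dots> = phi ?Y ?u \<otimes>\<^bsub>sec X ?Y\<^esub> res X V ?Y t'"
    unfolding h(2) using d hc tc by (simp add: e2[symmetric] Y.S.m_ac)
  finally have "res X V ?Y t = res X V ?Y t'"
  proof (rule germ_unit_cancel[OF Y(1) _ tc, rotated -1])
    show "phi ?Y ?u \<in> carrier (sec X ?Y)" using d hc by simp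
    fix y assume y: "y \<in> ?Y"
    then have "y \<in> D U (\<psi> ?u)" using W W' d hc by (simp add: D_psi_mult subset_iff)
    then show "germ_unit X y ?Y (phi ?Y ?u)"
      unfolding phi_def using y d hc by (subst germ_unit_res[OF open_chart Y(1,3)]) (auto simp: D_def)
  qed
  then show ?thesis using Y by blast
qed

text \<open>The usual rules for fractions, in the shape of \<open>loc_frac_mult\<close> and
  \<open>loc_frac_add\<close>, so that \<open>theta\<close> becomes a homomorphism.\<close>

lemma frac_at_ops:
  assumes V: "openin (under X) V" "V \<subseteq> U" "t \<in> carrier (sec X V)" "t' \<in> carrier (sec X V)" and x: "x \<in> V"
    and 1: "frac_at V t x a f" and 2: "frac_at V t' x b k"
  shows "frac_at V (t \<otimes>\<^bsub>sec X V\<^esub> t') x (a \<otimes> b) (f \<otimes> k)"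
    "frac_at V (t \<oplus>\<^bsub>sec X V\<^esub> t') x (a \<otimes> k \<oplus> b \<otimes> f) (f \<otimes> k)"
proof -
  obtain W where W: "openin (under X) W" "x \<in> W" "W \<subseteq> V" "W \<subseteq> D U (\<psi> f)"
    "phi W f \<otimes>\<^bsub>sec X W\<^esub> res X V W t = phi W a" using frac_at_near[OF V(1,2,3) 1] by blast
  obtain W' where W': "openin (under X) W'" "x \<in> W'" "W' \<subseteq> V" "W' \<subseteq> D U (\<psi> k)"
    "phi W' k \<otimes>\<^bsub>sec X W'\<^esub> res X V W' t' = phi W' b" using frac_at_near[OF V(1,2,4) 2] by blast
  note d = frac_atD[OF 1] frac_atD[OF 2]
  let ?Y = "W \<inter> W'"
  have Y: "openin (under X) ?Y" "?Y \<subseteq> V" "?Y \<subseteq> U" "x \<in> ?Y" using W W' V by auto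
  interpret Y: ring_hom_cring R "sec X ?Y" "phi ?Y" using phi_cring_hom[OF Y(1,3)] .
  have e1: "phi ?Y f \<otimes>\<^bsub>sec X ?Y\<^esub> res X V ?Y t = phi ?Y a"
    by (rule frac_eq_shrink[OF V(1,2,3) W(1,3) _ _ W(5) Y(1)]) (use d in auto)
  have e2: "phi ?Y k \<otimes>\<^bsub>sec X ?Y\<^esub> res X V ?Y t' = phi ?Y b"
    by (rule frac_eq_shrink[OF V(1,2,4) W'(1,3) _ _ W'(5) Y(1)]) (use d in auto)
  have tc: "res X V ?Y t \<in> carrier (sec X ?Y)" "res X V ?Y t' \<in> carrier (sec X ?Y)"
    using res_closed[OF V(1) Y(1,2)] V by auto
  have pc: "phi ?Y f \<in> carrier (sec X ?Y)" "phi ?Y k \<in> carrier (sec X ?Y)" using d by auto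
  have D: "x \<in> D U (\<psi> (f \<otimes> k))" using d by (simp add: D_psi_mult)
  have "phi ?Y (f \<otimes> k) \<otimes>\<^bsub>sec X ?Y\<^esub> res X V ?Y (t \<otimes>\<^bsub>sec X V\<^esub> t') = phi ?Y (a \<otimes> b)"
    using d tc pc res_mult[OF V(1) Y(1,2) V(3,4)] by (simp add: e1[symmetric] e2[symmetric] Y.S.m_ac)
  then show "frac_at V (t \<otimes>\<^bsub>sec X V\<^esub> t') x (a \<otimes> b) (f \<otimes> k)"
    unfolding frac_at_def using Y d D by (intro exI[of _ ?Y]) auto
  have "phi ?Y (f \<otimes> k) \<otimes>\<^bsub>sec X ?Y\<^esub> res X V ?Y (t \<oplus>\<^bsub>sec X V\<^esub> t') = phi ?Y (a \<otimes> k \<oplus> b \<otimes> f)"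
    using d tc pc res_add[OF V(1) Y(1,2) V(3,4)] by (simp add: e1[symmetric] e2[symmetric] Y.S.m_ac Y.S.r_distr)
  then show "frac_at V (t \<oplus>\<^bsub>sec X V\<^esub> t') x (a \<otimes> k \<oplus> b \<otimes> f) (f \<otimes> k)"
    unfolding frac_at_def using Y d D by (intro exI[of _ ?Y]) auto
qed

text \<open>The section of the structure sheaf corresponding to \<open>t\<close>. The definite
  description selects the class, which by \<open>frac_at_unique\<close> is the same for all local
  fractions.\<close>

definition theta :: "'p set \<Rightarrow> 'r \<Rightarrow> 's set \<Rightarrow> ('s \<times> 's) set" where
  "theta V t = (\<lambda>P\<in>v ` V. THE c. \<exists>a f. frac_at V t (point_of P) a f \<and> c = loc_frac R P a f)"

lemma theta_eq:
  assumes V: "openin (under X) V" "V \<subseteq> U" "t \<in> carrier (sec X V)" and x: "x \<in> V" and 1: "frac_at V t x a f"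
  shows "theta V t (v x) = loc_frac R (v x) a f"
proof -
  have xU: "x \<in> U" using x V by blast
  have "(THE c. \<exists>a f. frac_at V t x a f \<and> c = loc_frac R (v x) a f) = loc_frac R (v x) a f"
  proof (rule the_equality)
    fix c assume "\<exists>a f. frac_at V t x a f \<and> c = loc_frac R (v x) a f"
    then obtain b k where 2: "frac_at V t x b k" and c: "c = loc_frac R (v x) b k" by blast
    show "c = loc_frac R (v x) a f" unfolding c by (rule frac_at_unique[OF V x 2 1])
  qed (use 1 in blast)
  then show ?thesis using x xU by (simp add: theta_def)
qed

lemma theta_section:
  assumes V: "openin (under X) V" "V \<subseteq> U" "t \<in> carrier (sec X V)"
  shows "theta V t \<in> spec_sections R (v ` V)"
  unfolding spec_sections_def mem_Collect_eq
proof (intro conjI ballI)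
  show "theta V t \<in> PiE (v ` V) (\<lambda>P. carrier (localization R P))"
  proof (rule PiE_I)
    fix P assume "P \<in> v ` V"
    then obtain x where x: "x \<in> V" "P = v x" by blast
    obtain a f where af: "frac_at V t x a f" using frac_at_ex[OF V(1,2) x(1) V(3)] by blast
    show "theta V t P \<in> carrier (localization R P)"
      unfolding x(2) theta_eq[OF V x(1) af] using frac_atD[OF af] by (auto simp: localization_def)
  qed (simp add: theta_def)
next
  fix P assume "P \<in> v ` V"
  then obtain x where x: "x \<in> V" "P = v x" by blast
  obtain a f where af: "frac_at V t x a f" using frac_at_ex[OF V(1,2) x(1) V(3)] by blast
  obtain W where W: "openin (under X) W" "x \<in> W" "W \<subseteq> V" "W \<subseteq> D U (\<psi> f)"
    "phi W f \<otimes>\<^bsub>sec X W\<^esub> res X V W t = phi W a" using frac_at_near[OF V af] by blast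
  have WU: "W \<subseteq> U" using W V by blast
  have Q: "f \<notin> Q \<and> theta V t Q = loc_frac R Q a f" if QW: "Q \<in> v ` W" for Q
  proof -
    obtain y where y: "y \<in> W" "Q = v y" using QW by blast
    have "frac_at V t y a f" by (rule frac_at_neighbours[OF W(1,3,4) y(1) frac_atD(1,2)[OF af] W(5)])
    moreover have "y \<in> V" using y W by blast
    ultimately show ?thesis using theta_eq[OF V] frac_atD(4) y by blast
  qed
  show "\<exists>Z a f. openin (zariski R) Z \<and> P \<in> Z \<and> Z \<subseteq> v ` V \<and> a \<in> carrier R \<and> f \<in> carrier R \<and>
       (\<forall>Q\<in>Z. f \<notin> Q \<and> theta V t Q = loc_frac R Q a f)"
    using open_image[OF W(1) WU] x W Q frac_atD[OF af]
    by (intro exI[of _ "v ` W"] exI[of _ a] exI[of _ f]) auto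
qed

lemma theta_res:
  assumes V: "openin (under X) V" "V \<subseteq> U" "t \<in> carrier (sec X V)" and W: "openin (under X) W" "W \<subseteq> V"
  shows "theta W (res X V W t) = restrict (theta V t) (v ` W)"
proof
  fix P
  show "theta W (res X V W t) P = restrict (theta V t) (v ` W) P"
  proof (cases "P \<in> v ` W")
    case True
    then obtain x where x: "x \<in> W" "P = v x" by blast
    have xV: "x \<in> V" using x W by blast
    obtain a f where af: "frac_at V t x a f" using frac_at_ex[OF V(1,2) xV V(3)] by blast
    have "frac_at W (res X V W t) x a f" using frac_at_res[OF V W x(1)] af by blast
    then show ?thesis
      using theta_eq[OF W(1) _ res_closed[OF V(1) W V(3)] x(1)] theta_eq[OF V xV af] True x W V by auto
  next
    case False
    then show ?thesis by (simp add: theta_def)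
  qed
qed

text \<open>One local fraction at each point is enough to recognize the value of
  \<open>theta\<close>.\<close>

lemma theta_ext:
  assumes V: "openin (under X) V" "V \<subseteq> U" and s: "s \<in> extensional (v ` V)"
    and eq: "\<And>x. x \<in> V \<Longrightarrow> \<exists>a f. frac_at V t x a f \<and> s (v x) = loc_frac R (v x) a f"
    and t: "t \<in> carrier (sec X V)"
  shows "theta V t = s"
proof (rule extensionalityI[OF _ s])
  show "theta V t \<in> extensional (v ` V)" by (simp add: theta_def)
  fix P assume "P \<in> v ` V"
  then obtain x where x: "x \<in> V" "P = v x" by blast
  then show "theta V t P = s P" using eq[OF x(1)] theta_eq[OF V t x(1)] by auto
qed

lemma theta_hom:
  assumes V: "openin (under X) V" "V \<subseteq> U"
  shows "theta V \<in> ring_hom (sec X V) (sec (Spec R) (v ` V))"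
proof (rule ring_hom_memI)
  fix t assume "t \<in> carrier (sec X V)"
  then show "theta V t \<in> carrier (sec (Spec R) (v ` V))" using theta_section[OF V] by simp
next
  interpret V: cring "sec X V" using V sec_cring by blast
  fix t t' assume t: "t \<in> carrier (sec X V)" and t': "t' \<in> carrier (sec X V)"
  have *: "\<exists>a f b k. frac_at V t x a f \<and> frac_at V t' x b k" if "x \<in> V" for x
    using frac_at_ex[OF V that t] frac_at_ex[OF V that t'] by blast
  show "theta V (t \<otimes>\<^bsub>sec X V\<^esub> t') = theta V t \<otimes>\<^bsub>sec (Spec R) (v ` V)\<^esub> theta V t'"
  proof (rule theta_ext[OF V])
    fix x assume x: "x \<in> V"
    obtain a f b k where 1: "frac_at V t x a f" and 2: "frac_at V t' x b k" using *[OF x] by blast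
    have "x \<in> U" using x V by blast
    then show "\<exists>a f. frac_at V (t \<otimes>\<^bsub>sec X V\<^esub> t') x a f \<and>
         (theta V t \<otimes>\<^bsub>sec (Spec R) (v ` V)\<^esub> theta V t') (v x) = loc_frac R (v x) a f"
      using frac_at_ops(1)[OF V t t' x 1 2] theta_eq[OF V t x 1] theta_eq[OF V t' x 2] x
        loc_frac_mult[OF vanishing_prime frac_atD(1,4)[OF 1] frac_atD(1,4)[OF 2]]
      by (intro exI[of _ "a \<otimes> b"] exI[of _ "f \<otimes> k"]) simp
  qed (use t t' in auto)
  show "theta V (t \<oplus>\<^bsub>sec X V\<^esub> t') = theta V t \<oplus>\<^bsub>sec (Spec R) (v ` V)\<^esub> theta V t'"
  proof (rule theta_ext[OF V])
    fix x assume x: "x \<in> V"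
    obtain a f b k where 1: "frac_at V t x a f" and 2: "frac_at V t' x b k" using *[OF x] by blast
    have "x \<in> U" using x V by blast
    then show "\<exists>a f. frac_at V (t \<oplus>\<^bsub>sec X V\<^esub> t') x a f \<and>
         (theta V t \<oplus>\<^bsub>sec (Spec R) (v ` V)\<^esub> theta V t') (v x) = loc_frac R (v x) a f"
      using frac_at_ops(2)[OF V t t' x 1 2] theta_eq[OF V t x 1] theta_eq[OF V t' x 2] x
        loc_frac_add[OF vanishing_prime frac_atD(1,4)[OF 1] frac_atD(1,4)[OF 2]]
      by (intro exI[of _ "a \<otimes> k \<oplus> b \<otimes> f"] exI[of _ "f \<otimes> k"]) simp
  qed (use t t' in auto)
next
  interpret V: ring_hom_cring R "sec X V" "phi V" using phi_cring_hom[OF V] .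
  show "theta V \<one>\<^bsub>sec X V\<^esub> = \<one>\<^bsub>sec (Spec R) (v ` V)\<^esub>"
  proof (rule theta_ext[OF V])
    fix x assume x: "x \<in> V"
    have "frac_at V \<one>\<^bsub>sec X V\<^esub> x \<one> \<one>"
      unfolding frac_at_def using x V D_psi_one res_one[OF V(1) V(1)] by (intro exI[of _ V]) auto
    then show "\<exists>a f. frac_at V \<one>\<^bsub>sec X V\<^esub> x a f \<and> \<one>\<^bsub>sec (Spec R) (v ` V)\<^esub> (v x) = loc_frac R (v x) a f"
      using x by (intro exI[of _ \<one>]) simp
  qed auto
qed

lemma theta_inj:
  assumes V: "openin (under X) V" "V \<subseteq> U"
  shows "inj_on (theta V) (carrier (sec X V))"
proof (rule inj_onI)
  fix t t' assume t: "t \<in> carrier (sec X V)" and t': "t' \<in> carrier (sec X V)" and eq: "theta V t = theta V t'"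
  show "t = t'"
  proof (rule separated[OF V(1) t t'])
    fix x assume x: "x \<in> V"
    obtain a f b k where 1: "frac_at V t x a f" and 2: "frac_at V t' x b k"
      using frac_at_ex[OF V x t] frac_at_ex[OF V x t'] by blast
    then show "\<exists>Y. openin (under X) Y \<and> x \<in> Y \<and> Y \<subseteq> V \<and> res X V Y t = res X V Y t'"
      using theta_eq[OF V t x 1] theta_eq[OF V t' x 2] eq by (intro frac_at_agree[OF V t t' x 1 2]) simp
  qed
qed

text \<open>Locally a section of the spectrum is \<open>a / f\<close>, and \<open>f\<close> is
  invertible on the corresponding open set of \<open>X\<close>, so the fraction is realized there.
  The realizations agree on overlaps because \<open>theta\<close> is injective, and they
  glue.\<close>

lemma theta_surj:
  assumes V: "openin (under X) V" "V \<subseteq> U" and s: "s \<in> spec_sections R (v ` V)"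
  shows "\<exists>t\<in>carrier (sec X V). theta V t = s"
proof -
  have sext: "s \<in> extensional (v ` V)" using s by (auto simp: spec_sections_def PiE_def)
  define Q where "Q W t \<longleftrightarrow> openin (under X) W \<and> W \<subseteq> V \<and> t \<in> carrier (sec X W) \<and> theta W t = restrict s (v ` W)" for W t
  have cov: "\<exists>W t. x \<in> W \<and> Q W t" if x: "x \<in> V" for x
  proof -
    have xU: "x \<in> U" using x V by blast
    obtain Z a f where Z: "openin (zariski R) Z" "v x \<in> Z" "Z \<subseteq> v ` V" "a \<in> carrier R" "f \<in> carrier R"
       "\<And>P. P \<in> Z \<Longrightarrow> f \<notin> P \<and> s P = loc_frac R P a f"
      using spec_sectionsD[OF s imageI[OF x]] by auto
    let ?W = "{y \<in> U. v y \<in> Z}"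
    have W: "openin (under X) ?W" using open_preimage[OF Z(1)] .
    have WV: "?W \<subseteq> V" using Z(3) v_inj_mem[OF _ V(2)] by blast
    have WD: "?W \<subseteq> D U (\<psi> f)" using Z(5,6) D_iff by blast
    have WU: "?W \<subseteq> U" by blast
    interpret W: ring_hom_cring R "sec X ?W" "phi ?W" using phi_cring_hom[OF W WU] .
    have "phi ?W f \<in> Units (sec X ?W)"
      using Z(5) WD unfolding phi_def
      by (intro Units_from_germs[OF W]) (auto simp: res_closed[OF open_chart W WU] germ_unit_res[OF open_chart W WU] D_def)
    then obtain w where w: "w \<in> carrier (sec X ?W)" "phi ?W f \<otimes>\<^bsub>sec X ?W\<^esub> w = \<one>\<^bsub>sec X ?W\<^esub>"
      unfolding W.S.Units_iff by blast
    define t where "t = phi ?W a \<otimes>\<^bsub>sec X ?W\<^esub> w"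
    have t: "t \<in> carrier (sec X ?W)" using w Z(4) by (simp add: t_def)
    have fa: "phi ?W f \<otimes>\<^bsub>sec X ?W\<^esub> res X ?W ?W t = phi ?W a"
      using w Z(4,5) res_id[OF W t] by (simp add: t_def W.S.m_lcomm)
    have "theta ?W t = restrict s (v ` ?W)"
    proof (rule theta_ext[OF W WU _ _ t])
      fix y assume y: "y \<in> ?W"
      then have "frac_at ?W t y a f" using frac_at_neighbours[OF W subset_refl WD y Z(4,5) fa] by blast
      moreover have "s (v y) = loc_frac R (v y) a f" using Z(6) y by blast
      ultimately show "\<exists>a f. frac_at ?W t y a f \<and> restrict s (v ` ?W) (v y) = loc_frac R (v y) a f"
        using y by (intro exI[of _ a] exI[of _ f]) (simp add: image_iff, blast)
    qed auto
    then show "\<exists>W t. x \<in> W \<and> Q W t" using W WV t xU Z(2) unfolding Q_def by (intro exI[of _ ?W] exI[of _ t]) auto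
  qed
  have "\<exists>t\<in>carrier (sec X V). \<forall>W t'. Q W t' \<longrightarrow> res X V W t = t'"
  proof (rule glue[OF V(1) _ cov])
    fix W t W' t' assume q: "Q W t" "Q W' t'"
    let ?Y = "W \<inter> W'"
    have Y: "openin (under X) ?Y" "?Y \<subseteq> U" using q V by (auto simp: Q_def)
    have "theta ?Y (res X W ?Y t) = restrict s (v ` ?Y)"
      using q V theta_res[of W t ?Y] Y by (auto simp: Q_def Int_absorb1 image_mono)
    moreover have "theta ?Y (res X W' ?Y t') = restrict s (v ` ?Y)"
      using q V theta_res[of W' t' ?Y] Y by (auto simp: Q_def Int_absorb1 image_mono)
    ultimately show "res X W ?Y t = res X W' ?Y t'"
      using theta_inj[OF Y] res_closed[of W ?Y t] res_closed[of W' ?Y t'] q Y by (auto simp: Q_def inj_on_def)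
  next
    show "openin (under X) W \<and> W \<subseteq> V \<and> t \<in> carrier (sec X W)" if "Q W t" for W t using that by (simp add: Q_def)
  qed
  then obtain t where t: "t \<in> carrier (sec X V)" and tq: "\<And>W t'. Q W t' \<Longrightarrow> res X V W t = t'" by blast
  have "theta V t = s"
  proof (rule extensionalityI[OF _ sext])
    show "theta V t \<in> extensional (v ` V)" by (simp add: theta_def)
    fix P assume "P \<in> v ` V"
    then obtain x where x: "x \<in> V" "P = v x" by blast
    obtain W t' where W: "x \<in> W" "Q W t'" using cov[OF x(1)] by blast
    have "restrict (theta V t) (v ` W) = restrict s (v ` W)"
      using theta_res[OF V t, of W] tq[OF W(2)] W(2) by (simp add: Q_def)
    from fun_cong[OF this, of P] show "theta V t P = s P" using W(1) x(2) by simp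
  qed
  then show ?thesis using t by blast
qed

text \<open>The point map is \<open>vanishing\<close>, a bijection onto the primes that is a
  homeomorphism by \<open>open_image\<close> and \<open>open_preimage\<close>. Morphisms pull
  sections back, so on sections the isomorphism is the inverse of \<open>theta\<close>.\<close>

lemma Spec_iso: "\<exists>f. ringed_iso (open_subspace X U) (Spec R) f"
proof -
  let ?Y = "open_subspace X U" and ?S = "Spec R"
  let ?T = "{P. primeideal P R}"
  have opY: "openin (under ?Y) V \<longleftrightarrow> openin (under X) V \<and> V \<subseteq> U" for V
    using open_chart by (simp add: openin_open_subtopology)
  have ptsY: "pts ?Y = U" using openin_subset[OF open_chart] by (simp add: Int_absorb1)
  have ptsS: "pts ?S = ?T" by (simp add: topspace_zariski)
  define pre where "pre Z = {x \<in> U. v x \<in> Z}" for Z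
  have pre: "openin (under X) (pre Z)" "pre Z \<subseteq> U" if "openin (zariski R) Z" for Z
    using open_preimage[OF that] by (auto simp: pre_def)
  have im_pre: "v ` pre Z = Z" if "openin (zariski R) Z" for Z
  proof -
    have "Z \<subseteq> v ` U" using openin_subset[OF that] v_image by (simp add: topspace_zariski)
    then show ?thesis by (auto simp: pre_def)
  qed
  have pre_im: "pre (v ` V) = V" if "V \<subseteq> U" for V
    using v_inj_mem[OF _ that] that by (auto simp: pre_def)
  define F where "F = \<lparr>ptf = (\<lambda>x\<in>U. v x), shf = (\<lambda>Z\<in>opens ?S. \<lambda>s\<in>spec_sections R Z.
     inv_into (carrier (sec X (pre Z))) (theta (pre Z)) s)\<rparr>"
  define G where "G = \<lparr>ptf = (\<lambda>P\<in>?T. point_of P), shf = (\<lambda>V\<in>opens ?Y. \<lambda>t\<in>carrier (sec X V). theta V t)\<rparr>"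
  have preF: "preim ?Y F Z = pre Z" for Z
    unfolding preim_def ptsY by (auto simp: F_def pre_def)
  have preG: "preim ?S G V = v ` V" if "V \<subseteq> U" for V
  proof -
    have "preim ?S G V = {P \<in> v ` U. point_of P \<in> V}"
      unfolding preim_def ptsS v_image by (auto simp: G_def)
    also have "\<dots> = v ` V" using that by auto
    finally show ?thesis .
  qed
  have bij: "bij_betw (theta V) (carrier (sec X V)) (spec_sections R (v ` V))"
    if "openin (under X) V" "V \<subseteq> U" for V
    unfolding bij_betw_def using theta_inj[OF that] theta_section[OF that] theta_surj[OF that] by blast
  have hom: "theta V \<in> ring_hom (sec X V) (sec ?S (v ` V))" if "openin (under X) V" "V \<subseteq> U" for V
    by (rule theta_hom[OF that])
  define tinv where "tinv Z s = inv_into (carrier (sec X (pre Z))) (theta (pre Z)) s" for Z s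
  have inv_c: "tinv Z s \<in> carrier (sec X (pre Z))" and theta_inv: "theta (pre Z) (tinv Z s) = s"
    if "openin (zariski R) Z" "s \<in> spec_sections R Z" for Z s
    using bij_betw_imp_surj_on[OF bij[OF pre[OF that(1)]]] that im_pre[OF that(1)] unfolding tinv_def
    by (auto intro: inv_into_into f_inv_into_f)
  have inv_theta: "tinv Z t = s" if "openin (zariski R) Z" "s \<in> carrier (sec X (pre Z))" "t = theta (pre Z) s" for Z s t
    unfolding tinv_def that(3) by (rule inv_into_f_f[OF theta_inj[OF pre[OF that(1)]] that(2)])
  have inv_hom: "tinv Z \<in> ring_hom (sec ?S Z) (sec X (pre Z))" if Z: "openin (zariski R) Z" for Z
  proof (rule ring_hom_memI)
    interpret Z: cring "sec X (pre Z)" using pre(1)[OF Z] by (rule sec_cring)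
    note h = hom[OF pre[OF Z], unfolded im_pre[OF Z]]
    show "tinv Z \<one>\<^bsub>sec ?S Z\<^esub> = \<one>\<^bsub>sec X (pre Z)\<^esub>"
      using ring_hom_one[OF h] by (intro inv_theta[OF Z]) auto
    fix s assume s: "s \<in> carrier (sec ?S Z)"
    then show "tinv Z s \<in> carrier (sec X (pre Z))" using inv_c[OF Z] by simp
    fix t assume t: "t \<in> carrier (sec ?S Z)"
    show "tinv Z (s \<otimes>\<^bsub>sec ?S Z\<^esub> t) = tinv Z s \<otimes>\<^bsub>sec X (pre Z)\<^esub> tinv Z t"
      using ring_hom_mult[OF h, of "tinv Z s" "tinv Z t"] s t inv_c[OF Z] theta_inv[OF Z]
      by (intro inv_theta[OF Z]) (auto simp del: Spec_simps(3-6))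
    show "tinv Z (s \<oplus>\<^bsub>sec ?S Z\<^esub> t) = tinv Z s \<oplus>\<^bsub>sec X (pre Z)\<^esub> tinv Z t"
      using ring_hom_add[OF h, of "tinv Z s" "tinv Z t"] s t inv_c[OF Z] theta_inv[OF Z]
      by (intro inv_theta[OF Z]) (auto simp del: Spec_simps(3-6))
  qed
  have shfF: "shf F Z s = tinv Z s" if "openin (zariski R) Z" "s \<in> spec_sections R Z" for Z s
    using that by (simp add: F_def tinv_def)
  have shfG: "shf G V t = theta V t" if "openin (under X) V" "V \<subseteq> U" "t \<in> carrier (sec X V)" for V t
    using that opY[of V] by (simp add: G_def)
  have F: "ringed_morphism ?Y ?S F"
    unfolding ringed_morphism_def preF
  proof (intro conjI ballI impI)
    show "continuous_map (under ?Y) (under ?S) (ptf F)"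
      unfolding continuous_map_alt ptsY ptsS
    proof (intro conjI allI impI)
      show "ptf F \<in> U \<rightarrow> ?T" using v_image by (auto simp: F_def)
      fix Z assume Z: "openin (under ?S) Z"
      have "ptf F -` Z \<inter> U = pre Z" by (auto simp: F_def pre_def)
      then show "openin (under ?Y) (ptf F -` Z \<inter> U)" using pre[of Z] Z opY by simp
    qed
    show "ptf F \<in> extensional (pts ?Y)" unfolding ptsY by (simp add: F_def)
    show "shf F \<in> extensional (opens ?S)" by (simp add: F_def)
    fix Z assume Z: "Z \<in> opens ?S"
    show "shf F Z \<in> extensional (carrier (sec ?S Z))" using Z by (simp add: F_def)
    show "shf F Z \<in> ring_hom (sec ?S Z) (sec ?Y (pre Z))"
    proof -
      have oZ: "openin (zariski R) Z" using Z by simp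
      interpret Z: cring "sec X (pre Z)" using pre(1)[OF oZ] by (rule sec_cring)
      note h = hom[OF pre[OF oZ], unfolded im_pre[OF oZ]]
      have th: "s = theta (pre Z) (tinv Z s)" "tinv Z s \<in> carrier (sec X (pre Z))" if "s \<in> carrier (sec ?S Z)" for s
        using theta_inv[OF oZ] inv_c[OF oZ] that by auto
      show ?thesis unfolding open_subspace_simps
      proof (rule ring_hom_cong[OF inv_hom[OF oZ]])
        show "shf F Z s = tinv Z s" if "s \<in> carrier (sec ?S Z)" for s using shfF[OF oZ] that by simp
        show "\<one>\<^bsub>sec ?S Z\<^esub> \<in> carrier (sec ?S Z)"
          using ring_hom_closed[OF h Z.one_closed] ring_hom_one[OF h] by metis
        fix s t assume s: "s \<in> carrier (sec ?S Z)" and t: "t \<in> carrier (sec ?S Z)"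
        show "s \<otimes>\<^bsub>sec ?S Z\<^esub> t \<in> carrier (sec ?S Z)"
          using ring_hom_closed[OF h Z.m_closed[OF th(2)[OF s] th(2)[OF t]]]
            ring_hom_mult[OF h th(2)[OF s] th(2)[OF t]] th(1)[OF s] th(1)[OF t] by metis
        show "s \<oplus>\<^bsub>sec ?S Z\<^esub> t \<in> carrier (sec ?S Z)"
          using ring_hom_closed[OF h Z.a_closed[OF th(2)[OF s] th(2)[OF t]]]
            ring_hom_add[OF h th(2)[OF s] th(2)[OF t]] th(1)[OF s] th(1)[OF t] by metis
      qed
    qed
    fix W s assume W: "W \<in> opens ?S" "W \<subseteq> Z" and s: "s \<in> carrier (sec ?S Z)"
    have oZ: "openin (zariski R) Z" "openin (zariski R) W" and sc: "s \<in> spec_sections R Z" using Z W s by auto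
    have sub: "pre W \<subseteq> pre Z" using W(2) by (auto simp: pre_def)
    have "theta (pre W) (res X (pre Z) (pre W) (tinv Z s)) = restrict s W"
      using theta_res[OF pre[OF oZ(1)] inv_c[OF oZ(1) sc] pre(1)[OF oZ(2)] sub] theta_inv[OF oZ(1) sc] im_pre[OF oZ(2)]
      by simp
    moreover have "res X (pre Z) (pre W) (tinv Z s) \<in> carrier (sec X (pre W))"
      using res_closed[OF pre(1)[OF oZ(1)] pre(1)[OF oZ(2)] sub inv_c[OF oZ(1) sc]] .
    ultimately have "tinv W (restrict s W) = res X (pre Z) (pre W) (tinv Z s)" "restrict s W \<in> spec_sections R W"
      using inv_theta[OF oZ(2)] theta_section[OF pre[OF oZ(2)]] im_pre[OF oZ(2)] by metis+
    then show "res ?Y (pre Z) (pre W) (shf F Z s) = shf F W (res ?S Z W s)"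
      using shfF[OF oZ(1) sc] shfF[OF oZ(2)] by simp
  qed
  have G: "ringed_morphism ?S ?Y G"
    unfolding ringed_morphism_def
  proof (intro conjI ballI impI)
    show "continuous_map (under ?S) (under ?Y) (ptf G)"
      unfolding continuous_map_alt ptsY ptsS
    proof (intro conjI allI impI)
      show "ptf G \<in> ?T \<rightarrow> U"
      proof
        fix P assume "P \<in> ?T"
        then obtain x where "x \<in> U" "P = v x" using v_image by blast
        then show "ptf G P \<in> U" using vanishing_prime by (simp add: G_def)
      qed
      fix V assume V: "openin (under ?Y) V"
      have "ptf G -` V \<inter> ?T = preim ?S G V" unfolding preim_def ptsS by auto
      then show "openin (under ?S) (ptf G -` V \<inter> ?T)" using preG[of V] open_image[of V] V opY by simp
    qed
    show "ptf G \<in> extensional (pts ?S)" unfolding ptsS by (simp add: G_def)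
    show "shf G \<in> extensional (opens ?Y)" by (simp add: G_def)
    fix V assume "V \<in> opens ?Y"
    then have V: "openin (under X) V" "V \<subseteq> U" using opY by auto
    show "shf G V \<in> extensional (carrier (sec ?Y V))" using V opY[of V] by (simp add: G_def)
    show "shf G V \<in> ring_hom (sec ?Y V) (sec ?S (preim ?S G V))"
    proof -
      interpret V: cring "sec X V" using V(1) by (rule sec_cring)
      show ?thesis
        unfolding open_subspace_simps preG[OF V(2)]
        by (rule ring_hom_cong[OF hom[OF V]]) (auto simp: shfG[OF V])
    qed
    fix W s assume W: "W \<in> opens ?Y" "W \<subseteq> V" and s: "s \<in> carrier (sec ?Y V)"
    have oW: "openin (under X) W" "W \<subseteq> U" and sc: "s \<in> carrier (sec X V)" using W s opY by auto
    show "res ?S (preim ?S G V) (preim ?S G W) (shf G V s) = shf G W (res ?Y V W s)"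
      using theta_res[OF V sc oW(1) W(2)] shfG[OF V sc] shfG[OF oW res_closed[OF V(1) oW(1) W(2) sc]]
        preG[OF oW(2)] by simp
  qed
  have "comp_morph ?Y ?S ?Y G F = id_morph ?Y"
  proof -
    have 1: "(\<lambda>x\<in>U. ptf G (ptf F x)) = (\<lambda>x\<in>U. x)"
      using v_image by (auto simp: F_def G_def intro!: restrict_ext)
    have 2: "shf F (preim ?S G V) (shf G V s) = s" if "V \<in> opens ?Y" "s \<in> carrier (sec X V)" for V s
    proof -
      have V: "openin (under X) V" "V \<subseteq> U" using that opY by auto
      show ?thesis
        using shfG[OF V that(2)] preG[OF V(2)] shfF[OF open_image[OF V]] theta_section[OF V that(2)]
          inv_theta[OF open_image[OF V], of s] pre_im[OF V(2)] that(2) by simp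
    qed
    show ?thesis
      unfolding comp_morph_def id_morph_def ptsY 1
      using 2 by (auto intro!: restrict_ext)
  qed
  moreover have "comp_morph ?S ?Y ?S F G = id_morph ?S"
  proof -
    have 1: "(\<lambda>P\<in>?T. ptf F (ptf G P)) = (\<lambda>P\<in>?T. P)"
    proof (rule restrict_ext)
      fix P assume "P \<in> ?T"
      then obtain x where "x \<in> U" "P = v x" using v_image by blast
      then show "ptf F (ptf G P) = P" using vanishing_prime by (simp add: F_def G_def)
    qed
    have 2: "shf G (pre Z) (shf F Z s) = s" if "openin (zariski R) Z" "s \<in> spec_sections R Z" for Z s
      using shfF[OF that] shfG[OF pre[OF that(1)] inv_c[OF that]] theta_inv[OF that] by simp
    show ?thesis
      unfolding comp_morph_def id_morph_def ptsS 1 preF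
      using 2 by (auto intro!: restrict_ext)
  qed
  ultimately show ?thesis unfolding ringed_iso_def using F G by blast
qed

end

text \<open>The elements of \<open>R\<close> have the type of the sections, as
  \<open>affine_open\<close> demands; for the ring of sections itself this is automatic.\<close>

lemma affine_chart_imp_affine_open:
  fixes X :: "('p, 'r) ringed" and R :: "'r ring"
  assumes "affine_chart X U R \<psi>"
  shows "affine_open X U"
  using affine_chart.Spec_iso[OF assms] affine_chart.open_chart[OF assms] affine_chart.axioms(2)[OF assms]
  unfolding affine_open_def by blast

section \<open>Square zero augmentations\<close>

text \<open>The sheaf form of a square zero immersion, on a single space: \<open>P\<close> is the
  structure sheaf of the thickening and \<open>\<pi>\<close> its map onto that of \<open>S\<close>.
  As for any surjection of sheaves, lifts exist only locally. The base is arbitrary because an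
  amalgamated sum is also regarded as an extension of one of its summands.\<close>

locale augmentation = B: sheaf_space S + E: sheaf_space P
  for S :: "('p, 's) ringed" and P :: "('p, 'r) ringed" +
  fixes \<pi> :: "'p set \<Rightarrow> 'r \<Rightarrow> 's"
  assumes same_space [simp]: "under P = under S"
    and aug_hom: "openin (under S) U \<Longrightarrow> \<pi> U \<in> ring_hom (sec P U) (sec S U)"
    and aug_res: "openin (under S) U \<Longrightarrow> openin (under S) V \<Longrightarrow> V \<subseteq> U \<Longrightarrow> a \<in> carrier (sec P U) \<Longrightarrow>
        \<pi> V (res P U V a) = res S U V (\<pi> U a)"
    and aug_lift: "openin (under S) U \<Longrightarrow> b \<in> carrier (sec S U) \<Longrightarrow> x \<in> U \<Longrightarrow>
        \<exists>V u. openin (under S) V \<and> x \<in> V \<and> V \<subseteq> U \<and> u \<in> carrier (sec P V) \<and> \<pi> V u = res S U V b"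
    and aug_sqz: "openin (under S) U \<Longrightarrow> c \<in> carrier (sec P U) \<Longrightarrow> d \<in> carrier (sec P U) \<Longrightarrow>
        \<pi> U c = \<zero>\<^bsub>sec S U\<^esub> \<Longrightarrow> \<pi> U d = \<zero>\<^bsub>sec S U\<^esub> \<Longrightarrow> c \<otimes>\<^bsub>sec P U\<^esub> d = \<zero>\<^bsub>sec P U\<^esub>"
begin

lemma aug_closed: "openin (under S) U \<Longrightarrow> a \<in> carrier (sec P U) \<Longrightarrow> \<pi> U a \<in> carrier (sec S U)"
  using aug_hom ring_hom_closed by metis

lemma aug_cring_hom: "openin (under S) U \<Longrightarrow> ring_hom_cring (sec P U) (sec S U) (\<pi> U)"
  using aug_hom B.sec_cring E.sec_cring by (simp add: ring_hom_cring_def ring_hom_cring_axioms_def)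

text \<open>A section mapping to \<open>1\<close> has inverse \<open>2 - a\<close>.\<close>

lemma Units_of_one:
  assumes U: "openin (under S) U" and a: "a \<in> carrier (sec P U)" and one: "\<pi> U a = \<one>\<^bsub>sec S U\<^esub>"
  shows "a \<in> Units (sec P U)"
proof -
  interpret h: ring_hom_cring "sec P U" "sec S U" "\<pi> U" using aug_cring_hom[OF U] .
  define n where "n = a \<ominus>\<^bsub>sec P U\<^esub> \<one>\<^bsub>sec P U\<^esub>"
  have n: "n \<in> carrier (sec P U)" using a by (simp add: n_def)
  have "\<pi> U n = \<zero>\<^bsub>sec S U\<^esub>"
    using a one by (simp add: n_def h.R.minus_eq h.S.r_neg)
  then have nn: "n \<otimes>\<^bsub>sec P U\<^esub> n = \<zero>\<^bsub>sec P U\<^esub>" using aug_sqz[OF U n n] by simp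
  have an: "a = \<one>\<^bsub>sec P U\<^esub> \<oplus>\<^bsub>sec P U\<^esub> n" unfolding n_def using a by (simp add: h.R.minus_eq h.R.a_lcomm h.R.r_neg)
  have "a \<otimes>\<^bsub>sec P U\<^esub> (\<one>\<^bsub>sec P U\<^esub> \<ominus>\<^bsub>sec P U\<^esub> n) = \<one>\<^bsub>sec P U\<^esub>"
  proof -
    have "(\<one>\<^bsub>sec P U\<^esub> \<oplus>\<^bsub>sec P U\<^esub> n) \<otimes>\<^bsub>sec P U\<^esub> (\<one>\<^bsub>sec P U\<^esub> \<ominus>\<^bsub>sec P U\<^esub> n) = \<one>\<^bsub>sec P U\<^esub> \<ominus>\<^bsub>sec P U\<^esub> n \<otimes>\<^bsub>sec P U\<^esub> n"
      using n by algebra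
    then show ?thesis unfolding an nn by (simp add: h.R.minus_eq)
  qed
  then show ?thesis unfolding h.R.Units_iff using a n by (intro conjI bexI[of _ "\<one>\<^bsub>sec P U\<^esub> \<ominus>\<^bsub>sec P U\<^esub> n"]) auto
qed

text \<open>An inverse of the image lifts locally to some \<open>u\<close>; the product of
  \<open>a\<close> and \<open>u\<close> maps to 1 and is a unit by \<open>Units_of_one\<close>.
  Consequently \<open>S\<close> and \<open>P\<close> have the same basic open sets.\<close>

lemma germ_unit_aug:
  assumes U: "openin (under S) U" and x: "x \<in> U" and a: "a \<in> carrier (sec P U)"
  shows "germ_unit P x U a \<longleftrightarrow> germ_unit S x U (\<pi> U a)"
proof
  assume "germ_unit P x U a"
  then obtain V where V: "openin (under S) V" "x \<in> V" "V \<subseteq> U" "res P U V a \<in> Units (sec P V)"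
    unfolding germ_unit_def by auto
  then show "germ_unit S x U (\<pi> U a)"
    unfolding germ_unit_def using ring_hom_Units[OF aug_hom[OF V(1)] V(4)] aug_res[OF U V(1,3) a] by auto
next
  assume "germ_unit S x U (\<pi> U a)"
  then obtain V where V: "openin (under S) V" "x \<in> V" "V \<subseteq> U" "res S U V (\<pi> U a) \<in> Units (sec S V)"
    unfolding germ_unit_def by auto
  interpret V: cring "sec S V" using V(1) by (rule B.sec_cring)
  obtain b where b: "b \<in> carrier (sec S V)" "res S U V (\<pi> U a) \<otimes>\<^bsub>sec S V\<^esub> b = \<one>\<^bsub>sec S V\<^esub>"
    using V unfolding V.Units_iff by blast
  obtain W u where W: "openin (under S) W" "x \<in> W" "W \<subseteq> V" "u \<in> carrier (sec P W)" "\<pi> W u = res S V W b"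
    using aug_lift[OF V(1) b(1) V(2)] by blast
  have WU: "W \<subseteq> U" using W V by blast
  interpret W: cring "sec P W" using W(1) E.sec_cring by simp
  have aW: "res P U W a \<in> carrier (sec P W)" using E.res_closed[of U W a] U W WU a by simp
  have "\<pi> W (res P U W a \<otimes>\<^bsub>sec P W\<^esub> u) = res S U W (\<pi> U a) \<otimes>\<^bsub>sec S W\<^esub> res S V W b"
    using ring_hom_mult[OF aug_hom[OF W(1)] aW W(4)] aug_res[OF U W(1) WU a] W(5) by simp
  also have "\<dots> = res S V W (res S U V (\<pi> U a) \<otimes>\<^bsub>sec S V\<^esub> b)"
    using B.res_mult[OF V(1) W(1,3) _ b(1)] B.res_res[OF U V(1) W(1,3) V(3)] aug_closed[OF U a]
      B.res_closed[OF U V(1,3)] by simp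
  also have "\<dots> = \<one>\<^bsub>sec S W\<^esub>" unfolding b(2) by (rule B.res_one[OF V(1) W(1,3)])
  finally have "res P U W a \<otimes>\<^bsub>sec P W\<^esub> u \<in> Units (sec P W)"
    using W(1,4) aW by (intro Units_of_one) auto
  then have "res P U W a \<in> Units (sec P W)" using W.Units_mult_iff[OF aW W(4)] by simp
  then show "germ_unit P x U a" unfolding germ_unit_def using W WU by auto
qed

lemma D_aug:
  assumes "openin (under S) U" "a \<in> carrier (sec P U)"
  shows "E.D U a = B.D U (\<pi> U a)"
  using germ_unit_aug assms by (auto simp: E.D_def B.D_def)

section \<open>Charts of split square zero extensions\<close>

text \<open>The ring section \<open>\<sigma>\<close> decomposes \<open>P\<close> into
  \<open>S\<close> and the kernel. The kernel has square zero and lies in every prime, so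
  \<open>P\<close> and \<open>S\<close> have the same primes. \<open>Na\<close> and
  \<open>Nb\<close> are \<open>locally_zero\<close> and \<open>locally_fraction\<close> for elements
  of the kernel with denominators from \<open>S\<close>, that is, quasi-coherence of the kernel on
  \<open>W\<close>; combined with the chart of \<open>S\<close> they give these axioms for
  \<open>P\<close>.\<close>

lemma split_chart:
  fixes \<sigma> :: "'p set \<Rightarrow> 's \<Rightarrow> 'r"
  assumes ch: "affine_chart S W (sec S W) id"
    and s_hom: "\<And>U. openin (under S) U \<Longrightarrow> \<sigma> U \<in> ring_hom (sec S U) (sec P U)"
    and s_res: "\<And>U V b. openin (under S) U \<Longrightarrow> openin (under S) V \<Longrightarrow> V \<subseteq> U \<Longrightarrow> b \<in> carrier (sec S U) \<Longrightarrow>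
        res P U V (\<sigma> U b) = \<sigma> V (res S U V b)"
    and ps: "\<And>U b. openin (under S) U \<Longrightarrow> b \<in> carrier (sec S U) \<Longrightarrow> \<pi> U (\<sigma> U b) = b"
    and Na: "\<And>V x n. openin (under S) V \<Longrightarrow> V \<subseteq> W \<Longrightarrow> x \<in> V \<Longrightarrow> n \<in> carrier (sec P W) \<Longrightarrow>
        \<pi> W n = \<zero>\<^bsub>sec S W\<^esub> \<Longrightarrow> res P W V n = \<zero>\<^bsub>sec P V\<^esub> \<Longrightarrow>
        \<exists>h\<in>carrier (sec S W). germ_unit S x W h \<and> \<sigma> W h \<otimes>\<^bsub>sec P W\<^esub> n = \<zero>\<^bsub>sec P W\<^esub>"
    and Nb: "\<And>V x n. openin (under S) V \<Longrightarrow> V \<subseteq> W \<Longrightarrow> x \<in> V \<Longrightarrow> n \<in> carrier (sec P V) \<Longrightarrow>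
        \<pi> V n = \<zero>\<^bsub>sec S V\<^esub> \<Longrightarrow>
        \<exists>Y h m. openin (under S) Y \<and> x \<in> Y \<and> Y \<subseteq> V \<and> h \<in> carrier (sec S W) \<and> germ_unit S x W h \<and>
          m \<in> carrier (sec P W) \<and> \<pi> W m = \<zero>\<^bsub>sec S W\<^esub> \<and>
          res P W Y (\<sigma> W h) \<otimes>\<^bsub>sec P Y\<^esub> res P V Y n = res P W Y m"
  shows "affine_chart P W (sec P W) id"
proof -
  interpret C: affine_chart S W "sec S W" id by (rule ch)
  have W: "openin (under S) W" by (rule C.open_chart)
  have sc: "\<sigma> U b \<in> carrier (sec P U)" if "openin (under S) U" "b \<in> carrier (sec S U)" for U b
    using ring_hom_closed[OF s_hom[OF that(1)] that(2)] .
  interpret h: ring_hom_cring "sec P W" "sec S W" "\<pi> W" by (rule aug_cring_hom[OF W])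
  \<comment> \<open>The component of \<open>e\<close> in the kernel, relative to the
    splitting.\<close>
  define nil where "nil U e = e \<ominus>\<^bsub>sec P U\<^esub> \<sigma> U (\<pi> U e)" for U e
  have nil: "nil U e \<in> carrier (sec P U)" "\<pi> U (nil U e) = \<zero>\<^bsub>sec S U\<^esub>"
      "e = \<sigma> U (\<pi> U e) \<oplus>\<^bsub>sec P U\<^esub> nil U e"
    if U: "openin (under S) U" and e: "e \<in> carrier (sec P U)" for U e
  proof -
    interpret u: ring_hom_cring "sec P U" "sec S U" "\<pi> U" by (rule aug_cring_hom[OF U])
    have c: "\<sigma> U (\<pi> U e) \<in> carrier (sec P U)" using sc[OF U] e by simp
    show "nil U e \<in> carrier (sec P U)" "\<pi> U (nil U e) = \<zero>\<^bsub>sec S U\<^esub>"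
      "e = \<sigma> U (\<pi> U e) \<oplus>\<^bsub>sec P U\<^esub> nil U e"
      using e c ps[OF U] by (simp_all add: nil_def u.R.minus_eq u.S.r_neg u.R.a_lcomm u.R.r_neg)
  qed
  have Deq: "E.D W e = B.D W (\<pi> W e)" if "e \<in> carrier (sec P W)" for e using D_aug[OF W that] .
  have Ds: "E.D W (\<sigma> W b) = B.D W b" if "b \<in> carrier (sec S W)" for b
    using Deq[OF sc[OF W that]] ps[OF W that] by simp
  have van: "vanishing P W (sec P W) id x = {e \<in> carrier (sec P W). \<pi> W e \<in> vanishing S W (sec S W) id x}" if "x \<in> W" for x
    using germ_unit_aug[OF W that] by (auto simp: vanishing_def)
  have hr: "ring_hom_ring (sec P W) (sec S W) (\<pi> W)"
    using E.sec_ring[of W] B.sec_ring[OF W] W h.homh by (intro ring_hom_ringI2) simp_all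
  interpret s: ring_hom_cring "sec S W" "sec P W" "\<sigma> W"
    using s_hom[OF W] h.R.is_cring B.sec_cring[OF W] by (simp add: ring_hom_cring_def ring_hom_cring_axioms_def)
  have sr: "ring_hom_ring (sec S W) (sec P W) (\<sigma> W)"
    using E.sec_ring[of W] B.sec_ring[OF W] W s.homh by (intro ring_hom_ringI2) simp_all
  show ?thesis
  proof (intro affine_chart.intro affine_chart_axioms.intro; (unfold same_space)?)
    show "sheaf_space P" by (rule E.sheaf_space_axioms)
    show "cring (sec P W)" by (rule h.R.is_cring)
    show "openin (under S) W" by (rule W)
    show "id \<in> ring_hom (sec P W) (sec P W)" by simp
    show "primeideal (vanishing P W (sec P W) id x) (sec P W)" if "x \<in> W" for x
      unfolding van[OF that] by (rule ring_hom_ring.primeideal_vimage[OF hr h.R.is_cring C.vanishing_prime[OF that]])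
  next
    show "inj_on (vanishing P W (sec P W) id) W"
    proof (rule inj_onI)
      fix x y assume xy: "x \<in> W" "y \<in> W" "vanishing P W (sec P W) id x = vanishing P W (sec P W) id y"
      have "vanishing S W (sec S W) id z = {b \<in> carrier (sec S W). \<sigma> W b \<in> vanishing P W (sec P W) id z}" if "z \<in> W" for z
        unfolding van[OF that] using ps[OF W] by (auto simp: vanishing_def)
      then have "vanishing S W (sec S W) id x = vanishing S W (sec S W) id y" using xy by simp
      then show "x = y" using C.vanishing_inj xy by (auto dest: inj_onD)
    qed
  next
    fix Q assume Q: "primeideal Q (sec P W)"
    interpret Q: primeideal Q "sec P W" by fact
    define Q' where "Q' = {b \<in> carrier (sec S W). \<sigma> W b \<in> Q}"
    have "primeideal Q' (sec S W)" unfolding Q'_def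
      by (rule ring_hom_ring.primeideal_vimage[OF sr B.sec_cring[OF W] Q])
    then obtain x where x: "x \<in> W" "Q' = vanishing S W (sec S W) id x" using C.vanishing_surj by blast
    \<comment> \<open>A section of square zero lies in every prime.\<close>
    have nilQ: "nil W e \<in> Q" if "e \<in> carrier (sec P W)" for e
      using Q.I_prime[of "nil W e" "nil W e"] nil[OF W that] aug_sqz[OF W, of "nil W e" "nil W e"] Q.zero_closed by auto
    have mem: "e \<in> Q \<longleftrightarrow> \<sigma> W (\<pi> W e) \<in> Q" if e: "e \<in> carrier (sec P W)" for e
    proof
      assume "\<sigma> W (\<pi> W e) \<in> Q"
      then show "e \<in> Q" using Q.a_closed[OF _ nilQ[OF e]] nil(3)[OF W e] by metis
    next
      assume eQ: "e \<in> Q"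
      have "\<sigma> W (\<pi> W e) = e \<ominus>\<^bsub>sec P W\<^esub> nil W e"
        using e sc[OF W aug_closed[OF W e]] by (simp add: nil_def h.R.minus_eq h.R.minus_add h.R.a_assoc[symmetric] h.R.r_neg)
      then show "\<sigma> W (\<pi> W e) \<in> Q" using Q.a_closed[OF eQ Q.a_inv_closed[OF nilQ[OF e]]] by (simp add: h.R.minus_eq)
    qed
    have "Q = vanishing P W (sec P W) id x"
    proof (intro equalityI subsetI)
      fix e assume eQ: "e \<in> Q"
      then have "e \<in> carrier (sec P W)" by (rule Q.Icarr)
      moreover from this have "\<sigma> W (\<pi> W e) \<in> Q" using mem eQ by blast
      ultimately show "e \<in> vanishing P W (sec P W) id x"
        unfolding van[OF x(1)] x(2)[symmetric] Q'_def using aug_closed[OF W] by simp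
    next
      fix e assume "e \<in> vanishing P W (sec P W) id x"
      then show "e \<in> Q" unfolding van[OF x(1)] x(2)[symmetric] Q'_def using mem by simp
    qed
    then show "\<exists>x\<in>W. Q = vanishing P W (sec P W) id x" using x by blast
  next
    fix V x assume V: "openin (under S) V" "V \<subseteq> W" "x \<in> V"
    obtain f where "f \<in> carrier (sec S W)" "x \<in> B.D W f" "B.D W f \<subseteq> V" using C.basis[OF V] by auto
    then show "\<exists>f\<in>carrier (sec P W). x \<in> E.D W (id f) \<and> E.D W (id f) \<subseteq> V"
      using Ds sc[OF W] by (intro bexI[of _ "\<sigma> W f"]) auto
  next
    fix V x e assume V: "openin (under S) V" "V \<subseteq> W" "x \<in> V" and e: "e \<in> carrier (sec P W)"
      and z: "res P W V (id e) = \<zero>\<^bsub>sec P V\<^esub>"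
    have xW: "x \<in> W" using V by blast
    have pz: "res S W V (\<pi> W e) = \<zero>\<^bsub>sec S V\<^esub>"
      using aug_res[OF W V(1,2) e] z ring_hom_zero[OF aug_hom[OF V(1)]] B.sec_ring[OF V(1)] E.sec_ring[of V] V(1) by simp
    obtain k where k: "k \<in> carrier (sec S W)" "x \<in> B.D W k" "k \<otimes>\<^bsub>sec S W\<^esub> \<pi> W e = \<zero>\<^bsub>sec S W\<^esub>"
      using C.locally_zero[OF V, of "\<pi> W e"] pz e by auto
    interpret V: cring "sec P V" using V(1) E.sec_cring by simp
    have sz: "\<sigma> V \<zero>\<^bsub>sec S V\<^esub> = \<zero>\<^bsub>sec P V\<^esub>"
      using ring_hom_zero[OF s_hom[OF V(1)]] B.sec_ring[OF V(1)] E.sec_ring[of V] V(1) by simp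
    have "res P W V (nil W e) = \<zero>\<^bsub>sec P V\<^esub>"
      using E.res_minus(1)[of W V e "\<sigma> W (\<pi> W e)"] W V e z sc[OF W aug_closed[OF W e]] s_res[OF W V(1,2) aug_closed[OF W e]] pz sz
      by (simp add: nil_def V.minus_eq)
    then obtain l where l: "l \<in> carrier (sec S W)" "germ_unit S x W l" "\<sigma> W l \<otimes>\<^bsub>sec P W\<^esub> nil W e = \<zero>\<^bsub>sec P W\<^esub>"
      using Na[OF V nil(1,2)[OF W e]] by blast
    \<comment> \<open>\<open>k\<close> annihilates the component in \<open>S\<close> and
      \<open>l\<close> the component in the kernel; the product annihilates both.\<close>
    define h where "h = \<sigma> W (k \<otimes>\<^bsub>sec S W\<^esub> l)"
    have hc: "h \<in> carrier (sec P W)" using k l by (simp add: h_def)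
    have c: "\<sigma> W k \<in> carrier (sec P W)" "\<sigma> W l \<in> carrier (sec P W)" "nil W e \<in> carrier (sec P W)"
      "\<sigma> W (\<pi> W e) \<in> carrier (sec P W)"
      using k l nil[OF W e] e by auto
    have "h \<otimes>\<^bsub>sec P W\<^esub> e = h \<otimes>\<^bsub>sec P W\<^esub> (\<sigma> W (\<pi> W e) \<oplus>\<^bsub>sec P W\<^esub> nil W e)"
      using nil(3)[OF W e] by simp
    also have "\<dots> = \<sigma> W l \<otimes>\<^bsub>sec P W\<^esub> \<sigma> W (k \<otimes>\<^bsub>sec S W\<^esub> \<pi> W e) \<oplus>\<^bsub>sec P W\<^esub> \<sigma> W k \<otimes>\<^bsub>sec P W\<^esub> (\<sigma> W l \<otimes>\<^bsub>sec P W\<^esub> nil W e)"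
      unfolding h_def using k(1) l(1) c e by (simp add: h.R.r_distr h.R.m_ac)
    also have "\<dots> = \<zero>\<^bsub>sec P W\<^esub>" unfolding k(3) l(3) using c by simp
    finally have "h \<otimes>\<^bsub>sec P W\<^esub> e = \<zero>\<^bsub>sec P W\<^esub>" .
    moreover have "x \<in> E.D W h"
      unfolding h_def using Ds[of "k \<otimes>\<^bsub>sec S W\<^esub> l"] k l xW by (simp add: B.D_mult[OF W]) (simp add: B.D_def)
    ultimately show "\<exists>h\<in>carrier (sec P W). x \<in> E.D W (id h) \<and> h \<otimes>\<^bsub>sec P W\<^esub> e = \<zero>\<^bsub>sec P W\<^esub>"
      using hc by auto
  next
    fix V x t assume V: "openin (under S) V" "V \<subseteq> W" "x \<in> V" and t: "t \<in> carrier (sec P V)"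
    have xW: "x \<in> W" using V by blast
    obtain Y1 a1 f1 where 1: "openin (under S) Y1" "x \<in> Y1" "Y1 \<subseteq> V" "a1 \<in> carrier (sec S W)" "f1 \<in> carrier (sec S W)"
      "x \<in> B.D W f1" "res S W Y1 f1 \<otimes>\<^bsub>sec S Y1\<^esub> res S V Y1 (\<pi> V t) = res S W Y1 a1"
      using C.locally_fraction[OF V aug_closed[OF V(1) t]] by auto
    obtain Y2 f2 m where 2: "openin (under S) Y2" "x \<in> Y2" "Y2 \<subseteq> V" "f2 \<in> carrier (sec S W)" "germ_unit S x W f2"
      "m \<in> carrier (sec P W)" "\<pi> W m = \<zero>\<^bsub>sec S W\<^esub>"
      "res P W Y2 (\<sigma> W f2) \<otimes>\<^bsub>sec P Y2\<^esub> res P V Y2 (nil V t) = res P W Y2 m"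
      using Nb[OF V nil(1,2)[OF V(1) t]] by blast
    let ?Y = "Y1 \<inter> Y2"
    have Y: "openin (under S) ?Y" "?Y \<subseteq> V" "?Y \<subseteq> W" "x \<in> ?Y" using 1 2 V by auto
    have Y12: "?Y \<subseteq> Y1" "?Y \<subseteq> Y2" "Y1 \<subseteq> W" "Y2 \<subseteq> W" using 1 2 V by auto
    interpret Y: cring "sec P ?Y" using Y(1) E.sec_cring by simp
    have pt: "\<pi> V t \<in> carrier (sec S V)" using aug_closed[OF V(1) t] .
    have r1: "res S Y1 ?Y (res S W Y1 f1 \<otimes>\<^bsub>sec S Y1\<^esub> res S V Y1 (\<pi> V t)) = res S W ?Y f1 \<otimes>\<^bsub>sec S ?Y\<^esub> res S V ?Y (\<pi> V t)"
      using B.res_mult[OF 1(1) Y(1) Y12(1)] B.res_res[OF W 1(1) Y(1) Y12(1,3) 1(5)] B.res_res[OF V(1) 1(1) Y(1) Y12(1) 1(3) pt]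
        B.res_closed[OF W 1(1) Y12(3) 1(5)] B.res_closed[OF V(1) 1(1,3) pt] by simp
    have e1: "res S W ?Y f1 \<otimes>\<^bsub>sec S ?Y\<^esub> res S V ?Y (\<pi> V t) = res S W ?Y a1"
      using r1 1(7) B.res_res[OF W 1(1) Y(1) Y12(1,3) 1(4)] by simp
    have s2: "\<sigma> W f2 \<in> carrier (sec P W)" using sc[OF W 2(4)] .
    have nc: "nil V t \<in> carrier (sec P V)" using nil[OF V(1) t] by simp
    have r2: "res P Y2 ?Y (res P W Y2 (\<sigma> W f2) \<otimes>\<^bsub>sec P Y2\<^esub> res P V Y2 (nil V t)) = res P W ?Y (\<sigma> W f2) \<otimes>\<^bsub>sec P ?Y\<^esub> res P V ?Y (nil V t)"
      using E.res_mult[of Y2 ?Y] E.res_res[of W Y2 ?Y "\<sigma> W f2"] E.res_res[of V Y2 ?Y "nil V t"]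
        E.res_closed[of W Y2 "\<sigma> W f2"] E.res_closed[of V Y2 "nil V t"] W V 2(1-7) Y Y12 s2 nc by simp
    have e2: "res P W ?Y (\<sigma> W f2) \<otimes>\<^bsub>sec P ?Y\<^esub> res P V ?Y (nil V t) = res P W ?Y m"
      using r2 2(8) E.res_res[of W Y2 ?Y m] W 2(1-7) Y Y12 by simp
    have sY: "\<sigma> ?Y (res S W ?Y b) = res P W ?Y (\<sigma> W b)" if "b \<in> carrier (sec S W)" for b
      using s_res[OF W Y(1,3) that] by simp
    \<comment> \<open>The common denominator of the two components: from \<open>f1 T = a1\<close>
      and \<open>f2 N = m\<close> follows \<open>f1 f2 (T + N) = f2 a1 + f1 m\<close>.\<close>
    define f where "f = \<sigma> W (f1 \<otimes>\<^bsub>sec S W\<^esub> f2)"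
    define a where "a = \<sigma> W (f2 \<otimes>\<^bsub>sec S W\<^esub> a1) \<oplus>\<^bsub>sec P W\<^esub> \<sigma> W f1 \<otimes>\<^bsub>sec P W\<^esub> m"
    have fa: "f \<in> carrier (sec P W)" "a \<in> carrier (sec P W)" using 1 2 by (auto simp: f_def a_def)
    define F1 F2 T N where FT: "F1 = res P W ?Y (\<sigma> W f1)" "F2 = res P W ?Y (\<sigma> W f2)"
      "T = res P V ?Y (\<sigma> V (\<pi> V t))" "N = res P V ?Y (nil V t)"
    have stc: "\<sigma> V (\<pi> V t) \<in> carrier (sec P V)" using sc[OF V(1) pt] .
    have c: "F1 \<in> carrier (sec P ?Y)" "F2 \<in> carrier (sec P ?Y)" "T \<in> carrier (sec P ?Y)" "N \<in> carrier (sec P ?Y)"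
      unfolding FT using E.res_closed[of W ?Y] E.res_closed[of V ?Y] W V Y 1 2 stc nc by auto
    have tY: "res P V ?Y t = T \<oplus>\<^bsub>sec P ?Y\<^esub> N"
      unfolding FT using E.res_add[of V ?Y "\<sigma> V (\<pi> V t)" "nil V t"] nil(3)[OF V(1) t] V Y stc nc by simp
    have f1T: "F1 \<otimes>\<^bsub>sec P ?Y\<^esub> T = res P W ?Y (\<sigma> W a1)"
    proof -
      have "F1 \<otimes>\<^bsub>sec P ?Y\<^esub> T = \<sigma> ?Y (res S W ?Y f1) \<otimes>\<^bsub>sec P ?Y\<^esub> \<sigma> ?Y (res S V ?Y (\<pi> V t))"
        unfolding FT using sY[OF 1(5)] s_res[OF V(1) Y(1,2) pt] by simp
      also have "\<dots> = \<sigma> ?Y (res S W ?Y f1 \<otimes>\<^bsub>sec S ?Y\<^esub> res S V ?Y (\<pi> V t))"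
        using ring_hom_mult[OF s_hom[OF Y(1)]] B.res_closed[OF W Y(1,3) 1(5)] B.res_closed[OF V(1) Y(1,2) pt] by simp
      finally show ?thesis unfolding e1 using sY[OF 1(4)] by simp
    qed
    have "res P W ?Y f = F1 \<otimes>\<^bsub>sec P ?Y\<^esub> F2"
      unfolding f_def FT using E.res_mult[of W ?Y "\<sigma> W f1" "\<sigma> W f2"] W Y 1 2 by simp
    then have "res P W ?Y f \<otimes>\<^bsub>sec P ?Y\<^esub> res P V ?Y t = F2 \<otimes>\<^bsub>sec P ?Y\<^esub> (F1 \<otimes>\<^bsub>sec P ?Y\<^esub> T) \<oplus>\<^bsub>sec P ?Y\<^esub> F1 \<otimes>\<^bsub>sec P ?Y\<^esub> (F2 \<otimes>\<^bsub>sec P ?Y\<^esub> N)"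
      using c tY by (simp add: Y.r_distr Y.m_ac)
    also have "\<dots> = F2 \<otimes>\<^bsub>sec P ?Y\<^esub> res P W ?Y (\<sigma> W a1) \<oplus>\<^bsub>sec P ?Y\<^esub> F1 \<otimes>\<^bsub>sec P ?Y\<^esub> res P W ?Y m"
      using f1T e2 unfolding FT by simp
    also have "\<dots> = res P W ?Y a"
      unfolding a_def FT using E.res_mult[of W ?Y] E.res_add[of W ?Y] W Y 1 2 by simp
    finally have main: "res P W ?Y f \<otimes>\<^bsub>sec P ?Y\<^esub> res P V ?Y t = res P W ?Y a" .
    have "x \<in> E.D W f"
      unfolding f_def using Ds[of "f1 \<otimes>\<^bsub>sec S W\<^esub> f2"] 1 2 xW by (simp add: B.D_mult[OF W]) (simp add: B.D_def)
    then show "\<exists>Y a f. openin (under S) Y \<and> x \<in> Y \<and> Y \<subseteq> V \<and> a \<in> carrier (sec P W) \<and> f \<in> carrier (sec P W) \<and>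
       x \<in> E.D W (id f) \<and> res P W Y (id f) \<otimes>\<^bsub>sec P Y\<^esub> res P V Y t = res P W Y (id a)"
      using Y fa main by (intro exI[of _ ?Y] exI[of _ a] exI[of _ f]) auto
  qed
qed

end

section \<open>Square zero immersions\<close>

lemma ringed_spaceI:
  assumes "\<And>U. openin (under X) U \<Longrightarrow> cring (sec X U)"
    and "\<And>U V. openin (under X) U \<Longrightarrow> openin (under X) V \<Longrightarrow> V \<subseteq> U \<Longrightarrow> res X U V \<in> ring_hom (sec X U) (sec X V)"
    and "\<And>U s. openin (under X) U \<Longrightarrow> s \<in> carrier (sec X U) \<Longrightarrow> res X U U s = s"
    and "\<And>U V W s. openin (under X) U \<Longrightarrow> openin (under X) V \<Longrightarrow> openin (under X) W \<Longrightarrow> W \<subseteq> V \<Longrightarrow> V \<subseteq> U \<Longrightarrow>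
      s \<in> carrier (sec X U) \<Longrightarrow> res X V W (res X U V s) = res X U W s"
    and "\<And>\<V> s t. \<V> \<subseteq> opens X \<Longrightarrow> s \<in> carrier (sec X (\<Union>\<V>)) \<Longrightarrow> t \<in> carrier (sec X (\<Union>\<V>)) \<Longrightarrow>
      (\<And>V. V \<in> \<V> \<Longrightarrow> res X (\<Union>\<V>) V s = res X (\<Union>\<V>) V t) \<Longrightarrow> s = t"
    and "\<And>\<V> s. \<V> \<subseteq> opens X \<Longrightarrow> (\<And>V. V \<in> \<V> \<Longrightarrow> s V \<in> carrier (sec X V)) \<Longrightarrow>
      (\<And>V W. V \<in> \<V> \<Longrightarrow> W \<in> \<V> \<Longrightarrow> res X V (V \<inter> W) (s V) = res X W (V \<inter> W) (s W)) \<Longrightarrow>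
      \<exists>t\<in>carrier (sec X (\<Union>\<V>)). \<forall>V\<in>\<V>. res X (\<Union>\<V>) V t = s V"
  shows "ringed_space X"
  unfolding ringed_space_def
proof (intro conjI)
  show "\<forall>\<V>\<subseteq>opens X. \<forall>s\<in>carrier (sec X (\<Union>\<V>)). \<forall>t\<in>carrier (sec X (\<Union>\<V>)).
        (\<forall>V\<in>\<V>. res X (\<Union>\<V>) V s = res X (\<Union>\<V>) V t) \<longrightarrow> s = t"
    using assms(5) by metis
  show "\<forall>\<V>\<subseteq>opens X. \<forall>s. (\<forall>V\<in>\<V>. s V \<in> carrier (sec X V)) \<and>
        (\<forall>V\<in>\<V>. \<forall>W\<in>\<V>. res X V (V \<inter> W) (s V) = res X W (V \<inter> W) (s W)) \<longrightarrow>
        (\<exists>t\<in>carrier (sec X (\<Union>\<V>)). \<forall>V\<in>\<V>. res X (\<Union>\<V>) V t = s V)"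
    by (intro allI impI assms(6)) auto
qed (use assms(1-4) in auto)

context sheaf_space
begin

lemma separated_cover:
  assumes "\<V> \<subseteq> opens X" "s \<in> carrier (sec X (\<Union>\<V>))" "t \<in> carrier (sec X (\<Union>\<V>))"
    "\<And>V. V \<in> \<V> \<Longrightarrow> res X (\<Union>\<V>) V s = res X (\<Union>\<V>) V t"
  shows "s = t"
proof (rule separated)
  show "openin (under X) (\<Union>\<V>)" using assms(1) by (intro openin_Union) auto
  show "\<exists>V. openin (under X) V \<and> x \<in> V \<and> V \<subseteq> \<Union>\<V> \<and> res X (\<Union>\<V>) V s = res X (\<Union>\<V>) V t" if "x \<in> \<Union>\<V>" for x
    using that assms(1,4) by blast
qed (use assms in auto)

lemma glue_cover:
  assumes "\<V> \<subseteq> opens X" "\<And>V. V \<in> \<V> \<Longrightarrow> s V \<in> carrier (sec X V)"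
    "\<And>V W. V \<in> \<V> \<Longrightarrow> W \<in> \<V> \<Longrightarrow> res X V (V \<inter> W) (s V) = res X W (V \<inter> W) (s W)"
  shows "\<exists>t\<in>carrier (sec X (\<Union>\<V>)). \<forall>V\<in>\<V>. res X (\<Union>\<V>) V t = s V"
proof -
  have "\<exists>t\<in>carrier (sec X (\<Union>\<V>)). \<forall>V s'. (V \<in> \<V> \<and> s' = s V) \<longrightarrow> res X (\<Union>\<V>) V t = s'"
    by (rule glue) (use assms in \<open>auto intro!: openin_Union\<close>)
  then show ?thesis by blast
qed

end

text \<open>The inverse image of the structure sheaf of \<open>T\<close> on the space of
  \<open>S\<close>. Its sections can be taken over images because \<open>i\<close> turns out to be a
  homeomorphism.\<close>

definition pulled :: "('p, 's) ringed \<Rightarrow> ('q, 'r) ringed \<Rightarrow> ('p, 's, 'q, 'r) morph \<Rightarrow> ('p, 'r) ringed" where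
  "pulled S T i = \<lparr>under = under S, sec = (\<lambda>U. sec T (ptf i ` U)), res = (\<lambda>U V. res T (ptf i ` U) (ptf i ` V))\<rparr>"

lemma pulled_simps [simp]:
  "under (pulled S T i) = under S"
  "sec (pulled S T i) U = sec T (ptf i ` U)"
  "res (pulled S T i) U V = res T (ptf i ` U) (ptf i ` V)"
  by (simp_all add: pulled_def)

lemma ideal_sections_iff: "a \<in> ideal_sections X Y f V \<longleftrightarrow> a \<in> carrier (sec Y V) \<and> shf f V a = \<zero>\<^bsub>sec X (preim X f V)\<^esub>"
  by (auto simp: ideal_sections_def a_kernel_def kernel_def)

lemma scheme_sheaf: "scheme X \<Longrightarrow> sheaf_space X"
  by (simp add: scheme_def sheaf_space_def)

lemma scheme_chart:
  assumes "scheme X" "x \<in> pts X"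
  obtains U where "x \<in> U" "affine_chart X U (sec X U) id"
  using assms sheaf_space.affine_open_chart[OF scheme_sheaf[OF assms(1)]] unfolding scheme_def by blast

locale thickening =
  fixes S :: "('p, 's) ringed" and T :: "('q, 'r) ringed" and i :: "('p, 's, 'q, 'r) morph"
  assumes immersion: "square_zero_immersion S T i"
begin

lemma schemes: "scheme S" "scheme T"
  using immersion by (simp_all add: square_zero_immersion_def closed_immersion_def)

lemma morph: "ringed_morphism S T i"
  using immersion by (simp add: square_zero_immersion_def closed_immersion_def scheme_morphism_def)

end

sublocale thickening \<subseteq> S: sheaf_space S using scheme_sheaf[OF schemes(1)] .
sublocale thickening \<subseteq> T: sheaf_space T using scheme_sheaf[OF schemes(2)] .

context thickening
begin

lemma emb: "embedding_map (under S) (under T) (ptf i)"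
  using immersion by (simp add: square_zero_immersion_def closed_immersion_def)

lemma inj: "inj_on (ptf i) (pts S)"
  using emb by (simp add: embedding_map_def homeomorphic_map_def)

lemma maps: "x \<in> pts S \<Longrightarrow> ptf i x \<in> pts T"
  using morph unfolding ringed_morphism_def continuous_map_def by blast

lemma preim_image: "U \<subseteq> pts S \<Longrightarrow> preim S i (ptf i ` U) = U"
  using inj by (auto simp: preim_def inj_on_def)

lemma image_int: "U \<subseteq> pts S \<Longrightarrow> V \<subseteq> pts S \<Longrightarrow> ptf i ` (U \<inter> V) = ptf i ` U \<inter> ptf i ` V"
  by (rule inj_on_image_Int[OF inj])

lemma image_subset_iff: "U \<subseteq> pts S \<Longrightarrow> V \<subseteq> pts S \<Longrightarrow> ptf i ` V \<subseteq> ptf i ` U \<longleftrightarrow> V \<subseteq> U"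
  using inj_on_image_mem_iff[OF inj, of _ U] by blast

text \<open>Outside the closed image every section lies in the ideal, so
  \<open>1 = 1 * 1 = 0\<close> there. In an affine chart of \<open>T\<close> this would force a
  section that is nonvanishing at the point to be zero.\<close>

lemma surj: "ptf i ` pts S = pts T"
proof (rule ccontr)
  assume "\<not> ?thesis"
  then obtain y where y: "y \<in> pts T" "y \<notin> ptf i ` pts S" using maps by blast
  have cl: "closedin (under T) (ptf i ` pts S)"
    using immersion by (simp add: square_zero_immersion_def closed_immersion_def)
  obtain U where U: "y \<in> U" "affine_chart T U (sec T U) id" using scheme_chart[OF schemes(2) y(1)] .
  interpret C: affine_chart T U "sec T U" id by (rule U(2))
  let ?V = "(pts T - ptf i ` pts S) \<inter> U"
  have V: "openin (under T) ?V" using cl C.open_chart by (intro openin_Int) (auto simp: closedin_def)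
  have pV: "preim S i ?V = {}" by (auto simp: preim_def)
  interpret V: cring "sec T ?V" using V by (rule T.sec_cring)
  have hom: "shf i ?V \<in> ring_hom (sec T ?V) (sec S {})"
    using morph V pV unfolding ringed_morphism_def by auto
  interpret E: cring "sec S {}" by (rule S.sec_cring) simp
  \<comment> \<open>The preimage is empty, and over the empty set all sections coincide.\<close>
  have "shf i ?V \<one>\<^bsub>sec T ?V\<^esub> = \<zero>\<^bsub>sec S {}\<^esub>"
    using ring_hom_closed[OF hom V.one_closed] by (intro S.separated[of "{}"]) auto
  then have "\<one>\<^bsub>sec T ?V\<^esub> \<in> ideal_sections S T i ?V"
    unfolding ideal_sections_iff pV by simp
  then have "\<one>\<^bsub>sec T ?V\<^esub> \<otimes>\<^bsub>sec T ?V\<^esub> \<one>\<^bsub>sec T ?V\<^esub> = \<zero>\<^bsub>sec T ?V\<^esub>"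
    using immersion V unfolding square_zero_immersion_def by blast
  then have "res T U ?V (id \<one>\<^bsub>sec T U\<^esub>) = \<zero>\<^bsub>sec T ?V\<^esub>"
    using T.res_one[OF C.open_chart V] by simp
  then obtain h where h: "h \<in> carrier (sec T U)" "y \<in> T.D U (id h)" "h \<otimes>\<^bsub>sec T U\<^esub> \<one>\<^bsub>sec T U\<^esub> = \<zero>\<^bsub>sec T U\<^esub>"
    using C.locally_zero[OF V, of y "\<one>\<^bsub>sec T U\<^esub>"] y U by auto
  then show False using C.D_psi_zero by simp
qed

lemma homeo: "homeomorphic_map (under S) (under T) (ptf i)"
  using emb unfolding embedding_map_def surj by simp

lemma open_image: "openin (under S) U \<Longrightarrow> openin (under T) (ptf i ` U)"
  using homeomorphic_map_openness[OF homeo] openin_subset by blast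

lemma open_image_iff: "U \<subseteq> pts S \<Longrightarrow> openin (under T) (ptf i ` U) \<longleftrightarrow> openin (under S) U"
  using homeomorphic_map_openness[OF homeo] by blast

lemma image_preim: "V \<subseteq> pts T \<Longrightarrow> ptf i ` preim S i V = V"
  using surj by (auto simp: preim_def)

lemma open_preim: "openin (under T) V \<Longrightarrow> openin (under S) (preim S i V)"
  using open_image_iff[of "preim S i V"] image_preim[OF openin_subset, of V] by (auto simp: preim_def)

lemma open_cases:
  assumes "openin (under T) V"
  obtains U where "openin (under S) U" "V = ptf i ` U" "preim S i V = U"
  using that[of "preim S i V"] open_preim[OF assms] image_preim[OF openin_subset[OF assms]] by simp

lemma sub: "openin (under S) U \<Longrightarrow> U \<subseteq> pts S"
  by (rule openin_subset)

lemma pulled_ringed: "ringed_space (pulled S T i)"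
proof (rule ringed_spaceI; unfold pulled_simps)
  note o = open_image
  show "cring (sec T (ptf i ` U))" if "openin (under S) U" for U using that o T.sec_cring by blast
  show "res T (ptf i ` U) (ptf i ` V) \<in> ring_hom (sec T (ptf i ` U)) (sec T (ptf i ` V))"
    if "openin (under S) U" "openin (under S) V" "V \<subseteq> U" for U V
    using that o by (intro T.res_hom) auto
  show "res T (ptf i ` U) (ptf i ` U) s = s" if "openin (under S) U" "s \<in> carrier (sec T (ptf i ` U))" for U s
    using that o by (intro T.res_id) auto
  show "res T (ptf i ` V) (ptf i ` W) (res T (ptf i ` U) (ptf i ` V) s) = res T (ptf i ` U) (ptf i ` W) s"
    if "openin (under S) U" "openin (under S) V" "openin (under S) W" "W \<subseteq> V" "V \<subseteq> U" "s \<in> carrier (sec T (ptf i ` U))" for U V W s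
    using that o by (intro T.res_res) auto
next
  fix \<V> s t assume V: "\<V> \<subseteq> opens S" and s: "s \<in> carrier (sec T (ptf i ` \<Union>\<V>))"
    and t: "t \<in> carrier (sec T (ptf i ` \<Union>\<V>))"
    and eq: "\<And>V. V \<in> \<V> \<Longrightarrow> res T (ptf i ` \<Union>\<V>) (ptf i ` V) s = res T (ptf i ` \<Union>\<V>) (ptf i ` V) t"
  show "s = t"
  proof (rule T.separated_cover[of "(`) (ptf i) ` \<V>"])
    show "(`) (ptf i) ` \<V> \<subseteq> opens T" using V open_image by auto
  qed (use s t eq in \<open>auto simp flip: image_Union\<close>)
next
  fix \<V> s assume V: "\<V> \<subseteq> opens S" and s: "\<And>V. V \<in> \<V> \<Longrightarrow> s V \<in> carrier (sec T (ptf i ` V))"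
    and eq: "\<And>V W. V \<in> \<V> \<Longrightarrow> W \<in> \<V> \<Longrightarrow>
      res T (ptf i ` V) (ptf i ` (V \<inter> W)) (s V) = res T (ptf i ` W) (ptf i ` (V \<inter> W)) (s W)"
  have sb: "V \<subseteq> pts S" if "V \<in> \<V>" for V using V that openin_subset by auto
  have "\<exists>t\<in>carrier (sec T (\<Union>((`) (ptf i) ` \<V>))). \<forall>Y\<in>(`) (ptf i) ` \<V>. res T (\<Union>((`) (ptf i) ` \<V>)) Y t = s (preim S i Y)"
  proof (rule T.glue_cover)
    show "(`) (ptf i) ` \<V> \<subseteq> opens T" using V open_image by auto
    show "s (preim S i Y) \<in> carrier (sec T Y)" if "Y \<in> (`) (ptf i) ` \<V>" for Y
      using that s sb preim_image by auto
    show "res T Y (Y \<inter> Z) (s (preim S i Y)) = res T Z (Y \<inter> Z) (s (preim S i Z))"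
      if "Y \<in> (`) (ptf i) ` \<V>" "Z \<in> (`) (ptf i) ` \<V>" for Y Z
      using that eq sb preim_image image_int by auto
  qed
  then show "\<exists>t\<in>carrier (sec T (ptf i ` \<Union>\<V>)). \<forall>V\<in>\<V>. res T (ptf i ` \<Union>\<V>) (ptf i ` V) t = s V"
    using preim_image sb by (auto simp: image_Union)
qed

lemma shf_hom: "openin (under S) U \<Longrightarrow> shf i (ptf i ` U) \<in> ring_hom (sec T (ptf i ` U)) (sec S U)"
  using morph open_image[of U] preim_image[OF sub, of U] unfolding ringed_morphism_def by auto

lemma shf_res:
  assumes "openin (under S) U" "openin (under S) V" "V \<subseteq> U" "a \<in> carrier (sec T (ptf i ` U))"
  shows "shf i (ptf i ` V) (res T (ptf i ` U) (ptf i ` V) a) = res S U V (shf i (ptf i ` U) a)"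
proof -
  have "res S (preim S i (ptf i ` U)) (preim S i (ptf i ` V)) (shf i (ptf i ` U) a) =
    shf i (ptf i ` V) (res T (ptf i ` U) (ptf i ` V) a)"
    using morph open_image[OF assms(1)] open_image[OF assms(2)] image_mono[OF assms(3)] assms(4)
    unfolding ringed_morphism_def by blast
  then show ?thesis using preim_image sub assms by simp
qed

text \<open>Local lifts are the last clause of \<open>closed_immersion\<close>, carried along the
  homeomorphism.\<close>

lemma pulled_augmentation: "augmentation S (pulled S T i) (\<lambda>U. shf i (ptf i ` U))"
proof (intro augmentation.intro augmentation_axioms.intro S.sheaf_space_axioms sheaf_space.intro pulled_ringed; (unfold pulled_simps)?)
  fix U b x assume U: "openin (under S) U" and b: "b \<in> carrier (sec S U)" and x: "x \<in> U"
  have "\<exists>W u. openin (under T) W \<and> ptf i x \<in> W \<and> W \<subseteq> ptf i ` U \<and> u \<in> carrier (sec T W) \<and>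
      shf i W u = res S (preim S i (ptf i ` U)) (preim S i W) b"
  proof -
    have "\<forall>V\<in>opens T. \<forall>s\<in>carrier (sec S (preim S i V)). \<forall>y\<in>V.
        \<exists>W u. openin (under T) W \<and> y \<in> W \<and> W \<subseteq> V \<and> u \<in> carrier (sec T W) \<and>
              shf i W u = res S (preim S i V) (preim S i W) s"
      using immersion by (simp add: square_zero_immersion_def closed_immersion_def)
    moreover have "ptf i ` U \<in> opens T" "b \<in> carrier (sec S (preim S i (ptf i ` U)))" "ptf i x \<in> ptf i ` U"
      using U b x open_image preim_image[OF sub[OF U]] by auto
    ultimately show ?thesis by blast
  qed
  then obtain W u where W: "openin (under T) W" "ptf i x \<in> W" "W \<subseteq> ptf i ` U" "u \<in> carrier (sec T W)"
    "shf i W u = res S U (preim S i W) b" using preim_image[OF sub[OF U]] by auto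
  obtain V where V: "openin (under S) V" "W = ptf i ` V" "preim S i W = V" using open_cases[OF W(1)] .
  have VU: "V \<subseteq> U" using W(3) V image_subset_iff[OF sub[OF U] sub[OF V(1)]] by simp
  have "x \<in> V" using W(2) V(3) x sub[OF U] by (auto simp: preim_def)
  then show "\<exists>V u. openin (under S) V \<and> x \<in> V \<and> V \<subseteq> U \<and> u \<in> carrier (sec T (ptf i ` V)) \<and> shf i (ptf i ` V) u = res S U V b"
    using W V VU by (intro exI[of _ V] exI[of _ u]) simp
next
  fix U c d assume U: "openin (under S) U" and "c \<in> carrier (sec T (ptf i ` U))" "d \<in> carrier (sec T (ptf i ` U))"
    "shf i (ptf i ` U) c = \<zero>\<^bsub>sec S U\<^esub>" "shf i (ptf i ` U) d = \<zero>\<^bsub>sec S U\<^esub>"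
  then have "c \<in> ideal_sections S T i (ptf i ` U)" "d \<in> ideal_sections S T i (ptf i ` U)"
    using preim_image[OF sub[OF U]] by (auto simp: ideal_sections_iff)
  then show "c \<otimes>\<^bsub>sec T (ptf i ` U)\<^esub> d = \<zero>\<^bsub>sec T (ptf i ` U)\<^esub>"
    using immersion open_image[OF U] unfolding square_zero_immersion_def by blast
qed (use shf_hom shf_res in auto)

lemma ideal_iff:
  "openin (under S) U \<Longrightarrow> a \<in> ideal_sections S T i (ptf i ` U) \<longleftrightarrow>
     a \<in> carrier (sec T (ptf i ` U)) \<and> shf i (ptf i ` U) a = \<zero>\<^bsub>sec S U\<^esub>"
  using preim_image[OF sub] by (simp add: ideal_sections_iff)

lemma germ_unit_pulled:
  assumes U: "openin (under S) U" and x: "x \<in> U"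
  shows "germ_unit (pulled S T i) x U a \<longleftrightarrow> germ_unit T (ptf i x) (ptf i ` U) a"
proof
  assume "germ_unit (pulled S T i) x U a"
  then obtain V where "openin (under S) V" "x \<in> V" "V \<subseteq> U" "res T (ptf i ` U) (ptf i ` V) a \<in> Units (sec T (ptf i ` V))"
    unfolding germ_unit_def by auto
  then show "germ_unit T (ptf i x) (ptf i ` U) a"
    unfolding germ_unit_def using open_image by (intro exI[of _ "ptf i ` V"]) auto
next
  assume "germ_unit T (ptf i x) (ptf i ` U) a"
  then obtain W where W: "openin (under T) W" "ptf i x \<in> W" "W \<subseteq> ptf i ` U" "res T (ptf i ` U) W a \<in> Units (sec T W)"
    unfolding germ_unit_def by auto
  obtain V where V: "openin (under S) V" "W = ptf i ` V" "preim S i W = V" using open_cases[OF W(1)] .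
  have "V \<subseteq> U" using W(3) V image_subset_iff[OF sub[OF U] sub[OF V(1)]] by simp
  moreover have "x \<in> V" using W(2) V(3) x sub[OF U] by (auto simp: preim_def)
  ultimately show "germ_unit (pulled S T i) x U a"
    unfolding germ_unit_def using V W by (intro exI[of _ V]) auto
qed

end

sublocale thickening \<subseteq> A: augmentation S "pulled S T i" "\<lambda>U. shf i (ptf i ` U)"
  by (rule pulled_augmentation)

context thickening
begin

lemma germ_unit_iff:
  assumes "openin (under S) U" "x \<in> U" "a \<in> carrier (sec T (ptf i ` U))"
  shows "germ_unit T (ptf i x) (ptf i ` U) a \<longleftrightarrow> germ_unit S x U (shf i (ptf i ` U) a)"
  using A.germ_unit_aug[OF assms(1,2)] assms germ_unit_pulled[OF assms(1,2)] by simp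

text \<open>Pure transport: points, germs and open subsets of \<open>U\<close> correspond under
  \<open>i\<close> to those of its image.\<close>

lemma pulled_chart:
  assumes "affine_chart T V (sec T V) id" and V: "V = ptf i ` U" and U: "openin (under S) U"
  shows "affine_chart (pulled S T i) U (sec (pulled S T i) U) id"
proof -
  interpret C: affine_chart T V "sec T V" id by fact
  have sU: "U \<subseteq> pts S" using sub[OF U] .
  have D: "A.E.D U s = {x \<in> U. ptf i x \<in> T.D V s}" for s
    using germ_unit_pulled[OF U] by (auto simp: A.E.D_def T.D_def V)
  have van: "vanishing (pulled S T i) U (sec (pulled S T i) U) id x = vanishing T V (sec T V) id (ptf i x)" if "x \<in> U" for x
    using germ_unit_pulled[OF U that] by (simp add: vanishing_def V)
  have im: "W \<subseteq> U \<Longrightarrow> openin (under S) W \<Longrightarrow> openin (under T) (ptf i ` W) \<and> ptf i ` W \<subseteq> V" for W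
    using open_image V by blast
  show ?thesis
  proof (intro affine_chart.intro affine_chart_axioms.intro A.E.sheaf_space_axioms; (unfold pulled_simps V[symmetric])?)
    show "cring (sec T V)" by (rule C.is_cring)
    show "openin (under S) U" by (rule U)
    show "id \<in> ring_hom (sec T V) (sec T V)" by simp
    show "primeideal (vanishing (pulled S T i) U (sec T V) id x) (sec T V)" if "x \<in> U" for x
      using C.vanishing_prime[of "ptf i x"] van[OF that] that by (simp add: V)
    show "inj_on (vanishing (pulled S T i) U (sec T V) id) U"
    proof (rule inj_onI)
      fix x y assume xy: "x \<in> U" "y \<in> U" "vanishing (pulled S T i) U (sec T V) id x = vanishing (pulled S T i) U (sec T V) id y"
      then have "ptf i x = ptf i y"
        using van[OF xy(1)] van[OF xy(2)] inj_onD[OF C.vanishing_inj, of "ptf i x" "ptf i y"] by (simp add: V)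
      then show "x = y" using inj_onD[OF inj] xy sU by blast
    qed
    show "\<exists>x\<in>U. P = vanishing (pulled S T i) U (sec T V) id x" if "primeideal P (sec T V)" for P
      using C.vanishing_surj[OF that] van by (auto simp: V)
  next
    fix W x assume W: "openin (under S) W" "W \<subseteq> U" "x \<in> W"
    obtain f where f: "f \<in> carrier (sec T V)" "ptf i x \<in> T.D V (id f)" "T.D V (id f) \<subseteq> ptf i ` W"
      using C.basis[of "ptf i ` W" "ptf i x"] im[OF W(2,1)] W(3) by blast
    have "A.E.D U (id f) \<subseteq> W"
    proof
      fix y assume y: "y \<in> A.E.D U (id f)"
      then have "ptf i y \<in> ptf i ` W" "y \<in> U" using f D by auto
      then show "y \<in> W" using inj_on_image_mem_iff[OF inj, of y W] sU W by blast
    qed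
    then show "\<exists>f\<in>carrier (sec T V). x \<in> A.E.D U (id f) \<and> A.E.D U (id f) \<subseteq> W"
      using f W D by (intro bexI[of _ f]) auto
  next
    fix W x s assume W: "openin (under S) W" "W \<subseteq> U" "x \<in> W" and s: "s \<in> carrier (sec T V)"
      and z: "res T V (ptf i ` W) (id s) = \<zero>\<^bsub>sec T (ptf i ` W)\<^esub>"
    then show "\<exists>h\<in>carrier (sec T V). x \<in> A.E.D U (id h) \<and> h \<otimes>\<^bsub>sec T V\<^esub> s = \<zero>\<^bsub>sec T V\<^esub>"
      using C.locally_zero[of "ptf i ` W" "ptf i x" s] im[OF W(2,1)] D by auto
  next
    fix W x t assume W: "openin (under S) W" "W \<subseteq> U" "x \<in> W" and t: "t \<in> carrier (sec T (ptf i ` W))"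
    obtain Y' a f where Y': "openin (under T) Y'" "ptf i x \<in> Y'" "Y' \<subseteq> ptf i ` W" "a \<in> carrier (sec T V)" "f \<in> carrier (sec T V)"
      "ptf i x \<in> T.D V (id f)" "res T V Y' (id f) \<otimes>\<^bsub>sec T Y'\<^esub> res T (ptf i ` W) Y' t = res T V Y' (id a)"
      using C.locally_fraction[of "ptf i ` W" "ptf i x" t] im[OF W(2,1)] W(3) t by blast
    obtain Y where Y: "openin (under S) Y" "Y' = ptf i ` Y" "preim S i Y' = Y" using open_cases[OF Y'(1)] .
    have "Y \<subseteq> W" using Y'(3) Y image_subset_iff[OF sub[OF W(1)] sub[OF Y(1)]] by simp
    moreover have "x \<in> Y" using Y'(2) Y(3) W sU by (auto simp: preim_def)
    ultimately show "\<exists>Y a f. openin (under S) Y \<and> x \<in> Y \<and> Y \<subseteq> W \<and> a \<in> carrier (sec T V) \<and> f \<in> carrier (sec T V) \<and>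
       x \<in> A.E.D U (id f) \<and> res T V (ptf i ` Y) (id f) \<otimes>\<^bsub>sec T (ptf i ` Y)\<^esub> res T (ptf i ` W) (ptf i ` Y) t = res T V (ptf i ` Y) (id a)"
      using Y Y' W D by (intro exI[of _ Y] exI[of _ a] exI[of _ f]) auto
  qed
qed

text \<open>Basic open sets of a chart of \<open>T\<close> inside a basic open set of a chart of \<open>S\<close> are basic open
  in both.\<close>

lemma common_chart:
  assumes x: "x \<in> pts S"
  obtains W where "x \<in> W" "affine_chart S W (sec S W) id"
    "affine_chart (pulled S T i) W (sec (pulled S T i) W) id"
proof -
  obtain U where U: "x \<in> U" "affine_chart S U (sec S U) id" using scheme_chart[OF schemes(1) x] .
  interpret U: affine_chart S U "sec S U" id by (rule U(2))
  obtain V' where V': "ptf i x \<in> V'" "affine_chart T V' (sec T V') id" using scheme_chart[OF schemes(2) maps[OF x]] .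
  obtain V where V: "openin (under S) V" "V' = ptf i ` V" "preim S i V' = V"
    using open_cases affine_chart.open_chart[OF V'(2)] by blast
  have xV: "x \<in> V" using V'(1) V(3) x by (auto simp: preim_def)
  interpret V: affine_chart "pulled S T i" V "sec (pulled S T i) V" id
    by (rule pulled_chart[OF V'(2) V(2,1)])
  obtain f where f: "f \<in> carrier (sec S U)" "x \<in> S.D U (id f)" "S.D U (id f) \<subseteq> U \<inter> V"
    using U.basis[of "U \<inter> V" x] U.open_chart V(1) U(1) xV by blast
  let ?F = "S.D U (id f)"
  have F: "openin (under S) ?F" "?F \<subseteq> V" "affine_chart S ?F (sec S ?F) id"
    using U.open_D[OF f(1)] f U.basic_open_chart[OF f(1)] by auto
  interpret F: affine_chart S ?F "sec S ?F" id by (rule F(3))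
  obtain g where g: "g \<in> carrier (sec T (ptf i ` V))" "x \<in> A.E.D V (id g)" "A.E.D V (id g) \<subseteq> ?F"
    using V.basis[of ?F x] F f by auto
  let ?W = "A.E.D V (id g)"
  \<comment> \<open>An equation for the same set inside the chart \<open>?F\<close> of
    \<open>S\<close>: by \<open>D_aug\<close> a section of \<open>T\<close> and its image in
    \<open>S\<close> have the same locus.\<close>
  define g' where "g' = res S V ?F (shf i (ptf i ` V) g)"
  have sg: "shf i (ptf i ` V) g \<in> carrier (sec S V)" using ring_hom_closed[OF shf_hom[OF V(1)] g(1)] .
  have g': "g' \<in> carrier (sec S ?F)" using S.res_closed[OF V(1) F(1,2) sg] by (simp add: g'_def)
  have "?W = S.D V (shf i (ptf i ` V) g)" using A.D_aug[OF V(1), of g] g(1) by simp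
  then have "?W = S.D ?F (id g')"
    using S.D_res[OF V(1) F(1,2) sg] g(3) by (simp add: g'_def Int_absorb2)
  then have "affine_chart S ?W (sec S ?W) id" using F.basic_open_chart[OF g'] by simp
  moreover have "affine_chart (pulled S T i) ?W (sec (pulled S T i) ?W) id"
    using V.basic_open_chart[of g] g(1) by simp
  ultimately show ?thesis using that g(2) by blast
qed

end

section \<open>The category of pointed schemes\<close>

text \<open>The point maps of morphisms of square zero immersions are forced, and morphisms correspond
  to homomorphisms of sheaves of augmented rings on \<open>S\<close>.\<close>

definition sheaf_hom :: "('p, 'r) ringed \<Rightarrow> ('p, 'r) pointed \<Rightarrow> ('p, 'r) pointed \<Rightarrow> ('p set \<Rightarrow> 'r \<Rightarrow> 'r) \<Rightarrow> bool" where
  "sheaf_hom S = (\<lambda>(T, i) (T', i') F.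
     (\<forall>U. openin (under S) U \<longrightarrow> F U \<in> ring_hom (sec T' (ptf i' ` U)) (sec T (ptf i ` U)) \<and>
        (\<forall>s\<in>carrier (sec T' (ptf i' ` U)). shf i (ptf i ` U) (F U s) = shf i' (ptf i' ` U) s)) \<and>
     (\<forall>U V. openin (under S) U \<longrightarrow> openin (under S) V \<longrightarrow> V \<subseteq> U \<longrightarrow>
        (\<forall>s\<in>carrier (sec T' (ptf i' ` U)).
          res T (ptf i ` U) (ptf i ` V) (F U s) = F V (res T' (ptf i' ` U) (ptf i' ` V) s))))"

lemma sheaf_homI:
  assumes "\<And>U. openin (under S) U \<Longrightarrow> F U \<in> ring_hom (sec T' (ptf i' ` U)) (sec T (ptf i ` U))"
    and "\<And>U s. openin (under S) U \<Longrightarrow> s \<in> carrier (sec T' (ptf i' ` U)) \<Longrightarrow>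
      shf i (ptf i ` U) (F U s) = shf i' (ptf i' ` U) s"
    and "\<And>U V s. openin (under S) U \<Longrightarrow> openin (under S) V \<Longrightarrow> V \<subseteq> U \<Longrightarrow> s \<in> carrier (sec T' (ptf i' ` U)) \<Longrightarrow>
      res T (ptf i ` U) (ptf i ` V) (F U s) = F V (res T' (ptf i' ` U) (ptf i' ` V) s)"
  shows "sheaf_hom S (T, i) (T', i') F"
  using assms by (simp add: sheaf_hom_def)

lemma sheaf_homD:
  assumes "sheaf_hom S (T, i) (T', i') F" "openin (under S) U"
  shows "F U \<in> ring_hom (sec T' (ptf i' ` U)) (sec T (ptf i ` U))"
    "s \<in> carrier (sec T' (ptf i' ` U)) \<Longrightarrow> F U s \<in> carrier (sec T (ptf i ` U))"
    "s \<in> carrier (sec T' (ptf i' ` U)) \<Longrightarrow> shf i (ptf i ` U) (F U s) = shf i' (ptf i' ` U) s"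
    "openin (under S) V \<Longrightarrow> V \<subseteq> U \<Longrightarrow> s \<in> carrier (sec T' (ptf i' ` U)) \<Longrightarrow>
      res T (ptf i ` U) (ptf i ` V) (F U s) = F V (res T' (ptf i' ` U) (ptf i' ` V) s)"
  using assms ring_hom_closed[of "F U"] by (auto simp: sheaf_hom_def)

lemma Ob_pointed [simp]: "(T, i) \<in> Ob (pointed_schemes S) \<longleftrightarrow> thickening S T i"
  by (simp add: pointed_schemes_def thickening_def)

lemma Hom_pointed: "f \<in> Hom (pointed_schemes S) (T, i) (T', i') \<longleftrightarrow> scheme_morphism T T' f \<and> comp_morph S T T' f i = i'"
  by (simp add: pointed_schemes_def)

lemma Comp_pointed [simp]: "Comp (pointed_schemes S) (T, i) (T', i') (T'', i'') g f = comp_morph T T' T'' g f"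
  by (simp add: pointed_schemes_def)

lemma Id_pointed [simp]: "Id (pointed_schemes S) (T, i) = id_morph T"
  by (simp add: pointed_schemes_def)

lemma (in thickening) open_ex: "openin (under T) V \<Longrightarrow> \<exists>U. openin (under S) U \<and> V = ptf i ` U"
  using open_cases by metis

section \<open>Morphisms of thickenings as homomorphisms of sheaves on the base\<close>

locale thickenings = A: thickening S T i + B: thickening S T' i'
  for S :: "('p, 'r) ringed" and T :: "('p, 'r) ringed" and i :: "('p, 'r, 'p, 'r) morph"
    and T' :: "('p, 'r) ringed" and i' :: "('p, 'r, 'p, 'r) morph"
begin

lemma hom_point:
  assumes "f \<in> Hom (pointed_schemes S) (T, i) (T', i')" "x \<in> pts S"
  shows "ptf f (ptf i x) = ptf i' x"
proof -
  have "ptf (comp_morph S T T' f i) x = ptf i' x" using assms(1) by (simp add: Hom_pointed)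
  then show ?thesis using assms(2) by (simp add: comp_morph_def)
qed

lemma hom_preim:
  assumes "f \<in> Hom (pointed_schemes S) (T, i) (T', i')" "U \<subseteq> pts S"
  shows "preim T f (ptf i' ` U) = ptf i ` U"
proof (intro equalityI subsetI)
  fix y assume "y \<in> preim T f (ptf i' ` U)"
  then have "y \<in> pts T" "ptf f y \<in> ptf i' ` U" by (auto simp: preim_def)
  then obtain x u where "x \<in> pts S" "y = ptf i x" "u \<in> U" "ptf f y = ptf i' u"
    using A.surj by blast
  then have "x = u" using hom_point[OF assms(1), of x] inj_onD[OF B.inj, of x u] assms(2) by auto
  then show "y \<in> ptf i ` U" using \<open>y = ptf i x\<close> \<open>u \<in> U\<close> by simp
next
  fix y assume "y \<in> ptf i ` U"
  then obtain u where "u \<in> U" "y = ptf i u" by blast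
  then show "y \<in> preim T f (ptf i' ` U)"
    using hom_point[OF assms(1), of u] A.maps[of u] assms(2) by (auto simp: preim_def)
qed

lemma hom_family:
  assumes f: "f \<in> Hom (pointed_schemes S) (T, i) (T', i')"
  shows "sheaf_hom S (T, i) (T', i') (\<lambda>U. shf f (ptf i' ` U))"
proof (rule sheaf_homI)
  have m: "ringed_morphism T T' f" using f by (simp add: Hom_pointed scheme_morphism_def)
  fix U assume U: "openin (under S) U"
  have o: "ptf i' ` U \<in> opens T'" using B.open_image[OF U] by simp
  have p: "preim T f (ptf i' ` U) = ptf i ` U" by (rule hom_preim[OF f A.sub[OF U]])
  show "shf f (ptf i' ` U) \<in> ring_hom (sec T' (ptf i' ` U)) (sec T (ptf i ` U))"
    using m o p unfolding ringed_morphism_def by metis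
  fix s assume s: "s \<in> carrier (sec T' (ptf i' ` U))"
  have "shf (comp_morph S T T' f i) (ptf i' ` U) s = shf i' (ptf i' ` U) s" using f by (simp add: Hom_pointed)
  then show "shf i (ptf i ` U) (shf f (ptf i' ` U) s) = shf i' (ptf i' ` U) s"
    using o s p by (simp add: comp_morph_def)
  fix V assume V: "openin (under S) V" "V \<subseteq> U"
  have o': "ptf i' ` V \<in> opens T'" using B.open_image[OF V(1)] by simp
  have p': "preim T f (ptf i' ` V) = ptf i ` V" by (rule hom_preim[OF f A.sub[OF V(1)]])
  have "res T (preim T f (ptf i' ` U)) (preim T f (ptf i' ` V)) (shf f (ptf i' ` U) s) =
      shf f (ptf i' ` V) (res T' (ptf i' ` U) (ptf i' ` V) s)"
    using m o o' s image_mono[OF V(2)] unfolding ringed_morphism_def by blast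
  then show "res T (ptf i ` U) (ptf i ` V) (shf f (ptf i' ` U) s) =
      shf f (ptf i' ` V) (res T' (ptf i' ` U) (ptf i' ` V) s)"
    using p p' by simp
qed

lemma hom_extensional:
  assumes f: "f \<in> Hom (pointed_schemes S) (T, i) (T', i')"
  shows "ptf f \<in> extensional (pts T)" "shf f \<in> extensional (opens T')"
    "openin (under S) U \<Longrightarrow> shf f (ptf i' ` U) \<in> extensional (carrier (sec T' (ptf i' ` U)))"
proof -
  have m: "ringed_morphism T T' f" using f by (simp add: Hom_pointed scheme_morphism_def)
  show "ptf f \<in> extensional (pts T)" "shf f \<in> extensional (opens T')" using m by (simp_all add: ringed_morphism_def)
  show "openin (under S) U \<Longrightarrow> shf f (ptf i' ` U) \<in> extensional (carrier (sec T' (ptf i' ` U)))"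
    using m B.open_image unfolding ringed_morphism_def by blast
qed

text \<open>By \<open>hom_point\<close> both point maps are the same, so only sections remain to be
  compared. All later identities between morphisms are proved this way.\<close>

lemma hom_ext:
  assumes f: "f \<in> Hom (pointed_schemes S) (T, i) (T', i')" and g: "g \<in> Hom (pointed_schemes S) (T, i) (T', i')"
    and eq: "\<And>U s. openin (under S) U \<Longrightarrow> s \<in> carrier (sec T' (ptf i' ` U)) \<Longrightarrow>
      shf f (ptf i' ` U) s = shf g (ptf i' ` U) s"
  shows "f = g"
proof -
  have "ptf f = ptf g"
  proof (rule extensionalityI)
    show "ptf f \<in> extensional (pts T)" "ptf g \<in> extensional (pts T)" using hom_extensional f g by auto
    fix y assume "y \<in> pts T"
    then obtain x where "x \<in> pts S" "y = ptf i x" using A.surj by blast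
    then show "ptf f y = ptf g y" using hom_point f g by simp
  qed
  moreover have "shf f = shf g"
  proof (rule extensionalityI)
    show "shf f \<in> extensional (opens T')" "shf g \<in> extensional (opens T')" using hom_extensional f g by auto
    fix V assume "V \<in> opens T'"
    then obtain U where U: "openin (under S) U" "V = ptf i' ` U" using B.open_ex by blast
    show "shf f V = shf g V"
      unfolding U(2) using hom_extensional(3)[OF f U(1)] hom_extensional(3)[OF g U(1)] eq[OF U(1)]
      by (rule extensionalityI)
  qed
  ultimately show ?thesis by (intro morph.equality) auto
qed

text \<open>Locality comes for free: on both sides a germ is a unit exactly when its image in
  \<open>S\<close> is, and the homomorphism preserves images in \<open>S\<close>. Continuity holds
  since \<open>i\<close> and \<open>i'\<close> identify the open sets with those of
  \<open>S\<close>.\<close>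

lemma hom_intro:
  assumes e: "ptf f \<in> extensional (pts T)" "\<And>x. x \<in> pts S \<Longrightarrow> ptf f (ptf i x) = ptf i' x"
    "shf f \<in> extensional (opens T')"
    "\<And>U. openin (under S) U \<Longrightarrow> shf f (ptf i' ` U) \<in> extensional (carrier (sec T' (ptf i' ` U)))"
    and F: "sheaf_hom S (T, i) (T', i') (\<lambda>U. shf f (ptf i' ` U))"
  shows "f \<in> Hom (pointed_schemes S) (T, i) (T', i')"
proof -
  have pre: "preim T f (ptf i' ` U) = ptf i ` U" if "U \<subseteq> pts S" for U
  proof (intro equalityI subsetI)
    fix y assume "y \<in> preim T f (ptf i' ` U)"
    then have "y \<in> pts T" "ptf f y \<in> ptf i' ` U" by (auto simp: preim_def)
    then obtain x u where "x \<in> pts S" "y = ptf i x" "u \<in> U" "ptf f y = ptf i' u"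
      using A.surj by blast
    then have "x = u" using e(2)[of x] inj_onD[OF B.inj, of x u] that by auto
    then show "y \<in> ptf i ` U" using \<open>y = ptf i x\<close> \<open>u \<in> U\<close> by simp
  next
    fix y assume "y \<in> ptf i ` U"
    then obtain u where "u \<in> U" "y = ptf i u" by blast
    then show "y \<in> preim T f (ptf i' ` U)"
      using e(2)[of u] A.maps[of u] that by (auto simp: preim_def)
  qed
  have rm: "ringed_morphism T T' f"
    unfolding ringed_morphism_def
  proof (intro conjI ballI impI)
    show "continuous_map (under T) (under T') (ptf f)"
      unfolding continuous_map_def
    proof (intro conjI allI impI)
      show "ptf f \<in> pts T \<rightarrow> pts T'"
      proof
        fix y assume "y \<in> pts T"
        then obtain x where "x \<in> pts S" "y = ptf i x" using A.surj by blast
        then show "ptf f y \<in> pts T'" using e(2) B.maps by simp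
      qed
      fix V assume "openin (under T') V"
      then obtain U where U: "openin (under S) U" "V = ptf i' ` U" using B.open_ex by blast
      have "{x \<in> pts T. ptf f x \<in> V} = preim T f V" by (simp add: preim_def)
      then show "openin (under T) {x \<in> pts T. ptf f x \<in> V}"
        using pre[OF A.sub[OF U(1)]] A.open_image[OF U(1)] U(2) by simp
    qed
    show "ptf f \<in> extensional (pts T)" "shf f \<in> extensional (opens T')" by fact+
    fix V assume "V \<in> opens T'"
    then obtain U where U: "openin (under S) U" "V = ptf i' ` U" using B.open_ex by blast
    show "shf f V \<in> ring_hom (sec T' V) (sec T (preim T f V))"
      using sheaf_homD(1)[OF F U(1)] pre[OF A.sub[OF U(1)]] by (simp add: U(2))
    show "shf f V \<in> extensional (carrier (sec T' V))" using e(4)[OF U(1)] by (simp add: U(2))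
    fix W s assume "W \<in> opens T'" and WV: "W \<subseteq> V" and s: "s \<in> carrier (sec T' V)"
    then obtain Y where Y: "openin (under S) Y" "W = ptf i' ` Y" using B.open_ex by blast
    have "Y \<subseteq> U" using WV B.image_subset_iff[OF B.sub[OF U(1)] B.sub[OF Y(1)]] U Y by simp
    then show "res T (preim T f V) (preim T f W) (shf f V s) = shf f W (res T' V W s)"
      using sheaf_homD(4)[OF F U(1) Y(1)] s pre[OF A.sub[OF U(1)]] pre[OF A.sub[OF Y(1)]] by (simp add: U(2) Y(2))
  qed
  have loc: "germ_unit T' (ptf f y) V s"
    if V: "V \<in> opens T'" and s: "s \<in> carrier (sec T' V)" and y: "y \<in> preim T f V"
      and g: "germ_unit T y (preim T f V) (shf f V s)" for V s y
  proof -
    obtain U where U: "openin (under S) U" "V = ptf i' ` U" using V B.open_ex by blast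
    have p: "preim T f V = ptf i ` U" using pre[OF A.sub[OF U(1)]] U(2) by simp
    obtain x where x: "x \<in> U" "y = ptf i x" using y p by blast
    have s': "s \<in> carrier (sec T' (ptf i' ` U))" using s U(2) by simp
    have "germ_unit S x U (shf i (ptf i ` U) (shf f V s))"
      using g A.germ_unit_iff[OF U(1) x(1) sheaf_homD(2)[OF F U(1) s']] p x U(2) by simp
    then have "germ_unit S x U (shf i' (ptf i' ` U) s)"
      using sheaf_homD(3)[OF F U(1) s'] U(2) by simp
    then show ?thesis
      using B.germ_unit_iff[OF U(1) x(1) s'] e(2)[of x] A.sub[OF U(1)] x U(2) by auto
  qed
  have "comp_morph S T T' f i = i'"
  proof (rule morph.equality)
    have im: "ptf i' \<in> extensional (pts S)" "shf i' \<in> extensional (opens T')"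
      "\<And>V. V \<in> opens T' \<Longrightarrow> shf i' V \<in> extensional (carrier (sec T' V))"
      using B.morph by (simp_all add: ringed_morphism_def)
    show "ptf (comp_morph S T T' f i) = ptf i'"
      using e(2) by (intro extensionalityI[OF _ im(1)]) (auto simp: comp_morph_def)
    show "shf (comp_morph S T T' f i) = shf i'"
    proof (rule extensionalityI[OF _ im(2)])
      fix V assume V: "V \<in> opens T'"
      then obtain U where U: "openin (under S) U" "V = ptf i' ` U" using B.open_ex by blast
      show "shf (comp_morph S T T' f i) V = shf i' V"
        using V sheaf_homD(3)[OF F U(1)] pre[OF A.sub[OF U(1)]] U(2)
        by (intro extensionalityI[OF _ im(3)[OF V]]) (auto simp: comp_morph_def)
    qed (simp add: comp_morph_def)
  qed simp
  then show ?thesis unfolding Hom_pointed scheme_morphism_def using rm loc by blast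
qed

text \<open>The point map is forced to be \<open>i'\<close> after the inverse of \<open>i\<close>;
  outside carriers and open sets the default value makes the components extensional.\<close>

lemma hom_exists:
  assumes F: "sheaf_hom S (T, i) (T', i') F"
  obtains f where "f \<in> Hom (pointed_schemes S) (T, i) (T', i')"
    "\<And>U s. openin (under S) U \<Longrightarrow> s \<in> carrier (sec T' (ptf i' ` U)) \<Longrightarrow> shf f (ptf i' ` U) s = F U s"
proof -
  define f where "f = \<lparr>ptf = (\<lambda>y\<in>pts T. ptf i' (inv_into (pts S) (ptf i) y)),
    shf = (\<lambda>V\<in>opens T'. \<lambda>s\<in>carrier (sec T' V). F (preim S i' V) s)\<rparr>"
  have sf: "shf f (ptf i' ` U) s = F U s" if "openin (under S) U" "s \<in> carrier (sec T' (ptf i' ` U))" for U s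
    using that B.open_image B.preim_image[OF B.sub] by (simp add: f_def)
  have "f \<in> Hom (pointed_schemes S) (T, i) (T', i')"
  proof (rule hom_intro)
    show "ptf f (ptf i x) = ptf i' x" if "x \<in> pts S" for x
      using that A.maps A.inj by (simp add: f_def)
    show "sheaf_hom S (T, i) (T', i') (\<lambda>U. shf f (ptf i' ` U))"
    proof (rule sheaf_homI)
      fix U assume U: "openin (under S) U"
      interpret T'U: cring "sec T' (ptf i' ` U)" using B.open_image[OF U] B.T.sec_cring by blast
      show "shf f (ptf i' ` U) \<in> ring_hom (sec T' (ptf i' ` U)) (sec T (ptf i ` U))"
        by (rule ring_hom_cong[OF sheaf_homD(1)[OF F U] sf[OF U]]) auto
      fix s assume s: "s \<in> carrier (sec T' (ptf i' ` U))"
      show "shf i (ptf i ` U) (shf f (ptf i' ` U) s) = shf i' (ptf i' ` U) s"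
        using sheaf_homD(3)[OF F U s] sf[OF U s] by simp
      fix V assume V: "openin (under S) V" "V \<subseteq> U"
      have "res T' (ptf i' ` U) (ptf i' ` V) s \<in> carrier (sec T' (ptf i' ` V))"
        using B.T.res_closed[OF B.open_image[OF U] B.open_image[OF V(1)] image_mono[OF V(2)] s] .
      then show "res T (ptf i ` U) (ptf i ` V) (shf f (ptf i' ` U) s) = shf f (ptf i' ` V) (res T' (ptf i' ` U) (ptf i' ` V) s)"
        using sheaf_homD(4)[OF F U V s] sf[OF U s] sf[OF V(1)] by simp
    qed
    show "shf f (ptf i' ` U) \<in> extensional (carrier (sec T' (ptf i' ` U)))" if "openin (under S) U" for U
      using B.open_image[OF that] by (simp add: f_def)
  qed (simp_all add: f_def)
  then show ?thesis using that sf by blast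
qed

end

text \<open>Read on \<open>S\<close>, composition of morphisms is composition of sheaf homomorphisms
  in the opposite order.\<close>

lemma comp_shf:
  assumes "thickenings S T i T' i'" "thickening S T'' i''"
    and g: "g \<in> Hom (pointed_schemes S) (T', i') (T'', i'')"
    and U: "openin (under S) U" and s: "s \<in> carrier (sec T'' (ptf i'' ` U))"
  shows "shf (comp_morph T T' T'' g f) (ptf i'' ` U) s = shf f (ptf i' ` U) (shf g (ptf i'' ` U) s)"
proof -
  interpret thickenings S T i T' i' by fact
  interpret G: thickenings S T' i' T'' i''
    using assms(2) B.thickening_axioms by (simp add: thickenings_def)
  show ?thesis
    using G.hom_preim[OF g openin_subset[OF U]] thickening.open_image[OF assms(2) U] s by (simp add: comp_morph_def)
qed

lemma id_shf:
  assumes "thickening S T i" and U: "openin (under S) U" and s: "s \<in> carrier (sec T (ptf i ` U))"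
  shows "shf (id_morph T) (ptf i ` U) s = s"
  using thickening.open_image[OF assms(1) U] s by (simp add: id_morph_def)

lemma id_hom:
  assumes "thickening S T i"
  shows "id_morph T \<in> Hom (pointed_schemes S) (T, i) (T, i)"
proof -
  interpret thickenings S T i T i using assms by (simp add: thickenings_def)
  show ?thesis
  proof (rule hom_intro)
    show "sheaf_hom S (T, i) (T, i) (\<lambda>U. shf (id_morph T) (ptf i ` U))"
    proof (rule sheaf_homI)
      fix U assume U: "openin (under S) U"
      interpret TU: cring "sec T (ptf i ` U)" using A.open_image[OF U] A.T.sec_cring by blast
      show "shf (id_morph T) (ptf i ` U) \<in> ring_hom (sec T (ptf i ` U)) (sec T (ptf i ` U))"
        by (rule ring_hom_cong[OF id_ring_hom]) (auto simp: id_shf[OF assms U])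
      fix s assume s: "s \<in> carrier (sec T (ptf i ` U))"
      show "shf i (ptf i ` U) (shf (id_morph T) (ptf i ` U) s) = shf i (ptf i ` U) s"
        using id_shf[OF assms U s] by simp
      fix V assume V: "openin (under S) V" "V \<subseteq> U"
      have "res T (ptf i ` U) (ptf i ` V) s \<in> carrier (sec T (ptf i ` V))"
        using A.T.res_closed[OF A.open_image[OF U] A.open_image[OF V(1)] image_mono[OF V(2)] s] .
      then show "res T (ptf i ` U) (ptf i ` V) (shf (id_morph T) (ptf i ` U) s) =
          shf (id_morph T) (ptf i ` V) (res T (ptf i ` U) (ptf i ` V) s)"
        using id_shf[OF assms U s] id_shf[OF assms V(1)] by simp
    qed
    show "ptf (id_morph T) (ptf i x) = ptf i x" if "x \<in> pts S" for x
      using A.maps[OF that] by (simp add: id_morph_def)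
    show "shf (id_morph T) (ptf i ` U) \<in> extensional (carrier (sec T (ptf i ` U)))" if "openin (under S) U" for U
      using A.open_image[OF that] by (simp add: id_morph_def)
  qed (simp_all add: id_morph_def)
qed

lemma comp_hom:
  assumes A: "thickening S T i" and B: "thickening S T' i'" and C: "thickening S T'' i''"
    and f: "f \<in> Hom (pointed_schemes S) (T, i) (T', i')" and g: "g \<in> Hom (pointed_schemes S) (T', i') (T'', i'')"
  shows "comp_morph T T' T'' g f \<in> Hom (pointed_schemes S) (T, i) (T'', i'')"
proof -
  interpret C: thickening S T'' i'' by fact
  interpret F: thickenings S T i T' i' using A B by (simp add: thickenings_def)
  interpret G: thickenings S T' i' T'' i'' using B C by (simp add: thickenings_def)
  interpret H: thickenings S T i T'' i'' using A C by (simp add: thickenings_def)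
  note cs = comp_shf[OF F.thickenings_axioms C g]
  note fF = F.hom_family[OF f] and gG = G.hom_family[OF g]
  show ?thesis
  proof (rule H.hom_intro)
    show "sheaf_hom S (T, i) (T'', i'') (\<lambda>U. shf (comp_morph T T' T'' g f) (ptf i'' ` U))"
    proof (rule sheaf_homI)
      fix U assume U: "openin (under S) U"
      interpret TU: cring "sec T'' (ptf i'' ` U)" using C.open_image[OF U] C.T.sec_cring by blast
      show "shf (comp_morph T T' T'' g f) (ptf i'' ` U) \<in> ring_hom (sec T'' (ptf i'' ` U)) (sec T (ptf i ` U))"
        by (rule ring_hom_cong[OF ring_hom_trans[OF sheaf_homD(1)[OF gG U] sheaf_homD(1)[OF fF U]]])
          (auto simp: cs[OF U])
      fix s assume s: "s \<in> carrier (sec T'' (ptf i'' ` U))"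
      note gs = sheaf_homD(2)[OF gG U s]
      show "shf i (ptf i ` U) (shf (comp_morph T T' T'' g f) (ptf i'' ` U) s) = shf i'' (ptf i'' ` U) s"
        using cs[OF U s] sheaf_homD(3)[OF fF U gs] sheaf_homD(3)[OF gG U s] by simp
      fix V assume V: "openin (under S) V" "V \<subseteq> U"
      have sV: "res T'' (ptf i'' ` U) (ptf i'' ` V) s \<in> carrier (sec T'' (ptf i'' ` V))"
        using C.T.res_closed[OF C.open_image[OF U] C.open_image[OF V(1)] image_mono[OF V(2)] s] .
      show "res T (ptf i ` U) (ptf i ` V) (shf (comp_morph T T' T'' g f) (ptf i'' ` U) s) =
          shf (comp_morph T T' T'' g f) (ptf i'' ` V) (res T'' (ptf i'' ` U) (ptf i'' ` V) s)"
        using cs[OF U s] cs[OF V(1) sV] sheaf_homD(4)[OF fF U V gs] sheaf_homD(4)[OF gG U V s] by simp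
    qed
    show "ptf (comp_morph T T' T'' g f) (ptf i x) = ptf i'' x" if "x \<in> pts S" for x
      using F.hom_point[OF f that] G.hom_point[OF g that] F.A.maps[OF that] by (simp add: comp_morph_def)
    show "shf (comp_morph T T' T'' g f) (ptf i'' ` U) \<in> extensional (carrier (sec T'' (ptf i'' ` U)))"
      if "openin (under S) U" for U
      using C.open_image[OF that] by (simp add: comp_morph_def)
  qed (simp_all add: comp_morph_def)
qed

lemma category_pointed: "category (pointed_schemes S)"
proof -
  let ?C = "pointed_schemes S"
  have unit: "comp_morph T T T' f (id_morph T) = f \<and> comp_morph T T' T' (id_morph T') f = f"
    if A: "thickening S T i" and B: "thickening S T' i'" and f: "f \<in> Hom ?C (T, i) (T', i')" for T i T' i' f
  proof -
    interpret F: thickenings S T i T' i' using A B by (simp add: thickenings_def)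
    interpret I: thickenings S T i T i using A by (simp add: thickenings_def)
    note fF = F.hom_family[OF f]
    have "comp_morph T T T' f (id_morph T) = f"
      using comp_shf[OF I.thickenings_axioms B f] sheaf_homD(2)[OF fF] id_shf[OF A]
      by (intro F.hom_ext comp_hom[OF A A B id_hom[OF A] f] f) simp
    moreover have "comp_morph T T' T' (id_morph T') f = f"
      using comp_shf[OF F.thickenings_axioms B id_hom[OF B]] id_shf[OF B]
      by (intro F.hom_ext comp_hom[OF A B B f id_hom[OF B]] f) simp
    ultimately show ?thesis by simp
  qed
  have assoc: "comp_morph T1 T2 T4 (comp_morph T2 T3 T4 h g) f = comp_morph T1 T3 T4 h (comp_morph T1 T2 T3 g f)"
    if 1: "thickening S T1 i1" and 2: "thickening S T2 i2" and 3: "thickening S T3 i3" and 4: "thickening S T4 i4"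
      and f: "f \<in> Hom ?C (T1, i1) (T2, i2)" and g: "g \<in> Hom ?C (T2, i2) (T3, i3)" and h: "h \<in> Hom ?C (T3, i3) (T4, i4)"
    for T1 i1 T2 i2 T3 i3 T4 i4 f g h
  proof -
    interpret X12: thickenings S T1 i1 T2 i2 using 1 2 by (simp add: thickenings_def)
    interpret X13: thickenings S T1 i1 T3 i3 using 1 3 by (simp add: thickenings_def)
    interpret X14: thickenings S T1 i1 T4 i4 using 1 4 by (simp add: thickenings_def)
    interpret X23: thickenings S T2 i2 T3 i3 using 2 3 by (simp add: thickenings_def)
    interpret X34: thickenings S T3 i3 T4 i4 using 3 4 by (simp add: thickenings_def)
    note hg = comp_hom[OF 2 3 4 g h] and gf = comp_hom[OF 1 2 3 f g]
    show ?thesis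
      using comp_shf[OF X12.thickenings_axioms 4 hg] comp_shf[OF X23.thickenings_axioms 4 h]
        comp_shf[OF X13.thickenings_axioms 4 h] comp_shf[OF X12.thickenings_axioms 3 g]
        sheaf_homD(2)[OF X34.hom_family[OF h]]
      by (intro X14.hom_ext comp_hom[OF 1 2 4 f hg] comp_hom[OF 1 3 4 gf h]) simp
  qed
  show ?thesis
    unfolding category_def
  proof (intro conjI ballI)
    fix X assume X: "X \<in> Ob ?C"
    then show "Id ?C X \<in> Hom ?C X X" using id_hom by (cases X) simp
    fix Y assume Y: "Y \<in> Ob ?C"
    {
      fix f assume "f \<in> Hom ?C X Y"
      then show "Comp ?C X X Y f (Id ?C X) = f" "Comp ?C X Y Y (Id ?C Y) f = f"
        using X Y unit by (cases X; cases Y; simp)+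
    }
    fix Z f g assume Z: "Z \<in> Ob ?C" and f: "f \<in> Hom ?C X Y" and g: "g \<in> Hom ?C Y Z"
    then show "Comp ?C X Y Z g f \<in> Hom ?C X Z"
      using X Y comp_hom by (cases X; cases Y; cases Z) simp
    fix W h assume "W \<in> Ob ?C" "h \<in> Hom ?C Z W"
    then show "Comp ?C X Y W (Comp ?C Y Z W h g) f = Comp ?C X Z W h (Comp ?C X Y Z g f)"
      using X Y Z f g assoc by (cases X; cases Y; cases Z; cases W) simp
  qed
qed

lemma category_opposite: "category C \<Longrightarrow> category (opposite C)"
  unfolding category_def opposite_def by simp

text \<open>Turns an augmentation over the identity of the space into a morphism of ringed spaces;
  the immersions in \<open>amalg\<close> and \<open>I_pointed\<close> have this form.\<close>

definition inclusion :: "('p, 's) ringed \<Rightarrow> ('p, 'r) ringed \<Rightarrow> ('p set \<Rightarrow> 'r \<Rightarrow> 's) \<Rightarrow> ('p, 's, 'p, 'r) morph" where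
  "inclusion S P \<pi> = \<lparr>ptf = (\<lambda>x\<in>pts S. x), shf = (\<lambda>U\<in>opens S. \<lambda>s\<in>carrier (sec P U). \<pi> U s)\<rparr>"

lemma image_inclusion: "U \<subseteq> pts S \<Longrightarrow> (\<lambda>x\<in>pts S. x) ` U = U"
  by force

text \<open>A converse of \<open>pulled_augmentation\<close>: locality follows from
  \<open>germ_unit_aug\<close>, the image is closed because it is the whole space, and local lifts
  are \<open>aug_lift\<close>.\<close>

lemma (in augmentation) thickening_inclusion:
  assumes "scheme S" "scheme P"
  shows "thickening S P (inclusion S P \<pi>)"
proof -
  let ?i = "inclusion S P \<pi>"
  have sub: "U \<subseteq> pts S" if "openin (under S) U" for U using openin_subset[OF that] .
  have pt: "ptf ?i = (\<lambda>x\<in>pts S. x)" by (simp add: inclusion_def)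
  have pre: "preim S ?i U = U" if "openin (under S) U" for U
    using sub[OF that] by (auto simp: preim_def pt)
  have sh: "shf ?i U s = \<pi> U s" if "openin (under S) U" "s \<in> carrier (sec P U)" for U s
    using that by (simp add: inclusion_def)
  have homeo: "homeomorphic_map (under S) (under P) (ptf ?i)"
    unfolding pt same_space by (rule homeomorphic_map_eq[of _ _ id]) auto
  have rm: "ringed_morphism S P ?i"
    unfolding ringed_morphism_def
  proof (intro conjI ballI impI)
    show "continuous_map (under S) (under P) (ptf ?i)" using homeo by (rule homeomorphic_imp_continuous_map)
    fix V assume V': "V \<in> opens P"
    then have V: "openin (under S) V" by simp
    interpret V: cring "sec P V" using V E.sec_cring by simp
    show "shf ?i V \<in> ring_hom (sec P V) (sec S (preim S ?i V))"
      unfolding pre[OF V] by (rule ring_hom_cong[OF aug_hom[OF V] sh[OF V]]) auto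
    show "shf ?i V \<in> extensional (carrier (sec P V))" using V by (simp add: inclusion_def)
    fix W s assume W': "W \<in> opens P" and WV: "W \<subseteq> V" and s: "s \<in> carrier (sec P V)"
    then have W: "openin (under S) W" by simp
    have "res P V W s \<in> carrier (sec P W)" using E.res_closed[of V W s] V W WV s by simp
    then show "res S (preim S ?i V) (preim S ?i W) (shf ?i V s) = shf ?i W (res P V W s)"
      using pre[OF V] pre[OF W] sh[OF V s] sh[OF W] aug_res[OF V W WV s] by simp
  qed (simp_all add: inclusion_def)
  have "closed_immersion S P ?i"
    unfolding closed_immersion_def
  proof (intro conjI assms ballI)
    show "scheme_morphism S P ?i"
      unfolding scheme_morphism_def
    proof (intro conjI rm ballI impI)
      fix V s x assume V': "V \<in> opens P" and s: "s \<in> carrier (sec P V)" and x': "x \<in> preim S ?i V"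
        and g: "germ_unit S x (preim S ?i V) (shf ?i V s)"
      have V: "openin (under S) V" using V' by simp
      have x: "x \<in> V" "x \<in> pts S" using x' pre[OF V] sub[OF V] by auto
      show "germ_unit P (ptf ?i x) V s"
        using g germ_unit_aug[OF V x(1) s] pre[OF V] sh[OF V s] x by (simp add: pt)
    qed
    show "embedding_map (under S) (under P) (ptf ?i)"
      using homeo by (simp add: embedding_map_def homeomorphic_imp_surjective_map)
    show "closedin (under P) (ptf ?i ` pts S)"
      using homeomorphic_imp_surjective_map[OF homeo] by simp
    fix V s y assume V': "V \<in> opens P" and s: "s \<in> carrier (sec S (preim S ?i V))" and y: "y \<in> V"
    have V: "openin (under S) V" using V' by simp
    obtain W u where W: "openin (under S) W" "y \<in> W" "W \<subseteq> V" "u \<in> carrier (sec P W)" "\<pi> W u = res S V W s"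
      using aug_lift[OF V s[unfolded pre[OF V]] y] by blast
    then show "\<exists>W u. openin (under P) W \<and> y \<in> W \<and> W \<subseteq> V \<and> u \<in> carrier (sec P W) \<and>
              shf ?i W u = res S (preim S ?i V) (preim S ?i W) s"
      using pre[OF V] pre[OF W(1)] sh[OF W(1,4)] by (intro exI[of _ W] exI[of _ u]) simp
  qed
  moreover have "\<forall>V\<in>opens P. \<forall>a\<in>ideal_sections S P ?i V. \<forall>b\<in>ideal_sections S P ?i V. a \<otimes>\<^bsub>sec P V\<^esub> b = \<zero>\<^bsub>sec P V\<^esub>"
    using pre sh aug_sqz by (auto simp: ideal_sections_iff)
  ultimately show ?thesis by (simp add: thickening_def square_zero_immersion_def)
qed

section \<open>Amalgamated sums\<close>

lemma amalg_ring_simps [simp]: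
  "x \<otimes>\<^bsub>amalg_ring (T, i) (T', i') U\<^esub> y =
    Duo (left x \<otimes>\<^bsub>sec T (ptf i ` U)\<^esub> left y) (right x \<otimes>\<^bsub>sec T' (ptf i' ` U)\<^esub> right y)"
  "x \<oplus>\<^bsub>amalg_ring (T, i) (T', i') U\<^esub> y =
    Duo (left x \<oplus>\<^bsub>sec T (ptf i ` U)\<^esub> left y) (right x \<oplus>\<^bsub>sec T' (ptf i' ` U)\<^esub> right y)"
  "\<one>\<^bsub>amalg_ring (T, i) (T', i') U\<^esub> = Duo \<one>\<^bsub>sec T (ptf i ` U)\<^esub> \<one>\<^bsub>sec T' (ptf i' ` U)\<^esub>"
  "\<zero>\<^bsub>amalg_ring (T, i) (T', i') U\<^esub> = Duo \<zero>\<^bsub>sec T (ptf i ` U)\<^esub> \<zero>\<^bsub>sec T' (ptf i' ` U)\<^esub>"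
  by (simp_all add: amalg_ring_def Let_def)

lemma amalg_carrier_Duo [simp]:
  "Duo a b \<in> carrier (amalg_ring (T, i) (T', i') U) \<longleftrightarrow> a \<in> carrier (sec T (ptf i ` U)) \<and>
    b \<in> carrier (sec T' (ptf i' ` U)) \<and> shf i (ptf i ` U) a = shf i' (ptf i' ` U) b"
  by (auto simp: amalg_ring_def Let_def)

lemma amalg_carrierE:
  assumes "x \<in> carrier (amalg_ring (T, i) (T', i') U)"
  obtains a b where "x = Duo a b" "a \<in> carrier (sec T (ptf i ` U))" "b \<in> carrier (sec T' (ptf i' ` U))"
    "shf i (ptf i ` U) a = shf i' (ptf i' ` U) b"
  using assms by (auto simp: amalg_ring_def Let_def)

lemma amalg_space_simps [simp]:
  "under (amalg_space S (T, i) (T', i')) = under S"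
  "sec (amalg_space S (T, i) (T', i')) = amalg_ring (T, i) (T', i')"
  "res (amalg_space S (T, i) (T', i')) U V x =
    Duo (res T (ptf i ` U) (ptf i ` V) (left x)) (res T' (ptf i' ` U) (ptf i' ` V) (right x))"
  by (simp_all add: amalg_space_def)

locale amalgamation = thickenings S T i T' i'
  for S T :: "('p, 'a universe) ringed" and i and T' :: "('p, 'a universe) ringed" and i'
begin

abbreviation am where "am \<equiv> amalg_space S (T, i) (T', i')"

lemma homA: "openin (under S) U \<Longrightarrow> ring_hom_cring (sec T (ptf i ` U)) (sec S U) (shf i (ptf i ` U))"
  using A.A.aug_cring_hom by simp

lemma homB: "openin (under S) U \<Longrightarrow> ring_hom_cring (sec T' (ptf i' ` U)) (sec S U) (shf i' (ptf i' ` U))"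
  using B.A.aug_cring_hom by simp

lemma amalg_cring:
  assumes U: "openin (under S) U"
  shows "cring (amalg_ring (T, i) (T', i') U)"
proof -
  interpret a: ring_hom_cring "sec T (ptf i ` U)" "sec S U" "shf i (ptf i ` U)" by (rule homA[OF U])
  interpret b: ring_hom_cring "sec T' (ptf i' ` U)" "sec S U" "shf i' (ptf i' ` U)" by (rule homB[OF U])
  show ?thesis
  proof (intro cringI abelian_groupI comm_monoidI)
    fix x assume "x \<in> carrier (amalg_ring (T, i) (T', i') U)"
    then obtain c d where x: "x = Duo c d" "c \<in> carrier (sec T (ptf i ` U))" "d \<in> carrier (sec T' (ptf i' ` U))"
      "shf i (ptf i ` U) c = shf i' (ptf i' ` U) d" by (rule amalg_carrierE)
    then show "\<exists>y\<in>carrier (amalg_ring (T, i) (T', i') U). y \<oplus>\<^bsub>amalg_ring (T, i) (T', i') U\<^esub> x = \<zero>\<^bsub>amalg_ring (T, i) (T', i') U\<^esub>"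
      by (intro bexI[of _ "Duo (\<ominus>\<^bsub>sec T (ptf i ` U)\<^esub> c) (\<ominus>\<^bsub>sec T' (ptf i' ` U)\<^esub> d)"])
        (auto simp: a.R.l_neg b.R.l_neg)
  qed (auto elim!: amalg_carrierE simp: a.R.m_ac b.R.m_ac a.R.a_ac b.R.a_ac a.R.l_distr b.R.l_distr a.R.r_distr b.R.r_distr)
qed

lemma amalg_ringed: "ringed_space am"
proof (rule ringed_spaceI; (unfold amalg_space_simps)?)
  show "cring (amalg_ring (T, i) (T', i') U)" if "openin (under S) U" for U by (rule amalg_cring[OF that])
next
  fix U V assume U: "openin (under S) U" and V: "openin (under S) V" "V \<subseteq> U"
  note o = A.open_image[OF U] A.open_image[OF V(1)] image_mono[OF V(2), of "ptf i"]
  note o' = B.open_image[OF U] B.open_image[OF V(1)] image_mono[OF V(2), of "ptf i'"]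
  note s = A.A.E.res_closed[of U V] B.A.E.res_closed[of U V]
  have "res am U V \<in> ring_hom (amalg_ring (T, i) (T', i') U) (amalg_ring (T, i) (T', i') V)"
  proof (rule ring_hom_memI)
    fix x assume "x \<in> carrier (amalg_ring (T, i) (T', i') U)"
    then show "res am U V x \<in> carrier (amalg_ring (T, i) (T', i') V)"
      using A.T.res_closed[OF o] B.T.res_closed[OF o'] A.shf_res[OF U V] B.shf_res[OF U V]
      by (auto elim!: amalg_carrierE)
    fix y assume "y \<in> carrier (amalg_ring (T, i) (T', i') U)"
    with \<open>x \<in> carrier (amalg_ring (T, i) (T', i') U)\<close>
    show "res am U V (x \<otimes>\<^bsub>amalg_ring (T, i) (T', i') U\<^esub> y) = res am U V x \<otimes>\<^bsub>amalg_ring (T, i) (T', i') V\<^esub> res am U V y"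
      "res am U V (x \<oplus>\<^bsub>amalg_ring (T, i) (T', i') U\<^esub> y) = res am U V x \<oplus>\<^bsub>amalg_ring (T, i) (T', i') V\<^esub> res am U V y"
      by (auto elim!: amalg_carrierE simp: A.T.res_mult[OF o] B.T.res_mult[OF o'] A.T.res_add[OF o] B.T.res_add[OF o'])
  qed (simp add: A.T.res_one[OF o] B.T.res_one[OF o'])
  then show "(\<lambda>x. Duo (res T (ptf i ` U) (ptf i ` V) (left x)) (res T' (ptf i' ` U) (ptf i' ` V) (right x)))
      \<in> ring_hom (amalg_ring (T, i) (T', i') U) (amalg_ring (T, i) (T', i') V)"
    unfolding amalg_space_simps .
next
  fix U s assume "openin (under S) U" "s \<in> carrier (amalg_ring (T, i) (T', i') U)"
  then show "Duo (res T (ptf i ` U) (ptf i ` U) (left s)) (res T' (ptf i' ` U) (ptf i' ` U) (right s)) = s"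
    using A.open_image B.open_image by (auto elim!: amalg_carrierE simp: A.T.res_id B.T.res_id)
next
  fix U V W s assume "openin (under S) U" "openin (under S) V" "openin (under S) W" "W \<subseteq> V" "V \<subseteq> U"
    "s \<in> carrier (amalg_ring (T, i) (T', i') U)"
  then show "Duo (res T (ptf i ` V) (ptf i ` W) (left (Duo (res T (ptf i ` U) (ptf i ` V) (left s)) (res T' (ptf i' ` U) (ptf i' ` V) (right s)))))
        (res T' (ptf i' ` V) (ptf i' ` W) (right (Duo (res T (ptf i ` U) (ptf i ` V) (left s)) (res T' (ptf i' ` U) (ptf i' ` V) (right s))))) =
       Duo (res T (ptf i ` U) (ptf i ` W) (left s)) (res T' (ptf i' ` U) (ptf i' ` W) (right s))"
    using A.A.E.res_res[of U V W "left s"] B.A.E.res_res[of U V W "right s"] by (auto elim!: amalg_carrierE)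
next
  fix \<V> s t assume V: "\<V> \<subseteq> opens S" and s: "s \<in> carrier (amalg_ring (T, i) (T', i') (\<Union>\<V>))"
    and t: "t \<in> carrier (amalg_ring (T, i) (T', i') (\<Union>\<V>))"
    and eq: "\<And>V. V \<in> \<V> \<Longrightarrow> Duo (res T (ptf i ` \<Union>\<V>) (ptf i ` V) (left s)) (res T' (ptf i' ` \<Union>\<V>) (ptf i' ` V) (right s)) =
      Duo (res T (ptf i ` \<Union>\<V>) (ptf i ` V) (left t)) (res T' (ptf i' ` \<Union>\<V>) (ptf i' ` V) (right t))"
  have "left s = left t"
    by (rule A.A.E.separated_cover[of \<V>]) (use V s t eq in \<open>auto elim!: amalg_carrierE\<close>)
  moreover have "right s = right t"
    by (rule B.A.E.separated_cover[of \<V>]) (use V s t eq in \<open>auto elim!: amalg_carrierE\<close>)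
  ultimately show "s = t" using s t by (auto elim!: amalg_carrierE)
next
  fix \<V> s assume V: "\<V> \<subseteq> opens S" and s: "\<And>V. V \<in> \<V> \<Longrightarrow> s V \<in> carrier (amalg_ring (T, i) (T', i') V)"
    and eq: "\<And>V W. V \<in> \<V> \<Longrightarrow> W \<in> \<V> \<Longrightarrow>
      Duo (res T (ptf i ` V) (ptf i ` (V \<inter> W)) (left (s V))) (res T' (ptf i' ` V) (ptf i' ` (V \<inter> W)) (right (s V))) =
      Duo (res T (ptf i ` W) (ptf i ` (V \<inter> W)) (left (s W))) (res T' (ptf i' ` W) (ptf i' ` (V \<inter> W)) (right (s W)))"
  have oU: "openin (under S) (\<Union>\<V>)" using V by (intro openin_Union) auto
  have c: "left (s V) \<in> carrier (sec T (ptf i ` V))" "right (s V) \<in> carrier (sec T' (ptf i' ` V))"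
    "shf i (ptf i ` V) (left (s V)) = shf i' (ptf i' ` V) (right (s V))" "s V = Duo (left (s V)) (right (s V))" if "V \<in> \<V>" for V
    using s[OF that] by (auto elim!: amalg_carrierE)
  have e: "res T (ptf i ` V) (ptf i ` (V \<inter> W)) (left (s V)) = res T (ptf i ` W) (ptf i ` (V \<inter> W)) (left (s W))"
    "res T' (ptf i' ` V) (ptf i' ` (V \<inter> W)) (right (s V)) = res T' (ptf i' ` W) (ptf i' ` (V \<inter> W)) (right (s W))"
    if "V \<in> \<V>" "W \<in> \<V>" for V W
    using eq[OF that] by simp_all
  obtain t where t: "t \<in> carrier (sec T (ptf i ` \<Union>\<V>))" "\<And>V. V \<in> \<V> \<Longrightarrow> res T (ptf i ` \<Union>\<V>) (ptf i ` V) t = left (s V)"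
    using A.A.E.glue_cover[of \<V> "\<lambda>V. left (s V)", unfolded pulled_simps, OF V c(1) e(1)] by blast
  obtain t' where t': "t' \<in> carrier (sec T' (ptf i' ` \<Union>\<V>))" "\<And>V. V \<in> \<V> \<Longrightarrow> res T' (ptf i' ` \<Union>\<V>) (ptf i' ` V) t' = right (s V)"
    using B.A.E.glue_cover[of \<V> "\<lambda>V. right (s V)", unfolded pulled_simps, OF V c(2) e(2)] by blast
  have "shf i (ptf i ` \<Union>\<V>) t = shf i' (ptf i' ` \<Union>\<V>) t'"
  proof (rule A.S.separated_cover[OF V])
    fix V assume VV: "V \<in> \<V>"
    then have o: "openin (under S) V" "V \<subseteq> \<Union>\<V>" using V by auto
    show "res S (\<Union>\<V>) V (shf i (ptf i ` \<Union>\<V>) t) = res S (\<Union>\<V>) V (shf i' (ptf i' ` \<Union>\<V>) t')"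
      using A.shf_res[OF oU o t(1)] B.shf_res[OF oU o t'(1)] t(2)[OF VV] t'(2)[OF VV] c(3)[OF VV] by simp
  qed (use A.shf_hom[OF oU] B.shf_hom[OF oU] t t' ring_hom_closed in metis)+
  then show "\<exists>t\<in>carrier (amalg_ring (T, i) (T', i') (\<Union>\<V>)). \<forall>V\<in>\<V>.
      Duo (res T (ptf i ` \<Union>\<V>) (ptf i ` V) (left t)) (res T' (ptf i' ` \<Union>\<V>) (ptf i' ` V) (right t)) = s V"
    using t t' c(4) by (intro bexI[of _ "Duo t t'"]) auto
qed

text \<open>The image of \<open>b\<close> in \<open>S\<close> lifts locally to \<open>T'\<close>,
  and such a lift completes \<open>b\<close> to a pair.\<close>

lemma amalg_lift:
  assumes U: "openin (under S) U" and b: "b \<in> carrier (sec T (ptf i ` U))" and x: "x \<in> U"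
  shows "\<exists>V c. openin (under S) V \<and> x \<in> V \<and> V \<subseteq> U \<and>
    Duo (res T (ptf i ` U) (ptf i ` V) b) c \<in> carrier (amalg_ring (T, i) (T', i') V)"
proof -
  have c: "shf i (ptf i ` U) b \<in> carrier (sec S U)" using A.shf_hom[OF U] b ring_hom_closed by metis
  obtain V u where V: "openin (under S) V" "x \<in> V" "V \<subseteq> U" "u \<in> carrier (sec T' (ptf i' ` V))"
    "shf i' (ptf i' ` V) u = res S U V (shf i (ptf i ` U) b)"
    using B.A.aug_lift[OF U c x] by auto
  then show ?thesis
    using A.shf_res[OF U V(1,3) b] A.A.E.res_closed[of U V b] U b by (intro exI[of _ V] exI[of _ u]) simp
qed

lemma left_hom: "left \<in> ring_hom (amalg_ring (T, i) (T', i') U) (sec T (ptf i ` U))"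
  and right_hom: "right \<in> ring_hom (amalg_ring (T, i) (T', i') U) (sec T' (ptf i' ` U))"
  by (rule ring_hom_memI; auto elim!: amalg_carrierE)+

text \<open>Over \<open>T\<close> the kernel consists of the pairs \<open>(0, c)\<close> with
  \<open>c\<close> in the ideal of \<open>T'\<close>. The splitting argument that yields charts of
  the sum takes place over \<open>T\<close>, where a section can exist.\<close>

lemma amalg_augmentation_left: "augmentation (pulled S T i) am (\<lambda>U. left)"
proof (intro augmentation.intro augmentation_axioms.intro A.A.E.sheaf_space_axioms sheaf_space.intro amalg_ringed;
    (unfold pulled_simps amalg_space_simps)?)
  show "left \<in> ring_hom (amalg_ring (T, i) (T', i') U) (sec T (ptf i ` U))" for U
    by (rule left_hom)
next
  fix U b x assume U: "openin (under S) U" and b: "b \<in> carrier (sec T (ptf i ` U))" and x: "x \<in> U"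
  obtain V c where V: "openin (under S) V" "x \<in> V" "V \<subseteq> U"
    "Duo (res T (ptf i ` U) (ptf i ` V) b) c \<in> carrier (amalg_ring (T, i) (T', i') V)"
    using amalg_lift[OF U b x] by blast
  then show "\<exists>V u. openin (under S) V \<and> x \<in> V \<and> V \<subseteq> U \<and> u \<in> carrier (amalg_ring (T, i) (T', i') V) \<and>
      left u = res T (ptf i ` U) (ptf i ` V) b"
    by (intro exI[of _ V] exI[of _ "Duo (res T (ptf i ` U) (ptf i ` V) b) c"]) (simp del: amalg_carrier_Duo)
next
  fix U c d assume U: "openin (under S) U" and cd: "c \<in> carrier (amalg_ring (T, i) (T', i') U)"
    "d \<in> carrier (amalg_ring (T, i) (T', i') U)" "left c = \<zero>\<^bsub>sec T (ptf i ` U)\<^esub>" "left d = \<zero>\<^bsub>sec T (ptf i ` U)\<^esub>"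
  interpret a: ring_hom_cring "sec T (ptf i ` U)" "sec S U" "shf i (ptf i ` U)" by (rule homA[OF U])
  have "right c \<in> carrier (sec T' (ptf i' ` U))" "right d \<in> carrier (sec T' (ptf i' ` U))"
    "shf i' (ptf i' ` U) (right c) = shf i (ptf i ` U) (left c)" "shf i' (ptf i' ` U) (right d) = shf i (ptf i ` U) (left d)"
    using cd(1,2) by (auto elim!: amalg_carrierE)
  then have "right c \<otimes>\<^bsub>sec T' (ptf i' ` U)\<^esub> right d = \<zero>\<^bsub>sec T' (ptf i' ` U)\<^esub>"
    using B.A.aug_sqz[OF U, of "right c" "right d"] cd(3,4) by simp
  then show "c \<otimes>\<^bsub>amalg_ring (T, i) (T', i') U\<^esub> d = \<zero>\<^bsub>amalg_ring (T, i) (T', i') U\<^esub>"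
    using cd(3,4) by simp
qed auto

text \<open>Over \<open>S\<close> the kernel is the product of the two ideals, again of square
  zero.\<close>

lemma amalg_augmentation: "augmentation S am (\<lambda>U x. shf i (ptf i ` U) (left x))"
proof (intro augmentation.intro augmentation_axioms.intro A.S.sheaf_space_axioms sheaf_space.intro amalg_ringed;
    (unfold amalg_space_simps)?)
  fix U assume U: "openin (under S) U"
  interpret a: ring_hom_cring "sec T (ptf i ` U)" "sec S U" "shf i (ptf i ` U)" by (rule homA[OF U])
  show "(\<lambda>x. shf i (ptf i ` U) (left x)) \<in> ring_hom (amalg_ring (T, i) (T', i') U) (sec S U)"
    by (rule ring_hom_memI) (auto elim!: amalg_carrierE)
next
  fix U V a assume "openin (under S) U" "openin (under S) V" "V \<subseteq> U" "a \<in> carrier (amalg_ring (T, i) (T', i') U)"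
  then show "shf i (ptf i ` V) (left (Duo (res T (ptf i ` U) (ptf i ` V) (left a)) (res T' (ptf i' ` U) (ptf i' ` V) (right a)))) =
      res S U V (shf i (ptf i ` U) (left a))"
    using A.shf_res by (auto elim!: amalg_carrierE)
next
  fix U b x assume U: "openin (under S) U" and b: "b \<in> carrier (sec S U)" and x: "x \<in> U"
  obtain V u where V: "openin (under S) V" "x \<in> V" "V \<subseteq> U" "u \<in> carrier (sec T (ptf i ` V))"
    "shf i (ptf i ` V) u = res S U V b"
    using A.A.aug_lift[OF U b x] by auto
  obtain W c where W: "openin (under S) W" "x \<in> W" "W \<subseteq> V"
    "Duo (res T (ptf i ` V) (ptf i ` W) u) c \<in> carrier (amalg_ring (T, i) (T', i') W)"
    using amalg_lift[OF V(1,4,2)] by blast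
  have "shf i (ptf i ` W) (res T (ptf i ` V) (ptf i ` W) u) = res S U W b"
    using A.shf_res[OF V(1) W(1,3) V(4)] V(5) A.S.res_res[OF U V(1) W(1,3) V(3) b] by simp
  then show "\<exists>V u. openin (under S) V \<and> x \<in> V \<and> V \<subseteq> U \<and> u \<in> carrier (amalg_ring (T, i) (T', i') V) \<and>
      shf i (ptf i ` V) (left u) = res S U V b"
    using W V by (intro exI[of _ W] exI[of _ "Duo (res T (ptf i ` V) (ptf i ` W) u) c"]) (auto simp del: amalg_carrier_Duo)
next
  fix U c d assume U: "openin (under S) U" and cd: "c \<in> carrier (amalg_ring (T, i) (T', i') U)"
    "d \<in> carrier (amalg_ring (T, i) (T', i') U)"
    "shf i (ptf i ` U) (left c) = \<zero>\<^bsub>sec S U\<^esub>" "shf i (ptf i ` U) (left d) = \<zero>\<^bsub>sec S U\<^esub>"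
  then show "c \<otimes>\<^bsub>amalg_ring (T, i) (T', i') U\<^esub> d = \<zero>\<^bsub>amalg_ring (T, i) (T', i') U\<^esub>"
    using A.A.aug_sqz[OF U, of "left c" "left d"] B.A.aug_sqz[OF U, of "right c" "right d"] by (auto elim!: amalg_carrierE)
qed simp

lemma amalg_eq: "amalg S (T, i) (T', i') = (am, inclusion S am (\<lambda>U x. shf i (ptf i ` U) (left x)))"
  by (simp add: amalg_def inclusion_def)

end

lemma opposite_simps [simp]:
  "Ob (opposite C) = Ob C" "Hom (opposite C) X Y = Hom C Y X" "Id (opposite C) = Id C"
  "Comp (opposite C) X Y Z g f = Comp C Z Y X f g"
  by (simp_all add: opposite_def)

section \<open>Universal property of the amalgamated sum\<close>

text \<open>Once the sum is a scheme, its universal property is formal. The assumption is discharged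
  later when the second summand is the space of dual numbers.\<close>

locale amalgamation_scheme = amalgamation S T i T' i'
  for S T :: "('p, 'a universe) ringed" and i and T' :: "('p, 'a universe) ringed" and i' +
  assumes scheme_am: "scheme am"
begin

abbreviation inc where "inc \<equiv> inclusion S am (\<lambda>U x. shf i (ptf i ` U) (left x))"

lemma thick_am: "thickening S am inc"
  by (rule augmentation.thickening_inclusion[OF amalg_augmentation A.schemes(1) scheme_am])

lemma inc_image: "openin (under S) U \<Longrightarrow> ptf inc ` U = U"
  using image_inclusion[OF openin_subset] by (simp add: inclusion_def)

lemma inc_shf: "openin (under S) U \<Longrightarrow> x \<in> carrier (amalg_ring (T, i) (T', i') U) \<Longrightarrow> shf inc U x = shf i (ptf i ` U) (left x)"
  by (simp add: inclusion_def)

lemma inl_shf: "openin (under S) U \<Longrightarrow> x \<in> carrier (amalg_ring (T, i) (T', i') U) \<Longrightarrow>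
    shf (amalg_inl S (T, i) (T', i')) U x = left x"
  and inr_shf: "openin (under S) U \<Longrightarrow> x \<in> carrier (amalg_ring (T, i) (T', i') U) \<Longrightarrow>
    shf (amalg_inr S (T, i) (T', i')) U x = right x"
  by (simp_all add: amalg_inl_def amalg_inr_def)

lemma inl_hom: "amalg_inl S (T, i) (T', i') \<in> Hom (pointed_schemes S) (T, i) (am, inc)"
proof -
  interpret L: thickenings S T i am inc using A.thickening_axioms thick_am by (simp add: thickenings_def)
  show ?thesis
  proof (rule L.hom_intro)
    show "sheaf_hom S (T, i) (am, inc) (\<lambda>U. shf (amalg_inl S (T, i) (T', i')) (ptf inc ` U))"
    proof (rule sheaf_homI; simp add: inc_image)
      fix U assume U: "openin (under S) U"
      interpret am: cring "amalg_ring (T, i) (T', i') U" by (rule amalg_cring[OF U])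
      show "shf (amalg_inl S (T, i) (T', i')) U \<in> ring_hom (amalg_ring (T, i) (T', i') U) (sec T (ptf i ` U))"
        by (rule ring_hom_cong[OF left_hom inl_shf[OF U] am.one_closed am.m_closed am.a_closed])
      fix s assume s: "s \<in> carrier (amalg_ring (T, i) (T', i') U)"
      then show "shf i (ptf i ` U) (shf (amalg_inl S (T, i) (T', i')) U s) = shf inc U s"
        using inl_shf[OF U s] inc_shf[OF U s] by simp
      fix V assume V: "openin (under S) V" "V \<subseteq> U"
      have "res am U V s \<in> carrier (amalg_ring (T, i) (T', i') V)"
        using sheaf_space.res_closed[OF sheaf_space.intro[OF amalg_ringed], of U V s] U V s by simp
      then show "res T (ptf i ` U) (ptf i ` V) (shf (amalg_inl S (T, i) (T', i')) U s) =
           shf (amalg_inl S (T, i) (T', i')) V (Duo (res T (ptf i ` U) (ptf i ` V) (left s)) (res T' (ptf i' ` U) (ptf i' ` V) (right s)))"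
        using inl_shf[OF U s] inl_shf[OF V(1), of "res am U V s"] by (simp del: amalg_carrier_Duo)
    qed
    show "shf (amalg_inl S (T, i) (T', i')) (ptf inc ` U) \<in> extensional (carrier (sec am (ptf inc ` U)))"
      if "openin (under S) U" for U
      using that by (simp add: inc_image amalg_inl_def)
  qed (use A.maps A.inj in \<open>auto simp: amalg_inl_def point_inverse_def inclusion_def\<close>)
qed

lemma inr_hom: "amalg_inr S (T, i) (T', i') \<in> Hom (pointed_schemes S) (T', i') (am, inc)"
proof -
  interpret L: thickenings S T' i' am inc using B.thickening_axioms thick_am by (simp add: thickenings_def)
  show ?thesis
  proof (rule L.hom_intro)
    show "sheaf_hom S (T', i') (am, inc) (\<lambda>U. shf (amalg_inr S (T, i) (T', i')) (ptf inc ` U))"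
    proof (rule sheaf_homI; simp add: inc_image)
      fix U assume U: "openin (under S) U"
      interpret am: cring "amalg_ring (T, i) (T', i') U" by (rule amalg_cring[OF U])
      show "shf (amalg_inr S (T, i) (T', i')) U \<in> ring_hom (amalg_ring (T, i) (T', i') U) (sec T' (ptf i' ` U))"
        by (rule ring_hom_cong[OF right_hom inr_shf[OF U] am.one_closed am.m_closed am.a_closed])
      fix s assume s: "s \<in> carrier (amalg_ring (T, i) (T', i') U)"
      then show "shf i' (ptf i' ` U) (shf (amalg_inr S (T, i) (T', i')) U s) = shf inc U s"
        using inr_shf[OF U s] inc_shf[OF U s] by (auto elim!: amalg_carrierE)
      fix V assume V: "openin (under S) V" "V \<subseteq> U"
      have "res am U V s \<in> carrier (amalg_ring (T, i) (T', i') V)"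
        using sheaf_space.res_closed[OF sheaf_space.intro[OF amalg_ringed], of U V s] U V s by simp
      then show "res T' (ptf i' ` U) (ptf i' ` V) (shf (amalg_inr S (T, i) (T', i')) U s) =
           shf (amalg_inr S (T, i) (T', i')) V (Duo (res T (ptf i ` U) (ptf i ` V) (left s)) (res T' (ptf i' ` U) (ptf i' ` V) (right s)))"
        using inr_shf[OF U s] inr_shf[OF V(1), of "res am U V s"] by (simp del: amalg_carrier_Duo)
    qed
    show "shf (amalg_inr S (T, i) (T', i')) (ptf inc ` U) \<in> extensional (carrier (sec am (ptf inc ` U)))"
      if "openin (under S) U" for U
      using that by (simp add: inc_image amalg_inr_def)
  qed (use B.maps B.inj in \<open>auto simp: amalg_inr_def point_inverse_def inclusion_def\<close>)
qed

lemma comp_inl_inr: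
  assumes W: "thickening S W k" and h: "h \<in> Hom (pointed_schemes S) (am, inc) (W, k)"
    and U: "openin (under S) U" and s: "s \<in> carrier (sec W (ptf k ` U))"
  shows "shf (comp_morph T am W h (amalg_inl S (T, i) (T', i'))) (ptf k ` U) s = left (shf h (ptf k ` U) s)"
    "shf (comp_morph T' am W h (amalg_inr S (T, i) (T', i'))) (ptf k ` U) s = right (shf h (ptf k ` U) s)"
    "shf h (ptf k ` U) s \<in> carrier (amalg_ring (T, i) (T', i') U)"
proof -
  interpret L: thickenings S T i am inc using A.thickening_axioms thick_am by (simp add: thickenings_def)
  interpret R: thickenings S T' i' am inc using B.thickening_axioms thick_am by (simp add: thickenings_def)
  interpret H: thickenings S am inc W k using W thick_am by (simp add: thickenings_def)
  show hs: "shf h (ptf k ` U) s \<in> carrier (amalg_ring (T, i) (T', i') U)"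
    using sheaf_homD(2)[OF H.hom_family[OF h] U s] inc_image[OF U] by simp
  show "shf (comp_morph T am W h (amalg_inl S (T, i) (T', i'))) (ptf k ` U) s = left (shf h (ptf k ` U) s)"
    using comp_shf[OF L.thickenings_axioms W h U s] inl_shf[OF U hs] inc_image[OF U] by simp
  show "shf (comp_morph T' am W h (amalg_inr S (T, i) (T', i'))) (ptf k ` U) s = right (shf h (ptf k ` U) s)"
    using comp_shf[OF R.thickenings_axioms W h U s] inr_shf[OF U hs] inc_image[OF U] by simp
qed

text \<open>On sections the morphism is the pair of \<open>f\<close> and \<open>g\<close>; the
  components have the same image in \<open>S\<close> because both are morphisms under
  \<open>S\<close>.\<close>

lemma copairing_ex:
  assumes W: "thickening S W k" and f: "f \<in> Hom (pointed_schemes S) (T, i) (W, k)"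
    and g: "g \<in> Hom (pointed_schemes S) (T', i') (W, k)"
  shows "\<exists>h. h \<in> Hom (pointed_schemes S) (am, inc) (W, k) \<and>
    comp_morph T am W h (amalg_inl S (T, i) (T', i')) = f \<and> comp_morph T' am W h (amalg_inr S (T, i) (T', i')) = g \<and>
    (\<forall>U s. openin (under S) U \<longrightarrow> s \<in> carrier (sec W (ptf k ` U)) \<longrightarrow>
      shf h (ptf k ` U) s = Duo (shf f (ptf k ` U) s) (shf g (ptf k ` U) s))"
proof -
  interpret F: thickenings S T i W k using A.thickening_axioms W by (simp add: thickenings_def)
  interpret G: thickenings S T' i' W k using B.thickening_axioms W by (simp add: thickenings_def)
  interpret H: thickenings S am inc W k using W thick_am by (simp add: thickenings_def)
  note fF = F.hom_family[OF f] and gG = G.hom_family[OF g]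
  have "sheaf_hom S (am, inc) (W, k) (\<lambda>U s. Duo (shf f (ptf k ` U) s) (shf g (ptf k ` U) s))"
  proof (rule sheaf_homI; simp add: inc_image)
    fix U assume U: "openin (under S) U"
    note fU = sheaf_homD[OF fF U] and gU = sheaf_homD[OF gG U]
    show "(\<lambda>s. Duo (shf f (ptf k ` U) s) (shf g (ptf k ` U) s)) \<in> ring_hom (sec W (ptf k ` U)) (amalg_ring (T, i) (T', i') U)"
      using fU(2,3) gU(2,3) ring_hom_mult[OF fU(1)] ring_hom_mult[OF gU(1)] ring_hom_add[OF fU(1)] ring_hom_add[OF gU(1)]
        ring_hom_one[OF fU(1)] ring_hom_one[OF gU(1)]
      by (intro ring_hom_memI) auto
    fix s assume s: "s \<in> carrier (sec W (ptf k ` U))"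
    have d: "Duo (shf f (ptf k ` U) s) (shf g (ptf k ` U) s) \<in> carrier (amalg_ring (T, i) (T', i') U)"
      using fU(2,3) gU(2,3) s by simp
    show "shf inc U (Duo (shf f (ptf k ` U) s) (shf g (ptf k ` U) s)) = shf k (ptf k ` U) s"
      using inc_shf[OF U d] fU(3)[OF s] by simp
    fix V assume V: "openin (under S) V" "V \<subseteq> U"
    show "res T (ptf i ` U) (ptf i ` V) (shf f (ptf k ` U) s) = shf f (ptf k ` V) (res W (ptf k ` U) (ptf k ` V) s) \<and>
      res T' (ptf i' ` U) (ptf i' ` V) (shf g (ptf k ` U) s) = shf g (ptf k ` V) (res W (ptf k ` U) (ptf k ` V) s)"
      using fU(4)[OF V s] gU(4)[OF V s] by simp
  qed
  then obtain h where h: "h \<in> Hom (pointed_schemes S) (am, inc) (W, k)"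
    "\<And>U s. openin (under S) U \<Longrightarrow> s \<in> carrier (sec W (ptf k ` U)) \<Longrightarrow>
      shf h (ptf k ` U) s = Duo (shf f (ptf k ` U) s) (shf g (ptf k ` U) s)"
    by (rule H.hom_exists) blast
  have "comp_morph T am W h (amalg_inl S (T, i) (T', i')) = f"
    using comp_inl_inr(1)[OF W h(1)] h(2)
    by (intro F.hom_ext comp_hom[OF A.thickening_axioms thick_am W inl_hom h(1)] f) simp
  moreover have "comp_morph T' am W h (amalg_inr S (T, i) (T', i')) = g"
    using comp_inl_inr(2)[OF W h(1)] h(2)
    by (intro G.hom_ext comp_hom[OF B.thickening_axioms thick_am W inr_hom h(1)] g) simp
  ultimately show ?thesis using h by blast
qed

lemma copairing_unique:
  assumes W: "thickening S W k" and h: "h \<in> Hom (pointed_schemes S) (am, inc) (W, k)"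
    and h': "h' \<in> Hom (pointed_schemes S) (am, inc) (W, k)"
    and 1: "comp_morph T am W h (amalg_inl S (T, i) (T', i')) = comp_morph T am W h' (amalg_inl S (T, i) (T', i'))"
    and 2: "comp_morph T' am W h (amalg_inr S (T, i) (T', i')) = comp_morph T' am W h' (amalg_inr S (T, i) (T', i'))"
  shows "h = h'"
proof -
  interpret H: thickenings S am inc W k using W thick_am by (simp add: thickenings_def)
  show ?thesis
  proof (rule H.hom_ext[OF h h'])
    fix U s assume U: "openin (under S) U" and s: "s \<in> carrier (sec W (ptf k ` U))"
    have "left (shf h (ptf k ` U) s) = left (shf h' (ptf k ` U) s)"
      "right (shf h (ptf k ` U) s) = right (shf h' (ptf k ` U) s)"
      using comp_inl_inr(1,2)[OF W h U s] comp_inl_inr(1,2)[OF W h' U s] 1 2 by simp_all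
    then show "shf h (ptf k ` U) s = shf h' (ptf k ` U) s"
      using comp_inl_inr(3)[OF W h U s] comp_inl_inr(3)[OF W h' U s] by (auto elim!: amalg_carrierE)
  qed
qed

lemma coproduct: "is_product (opposite (pointed_schemes S)) (T, i) (T', i') (amalg S (T, i) (T', i'))
    (amalg_inl S (T, i) (T', i')) (amalg_inr S (T, i) (T', i'))"
  unfolding is_product_def amalg_eq opposite_simps
proof (intro conjI ballI)
  show "(T, i) \<in> Ob (pointed_schemes S)" "(T', i') \<in> Ob (pointed_schemes S)" "(am, inc) \<in> Ob (pointed_schemes S)"
    using A.thickening_axioms B.thickening_axioms thick_am by simp_all
  show "amalg_inl S (T, i) (T', i') \<in> Hom (pointed_schemes S) (T, i) (am, inc)"
    "amalg_inr S (T, i) (T', i') \<in> Hom (pointed_schemes S) (T', i') (am, inc)" by (rule inl_hom inr_hom)+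
  fix X f g assume X: "X \<in> Ob (pointed_schemes S)" and f: "f \<in> Hom (pointed_schemes S) (T, i) X"
    and g: "g \<in> Hom (pointed_schemes S) (T', i') X"
  obtain W k where Wk: "X = (W, k)" by (cases X)
  show "\<exists>!h. h \<in> Hom (pointed_schemes S) (am, inc) X \<and>
      Comp (pointed_schemes S) (T, i) (am, inc) X h (amalg_inl S (T, i) (T', i')) = f \<and>
      Comp (pointed_schemes S) (T', i') (am, inc) X h (amalg_inr S (T, i) (T', i')) = g"
    unfolding Wk Comp_pointed
  proof (rule ex_ex1I)
    show "\<exists>h. h \<in> Hom (pointed_schemes S) (am, inc) (W, k) \<and>
        comp_morph T am W h (amalg_inl S (T, i) (T', i')) = f \<and> comp_morph T' am W h (amalg_inr S (T, i) (T', i')) = g"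
      using copairing_ex[of W k f g] X f g Wk by auto
    show "h = h'" if "h \<in> Hom (pointed_schemes S) (am, inc) (W, k) \<and>
        comp_morph T am W h (amalg_inl S (T, i) (T', i')) = f \<and> comp_morph T' am W h (amalg_inr S (T, i) (T', i')) = g"
      "h' \<in> Hom (pointed_schemes S) (am, inc) (W, k) \<and>
        comp_morph T am W h' (amalg_inl S (T, i) (T', i')) = f \<and> comp_morph T' am W h' (amalg_inr S (T, i) (T', i')) = g" for h h'
      using that X Wk by (intro copairing_unique[of W k h h']) auto
  qed
qed

text \<open>Evaluates the definite description in \<open>pairing\<close>; the group law and the
  action are computed through this formula.\<close>

lemma pairing_formula:
  assumes W: "thickening S W k" and f: "f \<in> Hom (pointed_schemes S) (T, i) (W, k)"
    and g: "g \<in> Hom (pointed_schemes S) (T', i') (W, k)"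
  defines "h \<equiv> pairing (opposite (pointed_schemes S)) (T, i) (T', i') (amalg S (T, i) (T', i'))
    (amalg_inl S (T, i) (T', i')) (amalg_inr S (T, i) (T', i')) (W, k) f g"
  shows "h \<in> Hom (pointed_schemes S) (am, inc) (W, k)"
    "openin (under S) U \<Longrightarrow> s \<in> carrier (sec W (ptf k ` U)) \<Longrightarrow>
      shf h (ptf k ` U) s = Duo (shf f (ptf k ` U) s) (shf g (ptf k ` U) s)"
proof -
  obtain h' where h': "h' \<in> Hom (pointed_schemes S) (am, inc) (W, k)"
    "comp_morph T am W h' (amalg_inl S (T, i) (T', i')) = f" "comp_morph T' am W h' (amalg_inr S (T, i) (T', i')) = g"
    "\<And>U s. openin (under S) U \<Longrightarrow> s \<in> carrier (sec W (ptf k ` U)) \<Longrightarrow>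
      shf h' (ptf k ` U) s = Duo (shf f (ptf k ` U) s) (shf g (ptf k ` U) s)"
    using copairing_ex[OF W f g] by blast
  have "h = h'"
    unfolding h_def pairing_def amalg_eq opposite_simps Comp_pointed
  proof (rule the_equality)
    fix u assume u: "u \<in> Hom (pointed_schemes S) (am, inc) (W, k) \<and>
      comp_morph T am W u (amalg_inl S (T, i) (T', i')) = f \<and> comp_morph T' am W u (amalg_inr S (T, i) (T', i')) = g"
    show "u = h'" by (rule copairing_unique[OF W _ h'(1)]) (use u h'(2,3) in simp_all)
  qed (use h'(1-3) in simp)
  then show "h \<in> Hom (pointed_schemes S) (am, inc) (W, k)"
    "openin (under S) U \<Longrightarrow> s \<in> carrier (sec W (ptf k ` U)) \<Longrightarrow>
      shf h (ptf k ` U) s = Duo (shf f (ptf k ` U) s) (shf g (ptf k ` U) s)"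
    using h' by auto
qed

end

section \<open>The ideal as a module and the dual numbers\<close>

locale square_zero = thickening S T i
  for S T :: "('p, 'a universe) ringed" and i
begin

abbreviation J where "J U \<equiv> ideal_sections S T i (ptf i ` U)"
abbreviation M where "M \<equiv> ideal_module S (T, i)"
abbreviation R where "R U \<equiv> sec T (ptf i ` U)"
abbreviation aug where "aug U \<equiv> shf i (ptf i ` U)"
abbreviation act where "act U b j \<equiv> b \<odot>\<^bsub>msec M U\<^esub> j"
abbreviation rs where "rs U V \<equiv> res T (ptf i ` U) (ptf i ` V)"

lemma M_simps [simp]:
  "carrier (msec M U) = J U" "\<zero>\<^bsub>msec M U\<^esub> = \<zero>\<^bsub>R U\<^esub>" "a \<oplus>\<^bsub>msec M U\<^esub> b = a \<oplus>\<^bsub>R U\<^esub> b"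
  "mres M U V = rs U V"
  by (simp_all add: ideal_module_def Let_def)

lemma aug_hom: "openin (under S) U \<Longrightarrow> ring_hom_cring (R U) (sec S U) (aug U)"
  using A.aug_cring_hom by simp

lemma aug_closed: "openin (under S) U \<Longrightarrow> a \<in> carrier (R U) \<Longrightarrow> aug U a \<in> carrier (sec S U)"
  using A.aug_closed by simp

lemma J_iff: "openin (under S) U \<Longrightarrow> a \<in> J U \<longleftrightarrow> a \<in> carrier (R U) \<and> aug U a = \<zero>\<^bsub>sec S U\<^esub>"
  by (rule ideal_iff)

lemma J_carrier: "openin (under S) U \<Longrightarrow> a \<in> J U \<Longrightarrow> a \<in> carrier (R U)"
  by (simp add: J_iff)

lemma R_cring: "openin (under S) U \<Longrightarrow> cring (R U)"
  using A.E.sec_cring by simp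

lemmas rs_closed = A.E.res_closed[unfolded pulled_simps]
  and rs_rs = A.E.res_res[unfolded pulled_simps]
  and rs_mult = A.E.res_mult[unfolded pulled_simps]
  and rs_add = A.E.res_add[unfolded pulled_simps]
  and rs_minus = A.E.res_minus[unfolded pulled_simps]
  and rs_zero = A.E.res_zero[unfolded pulled_simps]
  and rs_one = A.E.res_one[unfolded pulled_simps]
  and rs_id = A.E.res_id[unfolded pulled_simps]
  and lift = A.aug_lift[unfolded pulled_simps]
  and R_separated = A.E.separated[unfolded pulled_simps]

lemma J_zero: "openin (under S) U \<Longrightarrow> \<zero>\<^bsub>R U\<^esub> \<in> J U"
proof -
  assume U: "openin (under S) U"
  interpret h: ring_hom_cring "R U" "sec S U" "aug U" by (rule aug_hom[OF U])
  show ?thesis using U by (simp add: J_iff)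
qed

lemma J_add: "openin (under S) U \<Longrightarrow> a \<in> J U \<Longrightarrow> b \<in> J U \<Longrightarrow> a \<oplus>\<^bsub>R U\<^esub> b \<in> J U"
proof -
  assume U: "openin (under S) U" and ab: "a \<in> J U" "b \<in> J U"
  interpret h: ring_hom_cring "R U" "sec S U" "aug U" by (rule aug_hom[OF U])
  show ?thesis using ab by (simp add: J_iff[OF U])
qed

lemma J_uminus: "openin (under S) U \<Longrightarrow> a \<in> J U \<Longrightarrow> \<ominus>\<^bsub>R U\<^esub> a \<in> J U"
proof -
  assume U: "openin (under S) U" and a: "a \<in> J U"
  interpret h: ring_hom_cring "R U" "sec S U" "aug U" by (rule aug_hom[OF U])
  show ?thesis using a by (simp add: J_iff[OF U])
qed

lemma J_mult: "openin (under S) U \<Longrightarrow> u \<in> carrier (R U) \<Longrightarrow> a \<in> J U \<Longrightarrow> u \<otimes>\<^bsub>R U\<^esub> a \<in> J U"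
proof -
  assume U: "openin (under S) U" and u: "u \<in> carrier (R U)" and a: "a \<in> J U"
  interpret h: ring_hom_cring "R U" "sec S U" "aug U" by (rule aug_hom[OF U])
  show ?thesis using u a by (simp add: J_iff[OF U])
qed

lemma J_sqz: "openin (under S) U \<Longrightarrow> a \<in> J U \<Longrightarrow> b \<in> J U \<Longrightarrow> a \<otimes>\<^bsub>R U\<^esub> b = \<zero>\<^bsub>R U\<^esub>"
  using A.aug_sqz[of U a b] by (simp add: J_iff)

lemma J_res: "openin (under S) U \<Longrightarrow> openin (under S) V \<Longrightarrow> V \<subseteq> U \<Longrightarrow> a \<in> J U \<Longrightarrow> rs U V a \<in> J V"
  using shf_res[of U V a] rs_closed[of U V a] S.res_zero[of U V] by (simp add: J_iff)

text \<open>The two lifts differ by an element of the ideal, which multiplies the ideal to zero.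
  This makes the ideal a module over the structure sheaf of \<open>S\<close>.\<close>

lemma lift_independent:
  assumes U: "openin (under S) U" and u: "u \<in> carrier (R U)" "u' \<in> carrier (R U)" "aug U u = aug U u'" and j: "j \<in> J U"
  shows "u \<otimes>\<^bsub>R U\<^esub> j = u' \<otimes>\<^bsub>R U\<^esub> j"
proof -
  interpret h: ring_hom_cring "R U" "sec S U" "aug U" by (rule aug_hom[OF U])
  have jc: "j \<in> carrier (R U)" using J_carrier[OF U j] .
  have n: "u \<ominus>\<^bsub>R U\<^esub> u' \<in> J U" using u by (simp add: J_iff[OF U] h.R.minus_eq h.S.r_neg)
  have "u = u' \<oplus>\<^bsub>R U\<^esub> (u \<ominus>\<^bsub>R U\<^esub> u')" using u by (simp add: h.R.minus_eq h.R.a_lcomm h.R.r_neg)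
  then have "u \<otimes>\<^bsub>R U\<^esub> j = u' \<otimes>\<^bsub>R U\<^esub> j \<oplus>\<^bsub>R U\<^esub> (u \<ominus>\<^bsub>R U\<^esub> u') \<otimes>\<^bsub>R U\<^esub> j"
    using u jc by (metis h.R.l_distr h.R.minus_closed)
  then show ?thesis using J_sqz[OF U n j] u jc by simp
qed

text \<open>Justifies the definite description in \<open>ideal_module\<close>: products with local
  lifts agree on overlaps by \<open>lift_independent\<close>, glue, and determine the result because
  lifts exist locally.\<close>

lemma act_exists:
  assumes U: "openin (under S) U" and b: "b \<in> carrier (sec S U)" and j: "j \<in> J U"
  shows "\<exists>!k. k \<in> J U \<and> (\<forall>V\<in>opens S. V \<subseteq> U \<longrightarrow> (\<forall>u\<in>carrier (R V). aug V u = res S U V b \<longrightarrow>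
      rs U V k = u \<otimes>\<^bsub>R V\<^esub> rs U V j))"
proof (rule ex_ex1I)
  have jc: "j \<in> carrier (R U)" using J_carrier[OF U j] .
  define Q where "Q V s \<longleftrightarrow> openin (under S) V \<and> V \<subseteq> U \<and>
    (\<exists>u\<in>carrier (R V). aug V u = res S U V b \<and> s = u \<otimes>\<^bsub>R V\<^esub> rs U V j)" for V s
  have Qc: "openin (under S) V \<and> V \<subseteq> U \<and> s \<in> carrier (R V)" if "Q V s" for V s
  proof -
    interpret V: cring "R V" using that R_cring by (simp add: Q_def)
    show ?thesis using that rs_closed[OF U _ _ jc] by (auto simp: Q_def)
  qed
  have "\<exists>k\<in>carrier (R U). \<forall>V s. Q V s \<longrightarrow> rs U V k = s"
  proof (rule A.E.glue[unfolded pulled_simps])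
    show "openin (under S) U" by (rule U)
    show "openin (under S) V \<and> V \<subseteq> U \<and> s \<in> carrier (R V)" if "Q V s" for V s by (rule Qc[OF that])
    show "\<exists>V s. x \<in> V \<and> Q V s" if "x \<in> U" for x
      using lift[OF U b that] by (auto simp: Q_def)
  next
    fix V s V' s' assume q: "Q V s" "Q V' s'"
    let ?W = "V \<inter> V'"
    obtain u where V: "openin (under S) V" "V \<subseteq> U" and u: "u \<in> carrier (R V)" "aug V u = res S U V b" "s = u \<otimes>\<^bsub>R V\<^esub> rs U V j"
      using q(1) by (auto simp: Q_def)
    obtain u' where V': "openin (under S) V'" "V' \<subseteq> U" and u': "u' \<in> carrier (R V')" "aug V' u' = res S U V' b" "s' = u' \<otimes>\<^bsub>R V'\<^esub> rs U V' j"
      using q(2) by (auto simp: Q_def)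
    have W: "openin (under S) ?W" "?W \<subseteq> U" using V V' by auto
    have s: "rs V ?W s = rs V ?W u \<otimes>\<^bsub>R ?W\<^esub> rs U ?W j"
      using rs_mult[OF V(1) W(1) _ u(1) rs_closed[OF U V jc]] rs_rs[OF U V(1) W(1) _ V(2) jc] u(3) by simp
    have s': "rs V' ?W s' = rs V' ?W u' \<otimes>\<^bsub>R ?W\<^esub> rs U ?W j"
      using rs_mult[OF V'(1) W(1) _ u'(1) rs_closed[OF U V' jc]] rs_rs[OF U V'(1) W(1) _ V'(2) jc] u'(3) by simp
    have "aug ?W (rs V ?W u) = aug ?W (rs V' ?W u')"
      using shf_res[OF V(1) W(1) _ u(1)] shf_res[OF V'(1) W(1) _ u'(1)] u(2) u'(2)
        S.res_res[OF U V(1) W(1) _ V(2) b] S.res_res[OF U V'(1) W(1) _ V'(2) b] by simp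
    then show "rs V ?W s = rs V' ?W s'"
      unfolding s s' using rs_closed[OF V(1) W(1) _ u(1)] rs_closed[OF V'(1) W(1) _ u'(1)] J_res[OF U W j]
      by (intro lift_independent[OF W(1)]) auto
  qed
  then obtain k where k: "k \<in> carrier (R U)" "\<And>V s. Q V s \<Longrightarrow> rs U V k = s" by blast
  \<comment> \<open>The glued section lies in the ideal because it does so locally.\<close>
  have "aug U k = \<zero>\<^bsub>sec S U\<^esub>"
  proof (rule S.separated[OF U])
    interpret S: cring "sec S U" using S.sec_cring[OF U] .
    show "aug U k \<in> carrier (sec S U)" "\<zero>\<^bsub>sec S U\<^esub> \<in> carrier (sec S U)" using aug_closed[OF U k(1)] by auto
    fix x assume "x \<in> U"
    then obtain V u where V: "openin (under S) V" "x \<in> V" "V \<subseteq> U" "u \<in> carrier (R V)" "aug V u = res S U V b"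
      using lift[OF U b] by blast
    then have "Q V (u \<otimes>\<^bsub>R V\<^esub> rs U V j)" by (auto simp: Q_def)
    then have "rs U V k \<in> J V" using k(2) J_mult[OF V(1,4) J_res[OF U V(1,3) j]] by simp
    then have "res S U V (aug U k) = res S U V \<zero>\<^bsub>sec S U\<^esub>"
      using shf_res[OF U V(1,3) k(1)] S.res_zero[OF U V(1,3)] by (simp add: J_iff[OF V(1)])
    then show "\<exists>V. openin (under S) V \<and> x \<in> V \<and> V \<subseteq> U \<and> res S U V (aug U k) = res S U V \<zero>\<^bsub>sec S U\<^esub>"
      using V by blast
  qed
  then have "k \<in> J U" using k(1) by (simp add: J_iff[OF U])
  then show "\<exists>k. k \<in> J U \<and> (\<forall>V\<in>opens S. V \<subseteq> U \<longrightarrow> (\<forall>u\<in>carrier (R V). aug V u = res S U V b \<longrightarrow>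
      rs U V k = u \<otimes>\<^bsub>R V\<^esub> rs U V j))"
    using k(2) unfolding Q_def by (intro exI[of _ k]) auto
next
  fix k k' assume k: "k \<in> J U \<and> (\<forall>V\<in>opens S. V \<subseteq> U \<longrightarrow> (\<forall>u\<in>carrier (R V). aug V u = res S U V b \<longrightarrow>
      rs U V k = u \<otimes>\<^bsub>R V\<^esub> rs U V j))"
    and k': "k' \<in> J U \<and> (\<forall>V\<in>opens S. V \<subseteq> U \<longrightarrow> (\<forall>u\<in>carrier (R V). aug V u = res S U V b \<longrightarrow>
      rs U V k' = u \<otimes>\<^bsub>R V\<^esub> rs U V j))"
  show "k = k'"
  proof (rule R_separated[OF _ J_carrier[OF U] J_carrier[OF U]])
    fix x assume "x \<in> U"
    then obtain V u where V: "openin (under S) V" "x \<in> V" "V \<subseteq> U" "u \<in> carrier (R V)" "aug V u = res S U V b"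
      using lift[OF U b] by blast
    then have "rs U V k = rs U V k'" using k k' by simp
    then show "\<exists>V. openin (under S) V \<and> x \<in> V \<and> V \<subseteq> U \<and> rs U V k = rs U V k'" using V by blast
  qed (use U k k' in auto)
qed

lemma act:
  assumes U: "openin (under S) U" and b: "b \<in> carrier (sec S U)" and j: "j \<in> J U"
  shows act_closed: "act U b j \<in> J U"
    and act_lift: "\<And>V u. openin (under S) V \<Longrightarrow> V \<subseteq> U \<Longrightarrow> u \<in> carrier (R V) \<Longrightarrow> aug V u = res S U V b \<Longrightarrow>
      rs U V (act U b j) = u \<otimes>\<^bsub>R V\<^esub> rs U V j"
proof -
  have e: "act U b j = (THE k. k \<in> J U \<and> (\<forall>V\<in>opens S. V \<subseteq> U \<longrightarrow> (\<forall>u\<in>carrier (R V). aug V u = res S U V b \<longrightarrow>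
      rs U V k = u \<otimes>\<^bsub>R V\<^esub> rs U V j)))"
    by (simp add: ideal_module_def Let_def)
  note t = theI'[OF act_exists[OF U b j], folded e]
  show "act U b j \<in> J U" using t by blast
  show "rs U V (act U b j) = u \<otimes>\<^bsub>R V\<^esub> rs U V j"
    if "openin (under S) V" "V \<subseteq> U" "u \<in> carrier (R V)" "aug V u = res S U V b" for V u
    using t that by blast
qed

text \<open>When a lift exists over all of \<open>U\<close>, the action is multiplication by it;
  computations with the dual numbers use the action in this form.\<close>

lemma act_aug:
  assumes U: "openin (under S) U" and u: "u \<in> carrier (R U)" and j: "j \<in> J U"
  shows "act U (aug U u) j = u \<otimes>\<^bsub>R U\<^esub> j"
proof -
  interpret h: ring_hom_cring "R U" "sec S U" "aug U" by (rule aug_hom[OF U])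
  have b: "aug U u \<in> carrier (sec S U)" using u by simp
  show ?thesis
    using act_lift[OF U b j U subset_refl u] S.res_id[OF U b] rs_id[of U "act U (aug U u) j"] rs_id[of U j]
      J_carrier[OF U act_closed[OF U b j]] J_carrier[OF U j] U by simp
qed

lemma J_eqI:
  assumes U: "openin (under S) U" and k: "k \<in> J U" "k' \<in> J U"
    and loc: "\<And>x. x \<in> U \<Longrightarrow> \<exists>V. openin (under S) V \<and> x \<in> V \<and> V \<subseteq> U \<and> rs U V k = rs U V k'"
  shows "k = k'"
  by (rule R_separated[OF _ J_carrier[OF U k(1)] J_carrier[OF U k(2)]]) (use U loc in auto)

lemma act_res:
  assumes U: "openin (under S) U" and V: "openin (under S) V" "V \<subseteq> U" and b: "b \<in> carrier (sec S U)" and j: "j \<in> J U"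
  shows "rs U V (act U b j) = act V (res S U V b) (rs U V j)"
proof (rule J_eqI[OF V(1) J_res[OF U V act_closed[OF U b j]]])
  have bV: "res S U V b \<in> carrier (sec S V)" using S.res_closed[OF U V b] .
  have jV: "rs U V j \<in> J V" using J_res[OF U V j] .
  show "act V (res S U V b) (rs U V j) \<in> J V" by (rule act_closed[OF V(1) bV jV])
  fix x assume x: "x \<in> V"
  then obtain W u where W: "openin (under S) W" "x \<in> W" "W \<subseteq> V" "u \<in> carrier (R W)" "aug W u = res S V W (res S U V b)"
    using lift[OF V(1) bV] by blast
  have WU: "W \<subseteq> U" using W V by blast
  have "rs V W (rs U V (act U b j)) = u \<otimes>\<^bsub>R W\<^esub> rs U W j"
    using act_lift[OF U b j W(1) WU W(4)] W(5) S.res_res[OF U V(1) W(1,3) V(2) b]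
      rs_rs[OF U V(1) W(1,3) V(2) J_carrier[OF U act_closed[OF U b j]]] by simp
  also have "\<dots> = rs V W (act V (res S U V b) (rs U V j))"
    using act_lift[OF V(1) bV jV W(1,3,4,5)] rs_rs[OF U V(1) W(1,3) V(2) J_carrier[OF U j]] by simp
  finally show "\<exists>W. openin (under S) W \<and> x \<in> W \<and> W \<subseteq> V \<and>
      rs V W (rs U V (act U b j)) = rs V W (act V (res S U V b) (rs U V j))" using W by blast
qed

text \<open>After shrinking, two sections of \<open>S\<close> lift simultaneously, which reduces the
  module laws to the ring \<open>R V\<close>.\<close>

lemma act_local:
  assumes U: "openin (under S) U" and x: "x \<in> U" and b: "b \<in> carrier (sec S U)" and c: "c \<in> carrier (sec S U)"
  obtains V u w where "openin (under S) V" "x \<in> V" "V \<subseteq> U" "u \<in> carrier (R V)" "w \<in> carrier (R V)"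
    "aug V u = res S U V b" "aug V w = res S U V c"
    "\<forall>j\<in>J U. rs U V (act U b j) = u \<otimes>\<^bsub>R V\<^esub> rs U V j"
    "\<forall>j\<in>J U. rs U V (act U c j) = w \<otimes>\<^bsub>R V\<^esub> rs U V j"
proof -
  obtain V u where V: "openin (under S) V" "x \<in> V" "V \<subseteq> U" "u \<in> carrier (R V)" "aug V u = res S U V b"
    using lift[OF U b x] by blast
  obtain V' w where V': "openin (under S) V'" "x \<in> V'" "V' \<subseteq> U" "w \<in> carrier (R V')" "aug V' w = res S U V' c"
    using lift[OF U c x] by blast
  let ?W = "V \<inter> V'"
  have W: "openin (under S) ?W" "x \<in> ?W" "?W \<subseteq> U" "?W \<subseteq> V" "?W \<subseteq> V'" using V V' by auto
  have u: "rs V ?W u \<in> carrier (R ?W)" "aug ?W (rs V ?W u) = res S U ?W b"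
    using rs_closed[OF V(1) W(1,4) V(4)] shf_res[OF V(1) W(1,4) V(4)] V(5) S.res_res[OF U V(1) W(1,4) V(3) b] by auto
  have w: "rs V' ?W w \<in> carrier (R ?W)" "aug ?W (rs V' ?W w) = res S U ?W c"
    using rs_closed[OF V'(1) W(1,5) V'(4)] shf_res[OF V'(1) W(1,5) V'(4)] V'(5) S.res_res[OF U V'(1) W(1,5) V'(3) c] by auto
  show ?thesis
    using that[OF W(1,2,3) u(1) w(1) u(2) w(2)] act_lift[OF U b _ W(1,3) u] act_lift[OF U c _ W(1,3) w] by blast
qed

lemma act_local1:
  assumes U: "openin (under S) U" and x: "x \<in> U" and b: "b \<in> carrier (sec S U)"
  obtains V u where "openin (under S) V" "x \<in> V" "V \<subseteq> U" "u \<in> carrier (R V)"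
    "\<forall>j\<in>J U. rs U V (act U b j) = u \<otimes>\<^bsub>R V\<^esub> rs U V j"
proof -
  obtain V u where V: "openin (under S) V" "x \<in> V" "V \<subseteq> U" "u \<in> carrier (R V)" "aug V u = res S U V b"
    using lift[OF U b x] by blast
  show ?thesis using that[OF V(1-4)] act_lift[OF U b _ V(1,3,4,5)] by blast
qed

section \<open>Module laws of the ideal, checked on local lifts\<close>

lemma act_add_right:
  assumes U: "openin (under S) U" and b: "b \<in> carrier (sec S U)" and j: "j \<in> J U" and k: "k \<in> J U"
  shows "act U b (j \<oplus>\<^bsub>R U\<^esub> k) = act U b j \<oplus>\<^bsub>R U\<^esub> act U b k"
proof -
  interpret h: ring_hom_cring "R U" "sec S U" "aug U" by (rule aug_hom[OF U])
  note ac = act_closed[OF U]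
  note Jc = J_carrier[OF U]
  show "act U b (j \<oplus>\<^bsub>R U\<^esub> k) = act U b j \<oplus>\<^bsub>R U\<^esub> act U b k"
  proof (rule J_eqI[OF U ac[OF b J_add[OF U j k]] J_add[OF U ac[OF b j] ac[OF b k]]])
    fix x assume "x \<in> U"
    then obtain V u where V: "openin (under S) V" "x \<in> V" "V \<subseteq> U" "u \<in> carrier (R V)"
      "\<forall>j\<in>J U. rs U V (act U b j) = u \<otimes>\<^bsub>R V\<^esub> rs U V j"
      by (rule act_local1[OF U _ b])
    interpret V: cring "R V" by (rule R_cring[OF V(1)])
    have "rs U V (act U b (j \<oplus>\<^bsub>R U\<^esub> k)) = rs U V (act U b j \<oplus>\<^bsub>R U\<^esub> act U b k)"
      using V(5)[rule_format, OF j] V(5)[rule_format, OF k] V(5)[rule_format, OF J_add[OF U j k]] rs_add[OF U V(1,3) Jc[OF j] Jc[OF k]]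
        rs_add[OF U V(1,3) Jc[OF ac[OF b j]] Jc[OF ac[OF b k]]] V(4) rs_closed[OF U V(1,3)] Jc j k
      by (simp add: V.r_distr)
    then show "\<exists>V. openin (under S) V \<and> x \<in> V \<and> V \<subseteq> U \<and> rs U V (act U b (j \<oplus>\<^bsub>R U\<^esub> k)) = rs U V (act U b j \<oplus>\<^bsub>R U\<^esub> act U b k)"
      using V by blast
  qed
qed

lemma act_add_left:
  assumes U: "openin (under S) U" and b: "b \<in> carrier (sec S U)" and c: "c \<in> carrier (sec S U)" and j: "j \<in> J U"
  shows "act U (b \<oplus>\<^bsub>sec S U\<^esub> c) j = act U b j \<oplus>\<^bsub>R U\<^esub> act U c j"
proof -
  interpret h: ring_hom_cring "R U" "sec S U" "aug U" by (rule aug_hom[OF U])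
  note ac = act_closed[OF U]
  note Jc = J_carrier[OF U]
  have bc: "b \<oplus>\<^bsub>sec S U\<^esub> c \<in> carrier (sec S U)" using b c by auto
  show "act U (b \<oplus>\<^bsub>sec S U\<^esub> c) j = act U b j \<oplus>\<^bsub>R U\<^esub> act U c j"
  proof (rule J_eqI[OF U ac[OF bc j] J_add[OF U ac[OF b j] ac[OF c j]]])
    fix x assume "x \<in> U"
    then obtain V u w where V: "openin (under S) V" "x \<in> V" "V \<subseteq> U" "u \<in> carrier (R V)" "w \<in> carrier (R V)"
      "aug V u = res S U V b" "aug V w = res S U V c"
      "\<forall>j\<in>J U. rs U V (act U b j) = u \<otimes>\<^bsub>R V\<^esub> rs U V j"
      "\<forall>j\<in>J U. rs U V (act U c j) = w \<otimes>\<^bsub>R V\<^esub> rs U V j"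
      by (rule act_local[OF U _ b c])
    interpret V: ring_hom_cring "R V" "sec S V" "aug V" by (rule aug_hom[OF V(1)])
    have "aug V (u \<oplus>\<^bsub>R V\<^esub> w) = res S U V (b \<oplus>\<^bsub>sec S U\<^esub> c)"
      using V(4-7) S.res_add[OF U V(1,3) b c] by simp
    then have "rs U V (act U (b \<oplus>\<^bsub>sec S U\<^esub> c) j) = (u \<oplus>\<^bsub>R V\<^esub> w) \<otimes>\<^bsub>R V\<^esub> rs U V j"
      using V(4,5) by (intro act_lift[OF U bc j V(1,3)]) auto
    then have "rs U V (act U (b \<oplus>\<^bsub>sec S U\<^esub> c) j) = rs U V (act U b j \<oplus>\<^bsub>R U\<^esub> act U c j)"
      using V(8)[rule_format, OF j] V(9)[rule_format, OF j] V(4,5) rs_closed[OF U V(1,3) Jc[OF j]]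
        rs_add[OF U V(1,3) Jc[OF ac[OF b j]] Jc[OF ac[OF c j]]] by (simp add: V.R.l_distr)
    then show "\<exists>V. openin (under S) V \<and> x \<in> V \<and> V \<subseteq> U \<and> rs U V (act U (b \<oplus>\<^bsub>sec S U\<^esub> c) j) = rs U V (act U b j \<oplus>\<^bsub>R U\<^esub> act U c j)"
      using V by blast
  qed
qed

lemma act_mult:
  assumes U: "openin (under S) U" and b: "b \<in> carrier (sec S U)" and c: "c \<in> carrier (sec S U)" and j: "j \<in> J U"
  shows "act U (b \<otimes>\<^bsub>sec S U\<^esub> c) j = act U b (act U c j)"
proof -
  interpret h: ring_hom_cring "R U" "sec S U" "aug U" by (rule aug_hom[OF U])
  note ac = act_closed[OF U]
  note Jc = J_carrier[OF U]
  have bc: "b \<otimes>\<^bsub>sec S U\<^esub> c \<in> carrier (sec S U)" using b c by auto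
  show "act U (b \<otimes>\<^bsub>sec S U\<^esub> c) j = act U b (act U c j)"
  proof (rule J_eqI[OF U ac[OF bc j] ac[OF b ac[OF c j]]])
    fix x assume "x \<in> U"
    then obtain V u w where V: "openin (under S) V" "x \<in> V" "V \<subseteq> U" "u \<in> carrier (R V)" "w \<in> carrier (R V)"
      "aug V u = res S U V b" "aug V w = res S U V c"
      "\<forall>j\<in>J U. rs U V (act U b j) = u \<otimes>\<^bsub>R V\<^esub> rs U V j"
      "\<forall>j\<in>J U. rs U V (act U c j) = w \<otimes>\<^bsub>R V\<^esub> rs U V j"
      by (rule act_local[OF U _ b c])
    interpret V: ring_hom_cring "R V" "sec S V" "aug V" by (rule aug_hom[OF V(1)])
    have "aug V (u \<otimes>\<^bsub>R V\<^esub> w) = res S U V (b \<otimes>\<^bsub>sec S U\<^esub> c)"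
      using V(4-7) S.res_mult[OF U V(1,3) b c] by simp
    then have "rs U V (act U (b \<otimes>\<^bsub>sec S U\<^esub> c) j) = (u \<otimes>\<^bsub>R V\<^esub> w) \<otimes>\<^bsub>R V\<^esub> rs U V j"
      using V(4,5) by (intro act_lift[OF U bc j V(1,3)]) auto
    then have "rs U V (act U (b \<otimes>\<^bsub>sec S U\<^esub> c) j) = rs U V (act U b (act U c j))"
      using V(8)[rule_format, OF ac[OF c j]] V(9)[rule_format, OF j] V(4,5) rs_closed[OF U V(1,3) Jc[OF j]] by (simp add: V.R.m_assoc)
    then show "\<exists>V. openin (under S) V \<and> x \<in> V \<and> V \<subseteq> U \<and> rs U V (act U (b \<otimes>\<^bsub>sec S U\<^esub> c) j) = rs U V (act U b (act U c j))"
      using V by blast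
  qed
qed

lemma act_one:
  assumes U: "openin (under S) U" and j: "j \<in> J U"
  shows "act U \<one>\<^bsub>sec S U\<^esub> j = j"
proof -
  interpret h: ring_hom_cring "R U" "sec S U" "aug U" by (rule aug_hom[OF U])
  note ac = act_closed[OF U]
  note Jc = J_carrier[OF U]
  show "act U \<one>\<^bsub>sec S U\<^esub> j = j" using act_aug[OF U h.R.one_closed j] Jc[OF j] by simp
qed

lemma act_zero_left:
  assumes U: "openin (under S) U" and j: "j \<in> J U"
  shows "act U \<zero>\<^bsub>sec S U\<^esub> j = \<zero>\<^bsub>R U\<^esub>"
proof -
  interpret h: ring_hom_cring "R U" "sec S U" "aug U" by (rule aug_hom[OF U])
  note ac = act_closed[OF U]
  note Jc = J_carrier[OF U]
  show "act U \<zero>\<^bsub>sec S U\<^esub> j = \<zero>\<^bsub>R U\<^esub>" using act_aug[OF U h.R.zero_closed j] Jc[OF j] by simp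
qed

lemma act_zero_right:
  assumes U: "openin (under S) U" and b: "b \<in> carrier (sec S U)"
  shows "act U b \<zero>\<^bsub>R U\<^esub> = \<zero>\<^bsub>R U\<^esub>"
proof -
  interpret h: ring_hom_cring "R U" "sec S U" "aug U" by (rule aug_hom[OF U])
  note ac = act_closed[OF U]
  note Jc = J_carrier[OF U]
  show "act U b \<zero>\<^bsub>R U\<^esub> = \<zero>\<^bsub>R U\<^esub>"
  proof (rule J_eqI[OF U ac[OF b J_zero[OF U]] J_zero[OF U]])
    fix x assume "x \<in> U"
    then obtain V u where V: "openin (under S) V" "x \<in> V" "V \<subseteq> U" "u \<in> carrier (R V)"
      "\<forall>j\<in>J U. rs U V (act U b j) = u \<otimes>\<^bsub>R V\<^esub> rs U V j"
      by (rule act_local1[OF U _ b])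
    interpret V: cring "R V" by (rule R_cring[OF V(1)])
    have "rs U V (act U b \<zero>\<^bsub>R U\<^esub>) = rs U V \<zero>\<^bsub>R U\<^esub>"
      using V(5)[rule_format, OF J_zero[OF U]] rs_zero[OF _ _ V(3)] U V(1,4) by simp
    then show "\<exists>V. openin (under S) V \<and> x \<in> V \<and> V \<subseteq> U \<and> rs U V (act U b \<zero>\<^bsub>R U\<^esub>) = rs U V \<zero>\<^bsub>R U\<^esub>"
      using V by blast
  qed
qed

section \<open>The sheaf of dual numbers\<close>

abbreviation dn where "dn \<equiv> dual_numbers S M"
abbreviation dr where "dr U \<equiv> dual_ring S M U"

lemma dual_ring_simps [simp]:
  "x \<otimes>\<^bsub>dr U\<^esub> y = Duo (left x \<otimes>\<^bsub>sec S U\<^esub> left y) (act U (left x) (right y) \<oplus>\<^bsub>R U\<^esub> act U (left y) (right x))"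
  "x \<oplus>\<^bsub>dr U\<^esub> y = Duo (left x \<oplus>\<^bsub>sec S U\<^esub> left y) (right x \<oplus>\<^bsub>R U\<^esub> right y)"
  "\<one>\<^bsub>dr U\<^esub> = Duo \<one>\<^bsub>sec S U\<^esub> \<zero>\<^bsub>R U\<^esub>"
  "\<zero>\<^bsub>dr U\<^esub> = Duo \<zero>\<^bsub>sec S U\<^esub> \<zero>\<^bsub>R U\<^esub>"
  by (simp_all add: dual_ring_def Let_def)

lemma dual_carrier_Duo [simp]: "Duo a m \<in> carrier (dr U) \<longleftrightarrow> a \<in> carrier (sec S U) \<and> m \<in> J U"
  by (auto simp: dual_ring_def Let_def)

lemma dual_carrierE:
  assumes "x \<in> carrier (dr U)"
  obtains a m where "x = Duo a m" "a \<in> carrier (sec S U)" "m \<in> J U"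
  using assms by (auto simp: dual_ring_def Let_def)

lemma dual_numbers_simps [simp]:
  "under dn = under S" "sec dn = dual_ring S M"
  "res dn U V x = Duo (res S U V (left x)) (rs U V (right x))"
  by (simp_all add: dual_numbers_def)

lemma dual_cring:
  assumes U: "openin (under S) U"
  shows "cring (dr U)"
proof -
  interpret h: ring_hom_cring "R U" "sec S U" "aug U" by (rule aug_hom[OF U])
  note a = act_closed[OF U] J_add[OF U] J_zero[OF U] J_uminus[OF U] J_carrier[OF U]
  have J1: "x \<in> J U \<Longrightarrow> x \<in> carrier (R U)" for x by (rule J_carrier[OF U])
  \<comment> \<open>Associativity of the product compares the two orders in which base sections act;
    they agree because the base ring is commutative.\<close>
  have comm: "act U b (act U c j) = act U c (act U b j)"
    if "b \<in> carrier (sec S U)" "c \<in> carrier (sec S U)" "j \<in> J U" for b c j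
    using act_mult[OF U that] act_mult[OF U that(2,1,3)] h.S.m_comm[OF that(1,2)] by simp
  show ?thesis
  proof (intro cringI abelian_groupI comm_monoidI)
    fix x y assume "x \<in> carrier (dr U)" "y \<in> carrier (dr U)"
    then obtain b j c k where xy: "x = Duo b j" "y = Duo c k" and
      c: "b \<in> carrier (sec S U)" "j \<in> J U" "c \<in> carrier (sec S U)" "k \<in> J U" by (metis dual_carrierE)
    show "x \<otimes>\<^bsub>dr U\<^esub> y \<in> carrier (dr U)" "x \<oplus>\<^bsub>dr U\<^esub> y \<in> carrier (dr U)" using c by (simp_all add: xy a)
    show "x \<otimes>\<^bsub>dr U\<^esub> y = y \<otimes>\<^bsub>dr U\<^esub> x" "x \<oplus>\<^bsub>dr U\<^esub> y = y \<oplus>\<^bsub>dr U\<^esub> x"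
      using c J1[OF a(1)[OF c(1,4)]] J1[OF a(1)[OF c(3,2)]] J1[OF c(2)] J1[OF c(4)]
      by (simp_all add: xy h.S.m_comm h.S.a_comm h.R.a_comm)
    fix z assume "z \<in> carrier (dr U)"
    then obtain d l where z: "z = Duo d l" and d: "d \<in> carrier (sec S U)" "l \<in> J U" by (metis dual_carrierE)
    note jj = J1[OF c(2)] J1[OF c(4)] J1[OF d(2)]
    show "x \<oplus>\<^bsub>dr U\<^esub> y \<oplus>\<^bsub>dr U\<^esub> z = x \<oplus>\<^bsub>dr U\<^esub> (y \<oplus>\<^bsub>dr U\<^esub> z)"
      using c d jj by (simp add: xy z h.S.a_assoc h.R.a_assoc)
    have cl: "act U p q \<in> carrier (R U)" if "p \<in> carrier (sec S U)" "q \<in> J U" for p q using J1[OF a(1)[OF that]] .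
    show "(x \<oplus>\<^bsub>dr U\<^esub> y) \<otimes>\<^bsub>dr U\<^esub> z = x \<otimes>\<^bsub>dr U\<^esub> z \<oplus>\<^bsub>dr U\<^esub> y \<otimes>\<^bsub>dr U\<^esub> z"
      using c d jj act_add_left[OF U c(1,3) d(2)] act_add_right[OF U d(1) c(2,4)] cl
      by (simp add: xy z h.S.l_distr h.R.a_ac)
    have 1: "act U d (act U b k \<oplus>\<^bsub>R U\<^esub> act U c j) = act U d (act U b k) \<oplus>\<^bsub>R U\<^esub> act U d (act U c j)"
      by (rule act_add_right[OF U d(1) a(1)[OF c(1,4)] a(1)[OF c(3,2)]])
    have 2: "act U b (act U c l \<oplus>\<^bsub>R U\<^esub> act U d k) = act U b (act U c l) \<oplus>\<^bsub>R U\<^esub> act U b (act U d k)"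
      by (rule act_add_right[OF U c(1) a(1)[OF c(3) d(2)] a(1)[OF d(1) c(4)]])
    have 3: "act U (b \<otimes>\<^bsub>sec S U\<^esub> c) l = act U b (act U c l)" by (rule act_mult[OF U c(1,3) d(2)])
    have 4: "act U (c \<otimes>\<^bsub>sec S U\<^esub> d) j = act U d (act U c j)"
      using act_mult[OF U c(3) d(1) c(2)] comm[OF c(3) d(1) c(2)] by simp
    have 5: "act U d (act U b k) = act U b (act U d k)" by (rule comm[OF d(1) c(1,4)])
    have cl3: "act U b (act U c l) \<in> carrier (R U)" "act U b (act U d k) \<in> carrier (R U)" "act U d (act U c j) \<in> carrier (R U)"
      using c d a(1) cl by auto
    show "x \<otimes>\<^bsub>dr U\<^esub> y \<otimes>\<^bsub>dr U\<^esub> z = x \<otimes>\<^bsub>dr U\<^esub> (y \<otimes>\<^bsub>dr U\<^esub> z)"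
      using c d cl3 by (simp add: xy z 1 2 3 4 5 h.S.m_assoc h.R.a_assoc)
  next
    fix x assume "x \<in> carrier (dr U)"
    then obtain b j where x: "x = Duo b j" "b \<in> carrier (sec S U)" "j \<in> J U" by (rule dual_carrierE)
    show "\<one>\<^bsub>dr U\<^esub> \<otimes>\<^bsub>dr U\<^esub> x = x"
      using x act_one[OF U x(3)] act_zero_right[OF U x(2)] J1[OF x(3)] by simp
    show "\<zero>\<^bsub>dr U\<^esub> \<oplus>\<^bsub>dr U\<^esub> x = x" using x J1[OF x(3)] by simp
    show "\<exists>y\<in>carrier (dr U). y \<oplus>\<^bsub>dr U\<^esub> x = \<zero>\<^bsub>dr U\<^esub>"
      using x J_uminus[OF U x(3)] J1[OF x(3)]
      by (intro bexI[of _ "Duo (\<ominus>\<^bsub>sec S U\<^esub> b) (\<ominus>\<^bsub>R U\<^esub> j)"]) (auto simp: h.S.l_neg h.R.l_neg)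
  qed (auto simp: J_zero[OF U])
qed

lemma dual_res_hom:
  assumes U: "openin (under S) U" and V: "openin (under S) V" "V \<subseteq> U"
  shows "res dn U V \<in> ring_hom (dr U) (dr V)"
proof (rule ring_hom_memI)
  fix x assume "x \<in> carrier (dr U)"
  then obtain b j where x: "x = Duo b j" "b \<in> carrier (sec S U)" "j \<in> J U" by (rule dual_carrierE)
  then show "res dn U V x \<in> carrier (dr V)" using S.res_closed[OF U V] J_res[OF U V] by simp
  fix y assume "y \<in> carrier (dr U)"
  then obtain c k where y: "y = Duo c k" "c \<in> carrier (sec S U)" "k \<in> J U" by (rule dual_carrierE)
  note Jc = J_carrier[OF U]
  show "res dn U V (x \<otimes>\<^bsub>dr U\<^esub> y) = res dn U V x \<otimes>\<^bsub>dr V\<^esub> res dn U V y"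
    using x y S.res_mult[OF U V x(2) y(2)] rs_add[OF U V, of "act U b k" "act U c j"]
      act_res[OF U V x(2) y(3)] act_res[OF U V y(2) x(3)] Jc[OF act_closed[OF U x(2) y(3)]] Jc[OF act_closed[OF U y(2) x(3)]]
    by simp
  show "res dn U V (x \<oplus>\<^bsub>dr U\<^esub> y) = res dn U V x \<oplus>\<^bsub>dr V\<^esub> res dn U V y"
    using x y S.res_add[OF U V x(2) y(2)] rs_add[OF U V Jc[OF x(3)] Jc[OF y(3)]] by simp
qed (use S.res_one[OF U V] rs_zero[OF _ _ V(2)] U V in simp)

text \<open>The sheaf axioms hold componentwise; that a glued second component lies in the ideal is
  checked locally.\<close>

lemma dual_ringed: "ringed_space dn"
proof (rule ringed_spaceI; (unfold dual_numbers_simps(1,2))?)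
  show "cring (dr U)" if "openin (under S) U" for U by (rule dual_cring[OF that])
  show "res dn U V \<in> ring_hom (dr U) (dr V)" if "openin (under S) U" "openin (under S) V" "V \<subseteq> U" for U V
    by (rule dual_res_hom[OF that])
next
  fix U s assume "openin (under S) U" "s \<in> carrier (dr U)"
  then show "res dn U U s = s"
    using S.res_id rs_id J_carrier by (auto elim!: dual_carrierE)
next
  fix U V W s assume o: "openin (under S) U" "openin (under S) V" "openin (under S) W" "W \<subseteq> V" "V \<subseteq> U" and s: "s \<in> carrier (dr U)"
  then show "res dn V W (res dn U V s) = res dn U W s"
    using S.res_res[OF o] rs_rs[of U V W] J_carrier[OF o(1)] by (auto elim!: dual_carrierE)
next
  fix \<V> s t assume V: "\<V> \<subseteq> opens S" and s: "s \<in> carrier (dr (\<Union>\<V>))" and t: "t \<in> carrier (dr (\<Union>\<V>))"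
    and eq: "\<And>V. V \<in> \<V> \<Longrightarrow> res dn (\<Union>\<V>) V s = res dn (\<Union>\<V>) V t"
  have oU: "openin (under S) (\<Union>\<V>)" using V by (intro openin_Union) auto
  have "left s = left t"
    by (rule S.separated_cover[of \<V>]) (use V s t eq in \<open>auto elim!: dual_carrierE\<close>)
  moreover have "right s = right t"
    by (rule A.E.separated_cover[of \<V>]) (use V s t eq J_carrier[OF oU] in \<open>auto elim!: dual_carrierE\<close>)
  ultimately show "s = t" using s t by (auto elim!: dual_carrierE)
next
  fix \<V> s assume V: "\<V> \<subseteq> opens S" and s: "\<And>V. V \<in> \<V> \<Longrightarrow> s V \<in> carrier (dr V)"
    and eq: "\<And>V W. V \<in> \<V> \<Longrightarrow> W \<in> \<V> \<Longrightarrow> res dn V (V \<inter> W) (s V) = res dn W (V \<inter> W) (s W)"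
  have oU: "openin (under S) (\<Union>\<V>)" using V by (intro openin_Union) auto
  have c: "left (s V) \<in> carrier (sec S V)" "right (s V) \<in> J V" "s V = Duo (left (s V)) (right (s V))" if "V \<in> \<V>" for V
    using s[OF that] by (auto elim!: dual_carrierE)
  have c': "right (s V) \<in> carrier (R V)" if "V \<in> \<V>" for V using c(2)[OF that] J_carrier[of V] V that by auto
  have e: "res S V (V \<inter> W) (left (s V)) = res S W (V \<inter> W) (left (s W))"
    "rs V (V \<inter> W) (right (s V)) = rs W (V \<inter> W) (right (s W))" if "V \<in> \<V>" "W \<in> \<V>" for V W
    using eq[OF that] by simp_all
  obtain t where t: "t \<in> carrier (sec S (\<Union>\<V>))" "\<And>V. V \<in> \<V> \<Longrightarrow> res S (\<Union>\<V>) V t = left (s V)"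
    using S.glue_cover[of \<V> "\<lambda>V. left (s V)", OF V c(1) e(1)] by blast
  obtain t' where t': "t' \<in> carrier (R (\<Union>\<V>))" "\<And>V. V \<in> \<V> \<Longrightarrow> rs (\<Union>\<V>) V t' = right (s V)"
    using A.E.glue_cover[of \<V> "\<lambda>V. right (s V)", unfolded pulled_simps, OF V c' e(2)] by blast
  interpret h: ring_hom_cring "R (\<Union>\<V>)" "sec S (\<Union>\<V>)" "aug (\<Union>\<V>)" by (rule aug_hom[OF oU])
  have "aug (\<Union>\<V>) t' = \<zero>\<^bsub>sec S (\<Union>\<V>)\<^esub>"
  proof (rule S.separated_cover[OF V])
    fix V assume VV: "V \<in> \<V>"
    then have o: "openin (under S) V" "V \<subseteq> \<Union>\<V>" using V by auto
    show "res S (\<Union>\<V>) V (aug (\<Union>\<V>) t') = res S (\<Union>\<V>) V \<zero>\<^bsub>sec S (\<Union>\<V>)\<^esub>"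
      using shf_res[OF oU o t'(1)] t'(2)[OF VV] c(2)[OF VV] S.res_zero[OF oU o] by (simp add: J_iff[OF o(1)])
  qed (use t' in auto)
  then have "t' \<in> J (\<Union>\<V>)" using t' by (simp add: J_iff[OF oU])
  then show "\<exists>t\<in>carrier (dr (\<Union>\<V>)). \<forall>V\<in>\<V>. res dn (\<Union>\<V>) V t = s V"
    using t t' c(3) by (intro bexI[of _ "Duo t t'"]) auto
qed

lemma left_dual_hom: "left \<in> ring_hom (dr U) (sec S U)"
  by (rule ring_hom_memI) (auto elim!: dual_carrierE)

lemma unit_hom:
  assumes U: "openin (under S) U"
  shows "(\<lambda>b. Duo b \<zero>\<^bsub>R U\<^esub>) \<in> ring_hom (sec S U) (dr U)"
proof -
  interpret h: ring_hom_cring "R U" "sec S U" "aug U" by (rule aug_hom[OF U])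
  show ?thesis
    using J_zero[OF U] act_zero_right[OF U] by (intro ring_hom_memI) auto
qed

text \<open>The lift \<open>b + 0 \<epsilon>\<close> exists over the whole of \<open>U\<close>, and
  the kernel has square zero since 0 acts as zero.\<close>

lemma dual_augmentation: "augmentation S dn (\<lambda>U. left)"
proof (intro augmentation.intro augmentation_axioms.intro S.sheaf_space_axioms sheaf_space.intro dual_ringed;
    (unfold dual_numbers_simps(1,2))?)
  show "left \<in> ring_hom (dr U) (sec S U)" for U by (rule left_dual_hom)
next
  fix U b x assume U: "openin (under S) U" and b: "b \<in> carrier (sec S U)" and x: "x \<in> U"
  then show "\<exists>V u. openin (under S) V \<and> x \<in> V \<and> V \<subseteq> U \<and> u \<in> carrier (dr V) \<and> left u = res S U V b"
    using J_zero[OF U] S.res_id[OF U b] by (intro exI[of _ U] exI[of _ "Duo b \<zero>\<^bsub>R U\<^esub>"]) auto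
next
  fix U c d assume U: "openin (under S) U" and cd: "c \<in> carrier (dr U)" "d \<in> carrier (dr U)"
    "left c = \<zero>\<^bsub>sec S U\<^esub>" "left d = \<zero>\<^bsub>sec S U\<^esub>"
  interpret h: ring_hom_cring "R U" "sec S U" "aug U" by (rule aug_hom[OF U])
  show "c \<otimes>\<^bsub>dr U\<^esub> d = \<zero>\<^bsub>dr U\<^esub>"
    using cd act_zero_left[OF U] by (auto elim!: dual_carrierE)
qed auto

end

section \<open>Quasi-coherence of the ideal and charts of the constructed spaces\<close>

context square_zero
begin

lemma act_zero_zero [simp]: "openin (under S) U \<Longrightarrow> act U \<zero>\<^bsub>sec S U\<^esub> \<zero>\<^bsub>R U\<^esub> = \<zero>\<^bsub>R U\<^esub>"
  using act_zero_left J_zero by blast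

text \<open>The annihilator is taken in \<open>T\<close>; its image in \<open>S\<close> has the same
  locus and serves as the denominator in \<open>split_chart\<close>.\<close>

lemma ideal_locally_zero:
  assumes C: "affine_chart (pulled S T i) W (R W) id" and V: "openin (under S) V" "V \<subseteq> W" "x \<in> V"
    and m: "m \<in> J W" "rs W V m = \<zero>\<^bsub>R V\<^esub>"
  obtains g where "g \<in> carrier (R W)" "germ_unit S x W (aug W g)" "g \<otimes>\<^bsub>R W\<^esub> m = \<zero>\<^bsub>R W\<^esub>"
proof -
  interpret C: affine_chart "pulled S T i" W "R W" id by (rule C)
  have W: "openin (under S) W" using C.open_chart by simp
  obtain g where g: "g \<in> carrier (R W)" "x \<in> A.E.D W g" "g \<otimes>\<^bsub>R W\<^esub> m = \<zero>\<^bsub>R W\<^esub>"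
    using C.locally_zero[of V x m] V m J_carrier[OF W m(1)] by auto
  then have "x \<in> S.D W (aug W g)" using A.D_aug[OF W, of g] by simp
  then show ?thesis using that g by (auto simp: S.D_def)
qed

text \<open>This is quasi-coherence of the ideal: since the locus where \<open>g\<close> is invertible is the same in
  \<open>S\<close> and \<open>T\<close>, a numerator vanishing on it in \<open>S\<close> vanishes globally after multiplication by a
  power of \<open>g\<close>.\<close>

lemma ideal_locally_fraction:
  assumes CS: "affine_chart S W (sec S W) id" and C: "affine_chart (pulled S T i) W (R W) id"
    and V: "openin (under S) V" "V \<subseteq> W" "x \<in> V" and j: "j \<in> J V"
  obtains Y g m where "openin (under S) Y" "x \<in> Y" "Y \<subseteq> V" "g \<in> carrier (R W)" "germ_unit S x W (aug W g)"
    "m \<in> J W" "rs W Y g \<otimes>\<^bsub>R Y\<^esub> rs V Y j = rs W Y m"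
proof -
  interpret C: affine_chart "pulled S T i" W "R W" id by (rule C)
  interpret CS: affine_chart S W "sec S W" id by (rule CS)
  have W: "openin (under S) W" using C.open_chart by simp
  interpret h: ring_hom_cring "R W" "sec S W" "aug W" by (rule aug_hom[OF W])
  have xW: "x \<in> W" using V by blast
  obtain Y0 a f where Y0: "openin (under S) Y0" "x \<in> Y0" "Y0 \<subseteq> V" "a \<in> carrier (R W)" "f \<in> carrier (R W)"
    "x \<in> A.E.D W f" "rs W Y0 f \<otimes>\<^bsub>R Y0\<^esub> rs V Y0 j = rs W Y0 a"
    using C.locally_fraction[of V x j] V J_carrier[OF V(1) j] by auto
  obtain g where g: "g \<in> carrier (R W)" "x \<in> A.E.D W g" "A.E.D W g \<subseteq> Y0"
    using C.basis[of Y0 x] Y0 V by auto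
  define Y where "Y = A.E.D W g"
  have YS: "Y = S.D W (aug W g)" unfolding Y_def using A.D_aug[OF W, of g] g by simp
  have ag: "aug W g \<in> carrier (sec S W)" "aug W a \<in> carrier (sec S W)" "aug W f \<in> carrier (sec S W)" using g Y0 by auto
  have Y: "openin (under S) Y" "Y \<subseteq> W" "Y \<subseteq> Y0" "Y \<subseteq> V" "x \<in> Y"
    using S.openin_D[OF W ag(1)] YS S.D_subset[of W] g Y0 Y_def by auto
  have Y0W: "Y0 \<subseteq> W" using Y0 V by blast
  interpret hY: ring_hom_cring "R Y" "sec S Y" "aug Y" by (rule aug_hom[OF Y(1)])
  have fa: "rs W Y f \<otimes>\<^bsub>R Y\<^esub> rs V Y j = rs W Y a"
  proof -
    have "rs Y0 Y (rs W Y0 f \<otimes>\<^bsub>R Y0\<^esub> rs V Y0 j) = rs Y0 Y (rs W Y0 a)" using Y0(7) by simp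
    then show ?thesis
      using rs_mult[OF Y0(1) Y(1,3) rs_closed[OF W Y0(1) Y0W Y0(5)] rs_closed[OF V(1) Y0(1,3) J_carrier[OF V(1) j]]]
        rs_rs[OF W Y0(1) Y(1,3) Y0W] rs_rs[OF V(1) Y0(1) Y(1,3) Y0(3) J_carrier[OF V(1) j]] Y0(4,5) by simp
  qed
  have rc: "rs W Y f \<in> carrier (R Y)" "rs V Y j \<in> J Y"
    using rs_closed[OF W Y(1,2) Y0(5)] J_res[OF V(1) Y(1,4) j] by auto
  \<comment> \<open>Over \<open>Y\<close> the numerator \<open>a\<close> equals \<open>f j\<close>,
    an element of the ideal, so its image in \<open>S\<close> vanishes there.\<close>
  have "res S W Y (aug W a) = \<zero>\<^bsub>sec S Y\<^esub>"
    using shf_res[OF W Y(1,2) Y0(4)] J_mult[OF Y(1) rc] by (simp add: fa[symmetric] J_iff[OF Y(1)])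
  then have "CS.phi (S.D W (id (aug W g))) (aug W a) = \<zero>\<^bsub>sec S (S.D W (id (aug W g)))\<^esub>"
    using YS by (simp add: CS.phi_def)
  then obtain n where n: "aug W g [^]\<^bsub>sec S W\<^esub> (n::nat) \<otimes>\<^bsub>sec S W\<^esub> aug W a = \<zero>\<^bsub>sec S W\<^esub>"
    using CS.zero_on_D[OF ag(1,2)] by blast
  \<comment> \<open>With this power of \<open>g\<close> the section \<open>u a\<close> has zero
    image over all of \<open>W\<close>, hence lies in the ideal: it is the numerator belonging to
    the denominator \<open>u f\<close>.\<close>
  define u where "u = g [^]\<^bsub>R W\<^esub> n"
  have u: "u \<in> carrier (R W)" using g by (simp add: u_def)
  have au: "aug W u = aug W g [^]\<^bsub>sec S W\<^esub> n"
    unfolding u_def by (rule ring_hom_ring.hom_nat_pow[OF ring_hom_ringI2]) (use g h.homh S.sec_ring[OF W] A.E.sec_ring[of W] W in auto)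
  have "aug W (u \<otimes>\<^bsub>R W\<^esub> a) = \<zero>\<^bsub>sec S W\<^esub>" using u Y0(4) n by (simp add: au)
  then have m: "u \<otimes>\<^bsub>R W\<^esub> a \<in> J W" using u Y0(4) by (simp add: J_iff[OF W])
  have uf: "u \<otimes>\<^bsub>R W\<^esub> f \<in> carrier (R W)" using u Y0 by simp
  have "germ_unit S x W (aug W g)" using Y(5) YS by (simp add: S.D_def)
  moreover have "germ_unit S x W (aug W f)" using Y0(5,6) A.D_aug[OF W, of f] by (simp add: S.D_def)
  ultimately have "germ_unit S x W (aug W (u \<otimes>\<^bsub>R W\<^esub> f))"
    using u Y0(5) ag S.germ_unit_pow[OF W xW ag(1)] S.germ_unit_mult[OF W xW] au by simp
  moreover have "rs W Y (u \<otimes>\<^bsub>R W\<^esub> f) \<otimes>\<^bsub>R Y\<^esub> rs V Y j = rs W Y (u \<otimes>\<^bsub>R W\<^esub> a)"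
    using rs_mult[OF W Y(1,2) u Y0(5)] rs_mult[OF W Y(1,2) u Y0(4)] fa rc J_carrier[OF Y(1) rc(2)] rs_closed[OF W Y(1,2) u]
    by (simp add: hY.R.m_assoc)
  ultimately show ?thesis using that[OF Y(1,5,4) uf _ m] by blast
qed

text \<open>Split by the zero section \<open>b + 0 \<epsilon>\<close>. A base section multiplies the
  kernel through its action on the ideal, so \<open>ideal_locally_zero\<close> and
  \<open>ideal_locally_fraction\<close> are the conditions that \<open>split_chart\<close>
  wants.\<close>

lemma dual_chart:
  assumes CS: "affine_chart S W (sec S W) id" and C: "affine_chart (pulled S T i) W (R W) id"
  shows "affine_chart dn W (sec dn W) id"
proof (rule augmentation.split_chart[OF dual_augmentation CS])
  have W: "openin (under S) W" using affine_chart.open_chart[OF CS] .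
  interpret h: ring_hom_cring "R W" "sec S W" "aug W" by (rule aug_hom[OF W])
  let ?s = "\<lambda>U b. Duo b \<zero>\<^bsub>R U\<^esub>"
  show "?s U \<in> ring_hom (sec S U) (sec dn U)" if "openin (under S) U" for U using unit_hom[OF that] by simp
  show "res dn U V (?s U b) = ?s V (res S U V b)"
    if "openin (under S) U" "openin (under S) V" "V \<subseteq> U" "b \<in> carrier (sec S U)" for U V b
    using rs_zero[of U V] that by simp
  show "left (?s U b) = b" for U b by simp
  fix V x n assume V: "openin (under S) V" "V \<subseteq> W" "x \<in> V"
  {
    assume n: "n \<in> carrier (sec dn W)" "left n = \<zero>\<^bsub>sec S W\<^esub>" "res dn W V n = \<zero>\<^bsub>sec dn V\<^esub>"
    then obtain m where m: "n = Duo \<zero>\<^bsub>sec S W\<^esub> m" "m \<in> J W" by (auto elim!: dual_carrierE)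
    then have "rs W V m = \<zero>\<^bsub>R V\<^esub>" using n by simp
    then obtain g where g: "g \<in> carrier (R W)" "germ_unit S x W (aug W g)" "g \<otimes>\<^bsub>R W\<^esub> m = \<zero>\<^bsub>R W\<^esub>"
      using ideal_locally_zero[OF C V m(2)] by blast
    have "?s W (aug W g) \<otimes>\<^bsub>sec dn W\<^esub> n = \<zero>\<^bsub>sec dn W\<^esub>"
      using m g act_aug[OF W g(1) m(2)] W by simp
    then show "\<exists>h\<in>carrier (sec S W). germ_unit S x W h \<and> ?s W h \<otimes>\<^bsub>sec dn W\<^esub> n = \<zero>\<^bsub>sec dn W\<^esub>"
      using g by (intro bexI[of _ "aug W g"]) auto
  }
  {
    assume n: "n \<in> carrier (sec dn V)" "left n = \<zero>\<^bsub>sec S V\<^esub>"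
    then obtain j where j: "n = Duo \<zero>\<^bsub>sec S V\<^esub> j" "j \<in> J V" by (auto elim!: dual_carrierE)
    obtain Y g m where Y: "openin (under S) Y" "x \<in> Y" "Y \<subseteq> V" "g \<in> carrier (R W)" "germ_unit S x W (aug W g)"
      "m \<in> J W" "rs W Y g \<otimes>\<^bsub>R Y\<^esub> rs V Y j = rs W Y m"
      using ideal_locally_fraction[OF CS C V j(2)] by blast
    have YW: "Y \<subseteq> W" using Y V by blast
    interpret hY: ring_hom_cring "R Y" "sec S Y" "aug Y" by (rule aug_hom[OF Y(1)])
    have gY: "rs W Y g \<in> carrier (R Y)" "aug Y (rs W Y g) = res S W Y (aug W g)"
      using rs_closed[OF W Y(1) YW Y(4)] shf_res[OF W Y(1) YW Y(4)] by auto
    have jY: "rs V Y j \<in> J Y" using J_res[OF V(1) Y(1,3) j(2)] .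
    have "act Y (res S W Y (aug W g)) (rs V Y j) = rs W Y m" using act_aug[OF Y(1) gY(1) jY] gY(2) Y(7) by simp
    moreover have "res S W Y (aug W g) \<in> carrier (sec S Y)" using gY hY.hom_closed by metis
    moreover have "rs W Y m \<in> carrier (R Y)" using J_carrier[OF Y(1) J_res[OF W Y(1) YW Y(6)]] .
    ultimately have "res dn W Y (?s W (aug W g)) \<otimes>\<^bsub>sec dn Y\<^esub> res dn V Y n = res dn W Y (Duo \<zero>\<^bsub>sec S W\<^esub> m)"
      using j rs_zero[of W Y] S.res_zero[OF V(1) Y(1,3)] S.res_zero[OF W Y(1) YW] W Y(1) YW by simp
    then show "\<exists>Y h m. openin (under S) Y \<and> x \<in> Y \<and> Y \<subseteq> V \<and> h \<in> carrier (sec S W) \<and> germ_unit S x W h \<and>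
          m \<in> carrier (sec dn W) \<and> left m = \<zero>\<^bsub>sec S W\<^esub> \<and>
          res dn W Y (?s W h) \<otimes>\<^bsub>sec dn Y\<^esub> res dn V Y n = res dn W Y m"
      using Y by (intro exI[of _ Y] exI[of _ "aug W g"] exI[of _ "Duo \<zero>\<^bsub>sec S W\<^esub> m"]) auto
  }
qed

abbreviation incd where "incd \<equiv> inclusion S dn (\<lambda>U. left)"

lemma dual_scheme: "scheme dn"
  unfolding scheme_def
proof (intro conjI dual_ringed ballI)
  fix x assume "x \<in> pts dn"
  then obtain W where "x \<in> W" "affine_chart S W (sec S W) id" "affine_chart (pulled S T i) W (sec (pulled S T i) W) id"
    using common_chart[of x] by auto
  then show "\<exists>U. x \<in> U \<and> affine_open dn U"
    using dual_chart affine_chart_imp_affine_open[of dn W "sec dn W" id] by auto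
qed

lemma thick_dual: "thickening S dn incd"
  by (rule augmentation.thickening_inclusion[OF dual_augmentation schemes(1) dual_scheme])

lemma I_pointed_eq: "I_pointed S M = (dn, incd)"
  by (simp add: I_pointed_def inclusion_def)

lemma incd_image [simp]: "openin (under S) U \<Longrightarrow> ptf incd ` U = U"
  using image_inclusion[OF openin_subset] by (simp add: inclusion_def)

lemma incd_shf [simp]: "openin (under S) U \<Longrightarrow> x \<in> carrier (dr U) \<Longrightarrow> shf incd U x = left x"
  by (simp add: inclusion_def)

text \<open>Split over \<open>T'\<close> by completing \<open>t\<close> with its image in
  \<open>S\<close> and zero \<epsilon>-part; the kernel is again the ideal of \<open>T\<close>. The
  denominators provided by the ideal lemmas live in \<open>R W\<close> and matter only through their
  images in \<open>S\<close>; \<open>lft\<close> lifts these images to \<open>T'\<close>, which is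
  the base of the splitting.\<close>

lemma amalg_chart:
  assumes k: "thickening S T' k" and CS: "affine_chart S W (sec S W) id" and C: "affine_chart (pulled S T i) W (R W) id"
    and C': "affine_chart (pulled S T' k) W (sec (pulled S T' k) W) id"
    and lft: "\<And>g. g \<in> carrier (R W) \<Longrightarrow> \<exists>h\<in>carrier (sec T' (ptf k ` W)). shf k (ptf k ` W) h = aug W g"
  shows "affine_chart (amalg_space S (T', k) (dn, incd)) W (sec (amalg_space S (T', k) (dn, incd)) W) id"
proof -
  interpret am: amalgamation S T' k dn incd using k thick_dual by (simp add: amalgamation_def thickenings_def)
  let ?am = "amalg_space S (T', k) (dn, incd)"
  let ?B = "\<lambda>U. sec T' (ptf k ` U)" and ?b = "\<lambda>U. shf k (ptf k ` U)"
  let ?s = "\<lambda>U t. Duo t (Duo (?b U t) \<zero>\<^bsub>R U\<^esub>)"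
  have W: "openin (under S) W" using affine_chart.open_chart[OF CS] .
  have dec: "\<exists>m\<in>J U. n = Duo \<zero>\<^bsub>?B U\<^esub> (Duo \<zero>\<^bsub>sec S U\<^esub> m)"
    if U: "openin (under S) U" and n: "n \<in> carrier (sec ?am U)" "left n = \<zero>\<^bsub>?B U\<^esub>" for U n
  proof -
    interpret b: ring_hom_cring "?B U" "sec S U" "?b U" by (rule am.homA[OF U])
    obtain d where d: "n = Duo \<zero>\<^bsub>?B U\<^esub> d" "d \<in> carrier (dr U)" "?b U \<zero>\<^bsub>?B U\<^esub> = shf incd U d"
      using n U by (auto elim!: amalg_carrierE)
    then show ?thesis using U by (auto elim!: dual_carrierE)
  qed
  have m_in: "Duo \<zero>\<^bsub>?B U\<^esub> (Duo \<zero>\<^bsub>sec S U\<^esub> m) \<in> carrier (sec ?am U)" if U: "openin (under S) U" and m: "m \<in> J U" for U m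
  proof -
    interpret b: ring_hom_cring "?B U" "sec S U" "?b U" by (rule am.homA[OF U])
    show ?thesis using U m by simp
  qed
  \<comment> \<open>A section of \<open>T'\<close> multiplies the kernel only through its image in
    \<open>S\<close>, so it can be traded for any \<open>g\<close> in \<open>R U\<close> with the
    same image.\<close>
  have prod: "Duo t (Duo (?b U t) \<zero>\<^bsub>R U\<^esub>) \<otimes>\<^bsub>sec ?am U\<^esub> Duo \<zero>\<^bsub>?B U\<^esub> (Duo \<zero>\<^bsub>sec S U\<^esub> m) =
      Duo \<zero>\<^bsub>?B U\<^esub> (Duo \<zero>\<^bsub>sec S U\<^esub> (g \<otimes>\<^bsub>R U\<^esub> m))"
    if U: "openin (under S) U" and "t \<in> carrier (?B U)" "g \<in> carrier (R U)" "m \<in> J U" "?b U t = aug U g" for U t g m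
  proof -
    interpret b: ring_hom_cring "?B U" "sec S U" "?b U" by (rule am.homA[OF U])
    interpret h: ring_hom_cring "R U" "sec S U" "aug U" by (rule aug_hom[OF U])
    show ?thesis using that act_aug[OF U that(3,4)] J_carrier[OF U that(4)] by simp
  qed
  show ?thesis
  proof (rule augmentation.split_chart[OF am.amalg_augmentation_left C', where \<sigma> = ?s]; (unfold pulled_simps)?)
    fix U assume U: "openin (under S) U"
    interpret b: ring_hom_cring "?B U" "sec S U" "?b U" by (rule am.homA[OF U])
    interpret h: ring_hom_cring "R U" "sec S U" "aug U" by (rule aug_hom[OF U])
    show "?s U \<in> ring_hom (?B U) (sec ?am U)"
      using U J_zero[OF U] act_zero_right[OF U] by (intro ring_hom_memI) auto
    fix V t assume V: "openin (under S) V" "V \<subseteq> U" and t: "t \<in> carrier (?B U)"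
    show "res ?am U V (?s U t) = ?s V (res T' (ptf k ` U) (ptf k ` V) t)"
      using U V am.A.shf_res[OF U V t] rs_zero[of U V] by simp
  next
    show "left (?s U t) = t" for U t by simp
  next
    fix V x n assume V: "openin (under S) V" "V \<subseteq> W" "x \<in> V" and n: "n \<in> carrier (sec ?am W)" "left n = \<zero>\<^bsub>?B W\<^esub>"
      "res ?am W V n = \<zero>\<^bsub>sec ?am V\<^esub>"
    obtain m where m: "m \<in> J W" "n = Duo \<zero>\<^bsub>?B W\<^esub> (Duo \<zero>\<^bsub>sec S W\<^esub> m)" using dec[OF W n(1,2)] by blast
    have "rs W V m = \<zero>\<^bsub>R V\<^esub>" using n(3) m V(1) W by simp
    then obtain g where g: "g \<in> carrier (R W)" "germ_unit S x W (aug W g)" "g \<otimes>\<^bsub>R W\<^esub> m = \<zero>\<^bsub>R W\<^esub>"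
      using ideal_locally_zero[OF C V m(1)] by blast
    obtain h where h: "h \<in> carrier (?B W)" "?b W h = aug W g" using lft[OF g(1)] by blast
    have xW: "x \<in> W" using V by blast
    have "germ_unit (pulled S T' k) x W h"
      using am.A.A.germ_unit_aug[OF W xW, of h] h g by simp
    moreover have "?s W h \<otimes>\<^bsub>sec ?am W\<^esub> n = \<zero>\<^bsub>sec ?am W\<^esub>"
      unfolding m(2) prod[OF W h(1) g(1) m(1) h(2)] using g(3) W by simp
    ultimately show "\<exists>h\<in>carrier (?B W). germ_unit (pulled S T' k) x W h \<and> ?s W h \<otimes>\<^bsub>sec ?am W\<^esub> n = \<zero>\<^bsub>sec ?am W\<^esub>"
      using h by blast
  next
    fix V x n assume V: "openin (under S) V" "V \<subseteq> W" "x \<in> V" and n: "n \<in> carrier (sec ?am V)" "left n = \<zero>\<^bsub>?B V\<^esub>"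
    obtain j where j: "j \<in> J V" "n = Duo \<zero>\<^bsub>?B V\<^esub> (Duo \<zero>\<^bsub>sec S V\<^esub> j)" using dec[OF V(1) n] by blast
    obtain Y g m where Y: "openin (under S) Y" "x \<in> Y" "Y \<subseteq> V" "g \<in> carrier (R W)" "germ_unit S x W (aug W g)"
      "m \<in> J W" "rs W Y g \<otimes>\<^bsub>R Y\<^esub> rs V Y j = rs W Y m"
      using ideal_locally_fraction[OF CS C V j(1)] by blast
    obtain h where h: "h \<in> carrier (?B W)" "?b W h = aug W g" using lft[OF Y(4)] by blast
    have YW: "Y \<subseteq> W" and xW: "x \<in> W" using Y V by blast+
    have gu: "germ_unit (pulled S T' k) x W h"
      using am.A.A.germ_unit_aug[OF W xW, of h] h Y(5) by simp
    have hY: "res T' (ptf k ` W) (ptf k ` Y) h \<in> carrier (?B Y)"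
      using am.A.A.E.res_closed[of W Y h] W Y(1) YW h by simp
    have bY: "?b Y (res T' (ptf k ` W) (ptf k ` Y) h) = aug Y (rs W Y g)"
      using am.A.shf_res[OF W Y(1) YW h(1)] shf_res[OF W Y(1) YW Y(4)] h(2) by simp
    have r: "res ?am U Y (Duo \<zero>\<^bsub>?B U\<^esub> (Duo \<zero>\<^bsub>sec S U\<^esub> q)) = Duo \<zero>\<^bsub>?B Y\<^esub> (Duo \<zero>\<^bsub>sec S Y\<^esub> (rs U Y q))"
      if "openin (under S) U" "Y \<subseteq> U" for U q
      using am.A.A.E.res_zero[of U Y] S.res_zero[of U Y] that Y(1) by simp
    have s: "res ?am W Y (?s W h) = ?s Y (res T' (ptf k ` W) (ptf k ` Y) h)"
      using W Y(1) am.A.shf_res[OF W Y(1) YW h(1)] rs_zero[of W Y] YW by simp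
    have "res ?am W Y (?s W h) \<otimes>\<^bsub>sec ?am Y\<^esub> res ?am V Y n = res ?am W Y (Duo \<zero>\<^bsub>?B W\<^esub> (Duo \<zero>\<^bsub>sec S W\<^esub> m))"
      unfolding j(2) r[OF V(1) Y(3)] r[OF W YW] s
        prod[OF Y(1) hY rs_closed[OF W Y(1) YW Y(4)] J_res[OF V(1) Y(1,3) j(1)] bY] Y(7) ..
    then show "\<exists>Y h m. openin (under S) Y \<and> x \<in> Y \<and> Y \<subseteq> V \<and> h \<in> carrier (?B W) \<and> germ_unit (pulled S T' k) x W h \<and>
          m \<in> carrier (sec ?am W) \<and> left m = \<zero>\<^bsub>?B W\<^esub> \<and>
          res ?am W Y (?s W h) \<otimes>\<^bsub>sec ?am Y\<^esub> res ?am V Y n = res ?am W Y m"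
      using Y h gu m_in[OF W Y(6)]
      by (intro exI[of _ Y] exI[of _ h] exI[of _ "Duo \<zero>\<^bsub>?B W\<^esub> (Duo \<zero>\<^bsub>sec S W\<^esub> m)"]) (auto simp del: amalg_carrier_Duo)
  qed
qed

lemma amalgamation_scheme_intro:
  assumes k: "thickening S T' k"
    and ch: "\<And>W. affine_chart S W (sec S W) id \<Longrightarrow> affine_chart (pulled S T i) W (R W) id \<Longrightarrow>
      affine_chart (pulled S T' k) W (sec (pulled S T' k) W) id \<and>
      (\<forall>g\<in>carrier (R W). \<exists>h\<in>carrier (sec T' (ptf k ` W)). shf k (ptf k ` W) h = aug W g)"
  shows "amalgamation_scheme S T' k dn incd"
proof -
  interpret am: amalgamation S T' k dn incd using k thick_dual by (simp add: amalgamation_def thickenings_def)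
  show ?thesis
  proof unfold_locales
    show "scheme (amalg_space S (T', k) (dn, incd))"
      unfolding scheme_def
    proof (intro conjI am.amalg_ringed ballI)
      fix x assume "x \<in> pts (amalg_space S (T', k) (dn, incd))"
      then obtain W where W: "x \<in> W" "affine_chart S W (sec S W) id" "affine_chart (pulled S T i) W (sec (pulled S T i) W) id"
        using common_chart[of x] by auto
      then show "\<exists>U. x \<in> U \<and> affine_open (amalg_space S (T', k) (dn, incd)) U"
        using amalg_chart[OF k W(2)] ch[OF W(2)] affine_chart_imp_affine_open[of "amalg_space S (T', k) (dn, incd)" W _ id]
        by auto
    qed
  qed
qed

text \<open>Here the first summand is \<open>T\<close> itself, and each \<open>g\<close> is its own
  lift.\<close>

lemma amalg_T: "amalgamation_scheme S T i dn incd"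
  by (rule amalgamation_scheme_intro[OF thickening_axioms]) auto

lemma amalg_I: "amalgamation_scheme S dn incd dn incd"
proof (rule amalgamation_scheme_intro[OF thick_dual])
  fix W assume CS: "affine_chart S W (sec S W) id" and C: "affine_chart (pulled S T i) W (R W) id"
  have W: "openin (under S) W" using affine_chart.open_chart[OF CS] .
  have "affine_chart (pulled S dn incd) W (sec (pulled S dn incd) W) id"
    by (rule thickening.pulled_chart[OF thick_dual dual_chart[OF CS C]]) (use W in auto)
  \<comment> \<open>The lift of \<open>g\<close> to the dual numbers is its image in
    \<open>S\<close> with zero \<epsilon>-part.\<close>
  moreover have "\<exists>h\<in>carrier (sec dn (ptf incd ` W)). shf incd (ptf incd ` W) h = aug W g" if "g \<in> carrier (R W)" for g
    using W J_zero[OF W] aug_closed[OF W that] by (intro bexI[of _ "Duo (aug W g) \<zero>\<^bsub>R W\<^esub>"]) auto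
  ultimately show "affine_chart (pulled S dn incd) W (sec (pulled S dn incd) W) id \<and>
      (\<forall>g\<in>carrier (R W). \<exists>h\<in>carrier (sec dn (ptf incd ` W)). shf incd (ptf incd ` W) h = aug W g)" by blast
qed

end

section \<open>The cogroup\<close>

text \<open>The extension with zero kernel: \<open>S\<close> becomes a thickening of itself, which
  is the initial object and the target of the counit.\<close>

lemma id_augmentation:
  assumes "scheme S"
  shows "augmentation S S (\<lambda>U s. s)"
proof -
  interpret sheaf_space S using scheme_sheaf[OF assms] .
  show ?thesis
  proof (intro augmentation.intro augmentation_axioms.intro sheaf_space_axioms)
    show "(\<lambda>s. s) \<in> ring_hom (sec S U) (sec S U)" for U using id_ring_hom[of "sec S U"] by (simp add: id_def)
    show "\<exists>V u. openin (under S) V \<and> x \<in> V \<and> V \<subseteq> U \<and> u \<in> carrier (sec S V) \<and> u = res S U V b"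
      if "openin (under S) U" "b \<in> carrier (sec S U)" "x \<in> U" for U b x
      using that res_id[of U b] by (intro exI[of _ U] exI[of _ b]) auto
    fix U c d assume U: "openin (under S) U" and c: "c \<in> carrier (sec S U)" and "d \<in> carrier (sec S U)" "c = \<zero>\<^bsub>sec S U\<^esub>"
    interpret cring "sec S U" by (rule sec_cring[OF U])
    show "c \<otimes>\<^bsub>sec S U\<^esub> d = \<zero>\<^bsub>sec S U\<^esub>" using \<open>c = _\<close> \<open>d \<in> _\<close> by simp
  qed auto
qed

lemma thickening_id: "scheme S \<Longrightarrow> thickening S S (id_morph S)"
  using augmentation.thickening_inclusion[OF id_augmentation] by (simp add: inclusion_def id_morph_def)

lemma id_image [simp]: "openin (under S) U \<Longrightarrow> ptf (id_morph S) ` U = U"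
  using image_inclusion[OF openin_subset] by (simp add: id_morph_def)

lemma id_shf_base [simp]: "openin (under S) U \<Longrightarrow> s \<in> carrier (sec S U) \<Longrightarrow> shf (id_morph S) U s = s"
  by (simp add: id_morph_def)

text \<open>\<open>S\<close> with its identity is initial: being a morphism under \<open>S\<close>
  means here that composition with the identity gives the immersion.\<close>

lemma (in thickening) immersion_hom:
  fixes T' :: "('p, 's) ringed"
  assumes "thickening S T' i'"
  shows "i' \<in> Hom (pointed_schemes S) (S, id_morph S) (T', i')"
    and "u \<in> Hom (pointed_schemes S) (S, id_morph S) (T', i') \<Longrightarrow> u = i'"
proof -
  interpret L: thickenings S S "id_morph S" T' i'
    using assms thickening_id[OF schemes(1)] by (simp add: thickenings_def)
  have "scheme_morphism S T' i'"
    using assms by (simp add: thickening_def square_zero_immersion_def closed_immersion_def)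
  \<comment> \<open>Composition with the identity restores the morphism on the nose because all
    components are extensional.\<close>
  moreover have c: "comp_morph S S T' u (id_morph S) = u"
    if "scheme_morphism S T' u" for u
  proof (rule morph.equality)
    have m: "ringed_morphism S T' u" using that by (simp add: scheme_morphism_def)
    show "ptf (comp_morph S S T' u (id_morph S)) = ptf u"
      using m by (intro extensionalityI[of _ "pts S"]) (auto simp: comp_morph_def id_morph_def ringed_morphism_def)
    show "shf (comp_morph S S T' u (id_morph S)) = shf u"
    proof (rule extensionalityI[of _ "opens T'"])
      fix V assume V: "V \<in> opens T'"
      have o: "openin (under S) (preim S u V)"
        using m V unfolding ringed_morphism_def continuous_map_def preim_def by blast
      have h: "shf u V \<in> ring_hom (sec T' V) (sec S (preim S u V))" and e: "shf u V \<in> extensional (carrier (sec T' V))"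
        using m V by (auto simp: ringed_morphism_def)
      show "shf (comp_morph S S T' u (id_morph S)) V = shf u V"
        using V o ring_hom_closed[OF h] by (intro extensionalityI[OF _ e]) (auto simp: comp_morph_def)
    qed (use m in \<open>auto simp: comp_morph_def ringed_morphism_def\<close>)
  qed simp
  ultimately show "i' \<in> Hom (pointed_schemes S) (S, id_morph S) (T', i')" by (simp add: Hom_pointed)
  show "u = i'" if "u \<in> Hom (pointed_schemes S) (S, id_morph S) (T', i')"
    using that c[of u] unfolding Hom_pointed by metis
qed

context square_zero
begin

interpretation II: amalgamation_scheme S dn incd dn incd by (rule amalg_I)

interpretation TI: amalgamation_scheme S T i dn incd by (rule amalg_T)

abbreviation PS where "PS \<equiv> pointed_schemes S"
abbreviation \<Gamma> where "\<Gamma> \<equiv> I_cogroup S M"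
abbreviation ds where "ds \<equiv> dual_structure S M"

lemma cogroup_simps [simp]:
  "gobj \<Gamma> = (dn, incd)" "gprod \<Gamma> = (II.am, II.inc)" "gfst \<Gamma> = amalg_inl S (dn, incd) (dn, incd)"
  "gsnd \<Gamma> = amalg_inr S (dn, incd) (dn, incd)" "gmul \<Gamma> = I_comult S M" "gterm \<Gamma> = (S, id_morph S)"
  "gunit \<Gamma> = ds" "ginv \<Gamma> = I_coinverse S M"
  by (simp_all add: I_cogroup_def I_pointed_eq II.amalg_eq)

lemma thick_base: "thickening S S (id_morph S)"
  by (rule thickening_id[OF schemes(1)])

lemma ds_shf: "openin (under S) U \<Longrightarrow> b \<in> carrier (sec S U) \<Longrightarrow> shf ds U b = Duo b \<zero>\<^bsub>R U\<^esub>"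
  by (simp add: dual_structure_def)

section \<open>Counit, comultiplication and coinverse as morphisms\<close>

lemma ds_hom: "ds \<in> Hom PS (dn, incd) (S, id_morph S)"
proof -
  interpret L: thickenings S dn incd S "id_morph S" using thick_dual thick_base by (simp add: thickenings_def)
  show ?thesis
  proof (rule L.hom_intro)
    show "sheaf_hom S (dn, incd) (S, id_morph S) (\<lambda>U. shf ds (ptf (id_morph S) ` U))"
    proof (rule sheaf_homI)
      fix U assume U: "openin (under S) U"
      interpret U: cring "sec S U" by (rule S.sec_cring[OF U])
      have "shf ds U \<in> ring_hom (sec S U) (dr U)" by (rule ring_hom_cong[OF unit_hom[OF U] ds_shf[OF U]]) auto
      then show "shf ds (ptf (id_morph S) ` U) \<in> ring_hom (sec S (ptf (id_morph S) ` U)) (sec dn (ptf incd ` U))" using U by simp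
      fix s assume s: "s \<in> carrier (sec S (ptf (id_morph S) ` U))"
      then show "shf incd (ptf incd ` U) (shf ds (ptf (id_morph S) ` U) s) = shf (id_morph S) (ptf (id_morph S) ` U) s"
        using U J_zero[OF U] by (simp add: ds_shf)
      fix V assume V: "openin (under S) V" "V \<subseteq> U"
      then show "res dn (ptf incd ` U) (ptf incd ` V) (shf ds (ptf (id_morph S) ` U) s) =
          shf ds (ptf (id_morph S) ` V) (res S (ptf (id_morph S) ` U) (ptf (id_morph S) ` V) s)"
        using U s S.res_closed[OF U V] rs_zero[of U V] by (simp add: ds_shf)
    qed
    show "shf ds (ptf (id_morph S) ` U) \<in> extensional (carrier (sec S (ptf (id_morph S) ` U)))" if "openin (under S) U" for U
      using that by (simp add: dual_structure_def)
  qed (simp_all add: dual_structure_def inclusion_def id_morph_def)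
qed

text \<open>The two components share the base part, which is the identification of the sum of two
  copies with the dual numbers of \<open>J \<times> J\<close>.\<close>

lemma II_elem:
  assumes U: "openin (under S) U" and x: "x \<in> carrier (amalg_ring (dn, incd) (dn, incd) U)"
  obtains a m n where "x = Duo (Duo a m) (Duo a n)" "a \<in> carrier (sec S U)" "m \<in> J U" "n \<in> J U"
proof -
  obtain c d where cd: "x = Duo c d" "c \<in> carrier (dr U)" "d \<in> carrier (dr U)" "left c = left d"
    using x U by (auto elim!: amalg_carrierE)
  then show ?thesis using that by (auto elim!: dual_carrierE)
qed

lemma comult_shf:
  assumes "openin (under S) U" "a \<in> carrier (sec S U)" "m \<in> J U" "n \<in> J U"
  shows "shf (I_comult S M) U (Duo (Duo a m) (Duo a n)) = Duo a (m \<oplus>\<^bsub>R U\<^esub> n)"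
  using assms by (simp add: I_comult_def I_pointed_eq)

text \<open>Multiplicativity amounts to additivity of the action in the ideal variable.\<close>

lemma comult_hom: "I_comult S M \<in> Hom PS (dn, incd) (II.am, II.inc)"
proof -
  interpret L: thickenings S dn incd II.am II.inc using thick_dual II.thick_am by (simp add: thickenings_def)
  show ?thesis
  proof (rule L.hom_intro)
    show "sheaf_hom S (dn, incd) (II.am, II.inc) (\<lambda>U. shf (I_comult S M) (ptf II.inc ` U))"
    proof (rule sheaf_homI)
      fix U assume U: "openin (under S) U"
      interpret h: ring_hom_cring "R U" "sec S U" "aug U" by (rule aug_hom[OF U])
      note Jc = J_carrier[OF U] and ac = act_closed[OF U] and Ja = J_add[OF U]
      have "shf (I_comult S M) U \<in> ring_hom (amalg_ring (dn, incd) (dn, incd) U) (dr U)"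
      proof (rule ring_hom_memI)
        fix x assume "x \<in> carrier (amalg_ring (dn, incd) (dn, incd) U)"
        then obtain a m n where x: "x = Duo (Duo a m) (Duo a n)" "a \<in> carrier (sec S U)" "m \<in> J U" "n \<in> J U"
          by (rule II_elem[OF U])
        then show "shf (I_comult S M) U x \<in> carrier (dr U)" using comult_shf[OF U] Ja by simp
        fix y assume "y \<in> carrier (amalg_ring (dn, incd) (dn, incd) U)"
        then obtain b p q where y: "y = Duo (Duo b p) (Duo b q)" "b \<in> carrier (sec S U)" "p \<in> J U" "q \<in> J U"
          by (rule II_elem[OF U])
        have c: "act U a p \<in> J U" "act U a q \<in> J U" "act U b m \<in> J U" "act U b n \<in> J U" using x y ac by auto
        have d: "m \<in> carrier (R U)" "n \<in> carrier (R U)" "p \<in> carrier (R U)" "q \<in> carrier (R U)"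
          using x y Jc by auto
        show "shf (I_comult S M) U (x \<otimes>\<^bsub>amalg_ring (dn, incd) (dn, incd) U\<^esub> y) =
            shf (I_comult S M) U x \<otimes>\<^bsub>dr U\<^esub> shf (I_comult S M) U y"
          using x y c Jc[OF c(1)] Jc[OF c(2)] Jc[OF c(3)] Jc[OF c(4)] U act_add_right[OF U x(2) y(3,4)] act_add_right[OF U y(2) x(3,4)]
          by (simp add: comult_shf[OF U] Ja h.R.a_ac)
        show "shf (I_comult S M) U (x \<oplus>\<^bsub>amalg_ring (dn, incd) (dn, incd) U\<^esub> y) =
            shf (I_comult S M) U x \<oplus>\<^bsub>dr U\<^esub> shf (I_comult S M) U y"
          using x y d U by (simp add: comult_shf[OF U] Ja h.R.a_ac)
      qed (use U J_zero[OF U] in \<open>simp add: comult_shf[OF U]\<close>)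
      then show "shf (I_comult S M) (ptf II.inc ` U) \<in> ring_hom (sec II.am (ptf II.inc ` U)) (sec dn (ptf incd ` U))"
        using U by (simp add: II.inc_image)
      fix s assume "s \<in> carrier (sec II.am (ptf II.inc ` U))"
      then have s': "s \<in> carrier (amalg_ring (dn, incd) (dn, incd) U)" using U by (simp add: II.inc_image)
      then obtain a m n where s: "s = Duo (Duo a m) (Duo a n)" "a \<in> carrier (sec S U)" "m \<in> J U" "n \<in> J U"
        by (rule II_elem[OF U])
      show "shf incd (ptf incd ` U) (shf (I_comult S M) (ptf II.inc ` U) s) = shf II.inc (ptf II.inc ` U) s"
        using s U Ja II.inc_shf[OF U s'] by (simp add: II.inc_image comult_shf[OF U])
      fix V assume V: "openin (under S) V" "V \<subseteq> U"
      show "res dn (ptf incd ` U) (ptf incd ` V) (shf (I_comult S M) (ptf II.inc ` U) s) =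
          shf (I_comult S M) (ptf II.inc ` V) (res II.am (ptf II.inc ` U) (ptf II.inc ` V) s)"
        using s U V S.res_closed[OF U V s(2)] J_res[OF U V s(3)] J_res[OF U V s(4)] rs_add[OF U V Jc[OF s(3)] Jc[OF s(4)]]
        by (simp add: II.inc_image comult_shf)
    qed
    show "shf (I_comult S M) (ptf II.inc ` U) \<in> extensional (carrier (sec II.am (ptf II.inc ` U)))" if "openin (under S) U" for U
      using that by (simp add: II.inc_image I_comult_def I_pointed_eq)
  qed (simp_all add: I_comult_def inclusion_def)
qed

text \<open>The inverse on the left is formed in the additive group with carrier \<open>J U\<close>;
  it agrees with the inverse in the ring because the ideal is closed under negation.\<close>

lemma M_uminus:
  assumes U: "openin (under S) U" and j: "j \<in> J U"
  shows "\<ominus>\<^bsub>msec M U\<^esub> j = \<ominus>\<^bsub>R U\<^esub> j"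
proof -
  interpret R: cring "R U" by (rule R_cring[OF U])
  have "abelian_group (msec M U)"
    by (rule abelian_groupI)
      (auto simp: J_add[OF U] J_zero[OF U] J_carrier[OF U] R.a_ac R.l_neg R.r_neg intro!: bexI[of _ "\<ominus>\<^bsub>R U\<^esub> _"] J_uminus[OF U])
  then interpret N: abelian_group "msec M U" .
  show ?thesis
    using N.minus_equality[of "\<ominus>\<^bsub>R U\<^esub> j" j] j J_uminus[OF U j] J_carrier[OF U j] by (simp add: R.l_neg)
qed

lemma act_uminus:
  assumes U: "openin (under S) U" and b: "b \<in> carrier (sec S U)" and j: "j \<in> J U"
  shows "act U b (\<ominus>\<^bsub>R U\<^esub> j) = \<ominus>\<^bsub>R U\<^esub> act U b j"
proof -
  interpret R: cring "R U" by (rule R_cring[OF U])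
  note m = J_uminus[OF U j]
  have "act U b (\<ominus>\<^bsub>R U\<^esub> j) \<oplus>\<^bsub>R U\<^esub> act U b j = \<zero>\<^bsub>R U\<^esub>"
    using act_add_right[OF U b m j] act_zero_right[OF U b] J_carrier[OF U j] by (simp add: R.l_neg)
  then show ?thesis
    using R.minus_equality J_carrier[OF U act_closed[OF U b j]] J_carrier[OF U act_closed[OF U b m]] by metis
qed

lemma coinverse_shf:
  assumes "openin (under S) U" "a \<in> carrier (sec S U)" "m \<in> J U"
  shows "shf (I_coinverse S M) U (Duo a m) = Duo a (\<ominus>\<^bsub>R U\<^esub> m)"
  using assms by (simp add: I_coinverse_def M_uminus)

lemma coinverse_hom: "I_coinverse S M \<in> Hom PS (dn, incd) (dn, incd)"
proof -
  show ?thesis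
  proof (rule II.hom_intro)
    show "sheaf_hom S (dn, incd) (dn, incd) (\<lambda>U. shf (I_coinverse S M) (ptf incd ` U))"
    proof (rule sheaf_homI)
      fix U assume U: "openin (under S) U"
      interpret h: ring_hom_cring "R U" "sec S U" "aug U" by (rule aug_hom[OF U])
      note Jc = J_carrier[OF U] and ac = act_closed[OF U] and Ja = J_add[OF U] and Ju = J_uminus[OF U]
      have "shf (I_coinverse S M) U \<in> ring_hom (dr U) (dr U)"
      proof (rule ring_hom_memI)
        fix x assume "x \<in> carrier (dr U)"
        then obtain a m where x: "x = Duo a m" "a \<in> carrier (sec S U)" "m \<in> J U" by (rule dual_carrierE)
        then show "shf (I_coinverse S M) U x \<in> carrier (dr U)" using coinverse_shf[OF U] Ju by simp
        fix y assume "y \<in> carrier (dr U)"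
        then obtain b p where y: "y = Duo b p" "b \<in> carrier (sec S U)" "p \<in> J U" by (rule dual_carrierE)
        have c: "act U a p \<in> J U" "act U b m \<in> J U" using x y ac by auto
        show "shf (I_coinverse S M) U (x \<otimes>\<^bsub>dr U\<^esub> y) = shf (I_coinverse S M) U x \<otimes>\<^bsub>dr U\<^esub> shf (I_coinverse S M) U y"
          using x y c Jc[OF c(1)] Jc[OF c(2)] act_uminus[OF U x(2) y(3)] act_uminus[OF U y(2) x(3)]
          by (simp add: coinverse_shf[OF U] Ja h.R.minus_add)
        show "shf (I_coinverse S M) U (x \<oplus>\<^bsub>dr U\<^esub> y) = shf (I_coinverse S M) U x \<oplus>\<^bsub>dr U\<^esub> shf (I_coinverse S M) U y"
          using x y Jc by (simp add: coinverse_shf[OF U] Ja h.R.minus_add)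
      qed (use J_zero[OF U] in \<open>simp add: coinverse_shf[OF U]\<close>)
      then show "shf (I_coinverse S M) (ptf incd ` U) \<in> ring_hom (sec dn (ptf incd ` U)) (sec dn (ptf incd ` U))" using U by simp
      fix s assume "s \<in> carrier (sec dn (ptf incd ` U))"
      then have "s \<in> carrier (dr U)" using U by simp
      then obtain a m where s: "s = Duo a m" "a \<in> carrier (sec S U)" "m \<in> J U" by (rule dual_carrierE)
      show "shf incd (ptf incd ` U) (shf (I_coinverse S M) (ptf incd ` U) s) = shf incd (ptf incd ` U) s"
        using s U Ju by (simp add: coinverse_shf)
      fix V assume V: "openin (under S) V" "V \<subseteq> U"
      show "res dn (ptf incd ` U) (ptf incd ` V) (shf (I_coinverse S M) (ptf incd ` U) s) =
          shf (I_coinverse S M) (ptf incd ` V) (res dn (ptf incd ` U) (ptf incd ` V) s)"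
        using s U V S.res_closed[OF U V s(2)] J_res[OF U V s(3)] rs_minus(2)[of U V m m] Jc[OF s(3)]
        by (simp add: coinverse_shf)
    qed
    show "shf (I_coinverse S M) (ptf incd ` U) \<in> extensional (carrier (sec dn (ptf incd ` U)))" if "openin (under S) U" for U
      using that by (simp add: I_coinverse_def)
  qed (simp_all add: I_coinverse_def inclusion_def)
qed

section \<open>Points of the cogroup and their group law\<close>

lemma base_terminal: "is_terminal (opposite PS) (S, id_morph S)"
  unfolding is_terminal_def opposite_simps
proof (intro conjI ballI)
  fix X assume "X \<in> Ob PS"
  then show "\<exists>!u. u \<in> Hom PS (S, id_morph S) X" using immersion_hom by (cases X) (simp, metis)
qed (simp add: thick_base)

lemma to_base: "thickening S W k \<Longrightarrow> to_terminal (opposite PS) (S, id_morph S) (W, k) = k"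
  unfolding to_terminal_def opposite_simps using immersion_hom by (intro the_equality) auto

text \<open>A point of the cogroup sends \<open>s\<close> to the image of \<open>s\<close> plus \<open>\<epsilon>\<close> times a derivation; the group
  operation is the addition of derivations.\<close>

lemma point:
  assumes W: "thickening S W k" and x: "x \<in> Hom PS (dn, incd) (W, k)" and U: "openin (under S) U"
    and s: "s \<in> carrier (sec W (ptf k ` U))"
  shows "shf x (ptf k ` U) s = Duo (shf k (ptf k ` U) s) (right (shf x (ptf k ` U) s))"
    "right (shf x (ptf k ` U) s) \<in> J U" "shf k (ptf k ` U) s \<in> carrier (sec S U)"
proof -
  interpret L: thickenings S dn incd W k using thick_dual W by (simp add: thickenings_def)
  have "shf x (ptf k ` U) s \<in> carrier (dr U)" using sheaf_homD(2)[OF L.hom_family[OF x] U s] U by simp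
  moreover have "left (shf x (ptf k ` U) s) = shf k (ptf k ` U) s"
    using sheaf_homD(3)[OF L.hom_family[OF x] U s] U calculation by simp
  ultimately show "shf x (ptf k ` U) s = Duo (shf k (ptf k ` U) s) (right (shf x (ptf k ` U) s))"
    "right (shf x (ptf k ` U) s) \<in> J U" "shf k (ptf k ` U) s \<in> carrier (sec S U)"
    by (auto elim!: dual_carrierE)
qed

abbreviation pg where "pg X \<equiv> points_group (opposite PS) \<Gamma> X"

lemma pg_carrier [simp]: "carrier (pg X) = Hom PS (dn, incd) X"
  by (simp add: points_group_def)

lemma pg_mult:
  assumes W: "thickening S W k" and x: "x \<in> Hom PS (dn, incd) (W, k)" and y: "y \<in> Hom PS (dn, incd) (W, k)"
  shows "x \<otimes>\<^bsub>pg (W, k)\<^esub> y \<in> Hom PS (dn, incd) (W, k)"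
    "openin (under S) U \<Longrightarrow> s \<in> carrier (sec W (ptf k ` U)) \<Longrightarrow>
      shf (x \<otimes>\<^bsub>pg (W, k)\<^esub> y) (ptf k ` U) s =
        Duo (shf k (ptf k ` U) s) (right (shf x (ptf k ` U) s) \<oplus>\<^bsub>R U\<^esub> right (shf y (ptf k ` U) s))"
proof -
  let ?p = "pairing (opposite PS) (dn, incd) (dn, incd) (amalg S (dn, incd) (dn, incd))
    (amalg_inl S (dn, incd) (dn, incd)) (amalg_inr S (dn, incd) (dn, incd)) (W, k) x y"
  note p = II.pairing_formula[OF W x y]
  have e: "x \<otimes>\<^bsub>pg (W, k)\<^esub> y = comp_morph dn II.am W ?p (I_comult S M)"
    by (simp add: points_group_def II.amalg_eq)
  show "x \<otimes>\<^bsub>pg (W, k)\<^esub> y \<in> Hom PS (dn, incd) (W, k)"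
    unfolding e by (rule comp_hom[OF thick_dual II.thick_am W comult_hom p(1)])
  assume U: "openin (under S) U" and s: "s \<in> carrier (sec W (ptf k ` U))"
  have L: "thickenings S dn incd II.am II.inc" using thick_dual II.thick_am by (simp add: thickenings_def)
  note px = point[OF W x U s] and py = point[OF W y U s]
  have "shf ?p (ptf k ` U) s = Duo (Duo (shf k (ptf k ` U) s) (right (shf x (ptf k ` U) s)))
      (Duo (shf k (ptf k ` U) s) (right (shf y (ptf k ` U) s)))"
    unfolding p(2)[OF U s] using px(1) py(1) by simp
  then show "shf (x \<otimes>\<^bsub>pg (W, k)\<^esub> y) (ptf k ` U) s =
      Duo (shf k (ptf k ` U) s) (right (shf x (ptf k ` U) s) \<oplus>\<^bsub>R U\<^esub> right (shf y (ptf k ` U) s))"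
    unfolding e comp_shf[OF L W p(1) U s] using comult_shf[OF U px(3,2) py(2)] U by (simp add: II.inc_image)
qed

lemma pg_one:
  assumes W: "thickening S W k"
  shows "\<one>\<^bsub>pg (W, k)\<^esub> \<in> Hom PS (dn, incd) (W, k)"
    "openin (under S) U \<Longrightarrow> s \<in> carrier (sec W (ptf k ` U)) \<Longrightarrow>
      shf \<one>\<^bsub>pg (W, k)\<^esub> (ptf k ` U) s = Duo (shf k (ptf k ` U) s) \<zero>\<^bsub>R U\<^esub>"
proof -
  have e: "\<one>\<^bsub>pg (W, k)\<^esub> = comp_morph dn S W k ds"
    by (simp add: points_group_def to_base[OF W])
  note k = immersion_hom(1)[OF W]
  show "\<one>\<^bsub>pg (W, k)\<^esub> \<in> Hom PS (dn, incd) (W, k)"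
    unfolding e by (rule comp_hom[OF thick_dual thick_base W ds_hom k])
  assume U: "openin (under S) U" and s: "s \<in> carrier (sec W (ptf k ` U))"
  have L: "thickenings S dn incd S (id_morph S)" using thick_dual thick_base by (simp add: thickenings_def)
  have "shf k (ptf k ` U) s \<in> carrier (sec S U)"
    using ring_hom_closed[OF thickening.shf_hom[OF W U] s] .
  then show "shf \<one>\<^bsub>pg (W, k)\<^esub> (ptf k ` U) s = Duo (shf k (ptf k ` U) s) \<zero>\<^bsub>R U\<^esub>"
    unfolding e comp_shf[OF L W k U s] using U by (simp add: ds_shf)
qed

lemma pg_inv:
  assumes W: "thickening S W k" and x: "x \<in> Hom PS (dn, incd) (W, k)"
  shows "comp_morph dn dn W x (I_coinverse S M) \<in> Hom PS (dn, incd) (W, k)"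
    "openin (under S) U \<Longrightarrow> s \<in> carrier (sec W (ptf k ` U)) \<Longrightarrow>
      shf (comp_morph dn dn W x (I_coinverse S M)) (ptf k ` U) s =
        Duo (shf k (ptf k ` U) s) (\<ominus>\<^bsub>R U\<^esub> right (shf x (ptf k ` U) s))"
proof -
  show "comp_morph dn dn W x (I_coinverse S M) \<in> Hom PS (dn, incd) (W, k)"
    by (rule comp_hom[OF thick_dual thick_dual W coinverse_hom x])
  assume U: "openin (under S) U" and s: "s \<in> carrier (sec W (ptf k ` U))"
  have L: "thickenings S dn incd dn incd" using thick_dual by (simp add: thickenings_def)
  note px = point[OF W x U s]
  show "shf (comp_morph dn dn W x (I_coinverse S M)) (ptf k ` U) s =
        Duo (shf k (ptf k ` U) s) (\<ominus>\<^bsub>R U\<^esub> right (shf x (ptf k ` U) s))"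
    using comp_shf[OF L W x U s] coinverse_shf[OF U px(3,2)] px(1) U by simp
qed

text \<open>With the explicit formulas for product, unit and inverse, \<open>hom_ext\<close> reduces
  each group law to the same law for addition in \<open>R U\<close>.\<close>

lemma pg_comm_group:
  assumes W: "thickening S W k"
  shows "comm_group (pg (W, k))"
    "x \<in> Hom PS (dn, incd) (W, k) \<Longrightarrow> comp_morph dn dn W x (I_coinverse S M) = inv\<^bsub>pg (W, k)\<^esub> x"
proof -
  interpret L: thickenings S dn incd W k using thick_dual W by (simp add: thickenings_def)
  note mc = pg_mult(1)[OF W] and m = pg_mult(2)[OF W] and oc = pg_one(1)[OF W] and o = pg_one(2)[OF W]
  have cr: "cring (R U)" if "openin (under S) U" for U by (rule R_cring[OF that])
  have rc: "right (shf x (ptf k ` U) s) \<in> carrier (R U)"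
    if "x \<in> Hom PS (dn, incd) (W, k)" "openin (under S) U" "s \<in> carrier (sec W (ptf k ` U))" for x U s
    using J_carrier[OF that(2) point(2)[OF W that]] .
  have linv: "comp_morph dn dn W x (I_coinverse S M) \<otimes>\<^bsub>pg (W, k)\<^esub> x = \<one>\<^bsub>pg (W, k)\<^esub>"
    if x: "x \<in> Hom PS (dn, incd) (W, k)" for x
  proof (rule L.hom_ext[OF mc[OF pg_inv(1)[OF W x] x] oc])
    fix U s assume U: "openin (under S) U" and s: "s \<in> carrier (sec W (ptf k ` U))"
    interpret R: cring "R U" by (rule cr[OF U])
    show "shf (comp_morph dn dn W x (I_coinverse S M) \<otimes>\<^bsub>pg (W, k)\<^esub> x) (ptf k ` U) s = shf \<one>\<^bsub>pg (W, k)\<^esub> (ptf k ` U) s"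
      using m[OF pg_inv(1)[OF W x] x U s] pg_inv(2)[OF W x U s] o[OF U s] rc[OF x U s] by (simp add: R.l_neg)
  qed
  have g: "group (pg (W, k))"
  proof (rule groupI; (unfold pg_carrier)?)
    fix x y assume x: "x \<in> Hom PS (dn, incd) (W, k)" and y: "y \<in> Hom PS (dn, incd) (W, k)"
    show "x \<otimes>\<^bsub>pg (W, k)\<^esub> y \<in> Hom PS (dn, incd) (W, k)" by (rule mc[OF x y])
    fix z assume z: "z \<in> Hom PS (dn, incd) (W, k)"
    show "x \<otimes>\<^bsub>pg (W, k)\<^esub> y \<otimes>\<^bsub>pg (W, k)\<^esub> z = x \<otimes>\<^bsub>pg (W, k)\<^esub> (y \<otimes>\<^bsub>pg (W, k)\<^esub> z)"
    proof (rule L.hom_ext[OF mc[OF mc[OF x y] z] mc[OF x mc[OF y z]]])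
      fix U s assume U: "openin (under S) U" and s: "s \<in> carrier (sec W (ptf k ` U))"
      interpret R: cring "R U" by (rule cr[OF U])
      show "shf (x \<otimes>\<^bsub>pg (W, k)\<^esub> y \<otimes>\<^bsub>pg (W, k)\<^esub> z) (ptf k ` U) s = shf (x \<otimes>\<^bsub>pg (W, k)\<^esub> (y \<otimes>\<^bsub>pg (W, k)\<^esub> z)) (ptf k ` U) s"
        using m[OF mc[OF x y] z U s] m[OF x mc[OF y z] U s] m[OF x y U s] m[OF y z U s] rc[OF x U s] rc[OF y U s] rc[OF z U s]
        by (simp add: R.a_assoc)
    qed
  next
    fix x assume x: "x \<in> Hom PS (dn, incd) (W, k)"
    show "\<one>\<^bsub>pg (W, k)\<^esub> \<otimes>\<^bsub>pg (W, k)\<^esub> x = x"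
    proof (rule L.hom_ext[OF mc[OF oc x] x])
      fix U s assume U: "openin (under S) U" and s: "s \<in> carrier (sec W (ptf k ` U))"
      interpret R: cring "R U" by (rule cr[OF U])
      show "shf (\<one>\<^bsub>pg (W, k)\<^esub> \<otimes>\<^bsub>pg (W, k)\<^esub> x) (ptf k ` U) s = shf x (ptf k ` U) s"
        unfolding m[OF oc x U s] o[OF U s] using rc[OF x U s] point(1)[OF W x U s] by simp
    qed
    show "\<exists>y\<in>Hom PS (dn, incd) (W, k). y \<otimes>\<^bsub>pg (W, k)\<^esub> x = \<one>\<^bsub>pg (W, k)\<^esub>"
      using linv[OF x] pg_inv(1)[OF W x] by blast
  qed (rule oc)
  have comm: "x \<otimes>\<^bsub>pg (W, k)\<^esub> y = y \<otimes>\<^bsub>pg (W, k)\<^esub> x"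
    if x: "x \<in> Hom PS (dn, incd) (W, k)" and y: "y \<in> Hom PS (dn, incd) (W, k)" for x y
  proof (rule L.hom_ext[OF mc[OF x y] mc[OF y x]])
    fix U s assume U: "openin (under S) U" and s: "s \<in> carrier (sec W (ptf k ` U))"
    interpret R: cring "R U" by (rule cr[OF U])
    show "shf (x \<otimes>\<^bsub>pg (W, k)\<^esub> y) (ptf k ` U) s = shf (y \<otimes>\<^bsub>pg (W, k)\<^esub> x) (ptf k ` U) s"
      using m[OF x y U s] m[OF y x U s] rc[OF x U s] rc[OF y U s] by (simp add: R.a_comm)
  qed
  show "comm_group (pg (W, k))"
    by (rule group.group_comm_groupI[OF g]) (use comm in simp)
  show "comp_morph dn dn W x (I_coinverse S M) = inv\<^bsub>pg (W, k)\<^esub> x" if x: "x \<in> Hom PS (dn, incd) (W, k)"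
    using group.inv_equality[OF g linv[OF x]] x pg_inv(1)[OF W x] by simp
qed

lemma cogroup: "coabelian_cogroup_object PS \<Gamma>"
  unfolding coabelian_cogroup_object_def abelian_group_object_def group_object_def
proof (intro conjI ballI)
  show "category (opposite PS)" by (rule category_opposite[OF category_pointed])
  show "is_terminal (opposite PS) (gterm \<Gamma>)" using base_terminal by simp
  show "is_product (opposite PS) (gobj \<Gamma>) (gobj \<Gamma>) (gprod \<Gamma>) (gfst \<Gamma>) (gsnd \<Gamma>)"
    using II.coproduct by (simp add: II.amalg_eq)
  show "gmul \<Gamma> \<in> Hom (opposite PS) (gprod \<Gamma>) (gobj \<Gamma>)" using comult_hom by simp
  show "gunit \<Gamma> \<in> Hom (opposite PS) (gterm \<Gamma>) (gobj \<Gamma>)" using ds_hom by simp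
  show "ginv \<Gamma> \<in> Hom (opposite PS) (gobj \<Gamma>) (gobj \<Gamma>)" using coinverse_hom by simp
next
  fix X assume "X \<in> Ob (opposite PS)"
  then obtain W k where X: "X = (W, k)" "thickening S W k" by (cases X) simp
  show "comm_group (pg X)" using pg_comm_group(1)[OF X(2)] X(1) by simp
  then show "group (pg X)" by (rule comm_group.axioms(2))
  fix x assume "x \<in> Hom (opposite PS) X (gobj \<Gamma>)"
  then show "Comp (opposite PS) X (gobj \<Gamma>) (gobj \<Gamma>) (ginv \<Gamma>) x = inv\<^bsub>pg X\<^esub> x"
    using pg_comm_group(2)[OF X(2), of x] X(1) by simp
qed

text \<open>The structure morphism is the identity on points, so the direct image of the structure
  sheaf is the sheaf itself and the comparison isomorphism is the identity. The content is
  affineness over \<open>S\<close>, which is read off from the common charts.\<close>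

lemma relative_spectrum_dual: "relative_spectrum S dn ds dn ds"
  unfolding relative_spectrum_def
proof (intro conjI ballI)
  have sm: "scheme_morphism dn S ds" using ds_hom by (simp add: Hom_pointed)
  show "ringed_space dn" by (rule dual_ringed)
  show "under dn = under S" by simp
  show "ringed_morphism dn S ds" using sm by (simp add: scheme_morphism_def)
  show "ptf ds x = x" if "x \<in> pts S" for x using that by (simp add: dual_structure_def)
  have pre: "preim dn ds U = U" if "openin (under S) U" for U
    using openin_subset[OF that] by (auto simp: preim_def dual_structure_def)
  show "affine_morphism dn S ds"
    unfolding affine_morphism_def
  proof (intro conjI sm dual_scheme schemes(1) ballI)
    fix x assume "x \<in> pts S"
    then obtain W where W: "x \<in> W" "affine_chart S W (sec S W) id" "affine_chart (pulled S T i) W (sec (pulled S T i) W) id"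
      using common_chart[of x] by auto
    have o: "openin (under S) W" using affine_chart.open_chart[OF W(2)] .
    have "affine_open S W" using affine_chart_imp_affine_open[OF W(2)] .
    moreover have "affine_open dn (preim dn ds W)"
      using affine_chart_imp_affine_open[OF dual_chart[OF W(2)]] W(3) pre[OF o] by simp
    ultimately show "\<exists>U. x \<in> U \<and> affine_open S U \<and> affine_open dn (preim dn ds U)" using W(1) by blast
  qed
  show "\<exists>\<phi>. (\<forall>U\<in>opens S. \<phi> U \<in> ring_iso (sec dn U) (sec dn (preim dn ds U))) \<and>
          (\<forall>U\<in>opens S. \<forall>V\<in>opens S. V \<subseteq> U \<longrightarrow> (\<forall>s\<in>carrier (sec dn U).
             \<phi> V (res dn U V s) = res dn (preim dn ds U) (preim dn ds V) (\<phi> U s))) \<and>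
          (\<forall>U\<in>opens S. \<forall>b\<in>carrier (sec S U). \<phi> U (shf ds U b) = shf ds U b)"
    using pre id_ring_hom by (intro exI[of _ "\<lambda>U. id"]) (auto simp: ring_iso_def bij_betw_id)
qed

end

section \<open>The cotorsor\<close>

context square_zero
begin

interpretation II: amalgamation_scheme S dn incd dn incd by (rule amalg_I)

interpretation TI: amalgamation_scheme S T i dn incd by (rule amalg_T)

abbreviation \<nu> where "\<nu> \<equiv> coaction S (T, i)"
abbreviation inlT where "inlT \<equiv> amalg_inl S (T, i) (dn, incd)"
abbreviation inrT where "inrT \<equiv> amalg_inr S (T, i) (dn, incd)"

section \<open>The coaction as a morphism and as an action\<close>

lemma TI_elem:
  assumes U: "openin (under S) U" and x: "x \<in> carrier (amalg_ring (T, i) (dn, incd) U)"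
  obtains u j where "x = Duo u (Duo (aug U u) j)" "u \<in> carrier (R U)" "j \<in> J U"
proof -
  obtain u d where ud: "x = Duo u d" "u \<in> carrier (R U)" "d \<in> carrier (dr U)" "aug U u = left d"
    using x U by (auto elim!: amalg_carrierE)
  then show ?thesis using that by (auto elim!: dual_carrierE)
qed

lemma TI_mem:
  "openin (under S) U \<Longrightarrow> u \<in> carrier (R U) \<Longrightarrow> j \<in> J U \<Longrightarrow>
    Duo u (Duo (aug U u) j) \<in> carrier (amalg_ring (T, i) (dn, incd) U)"
  using aug_closed by simp

lemma coaction_shf:
  "openin (under S) U \<Longrightarrow> u \<in> carrier (R U) \<Longrightarrow> j \<in> J U \<Longrightarrow>
    shf \<nu> U (Duo u (Duo (aug U u) j)) = u \<oplus>\<^bsub>R U\<^esub> j"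
  using TI_mem[of U u j] by (simp add: coaction_def I_pointed_eq del: amalg_carrier_Duo)

lemma coaction_hom: "\<nu> \<in> Hom PS (T, i) (TI.am, TI.inc)"
proof -
  interpret L: thickenings S T i TI.am TI.inc using thickening_axioms TI.thick_am by (simp add: thickenings_def)
  show ?thesis
  proof (rule L.hom_intro)
    show "sheaf_hom S (T, i) (TI.am, TI.inc) (\<lambda>U. shf \<nu> (ptf TI.inc ` U))"
    proof (rule sheaf_homI)
      fix U assume U: "openin (under S) U"
      interpret h: ring_hom_cring "R U" "sec S U" "aug U" by (rule aug_hom[OF U])
      note Jc = J_carrier[OF U]
      have "shf \<nu> U \<in> ring_hom (amalg_ring (T, i) (dn, incd) U) (R U)"
      proof (rule ring_hom_memI)
        fix x assume "x \<in> carrier (amalg_ring (T, i) (dn, incd) U)"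
        then obtain u j where x: "x = Duo u (Duo (aug U u) j)" "u \<in> carrier (R U)" "j \<in> J U" by (rule TI_elem[OF U])
        then show "shf \<nu> U x \<in> carrier (R U)" using coaction_shf[OF U] Jc by simp
        fix y assume "y \<in> carrier (amalg_ring (T, i) (dn, incd) U)"
        then obtain w l where y: "y = Duo w (Duo (aug U w) l)" "w \<in> carrier (R U)" "l \<in> J U" by (rule TI_elem[OF U])
        have jl: "j \<in> carrier (R U)" "l \<in> carrier (R U)" using x y Jc by auto
        have "x \<otimes>\<^bsub>amalg_ring (T, i) (dn, incd) U\<^esub> y =
            Duo (u \<otimes>\<^bsub>R U\<^esub> w) (Duo (aug U (u \<otimes>\<^bsub>R U\<^esub> w)) (u \<otimes>\<^bsub>R U\<^esub> l \<oplus>\<^bsub>R U\<^esub> w \<otimes>\<^bsub>R U\<^esub> j))"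
          using x y U act_aug[OF U x(2) y(3)] act_aug[OF U y(2) x(3)] by simp
        then have "shf \<nu> U (x \<otimes>\<^bsub>amalg_ring (T, i) (dn, incd) U\<^esub> y) = u \<otimes>\<^bsub>R U\<^esub> w \<oplus>\<^bsub>R U\<^esub> (u \<otimes>\<^bsub>R U\<^esub> l \<oplus>\<^bsub>R U\<^esub> w \<otimes>\<^bsub>R U\<^esub> j)"
          using coaction_shf[OF U, of "u \<otimes>\<^bsub>R U\<^esub> w"] x y J_mult[OF U x(2) y(3)] J_mult[OF U y(2) x(3)] J_add[OF U] by simp
        \<comment> \<open>The two products differ by \<open>j l\<close>, which vanishes because the
          ideal has square zero.\<close>
        moreover have "(u \<oplus>\<^bsub>R U\<^esub> j) \<otimes>\<^bsub>R U\<^esub> (w \<oplus>\<^bsub>R U\<^esub> l) =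
            u \<otimes>\<^bsub>R U\<^esub> w \<oplus>\<^bsub>R U\<^esub> (u \<otimes>\<^bsub>R U\<^esub> l \<oplus>\<^bsub>R U\<^esub> w \<otimes>\<^bsub>R U\<^esub> j) \<oplus>\<^bsub>R U\<^esub> j \<otimes>\<^bsub>R U\<^esub> l"
          using x(2) y(2) jl by (simp add: h.R.l_distr h.R.r_distr h.R.m_ac h.R.a_ac)
        ultimately show "shf \<nu> U (x \<otimes>\<^bsub>amalg_ring (T, i) (dn, incd) U\<^esub> y) = shf \<nu> U x \<otimes>\<^bsub>R U\<^esub> shf \<nu> U y"
          using J_sqz[OF U x(3) y(3)] coaction_shf[OF U x(2,3)] coaction_shf[OF U y(2,3)] x(1,2) y(1,2) jl by simp
        have "x \<oplus>\<^bsub>amalg_ring (T, i) (dn, incd) U\<^esub> y = Duo (u \<oplus>\<^bsub>R U\<^esub> w) (Duo (aug U (u \<oplus>\<^bsub>R U\<^esub> w)) (j \<oplus>\<^bsub>R U\<^esub> l))"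
          using x y U by simp
        then show "shf \<nu> U (x \<oplus>\<^bsub>amalg_ring (T, i) (dn, incd) U\<^esub> y) = shf \<nu> U x \<oplus>\<^bsub>R U\<^esub> shf \<nu> U y"
          using coaction_shf[OF U, of "u \<oplus>\<^bsub>R U\<^esub> w" "j \<oplus>\<^bsub>R U\<^esub> l"] coaction_shf[OF U x(2,3)] coaction_shf[OF U y(2,3)]
            x y J_add[OF U] jl by (simp add: h.R.a_ac)
      next
        have "\<one>\<^bsub>amalg_ring (T, i) (dn, incd) U\<^esub> = Duo \<one>\<^bsub>R U\<^esub> (Duo (aug U \<one>\<^bsub>R U\<^esub>) \<zero>\<^bsub>R U\<^esub>)" using U by simp
        then show "shf \<nu> U \<one>\<^bsub>amalg_ring (T, i) (dn, incd) U\<^esub> = \<one>\<^bsub>R U\<^esub>"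
          using coaction_shf[OF U h.R.one_closed J_zero[OF U]] by simp
      qed
      then show "shf \<nu> (ptf TI.inc ` U) \<in> ring_hom (sec TI.am (ptf TI.inc ` U)) (R U)"
        using U by (simp add: TI.inc_image)
      fix s assume "s \<in> carrier (sec TI.am (ptf TI.inc ` U))"
      then have s': "s \<in> carrier (amalg_ring (T, i) (dn, incd) U)" using U by (simp add: TI.inc_image)
      then obtain u j where s: "s = Duo u (Duo (aug U u) j)" "u \<in> carrier (R U)" "j \<in> J U" by (rule TI_elem[OF U])
      show "aug U (shf \<nu> (ptf TI.inc ` U) s) = shf TI.inc (ptf TI.inc ` U) s"
        using s U Jc[OF s(3)] TI.inc_shf[OF U s'] by (simp add: TI.inc_image coaction_shf[OF U] J_iff)
      fix V assume V: "openin (under S) V" "V \<subseteq> U"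
      show "rs U V (shf \<nu> (ptf TI.inc ` U) s) = shf \<nu> (ptf TI.inc ` V) (res TI.am (ptf TI.inc ` U) (ptf TI.inc ` V) s)"
        using s U V rs_closed[OF U V s(2)] J_res[OF U V s(3)] rs_add[OF U V s(2) Jc[OF s(3)]]
          coaction_shf[OF V(1) rs_closed[OF U V s(2)] J_res[OF U V s(3)]] shf_res[OF U V s(2)]
        by (simp add: TI.inc_image coaction_shf[OF U])
    qed
    show "shf \<nu> (ptf TI.inc ` U) \<in> extensional (carrier (sec TI.am (ptf TI.inc ` U)))" if "openin (under S) U" for U
      using that by (simp add: TI.inc_image coaction_def I_pointed_eq)
  qed (use maps inj in \<open>auto simp: coaction_def point_inverse_def inclusion_def\<close>)
qed

lemma coaction_comp:
  assumes W: "thickening S W k" and h: "h \<in> Hom PS (TI.am, TI.inc) (W, k)"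
    and U: "openin (under S) U" and s: "s \<in> carrier (sec W (ptf k ` U))"
  shows "shf (comp_morph T TI.am W h \<nu>) (ptf k ` U) s = shf \<nu> U (shf h (ptf k ` U) s)"
proof -
  have L: "thickenings S T i TI.am TI.inc" using thickening_axioms TI.thick_am by (simp add: thickenings_def)
  show ?thesis using comp_shf[OF L W h U s] U by (simp add: TI.inc_image)
qed

text \<open>The point \<open>g\<close> acts on the homomorphism \<open>x\<close> by adding its
  derivation, so the axioms of an action become laws of addition.\<close>

lemma action_formula:
  assumes W: "thickening S W k" and x: "x \<in> Hom PS (T, i) (W, k)" and g: "g \<in> Hom PS (dn, incd) (W, k)"
  defines "a \<equiv> Comp (opposite PS) (W, k) (TI.am, TI.inc) (T, i) \<nu>
    (pairing (opposite PS) (T, i) (dn, incd) (TI.am, TI.inc) inlT inrT (W, k) x g)"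
  shows "a \<in> Hom PS (T, i) (W, k)"
    "openin (under S) U \<Longrightarrow> s \<in> carrier (sec W (ptf k ` U)) \<Longrightarrow>
      shf a (ptf k ` U) s = shf x (ptf k ` U) s \<oplus>\<^bsub>R U\<^esub> right (shf g (ptf k ` U) s)"
proof -
  let ?p = "pairing (opposite PS) (T, i) (dn, incd) (TI.am, TI.inc) inlT inrT (W, k) x g"
  note p = TI.pairing_formula[OF W x g, unfolded TI.amalg_eq]
  have a: "a = comp_morph T TI.am W ?p \<nu>" by (simp add: a_def)
  show "a \<in> Hom PS (T, i) (W, k)"
    unfolding a by (rule comp_hom[OF thickening_axioms TI.thick_am W coaction_hom p(1)])
  assume U: "openin (under S) U" and s: "s \<in> carrier (sec W (ptf k ` U))"
  interpret L: thickenings S T i W k using thickening_axioms W by (simp add: thickenings_def)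
  note xs = sheaf_homD(2,3)[OF L.hom_family[OF x] U s]
  note gs = point[OF W g U s]
  have "shf ?p (ptf k ` U) s = Duo (shf x (ptf k ` U) s) (Duo (aug U (shf x (ptf k ` U) s)) (right (shf g (ptf k ` U) s)))"
    unfolding p(2)[OF U s] using gs(1) xs(2) by simp
  then show "shf a (ptf k ` U) s = shf x (ptf k ` U) s \<oplus>\<^bsub>R U\<^esub> right (shf g (ptf k ` U) s)"
    unfolding a coaction_comp[OF W p(1) U s] using coaction_shf[OF U xs(1) gs(2)] by simp
qed

lemma coaction_right_action: "right_action (opposite PS) \<Gamma> (T, i) (TI.am, TI.inc) inlT inrT \<nu>"
  unfolding right_action_def Let_def
proof (intro conjI ballI)
  show "is_product (opposite PS) (T, i) (gobj \<Gamma>) (TI.am, TI.inc) inlT inrT"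
    using TI.coproduct by (simp add: TI.amalg_eq)
  show "\<nu> \<in> Hom (opposite PS) (TI.am, TI.inc) (T, i)" using coaction_hom by simp
  fix X x assume "X \<in> Ob (opposite PS)" and x': "x \<in> Hom (opposite PS) X (T, i)"
  then obtain W k where X: "X = (W, k)" and W: "thickening S W k" by (cases X) simp
  have x: "x \<in> Hom PS (T, i) (W, k)" using x' X by simp
  interpret L: thickenings S T i W k using thickening_axioms W by (simp add: thickenings_def)
  note a1 = action_formula(1)[OF W] and a2 = action_formula(2)[OF W]
  have xc: "shf x (ptf k ` U) s \<in> carrier (R U)" if "openin (under S) U" "s \<in> carrier (sec W (ptf k ` U))" for U s
    using sheaf_homD(2)[OF L.hom_family[OF x] that] .
  have gc: "right (shf g (ptf k ` U) s) \<in> carrier (R U)"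
    if "g \<in> Hom PS (dn, incd) (W, k)" "openin (under S) U" "s \<in> carrier (sec W (ptf k ` U))" for g U s
    using J_carrier[OF that(2) point(2)[OF W that]] .
  show "Comp (opposite PS) X (TI.am, TI.inc) (T, i) \<nu>
      (pairing (opposite PS) (T, i) (gobj \<Gamma>) (TI.am, TI.inc) inlT inrT X x \<one>\<^bsub>pg X\<^esub>) = x"
    unfolding X cogroup_simps
  proof (rule L.hom_ext[OF a1[OF x pg_one(1)[OF W]] x])
    fix U s assume U: "openin (under S) U" and s: "s \<in> carrier (sec W (ptf k ` U))"
    interpret R: cring "R U" by (rule R_cring[OF U])
    show "shf (Comp (opposite PS) (W, k) (TI.am, TI.inc) (T, i) \<nu>
        (pairing (opposite PS) (T, i) (dn, incd) (TI.am, TI.inc) inlT inrT (W, k) x \<one>\<^bsub>pg (W, k)\<^esub>)) (ptf k ` U) s = shf x (ptf k ` U) s"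
      unfolding a2[OF x pg_one(1)[OF W] U s] pg_one(2)[OF W U s] using xc[OF U s] by simp
  qed
  fix g h assume "g \<in> Hom (opposite PS) X (gobj \<Gamma>)" "h \<in> Hom (opposite PS) X (gobj \<Gamma>)"
  then have g: "g \<in> Hom PS (dn, incd) (W, k)" and h: "h \<in> Hom PS (dn, incd) (W, k)" using X by simp_all
  show "Comp (opposite PS) X (TI.am, TI.inc) (T, i) \<nu> (pairing (opposite PS) (T, i) (gobj \<Gamma>) (TI.am, TI.inc) inlT inrT X
        (Comp (opposite PS) X (TI.am, TI.inc) (T, i) \<nu> (pairing (opposite PS) (T, i) (gobj \<Gamma>) (TI.am, TI.inc) inlT inrT X x g)) h) =
      Comp (opposite PS) X (TI.am, TI.inc) (T, i) \<nu> (pairing (opposite PS) (T, i) (gobj \<Gamma>) (TI.am, TI.inc) inlT inrT X x (g \<otimes>\<^bsub>pg X\<^esub> h))"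
    unfolding X cogroup_simps
  proof (rule L.hom_ext[OF a1[OF a1[OF x g] h] a1[OF x pg_mult(1)[OF W g h]]])
    fix U s assume U: "openin (under S) U" and s: "s \<in> carrier (sec W (ptf k ` U))"
    interpret R: cring "R U" by (rule R_cring[OF U])
    show "shf (Comp (opposite PS) (W, k) (TI.am, TI.inc) (T, i) \<nu> (pairing (opposite PS) (T, i) (dn, incd) (TI.am, TI.inc) inlT inrT (W, k)
        (Comp (opposite PS) (W, k) (TI.am, TI.inc) (T, i) \<nu> (pairing (opposite PS) (T, i) (dn, incd) (TI.am, TI.inc) inlT inrT (W, k) x g)) h)) (ptf k ` U) s =
      shf (Comp (opposite PS) (W, k) (TI.am, TI.inc) (T, i) \<nu> (pairing (opposite PS) (T, i) (dn, incd) (TI.am, TI.inc) inlT inrT (W, k) x (g \<otimes>\<^bsub>pg (W, k)\<^esub> h))) (ptf k ` U) s"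
      unfolding a2[OF a1[OF x g] h U s] a2[OF x g U s] a2[OF x pg_mult(1)[OF W g h] U s] pg_mult(2)[OF W g h U s]
      using xc[OF U s] gc[OF g U s] gc[OF h U s] by (simp add: R.a_assoc)
  qed
qed

text \<open>Sections \<open>(u, v)\<close> of \<open>\<O>\<^sub>\<Sigma> \<times> \<O>\<^sub>\<Sigma>\<close> over \<open>\<O>\<^sub>S\<close> correspond to \<open>(u, \<bar>u + (v - u)\<epsilon>)\<close>, so that the
  amalgamated sum with the dual numbers is also the coproduct of two copies of \<open>\<Sigma>\<close>.\<close>

lemma coproduct_self: "is_product (opposite PS) (T, i) (T, i) (TI.am, TI.inc) inlT \<nu>"
  unfolding is_product_def opposite_simps
proof (intro conjI ballI)
  show "(T, i) \<in> Ob PS" "(T, i) \<in> Ob PS" "(TI.am, TI.inc) \<in> Ob PS"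
    using thickening_axioms TI.thick_am by simp_all
  show "inlT \<in> Hom PS (T, i) (TI.am, TI.inc)" "\<nu> \<in> Hom PS (T, i) (TI.am, TI.inc)"
    by (rule TI.inl_hom coaction_hom)+
  fix X f g assume "X \<in> Ob PS" and f': "f \<in> Hom PS (T, i) X" and g': "g \<in> Hom PS (T, i) X"
  then obtain W k where X: "X = (W, k)" and W: "thickening S W k" by (cases X) simp
  have f: "f \<in> Hom PS (T, i) (W, k)" and g: "g \<in> Hom PS (T, i) (W, k)" using f' g' X by simp_all
  interpret L: thickenings S T i W k using thickening_axioms W by (simp add: thickenings_def)
  interpret H: thickenings S TI.am TI.inc W k using W TI.thick_am by (simp add: thickenings_def)
  define F where "F U s = shf f (ptf k ` U) s" for U s
  define G where "G U s = shf g (ptf k ` U) s" for U s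
  \<comment> \<open>The difference of the two homomorphisms; both lie over the same map to
    \<open>S\<close>, so its values are in the ideal.\<close>
  define N where "N U s = G U s \<ominus>\<^bsub>R U\<^esub> F U s" for U s
  note fF = sheaf_homD[OF L.hom_family[OF f], folded F_def] and gG = sheaf_homD[OF L.hom_family[OF g], folded G_def]
  have fF1: "F U \<in> ring_hom (sec W (ptf k ` U)) (R U)" and gG1: "G U \<in> ring_hom (sec W (ptf k ` U)) (R U)"
    if "openin (under S) U" for U
    using fF(1)[OF that] gG(1)[OF that] by (simp_all add: F_def[abs_def] G_def[abs_def])
  have N: "N U s \<in> J U" "F U s \<oplus>\<^bsub>R U\<^esub> N U s = G U s" if U: "openin (under S) U" and s: "s \<in> carrier (sec W (ptf k ` U))" for U s
  proof -
    interpret h: ring_hom_cring "R U" "sec S U" "aug U" by (rule aug_hom[OF U])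
    note c = fF(2)[OF U s] gG(2)[OF U s]
    have k: "shf k (ptf k ` U) s \<in> carrier (sec S U)" using fF(3)[OF U s] h.hom_closed[OF c(1)] by simp
    show "N U s \<in> J U" unfolding N_def J_iff[OF U] using c fF(3)[OF U s] gG(3)[OF U s] k by (simp add: h.R.minus_eq h.S.r_neg)
    show "F U s \<oplus>\<^bsub>R U\<^esub> N U s = G U s" unfolding N_def using c by algebra
  qed
  \<comment> \<open>The only possible homomorphism to the fibre product: its first component must be
    \<open>F\<close>, and the coaction must turn it into \<open>F + N = G\<close>.\<close>
  define K where "K U s = Duo (F U s) (Duo (aug U (F U s)) (N U s))" for U s
  have K: "K U s \<in> carrier (amalg_ring (T, i) (dn, incd) U)" if "openin (under S) U" "s \<in> carrier (sec W (ptf k ` U))" for U s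
    unfolding K_def by (rule TI_mem[OF that(1) fF(2)[OF that] N(1)[OF that]])
  have "sheaf_hom S (TI.am, TI.inc) (W, k) K"
  proof (rule sheaf_homI; (simp add: TI.inc_image del: amalg_space_simps(3))?)
    fix U assume U: "openin (under S) U"
    interpret h: ring_hom_cring "R U" "sec S U" "aug U" by (rule aug_hom[OF U])
    interpret W: cring "sec W (ptf k ` U)" using thickening.open_image[OF W U] L.B.T.sec_cring by blast
    show "K U \<in> ring_hom (sec W (ptf k ` U)) (amalg_ring (T, i) (dn, incd) U)"
    proof (rule ring_hom_memI)
      fix s assume s: "s \<in> carrier (sec W (ptf k ` U))"
      show "K U s \<in> carrier (amalg_ring (T, i) (dn, incd) U)" by (rule K[OF U s])
      fix t assume t: "t \<in> carrier (sec W (ptf k ` U))"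
      note c = fF(2)[OF U s] fF(2)[OF U t] gG(2)[OF U s] gG(2)[OF U t]
      note n = N[OF U s] N[OF U t]
      have nc: "N U s \<in> carrier (R U)" "N U t \<in> carrier (R U)" using n J_carrier[OF U] by auto
      note m = W.m_closed[OF s t] and a = W.a_closed[OF s t]
      \<comment> \<open>The product formula for a difference of homomorphisms carries the extra term
        \<open>N s N t\<close>, which vanishes; this makes \<open>N\<close> a derivation over
        \<open>F\<close>.\<close>
      have "N U (s \<otimes>\<^bsub>sec W (ptf k ` U)\<^esub> t) = F U s \<otimes>\<^bsub>R U\<^esub> N U t \<oplus>\<^bsub>R U\<^esub> F U t \<otimes>\<^bsub>R U\<^esub> N U s"
      proof -
        have "N U (s \<otimes>\<^bsub>sec W (ptf k ` U)\<^esub> t) = G U s \<otimes>\<^bsub>R U\<^esub> G U t \<ominus>\<^bsub>R U\<^esub> F U s \<otimes>\<^bsub>R U\<^esub> F U t"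
          unfolding N_def using ring_hom_mult[OF fF1[OF U] s t] ring_hom_mult[OF gG1[OF U] s t] by (simp add: F_def G_def)
        also have "\<dots> = F U s \<otimes>\<^bsub>R U\<^esub> N U t \<oplus>\<^bsub>R U\<^esub> F U t \<otimes>\<^bsub>R U\<^esub> N U s \<oplus>\<^bsub>R U\<^esub> N U s \<otimes>\<^bsub>R U\<^esub> N U t"
          unfolding n(2)[symmetric] n(4)[symmetric] using c(1,2) nc by algebra
        finally show ?thesis using J_sqz[OF U n(1,3)] c nc by simp
      qed
      then show "K U (s \<otimes>\<^bsub>sec W (ptf k ` U)\<^esub> t) = K U s \<otimes>\<^bsub>amalg_ring (T, i) (dn, incd) U\<^esub> K U t"
        unfolding K_def using U c act_aug[OF U c(1) n(3)] act_aug[OF U c(2) n(1)] ring_hom_mult[OF fF1[OF U] s t] by simp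
      have "N U (s \<oplus>\<^bsub>sec W (ptf k ` U)\<^esub> t) = N U s \<oplus>\<^bsub>R U\<^esub> N U t"
        unfolding N_def ring_hom_add[OF fF1[OF U] s t] ring_hom_add[OF gG1[OF U] s t] using c by algebra
      then show "K U (s \<oplus>\<^bsub>sec W (ptf k ` U)\<^esub> t) = K U s \<oplus>\<^bsub>amalg_ring (T, i) (dn, incd) U\<^esub> K U t"
        unfolding K_def using U c ring_hom_add[OF fF1[OF U] s t] by simp
    next
      have "N U \<one>\<^bsub>sec W (ptf k ` U)\<^esub> = \<zero>\<^bsub>R U\<^esub>"
        unfolding N_def using ring_hom_one[OF fF1[OF U]] ring_hom_one[OF gG1[OF U]] by (simp add: h.R.minus_eq h.R.r_neg)
      then show "K U \<one>\<^bsub>sec W (ptf k ` U)\<^esub> = \<one>\<^bsub>amalg_ring (T, i) (dn, incd) U\<^esub>"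
        unfolding K_def using U ring_hom_one[OF fF1[OF U]] by simp
    qed
    fix s assume s: "s \<in> carrier (sec W (ptf k ` U))"
    show "shf TI.inc U (K U s) = shf k (ptf k ` U) s"
      using TI.inc_shf[OF U K[OF U s]] fF(3)[OF U s] by (simp add: K_def)
    fix V assume V: "openin (under S) V" "V \<subseteq> U"
    have "rs U V (N U s) = N V (res W (ptf k ` U) (ptf k ` V) s)"
      unfolding N_def rs_minus(1)[of U V, simplified, OF U V gG(2)[OF U s] fF(2)[OF U s]] fF(4)[OF U V s] gG(4)[OF U V s] ..
    then show "res TI.am U V (K U s) = K V (res W (ptf k ` U) (ptf k ` V) s)"
      unfolding K_def using U V fF(4)[OF U V s] shf_res[OF U V fF(2)[OF U s]] by simp
  qed
  then obtain h where h: "h \<in> Hom PS (TI.am, TI.inc) (W, k)"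
    "\<And>U s. openin (under S) U \<Longrightarrow> s \<in> carrier (sec W (ptf k ` U)) \<Longrightarrow> shf h (ptf k ` U) s = K U s"
    by (rule H.hom_exists) blast
  have 1: "comp_morph T TI.am W h inlT = f"
    using TI.comp_inl_inr(1)[OF W h(1)] h(2)
    by (intro L.hom_ext comp_hom[OF thickening_axioms TI.thick_am W TI.inl_hom h(1)] f) (simp add: K_def F_def)
  have 2: "comp_morph T TI.am W h \<nu> = g"
  proof (rule L.hom_ext[OF comp_hom[OF thickening_axioms TI.thick_am W coaction_hom h(1)] g])
    fix U s assume U: "openin (under S) U" and s: "s \<in> carrier (sec W (ptf k ` U))"
    show "shf (comp_morph T TI.am W h \<nu>) (ptf k ` U) s = shf g (ptf k ` U) s"
      unfolding coaction_comp[OF W h(1) U s] h(2)[OF U s] K_def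
      using coaction_shf[OF U fF(2)[OF U s] N(1)[OF U s]] N(2)[OF U s] by (simp add: G_def)
  qed
  show "\<exists>!h. h \<in> Hom PS (TI.am, TI.inc) X \<and> Comp PS (T, i) (TI.am, TI.inc) X h inlT = f \<and>
      Comp PS (T, i) (TI.am, TI.inc) X h \<nu> = g"
    unfolding X Comp_pointed
  proof (rule ex_ex1I)
    show "\<exists>h. h \<in> Hom PS (TI.am, TI.inc) (W, k) \<and> comp_morph T TI.am W h inlT = f \<and> comp_morph T TI.am W h \<nu> = g"
      using h(1) 1 2 by blast
    fix h h' assume h: "h \<in> Hom PS (TI.am, TI.inc) (W, k) \<and> comp_morph T TI.am W h inlT = f \<and> comp_morph T TI.am W h \<nu> = g"
      and h': "h' \<in> Hom PS (TI.am, TI.inc) (W, k) \<and> comp_morph T TI.am W h' inlT = f \<and> comp_morph T TI.am W h' \<nu> = g"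
    have hh: "h \<in> Hom PS (TI.am, TI.inc) (W, k)" "h' \<in> Hom PS (TI.am, TI.inc) (W, k)" using h h' by simp_all
    show "h = h'"
    proof (rule H.hom_ext[OF hh])
      fix U s assume U: "openin (under S) U" and s: "s \<in> carrier (sec W (ptf k ` U))"
      interpret R: cring "R U" by (rule R_cring[OF U])
      \<comment> \<open>An element of the fibre product is determined by \<open>u\<close> and
        \<open>u + j\<close>, its values under the coprojection and the coaction.\<close>
      obtain u j where u: "shf h (ptf k ` U) s = Duo u (Duo (aug U u) j)" "u \<in> carrier (R U)" "j \<in> J U"
        by (rule TI_elem[OF U TI.comp_inl_inr(3)[OF W hh(1) U s]])
      obtain u' j' where u': "shf h' (ptf k ` U) s = Duo u' (Duo (aug U u') j')" "u' \<in> carrier (R U)" "j' \<in> J U"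
        by (rule TI_elem[OF U TI.comp_inl_inr(3)[OF W hh(2) U s]])
      have "u = u'"
        using TI.comp_inl_inr(1)[OF W hh(1) U s] TI.comp_inl_inr(1)[OF W hh(2) U s] h h' u u' by simp
      moreover have "u \<oplus>\<^bsub>R U\<^esub> j = u' \<oplus>\<^bsub>R U\<^esub> j'"
        using coaction_comp[OF W hh(1) U s] coaction_comp[OF W hh(2) U s] h h'
          coaction_shf[OF U u(2,3)] coaction_shf[OF U u'(2,3)] u(1) u'(1) by simp
      ultimately have "j = j'" using u(2) J_carrier[OF U u(3)] J_carrier[OF U u'(3)] R.add.right_cancel[of u j j'] R.a_comm[of u] by simp
      with \<open>u = u'\<close> show "shf h (ptf k ` U) s = shf h' (ptf k ` U) s" using u u' by simp
    qed
  qed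
qed

text \<open>The comparison morphism is induced by the legs \<open>inlT\<close> and
  \<open>\<nu>\<close> of the very object that represents the product, so it is the
  identity.\<close>

lemma TI_iso: "is_iso (opposite PS) (TI.am, TI.inc) (TI.am, TI.inc)
    (pairing (opposite PS) (T, i) (T, i) (TI.am, TI.inc) inlT \<nu> (TI.am, TI.inc) inlT \<nu>)"
proof -
  let ?P = "(TI.am, TI.inc)"
  have cat: "category PS" by (rule category_pointed)
  have P: "?P \<in> Ob PS" using TI.thick_am by simp
  have id: "id_morph TI.am \<in> Hom PS ?P ?P" by (rule id_hom[OF TI.thick_am])
  have unit: "comp_morph X TI.am TI.am (id_morph TI.am) f = f" if "thickening S X k" "f \<in> Hom PS (X, k) ?P" for X k f
  proof -
    have "Comp PS (X, k) ?P ?P (Id PS ?P) f = f" using cat P that unfolding category_def by (metis Ob_pointed)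
    then show ?thesis by simp
  qed
  have "pairing (opposite PS) (T, i) (T, i) ?P inlT \<nu> ?P inlT \<nu> = id_morph TI.am"
    unfolding pairing_def opposite_simps
  proof (rule the1_equality)
    show "\<exists>!h. h \<in> Hom PS ?P ?P \<and> Comp PS (T, i) ?P ?P h inlT = inlT \<and> Comp PS (T, i) ?P ?P h \<nu> = \<nu>"
      using coproduct_self P TI.inl_hom coaction_hom unfolding is_product_def opposite_simps by blast
    show "id_morph TI.am \<in> Hom PS ?P ?P \<and> Comp PS (T, i) ?P ?P (id_morph TI.am) inlT = inlT \<and>
        Comp PS (T, i) ?P ?P (id_morph TI.am) \<nu> = \<nu>"
      using id unit[OF thickening_axioms TI.inl_hom] unit[OF thickening_axioms coaction_hom] by simp
  qed
  then show ?thesis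
    unfolding is_iso_def opposite_simps using id unit[OF TI.thick_am id] by auto
qed

text \<open>A morphism equalizing the coprojection and the coaction kills the ideal, hence factors through
  the quotient sheaf \<open>\<O>\<^sub>S\<close>; the factorization is glued from local lifts.\<close>

lemma base_equalizer:
  "is_coequalizer (opposite PS) (TI.am, TI.inc) (T, i) inlT \<nu> (S, id_morph S) i"
  unfolding is_coequalizer_def opposite_simps
proof (intro conjI ballI impI)
  show "i \<in> Hom PS (S, id_morph S) (T, i)" by (rule immersion_hom(1)[OF thickening_axioms])
  \<comment> \<open>Both are morphisms under \<open>S\<close>: composed with \<open>i\<close>, each
    gives the immersion of \<open>S\<close> into the sum.\<close>
  have "comp_morph S T TI.am inlT i = comp_morph S T TI.am \<nu> i"
    using TI.inl_hom coaction_hom by (simp add: Hom_pointed)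
  then show "Comp PS (S, id_morph S) (T, i) (TI.am, TI.inc) inlT i = Comp PS (S, id_morph S) (T, i) (TI.am, TI.inc) \<nu> i" by simp
  fix X v assume "X \<in> Ob PS" and v': "v \<in> Hom PS X (T, i)"
    and eq': "Comp PS X (T, i) (TI.am, TI.inc) inlT v = Comp PS X (T, i) (TI.am, TI.inc) \<nu> v"
  then obtain W k where X: "X = (W, k)" and W: "thickening S W k" by (cases X) simp
  have v: "v \<in> Hom PS (W, k) (T, i)" and eq: "comp_morph W T TI.am inlT v = comp_morph W T TI.am \<nu> v"
    using v' eq' X by simp_all
  interpret w: thickening S W k by (rule W)
  interpret V: thickenings S W k T i using W thickening_axioms by (simp add: thickenings_def)
  interpret Z: thickenings S W k S "id_morph S" using W thick_base by (simp add: thickenings_def)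
  define B where "B U = sec W (ptf k ` U)" for U
  define r where "r U U' = res W (ptf k ` U) (ptf k ` U')" for U U'
  define F where "F U s = shf v (ptf i ` U) s" for U s
  note vF = sheaf_homD[OF V.hom_family[OF v], folded F_def B_def r_def]
  have vF1: "F U \<in> ring_hom (R U) (B U)" if "openin (under S) U" for U
    using vF(1)[OF that] by (simp add: F_def[abs_def])
  note Bs = w.A.E.separated[unfolded pulled_simps, folded B_def r_def]
    and Bglue = w.A.E.glue[unfolded pulled_simps, folded B_def r_def]
    and Bc = w.A.E.res_closed[unfolded pulled_simps, folded B_def r_def]
    and Br = w.A.E.res_res[unfolded pulled_simps, folded B_def r_def]
    and Bm = w.A.E.res_mult[unfolded pulled_simps, folded B_def r_def]
    and Ba = w.A.E.res_add[unfolded pulled_simps, folded B_def r_def]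
    and Bid = w.A.E.res_id[unfolded pulled_simps, folded B_def r_def]
    and Bring = w.A.E.sec_cring[unfolded pulled_simps, folded B_def]
    and Baug = w.shf_hom[folded B_def] and Baug_res = w.shf_res[folded B_def r_def]
  \<comment> \<open>The two composites are compared on the pair of \<open>u\<close> and its image
    with \<epsilon>-part \<open>j\<close>: the coprojection yields \<open>u\<close>, the coaction
    \<open>u + j\<close>.\<close>
  have kill: "F U (u \<oplus>\<^bsub>R U\<^esub> j) = F U u" if U: "openin (under S) U" and u: "u \<in> carrier (R U)" and j: "j \<in> J U" for U u j
  proof -
    let ?x = "Duo u (Duo (aug U u) j)"
    have x: "?x \<in> carrier (amalg_ring (T, i) (dn, incd) U)" by (rule TI_mem[OF U u j])
    have xs: "?x \<in> carrier (sec TI.am (ptf TI.inc ` U))" using x U by (simp add: TI.inc_image del: amalg_carrier_Duo)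
    have "F U (shf inlT U ?x) = F U (shf \<nu> U ?x)"
      using comp_shf[OF V.thickenings_axioms TI.thick_am TI.inl_hom U xs]
        comp_shf[OF V.thickenings_axioms TI.thick_am coaction_hom U xs]
        arg_cong[OF eq, of "\<lambda>f. shf f U ?x"] U by (simp add: F_def TI.inc_image)
    then show ?thesis using TI.inl_shf[OF U x] coaction_shf[OF U u j] by simp
  qed
  \<comment> \<open>Two lifts of the same section differ by an element of the ideal, which
    \<open>F\<close> ignores by \<open>kill\<close>.\<close>
  have indep: "F U u = F U u'"
    if U: "openin (under S) U" and u: "u \<in> carrier (R U)" "u' \<in> carrier (R U)" "aug U u = aug U u'" for U u u'
  proof -
    interpret h: ring_hom_cring "R U" "sec S U" "aug U" by (rule aug_hom[OF U])
    have n: "u \<ominus>\<^bsub>R U\<^esub> u' \<in> J U" using u by (simp add: J_iff[OF U] h.R.minus_eq h.S.r_neg)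
    have "u = u' \<oplus>\<^bsub>R U\<^esub> (u \<ominus>\<^bsub>R U\<^esub> u')" using u(1,2) by algebra
    then show ?thesis using kill[OF U u(2) n] by simp
  qed
  \<comment> \<open>Characterizes the value of the factorization at \<open>b\<close> through all
    local lifts at once, so that the chosen value is determined wherever \<open>b\<close>
    lifts.\<close>
  define good where "good U b c \<longleftrightarrow> c \<in> carrier (B U) \<and>
    (\<forall>Y u. openin (under S) Y \<longrightarrow> Y \<subseteq> U \<longrightarrow> u \<in> carrier (R Y) \<longrightarrow> aug Y u = res S U Y b \<longrightarrow> r U Y c = F Y u)" for U b c
  have good_ex: "\<exists>c. good U b c" if U: "openin (under S) U" and b: "b \<in> carrier (sec S U)" for U b
  proof -
    define Q where "Q Y c \<longleftrightarrow> openin (under S) Y \<and> Y \<subseteq> U \<and> (\<exists>u\<in>carrier (R Y). aug Y u = res S U Y b \<and> c = F Y u)" for Y c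
    have "\<exists>c\<in>carrier (B U). \<forall>Y c'. Q Y c' \<longrightarrow> r U Y c = c'"
    proof (rule Bglue)
      show "openin (under S) U" by (rule U)
      show "openin (under S) Y \<and> Y \<subseteq> U \<and> c \<in> carrier (B Y)" if "Q Y c" for Y c using that vF(2) by (auto simp: Q_def)
      show "\<exists>Y c. x \<in> Y \<and> Q Y c" if "x \<in> U" for x using lift[OF U b that] by (auto simp: Q_def)
      fix Y c Y' c' assume q: "Q Y c" "Q Y' c'"
      obtain u where u: "openin (under S) Y" "Y \<subseteq> U" "u \<in> carrier (R Y)" "aug Y u = res S U Y b" "c = F Y u"
        using q(1) by (auto simp: Q_def)
      obtain u' where u': "openin (under S) Y'" "Y' \<subseteq> U" "u' \<in> carrier (R Y')" "aug Y' u' = res S U Y' b" "c' = F Y' u'"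
        using q(2) by (auto simp: Q_def)
      let ?Y = "Y \<inter> Y'"
      have o: "openin (under S) ?Y" "?Y \<subseteq> Y" "?Y \<subseteq> Y'" using u u' by auto
      have "aug ?Y (rs Y ?Y u) = aug ?Y (rs Y' ?Y u')"
        using shf_res[OF u(1) o(1,2) u(3)] shf_res[OF u'(1) o(1,3) u'(3)] u(4) u'(4)
          S.res_res[OF U u(1) o(1,2) u(2) b] S.res_res[OF U u'(1) o(1,3) u'(2) b] by simp
      then show "r Y ?Y c = r Y' ?Y c'"
        using vF(4)[OF u(1) o(1,2) u(3)] vF(4)[OF u'(1) o(1,3) u'(3)] u(5) u'(5)
          indep[OF o(1) rs_closed[OF u(1) o(1,2) u(3)] rs_closed[OF u'(1) o(1,3) u'(3)]] by simp
    qed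
    then obtain c where "c \<in> carrier (B U)" "\<And>Y c'. Q Y c' \<Longrightarrow> r U Y c = c'" by blast
    then have "good U b c" unfolding good_def Q_def by blast
    then show ?thesis by blast
  qed
  define w where "w U b = (SOME c. good U b c)" for U b
  have w: "good U b (w U b)" if "openin (under S) U" "b \<in> carrier (sec S U)" for U b
    unfolding w_def by (rule someI_ex[OF good_ex[OF that]])
  have wc: "w U b \<in> carrier (B U)" if "openin (under S) U" "b \<in> carrier (sec S U)" for U b
    using w[OF that] by (simp add: good_def)
  have wl: "r U Y (w U b) = F Y u"
    if "openin (under S) U" "b \<in> carrier (sec S U)" "openin (under S) Y" "Y \<subseteq> U" "u \<in> carrier (R Y)" "aug Y u = res S U Y b" for U b Y u
    using w[OF that(1,2)] that(3-6) by (auto simp: good_def)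
  have wa: "w U (aug U u) = F U u" if U: "openin (under S) U" and u: "u \<in> carrier (R U)" for U u
  proof -
    have b: "aug U u \<in> carrier (sec S U)" using aug_closed[OF U u] .
    show ?thesis using wl[OF U b U subset_refl u] S.res_id[OF U b] Bid[of U "w U (aug U u)"] wc[OF U b] U by simp
  qed
  have local_eq: "c = c'" if U: "openin (under S) U" and c: "c \<in> carrier (B U)" "c' \<in> carrier (B U)"
    and l: "\<And>x. x \<in> U \<Longrightarrow> \<exists>Y. openin (under S) Y \<and> x \<in> Y \<and> Y \<subseteq> U \<and> r U Y c = r U Y c'" for U c c'
    by (rule Bs[OF _ c]) (use U l in auto)
  have wr: "r U Y (w U b) = w Y (res S U Y b)"
    if U: "openin (under S) U" and Y: "openin (under S) Y" "Y \<subseteq> U" and b: "b \<in> carrier (sec S U)" for U Y b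
  proof -
    have bY: "res S U Y b \<in> carrier (sec S Y)" by (rule S.res_closed[OF U Y b])
    have c1: "r U Y (w U b) \<in> carrier (B Y)" using Bc[of U Y] U Y wc[OF U b] by simp
    show ?thesis
    proof (rule local_eq[OF Y(1) c1 wc[OF Y(1) bY]])
      fix x assume "x \<in> Y"
      then obtain Z u where Z: "openin (under S) Z" "x \<in> Z" "Z \<subseteq> Y" "u \<in> carrier (R Z)" "aug Z u = res S Y Z (res S U Y b)"
        using lift[OF Y(1) bY] by blast
      have ZU: "Z \<subseteq> U" using Z Y by blast
      have "r Y Z (r U Y (w U b)) = F Z u"
        using wl[OF U b Z(1) ZU Z(4)] Z(5) S.res_res[OF U Y(1) Z(1,3) Y(2) b] Br[of U Y Z "w U b"] U Y Z wc[OF U b] by simp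
      moreover have "r Y Z (w Y (res S U Y b)) = F Z u" by (rule wl[OF Y(1) bY Z(1,3,4,5)])
      ultimately show "\<exists>Z. openin (under S) Z \<and> x \<in> Z \<and> Z \<subseteq> Y \<and> r Y Z (r U Y (w U b)) = r Y Z (w Y (res S U Y b))"
        using Z by auto
    qed
  qed
  have lift2: "\<exists>Y u u'. openin (under S) Y \<and> x \<in> Y \<and> Y \<subseteq> U \<and> u \<in> carrier (R Y) \<and> u' \<in> carrier (R Y) \<and>
      aug Y u = res S U Y b \<and> aug Y u' = res S U Y c"
    if U: "openin (under S) U" and "x \<in> U" "b \<in> carrier (sec S U)" "c \<in> carrier (sec S U)" for U x b c
    by (rule act_local[OF U that(2-4)]) blast
  have "sheaf_hom S (W, k) (S, id_morph S) w"
  proof (rule sheaf_homI; (fold B_def r_def)?)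
    fix U assume U: "openin (under S) U"
    interpret b: cring "B U" using Bring[of U] U by simp
    interpret s: cring "sec S U" by (rule S.sec_cring[OF U])
    have "w U \<in> ring_hom (sec S U) (B U)"
    proof (rule ring_hom_memI)
      fix b assume b: "b \<in> carrier (sec S U)"
      show "w U b \<in> carrier (B U)" by (rule wc[OF U b])
      fix c assume c: "c \<in> carrier (sec S U)"
      note W2 = wc[OF U b] wc[OF U c]
      show "w U (b \<otimes>\<^bsub>sec S U\<^esub> c) = w U b \<otimes>\<^bsub>B U\<^esub> w U c"
      proof (rule local_eq[OF U wc[OF U s.m_closed[OF b c]] b.m_closed[OF W2]])
        fix x assume "x \<in> U"
        then obtain Y u u' where Y: "openin (under S) Y" "x \<in> Y" "Y \<subseteq> U" "u \<in> carrier (R Y)" "u' \<in> carrier (R Y)"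
          "aug Y u = res S U Y b" "aug Y u' = res S U Y c" using lift2[OF U _ b c] by blast
        interpret h: ring_hom_cring "R Y" "sec S Y" "aug Y" by (rule aug_hom[OF Y(1)])
        have "aug Y (u \<otimes>\<^bsub>R Y\<^esub> u') = res S U Y (b \<otimes>\<^bsub>sec S U\<^esub> c)" using Y(4-7) S.res_mult[OF U Y(1,3) b c] by simp
        then have "r U Y (w U (b \<otimes>\<^bsub>sec S U\<^esub> c)) = F Y (u \<otimes>\<^bsub>R Y\<^esub> u')"
          using wl[OF U s.m_closed[OF b c] Y(1,3)] Y(4,5) by simp
        also have "\<dots> = r U Y (w U b \<otimes>\<^bsub>B U\<^esub> w U c)"
          using ring_hom_mult[OF vF1[OF Y(1)] Y(4,5)] wl[OF U b Y(1,3,4,6)] wl[OF U c Y(1,3,5,7)] Bm[of U Y "w U b" "w U c"] U Y(1,3) W2 by simp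
        finally show "\<exists>Y. openin (under S) Y \<and> x \<in> Y \<and> Y \<subseteq> U \<and> r U Y (w U (b \<otimes>\<^bsub>sec S U\<^esub> c)) = r U Y (w U b \<otimes>\<^bsub>B U\<^esub> w U c)"
          using Y by blast
      qed
      show "w U (b \<oplus>\<^bsub>sec S U\<^esub> c) = w U b \<oplus>\<^bsub>B U\<^esub> w U c"
      proof (rule local_eq[OF U wc[OF U s.a_closed[OF b c]] b.a_closed[OF W2]])
        fix x assume "x \<in> U"
        then obtain Y u u' where Y: "openin (under S) Y" "x \<in> Y" "Y \<subseteq> U" "u \<in> carrier (R Y)" "u' \<in> carrier (R Y)"
          "aug Y u = res S U Y b" "aug Y u' = res S U Y c" using lift2[OF U _ b c] by blast
        interpret h: ring_hom_cring "R Y" "sec S Y" "aug Y" by (rule aug_hom[OF Y(1)])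
        have "aug Y (u \<oplus>\<^bsub>R Y\<^esub> u') = res S U Y (b \<oplus>\<^bsub>sec S U\<^esub> c)" using Y(4-7) S.res_add[OF U Y(1,3) b c] by simp
        then have "r U Y (w U (b \<oplus>\<^bsub>sec S U\<^esub> c)) = F Y (u \<oplus>\<^bsub>R Y\<^esub> u')"
          using wl[OF U s.a_closed[OF b c] Y(1,3)] Y(4,5) by simp
        also have "\<dots> = r U Y (w U b \<oplus>\<^bsub>B U\<^esub> w U c)"
          using ring_hom_add[OF vF1[OF Y(1)] Y(4,5)] wl[OF U b Y(1,3,4,6)] wl[OF U c Y(1,3,5,7)] Ba[of U Y "w U b" "w U c"] U Y(1,3) W2 by simp
        finally show "\<exists>Y. openin (under S) Y \<and> x \<in> Y \<and> Y \<subseteq> U \<and> r U Y (w U (b \<oplus>\<^bsub>sec S U\<^esub> c)) = r U Y (w U b \<oplus>\<^bsub>B U\<^esub> w U c)"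
          using Y by blast
      qed
    next
      interpret h: ring_hom_cring "R U" "sec S U" "aug U" by (rule aug_hom[OF U])
      show "w U \<one>\<^bsub>sec S U\<^esub> = \<one>\<^bsub>B U\<^esub>" using wa[OF U h.R.one_closed] ring_hom_one[OF vF1[OF U]] by simp
    qed
    then show "w U \<in> ring_hom (sec S (ptf (id_morph S) ` U)) (B U)" using U by simp
    fix b assume "b \<in> carrier (sec S (ptf (id_morph S) ` U))"
    then have b: "b \<in> carrier (sec S U)" using U by simp
    \<comment> \<open>The factorization is again compatible with the immersions; on local lifts this
      is the compatibility of \<open>v\<close>.\<close>
    have "shf k (ptf k ` U) (w U b) = b"
    proof (rule S.separated[OF U _ b])
      show "shf k (ptf k ` U) (w U b) \<in> carrier (sec S U)" using ring_hom_closed[OF Baug[OF U] wc[OF U b]] .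
      fix x assume "x \<in> U"
      then obtain Y u where Y: "openin (under S) Y" "x \<in> Y" "Y \<subseteq> U" "u \<in> carrier (R Y)" "aug Y u = res S U Y b"
        using lift[OF U b] by blast
      have "res S U Y (shf k (ptf k ` U) (w U b)) = res S U Y b"
        using Baug_res[OF U Y(1,3) wc[OF U b]] wl[OF U b Y(1,3,4,5)] vF(3)[OF Y(1,4)] Y(5) by simp
      then show "\<exists>Y. openin (under S) Y \<and> x \<in> Y \<and> Y \<subseteq> U \<and> res S U Y (shf k (ptf k ` U) (w U b)) = res S U Y b" using Y by blast
    qed
    then show "shf k (ptf k ` U) (w U b) = shf (id_morph S) (ptf (id_morph S) ` U) b" using U b by simp
    fix Y assume Y: "openin (under S) Y" "Y \<subseteq> U"
    show "r U Y (w U b) = w Y (res S (ptf (id_morph S) ` U) (ptf (id_morph S) ` Y) b)" using wr[OF U Y b] U Y by simp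
  qed
  then obtain z where z: "z \<in> Hom PS (W, k) (S, id_morph S)"
    "\<And>U s. openin (under S) U \<Longrightarrow> s \<in> carrier (sec S (ptf (id_morph S) ` U)) \<Longrightarrow> shf z (ptf (id_morph S) ` U) s = w U s"
    by (rule Z.hom_exists) blast
  note ih = immersion_hom(1)[OF thickening_axioms]
  have comp: "shf (comp_morph W S T i z) (ptf i ` U) s = shf z U (aug U s)"
    if "z \<in> Hom PS (W, k) (S, id_morph S)" "openin (under S) U" "s \<in> carrier (R U)" for z U s
    using comp_shf[OF Z.thickenings_axioms thickening_axioms ih that(2,3)] that(2) by simp
  have "comp_morph W S T i z = v"
  proof (rule V.hom_ext[OF comp_hom[OF W thick_base thickening_axioms z(1) ih] v])
    fix U s assume U: "openin (under S) U" and s: "s \<in> carrier (R U)"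
    show "shf (comp_morph W S T i z) (ptf i ` U) s = shf v (ptf i ` U) s"
      using comp[OF z(1) U s] z(2)[OF U, of "aug U s"] wa[OF U s] aug_closed[OF U s] U by (simp add: F_def)
  qed
  \<comment> \<open>Sections of \<open>S\<close> lift locally to \<open>T\<close>, and on lifts both
    morphisms are determined by their composites with \<open>i\<close>.\<close>
  moreover have "z1 = z2" if z1: "z1 \<in> Hom PS (W, k) (S, id_morph S)" and z2: "z2 \<in> Hom PS (W, k) (S, id_morph S)"
    and c: "comp_morph W S T i z1 = comp_morph W S T i z2" for z1 z2
  proof (rule Z.hom_ext[OF z1 z2])
    fix U s assume U: "openin (under S) U" and "s \<in> carrier (sec S (ptf (id_morph S) ` U))"
    then have s: "s \<in> carrier (sec S U)" by simp
    note f1 = sheaf_homD[OF Z.hom_family[OF z1], folded B_def r_def] and f2 = sheaf_homD[OF Z.hom_family[OF z2], folded B_def r_def]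
    have "shf z1 U s = shf z2 U s"
    proof (rule local_eq[OF U])
      show "shf z1 U s \<in> carrier (B U)" "shf z2 U s \<in> carrier (B U)" using f1(2)[OF U] f2(2)[OF U] s U by simp_all
      fix x assume "x \<in> U"
      then obtain Y u where Y: "openin (under S) Y" "x \<in> Y" "Y \<subseteq> U" "u \<in> carrier (R Y)" "aug Y u = res S U Y s"
        using lift[OF U s] by blast
      have "r U Y (shf z1 U s) = r U Y (shf z2 U s)"
        using f1(4)[OF U Y(1,3)] f2(4)[OF U Y(1,3)] s U Y(1,5) comp[OF z1 Y(1,4)] comp[OF z2 Y(1,4)] c by simp
      then show "\<exists>Y. openin (under S) Y \<and> x \<in> Y \<and> Y \<subseteq> U \<and> r U Y (shf z1 U s) = r U Y (shf z2 U s)" using Y by blast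
    qed
    then show "shf z1 (ptf (id_morph S) ` U) s = shf z2 (ptf (id_morph S) ` U) s" using U by simp
  qed
  ultimately show "\<exists>!z. z \<in> Hom PS X (S, id_morph S) \<and> Comp PS X (S, id_morph S) (T, i) i z = v"
    unfolding X Comp_pointed using z(1) by (intro ex_ex1I) auto
qed

text \<open>The product of \<open>(T, i)\<close> with itself demanded by \<open>right_torsor\<close>
  is taken to be the sum with the dual numbers, with legs \<open>inlT\<close> and
  \<open>\<nu>\<close>. The morphism to the terminal object is \<open>i\<close>, so inhabitedness is
  \<open>base_equalizer\<close>.\<close>

lemma cotorsor: "right_cotorsor PS \<Gamma> (T, i) (TI.am, TI.inc) inlT inrT \<nu>"
  unfolding right_cotorsor_def right_torsor_def
proof (intro conjI exI)
  show "group_object (opposite PS) \<Gamma>"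
    using cogroup by (simp add: coabelian_cogroup_object_def abelian_group_object_def)
  show "right_action (opposite PS) \<Gamma> (T, i) (TI.am, TI.inc) inlT inrT \<nu>" by (rule coaction_right_action)
  show "is_product (opposite PS) (T, i) (T, i) (TI.am, TI.inc) inlT \<nu>" by (rule coproduct_self)
  show "is_iso (opposite PS) (TI.am, TI.inc) (TI.am, TI.inc)
    (pairing (opposite PS) (T, i) (T, i) (TI.am, TI.inc) inlT \<nu> (TI.am, TI.inc) inlT \<nu>)" by (rule TI_iso)
  show "is_coequalizer (opposite PS) (TI.am, TI.inc) (T, i) inlT \<nu> (gterm \<Gamma>) (to_terminal (opposite PS) (gterm \<Gamma>) (T, i))"
    using base_equalizer to_base[OF thickening_axioms] by simp
qed

lemma cotorsor_amalg:
  "right_cotorsor PS \<Gamma> (T, i) (amalg S (T, i) (I_pointed S M)) (amalg_inl S (T, i) (I_pointed S M))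
    (amalg_inr S (T, i) (I_pointed S M)) \<nu>"
  using cotorsor by (simp add: I_pointed_eq TI.amalg_eq)

end

theorem proposition1p18:
  fixes S \<Sigma> :: "('p, 'a universe) ringed"
    and i :: "('p, 'a universe, 'p, 'a universe) morph"
  assumes "square_zero_immersion S \<Sigma> i"
  shows "let J = ideal_module S (\<Sigma>, i);
             I = I_pointed S J
         in relative_spectrum S (dual_numbers S J) (dual_structure S J)
              (fst I) (dual_structure S J) \<and>
            coabelian_cogroup_object (pointed_schemes S) (I_cogroup S J) \<and>
            right_cotorsor (pointed_schemes S) (I_cogroup S J) (\<Sigma>, i)
              (amalg S (\<Sigma>, i) I) (amalg_inl S (\<Sigma>, i) I) (amalg_inr S (\<Sigma>, i) I)
              (coaction S (\<Sigma>, i))"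
proof -
  interpret square_zero S \<Sigma> i
    using assms by (intro square_zero.intro thickening.intro)
  show ?thesis
    unfolding Let_def using relative_spectrum_dual cogroup cotorsor_amalg by (simp add: I_pointed_eq)
qed

end
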